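(* Assume: there is $L>0$ with $|f_i(x,a)-f_i(y,a)|\le L|x-y|$ for all $i\in\{1,2,3\}$, $a\in A$, $x,y$; for each $i$ there are $a_i^-,a_i^+\in A$ with $f_i(0,a_i^-)<0<f_i(0,a_i^+)$; and there is a continuous increasing $\omega_\ell:[0,\infty)\to[0,\infty)$, $\omega_\ell(0)=0$, with $|\ell_i(x,a)-\ell_i(y,a)|\le\omega_\ell(|x-y|)$. Let $V$ be the value function of the threefold junction optimal control problem with uniform-threshold junction controls, and let $V_{\varepsilon,\varepsilon,\varepsilon}$ be the value function of the approximating three-thermostatic problem with thresholds $(\varepsilon,\varepsilon,\varepsilon)$ (both defined in the context). Then $$V(x,i)=\lim_{\varepsilon\to0^+}V_{\varepsilon,\varepsilon,\varepsilon}(x,i)\qquad\forall (x,i)\in R_i,\ i=1,2,3,$$ and the convergence is uniform. Moreover, when $x=0$ the limit is independent of $i=1,2,3$.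
   Context: Network. $R_i=[0,+\infty)\times\{i\}$, $i=1,2,3$; $TR=R_1\cup R_2\cup R_3$ with the three points $(0,i)$ identified (the junction, denoted $0$). $A$ is a compact control set, $\lambda>0$; $f_i:R_i\times A\to\mathbb{R}$ and $\ell_i:R_i\times A\to[0,+\infty)$ are continuous and bounded (the label $i$ in the argument is dropped). Approximating problem. For $\varepsilon_1,\varepsilon_2,\varepsilon_3>0$, $f_i,\ell_i$ are extended to $[-\varepsilon_i,+\infty)\times A$ by constancy in $x$ on $[-\varepsilon_i,0]$. Set $1^+=2$, $2^+=3$, $3^+=1$. From $(x_0,i_0)$ with $x_0\in[-\varepsilon_{i_0},+\infty)$ and a measurable control $\alpha:[0,\infty)\to A$, the state $(x(t),i(t))$ evolves with $x'=f_i(x,\alpha)$ with constant $i$ as long as $x\ge-\varepsilon_i$; when $x$ (on branch $i$) goes below $-\varepsilon_i$, the label must switch to $i^+$ and the position is reset to $\varepsilon_{i^+}$. Then $V_{\varepsilon_1,\varepsilon_2,\varepsilon_3}(x_0,i_0)=\inf_\alpha\int_0^\infty e^{-\lambda t}\ell_{i(t)}(x(t),\alpha(t))\,dt$, and $V_{\varepsilon,\varepsilon,\varepsilon}$ is the case $\varepsilon_1=\varepsilon_2=\varepsilon_3=\varepsilon$. Junction controls for the limit problem. Let $$A_0=\{(a_1,a_2,a_3)\in A^3: f_i(0,a_i)\le0 \text{ for } i=1,2,3,\ \text{with at most one equal to } 0\},$$ $$\widetilde A=\{(a,i)\in A\times\{1,2,3\}: f_i(0,a)\ge0\},\qquad A(0)=A_0\cup\widetilde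 A.$$ For $(a_1,a_2,a_3)\in A_0$, writing $f_i=f_i(0,a_i)$ and $D=f_2f_3+f_1f_3+f_1f_2$, put $\mu_1=f_2f_3/D$, $\mu_2=f_1f_3/D$, $\mu_3=f_1f_2/D$. For $\hat a\in A(0)$: if $\hat a=(a,i)\in\widetilde A$ then $f_0(0,\hat a)=f_i(0,a)$, $\ell_0(0,\hat a)=\ell_i(0,a)$; if $\hat a=(a_1,a_2,a_3)\in A_0$ then $f_0(0,\hat a)=0$, $\ell_0(0,\hat a)=\sum_{i=1}^3\mu_i\ell_i(0,a_i)$. Limit optimal control problem. Given $(x_0,i_0)\in TR$ and a measurable control $\alpha(t)\in A\cup A(0)$, an admissible trajectory $(x(t),i(t))$ in $TR$ starting at $(x_0,i_0)$ is one for which $i(t)$ remains constant while $x(t)>0$, with $x'=f_i(x,\alpha)$, $\alpha\in A$, while $x>0$; when $x=0$ the control is in $A(0)$ and the dynamics is $f_0(0,\alpha)$, an element $(a,i)\in\widetilde A$ meaning use of branch $i$. $\mathcal A_{(x_0,i_0)}$ is the (nonempty) set of measurable controls for which there is a unique admissible trajectory. With running cost $\ell=\ell_i(x,\alpha)$ if $x>0$ and $\ell=\ell_0(0,\alpha)$ if $x=0$, $$V(x_0,i_0)=\inf_{\alpha\in\mathcal A_{(x_0,i_0)}}\int_0^{+\infty}e^{-\lambda t}\ell(x(t),i(t),\alpha(t))\,dt.$$ *)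

theory Defs
  imports "HOL-Analysis.Analysis"
begin

text \<open>The data \<open>f i x a\<close> and \<open>l i x a\<close> (drift and running cost on branch \<open>i\<close>) matter only for
  \<open>x \<ge> 0\<close> and \<open>a \<in> A\<close>.\<close>

datatype branch = B1 | B2 | B3

fun succ_branch :: "branch \<Rightarrow> branch" where
  "succ_branch B1 = B2"
| "succ_branch B2 = B3"
| "succ_branch B3 = B1"

type_synonym 'a data = "branch \<Rightarrow> real \<Rightarrow> 'a \<Rightarrow> real"


section \<open>The three-thermostatic approximating problem\<close>

text \<open>Constant extension in \<open>x\<close> to the left of \<open>0\<close>. It is made on the whole half-line, so that one
  can speak of a solution going below the threshold \<open>-\<epsilon> i\<close>; a trajectory itself stays in
  \<open>[-\<epsilon> i, \<infinity>)\<close>.\<close>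

definition extend_left :: "'a data \<Rightarrow> 'a data" where
  "extend_left g i x a = g i (max x 0) a"

definition controls :: "'a::metric_space set \<Rightarrow> (real \<Rightarrow> 'a) set" where
  "controls A = {\<alpha>. \<alpha> \<in> borel_measurable (lebesgue_on {0..}) \<and> (\<forall>t\<ge>0. \<alpha> t \<in> A)}"

text \<open>Stage \<open>k\<close> lasts from \<open>s k\<close> to \<open>s (Suc k)\<close>, has label \<open>(succ_branch ^^ k) i0\<close> and starts at
  \<open>x0\<close> for \<open>k = 0\<close>, at the reset position for \<open>k > 0\<close>. The function \<open>y k\<close> is the solution on the
  fixed branch, in integrated form, continued beyond the stage; the stage ends at the infimum of
  the times at which \<open>y k\<close> is strictly below the threshold. This infimum is \<open>\<infinity>\<close> if there is no
  such time, and all later stages are then void. If \<open>x0\<close> is the threshold itself, stage \<open>0\<close> may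
  have length \<open>0\<close>.\<close>

definition stage_start :: "(branch \<Rightarrow> real) \<Rightarrow> real \<Rightarrow> branch \<Rightarrow> nat \<Rightarrow> real" where
  "stage_start \<epsilon> x0 i0 k = (if k = 0 then x0 else \<epsilon> ((succ_branch ^^ k) i0))"

definition thermostat_trajectory ::
  "'a data \<Rightarrow> (branch \<Rightarrow> real) \<Rightarrow> (real \<Rightarrow> 'a) \<Rightarrow> real \<Rightarrow> branch \<Rightarrow> (real \<Rightarrow> real) \<Rightarrow> (real \<Rightarrow> branch) \<Rightarrow> bool"
where
  "thermostat_trajectory f \<epsilon> \<alpha> x0 i0 x i \<longleftrightarrow>
    (\<exists>(s :: nat \<Rightarrow> ereal) (y :: nat \<Rightarrow> real \<Rightarrow> real).
       s 0 = 0 \<and>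
       (\<forall>k t. s k \<le> ereal t \<longrightarrow>
          ((\<lambda>r. extend_left f ((succ_branch ^^ k) i0) (y k r) (\<alpha> r))
             has_integral (y k t - stage_start \<epsilon> x0 i0 k)) {real_of_ereal (s k)..t}) \<and>
       (\<forall>k. s (Suc k) = Inf (ereal ` {t. s k \<le> ereal t \<and> y k t < - \<epsilon> ((succ_branch ^^ k) i0)})) \<and>
       (\<forall>k t. s k \<le> ereal t \<and> ereal t < s (Suc k) \<longrightarrow> x t = y k t \<and> i t = (succ_branch ^^ k) i0))"

definition thermostat_cost ::
  "'a data \<Rightarrow> real \<Rightarrow> (real \<Rightarrow> 'a) \<Rightarrow> (real \<Rightarrow> real) \<Rightarrow> (real \<Rightarrow> branch) \<Rightarrow> real"
where
  "thermostat_cost l lam \<alpha> x i =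
    (LINT t:{0..}|lebesgue. exp (- lam * t) * extend_left l (i t) (x t) (\<alpha> t))"

definition V_thermostat ::
  "'a::metric_space set \<Rightarrow> 'a data \<Rightarrow> 'a data \<Rightarrow> real \<Rightarrow> (branch \<Rightarrow> real) \<Rightarrow> real \<Rightarrow> branch \<Rightarrow> real"
where
  "V_thermostat A f l lam \<epsilon> x0 i0 =
    Inf {thermostat_cost l lam \<alpha> x i | \<alpha> x i.
           \<alpha> \<in> controls A \<and> thermostat_trajectory f \<epsilon> \<alpha> x0 i0 x i}"


section \<open>The limit problem on the junction\<close>

type_synonym 'a junction_control = "('a \<times> 'a \<times> 'a) + ('a \<times> branch)"

definition A0 :: "'a set \<Rightarrow> 'a data \<Rightarrow> ('a \<times> 'a \<times> 'a) set" where
  "A0 A f = {(a1, a2, a3). a1 \<in> A \<and> a2 \<in> A \<and> a3 \<in> A \<and>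
     f B1 0 a1 \<le> 0 \<and> f B2 0 a2 \<le> 0 \<and> f B3 0 a3 \<le> 0 \<and>
     \<not> (f B1 0 a1 = 0 \<and> f B2 0 a2 = 0) \<and>
     \<not> (f B1 0 a1 = 0 \<and> f B3 0 a3 = 0) \<and>
     \<not> (f B2 0 a2 = 0 \<and> f B3 0 a3 = 0)}"

definition A_tilde :: "'a set \<Rightarrow> 'a data \<Rightarrow> ('a \<times> branch) set" where
  "A_tilde A f = {(a, i). a \<in> A \<and> 0 \<le> f i 0 a}"

definition junction_controls :: "'a set \<Rightarrow> 'a data \<Rightarrow> 'a junction_control set" where
  "junction_controls A f = A0 A f <+> A_tilde A f"

fun f0 :: "'a data \<Rightarrow> 'a junction_control \<Rightarrow> real" where
  "f0 f (Inl (a1, a2, a3)) = 0"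
| "f0 f (Inr (a, i)) = f i 0 a"

fun l0 :: "'a data \<Rightarrow> 'a data \<Rightarrow> 'a junction_control \<Rightarrow> real" where
  "l0 f l (Inl (a1, a2, a3)) =
    (let f1 = f B1 0 a1; f2 = f B2 0 a2; f3 = f B3 0 a3;
         D = f2 * f3 + f1 * f3 + f1 * f2;
         \<mu>1 = f2 * f3 / D; \<mu>2 = f1 * f3 / D; \<mu>3 = f1 * f2 / D
     in \<mu>1 * l B1 0 a1 + \<mu>2 * l B2 0 a2 + \<mu>3 * l B3 0 a3)"
| "l0 f l (Inr (a, i)) = l i 0 a"

text \<open>Lebesgue measurability of a control with values in the disjoint union of the control
  spaces \<open>A\<close>, \<open>A\<^sup>3\<close> and \<open>A \<times> {1, 2, 3}\<close>, each with its Borel sets.\<close>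

definition measurable_mixed :: "(real \<Rightarrow> 'a::metric_space + 'a junction_control) \<Rightarrow> bool" where
  "measurable_mixed \<alpha> \<longleftrightarrow>
    (\<forall>U. open U \<longrightarrow> {t. 0 \<le> t \<and> \<alpha> t \<in> Inl ` U} \<in> sets lebesgue) \<and>
    (\<forall>U. open U \<longrightarrow> {t. 0 \<le> t \<and> \<alpha> t \<in> Inr ` Inl ` U} \<in> sets lebesgue) \<and>
    (\<forall>U j. open U \<longrightarrow> {t. 0 \<le> t \<and> \<alpha> t \<in> Inr ` Inr ` (U \<times> {j})} \<in> sets lebesgue)"

definition mixed_controls ::
  "'a::metric_space set \<Rightarrow> 'a data \<Rightarrow> (real \<Rightarrow> 'a + 'a junction_control) set"
where
  "mixed_controls A f =
    {\<alpha>. measurable_mixed \<alpha> \<and> (\<forall>t\<ge>0. \<alpha> t \<in> A <+> junction_controls A f)}"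

text \<open>A pair \<open>(x, i)\<close> with \<open>x \<ge> 0\<close> represents a point of the network; the pairs \<open>(0, i)\<close> all
  represent the junction.\<close>

definition same_point :: "real \<Rightarrow> branch \<Rightarrow> real \<Rightarrow> branch \<Rightarrow> bool" where
  "same_point x i y j \<longleftrightarrow> x = y \<and> (x > 0 \<longrightarrow> i = j)"

text \<open>The control constraints and the meaning of \<open>(a, j)\<close> at the junction are imposed at every
  time: the branch entered when leaving the junction is decided at the single instant of departure,
  which an almost-everywhere condition would not see. In the fourth condition the left end point
  \<open>s\<close> may be such an instant.\<close>

definition junction_trajectory ::
  "'a data \<Rightarrow> (real \<Rightarrow> 'a + 'a junction_control) \<Rightarrow> real \<Rightarrow> branch \<Rightarrow>
    (real \<Rightarrow> real) \<Rightarrow> (real \<Rightarrow> branch) \<Rightarrow> bool"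
where
  "junction_trajectory f \<alpha> x0 i0 x i \<longleftrightarrow>
    same_point (x 0) (i 0) x0 i0 \<and>
    (\<forall>t\<ge>0. 0 \<le> x t) \<and>
    (\<forall>t\<ge>0. ((\<lambda>r. if x r > 0 then f (i r) (x r) (projl (\<alpha> r)) else f0 f (projr (\<alpha> r)))
                has_integral (x t - x0)) {0..t}) \<and>
    (\<forall>s t. 0 \<le> s \<and> s \<le> t \<and> (\<forall>r\<in>{s<..t}. 0 < x r) \<longrightarrow> i t = i s) \<and>
    (\<forall>t\<ge>0. 0 < x t \<longrightarrow> isl (\<alpha> t)) \<and>
    (\<forall>t\<ge>0. x t = 0 \<longrightarrow> \<not> isl (\<alpha> t)) \<and>
    (\<forall>t\<ge>0. \<forall>a j. x t = 0 \<and> \<alpha> t = Inr (Inr (a, j)) \<longrightarrow> i t = j)"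

definition admissible_controls ::
  "'a::metric_space set \<Rightarrow> 'a data \<Rightarrow> real \<Rightarrow> branch \<Rightarrow> (real \<Rightarrow> 'a + 'a junction_control) set"
where
  "admissible_controls A f x0 i0 =
    {\<alpha> \<in> mixed_controls A f.
       \<exists>x i. junction_trajectory f \<alpha> x0 i0 x i \<and>
         (\<forall>y j. junction_trajectory f \<alpha> x0 i0 y j \<longrightarrow>
            (\<forall>t\<ge>0. same_point (x t) (i t) (y t) (j t)))}"

definition junction_cost ::
  "'a data \<Rightarrow> 'a data \<Rightarrow> real \<Rightarrow> (real \<Rightarrow> 'a + 'a junction_control) \<Rightarrow>
    (real \<Rightarrow> real) \<Rightarrow> (real \<Rightarrow> branch) \<Rightarrow> real"
where
  "junction_cost f l lam \<alpha> x i =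
    (LINT t:{0..}|lebesgue. exp (- lam * t) *
       (if x t > 0 then l (i t) (x t) (projl (\<alpha> t)) else l0 f l (projr (\<alpha> t))))"

definition V_junction ::
  "'a::metric_space set \<Rightarrow> 'a data \<Rightarrow> 'a data \<Rightarrow> real \<Rightarrow> real \<Rightarrow> branch \<Rightarrow> real"
where
  "V_junction A f l lam x0 i0 =
    Inf {junction_cost f l lam \<alpha> x i | \<alpha> x i.
           \<alpha> \<in> admissible_controls A f x0 i0 \<and> junction_trajectory f \<alpha> x0 i0 x i}"

end

theory Submission imports Defs begin

text \<open>Let \<open>W\<close> be the value of the limit problem at the junction. A junction trajectory decomposes into
  stationary times spent at the junction and excursions into the branches, and \<open>lam * W\<close> is the
  largest \<open>R\<close> such that no stationary junction control has running cost below \<open>R\<close> and no excursion has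
  discounted cost below that of the constant running cost \<open>R\<close>.

  Lower bound: applied to stationary triples and to fast excursions, this optimality yields slopes
  \<open>q i\<close> with nonnegative sum such that \<open>l i 0 a - lam * W + q i * f i 0 a \<ge> 0\<close> for all \<open>a\<close>.
  Adding the discounted derivative of \<open>q i * (x - \<epsilon>)\<close> to the running cost near the junction
  turns the cost of a thermostat stage into that of the constant running cost \<open>lam * W\<close>, up to a
  boundary term \<open>2 * q i * \<epsilon>\<close>; along the cycle of branches these terms telescope.

  Upper bound: if the thermostat values at \<open>0\<close> were all at least \<open>R / lam\<close> for arbitrarily small
  \<open>\<epsilon>\<close>, dynamic programming would show that no excursion and no stationary junction control beats
  \<open>R\<close>, hence \<open>R \<le> lam * W\<close>; a triple is tested by running through the cycle of branches with its
  components, the weights \<open>\<mu>\<close> being the proportions of time spent on each branch. The thermostat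
  values at \<open>0\<close> differ by \<open>O(\<epsilon>)\<close>, so all of them are eventually at most \<open>W + \<delta>\<close>.\<close>

section \<open>Primitives and ordinary differential equations\<close>

text \<open>The times spent away from the junction form an open set that may have infinitely many
  components in no particular order, so excursions are not treated by induction: an integral is
  signed on every component, the signs are summed by countable additivity, and the complementary
  closed set is treated pointwise. The obstacle in the lower bound is that a thermostat stage may
  contain many excursions above \<open>\<epsilon>\<close>, while comparing one of them with
  \<open>W\<close> costs O(\<open>\<epsilon>\<close>). Excursions below a fixed height
  \<open>h\<close> start and end at \<open>\<epsilon>\<close>, where the corrector vanishes, and
  leave no boundary error; the others last at least \<open>h / (2 * M)\<close> and pay for their
  error by a loss \<open>\<eta>\<close> in the running cost. The slope \<open>q i\<close> is the
  infimum of \<open>(l i 0 a - lam * W) / (- f i 0 a)\<close> over the controls with negative drift;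
  for a triple of such controls the sum of the quotients is a positive multiple of
  \<open>l0 - lam * W\<close>. In the upper bound one turn of the cycle suffices: adding three
  dynamic programming inequalities cancels the values, and a triple cheaper than \<open>R\<close>
  would leave a gain of order \<open>\<epsilon>\<close> against errors of order
  \<open>\<epsilon>\<^sup>2\<close>.\<close>

lemma integrable_on_Icc_bounded_measurable:
  fixes g :: "real \<Rightarrow> real"
  assumes "g \<in> borel_measurable (lebesgue_on {a..b})" and "\<And>t. t \<in> {a..b} \<Longrightarrow> \<bar>g t\<bar> \<le> K"
  shows "g integrable_on {a..b}"
proof (rule measurable_bounded_by_integrable_imp_integrable_real)
  show "(\<lambda>_. K) integrable_on {a..b}" by (rule integrable_const_ivl)
qed (use assms in auto)

text \<open>The control values range over a space without a countable base in general, so open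
  subsets of the product need not be countable unions of rectangles. Joint continuity is used by
  hand: the superlevel set is a union, over rational intervals of values of \<open>x\<close>, of
  intersections with preimages of open sets of control values.\<close>

lemma borel_measurable_joint_continuous:
  fixes x :: "real \<Rightarrow> real" and \<beta> :: "real \<Rightarrow> 'b::topological_space" and H :: "real \<Rightarrow> 'b \<Rightarrow> real"
  assumes S: "S \<in> sets lebesgue"
    and \<beta>: "\<And>U. open U \<Longrightarrow> {t \<in> S. \<beta> t \<in> U} \<in> sets lebesgue" "\<And>t. t \<in> S \<Longrightarrow> \<beta> t \<in> B"
    and x: "x \<in> borel_measurable (lebesgue_on S)" "\<And>t. t \<in> S \<Longrightarrow> x t \<in> X"
    and H: "continuous_on (X \<times> B) (\<lambda>(x, b). H x b)"
  shows "(\<lambda>t. H (x t) (\<beta> t)) \<in> borel_measurable (lebesgue_on S)"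
proof -
  have "{t \<in> S. c < H (x t) (\<beta> t)} \<in> sets lebesgue" for c
  proof -
    \<comment> \<open>\<open>U p q\<close> is the largest open set of control values for which
      \<open>H\<close> exceeds \<open>c\<close> over the whole interval; it depends on
      \<open>p\<close>, \<open>q\<close> and \<open>c\<close> only, which keeps the union
      countable.\<close>
    define U where "U p q = \<Union>{V. open V \<and> (\<forall>y\<in>X \<inter> {p<..<q}. \<forall>b\<in>V \<inter> B. c < H y b)}" for p q
    have opU: "open (U p q)" for p q
      unfolding U_def by auto
    have *: "{t \<in> S. c < H (x t) (\<beta> t)} =
      (\<Union>(p, q)\<in>\<rat> \<times> \<rat>. {t \<in> S. x t \<in> {p<..<q}} \<inter> {t \<in> S. \<beta> t \<in> U p q})" (is "?l = ?r")
    proof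
      show "?r \<subseteq> ?l"
      proof
        fix t assume "t \<in> ?r"
        then obtain p q where t: "t \<in> S" "x t \<in> {p<..<q}" "\<beta> t \<in> U p q"
          by blast
        then obtain V where "\<beta> t \<in> V" "\<forall>y\<in>X \<inter> {p<..<q}. \<forall>b\<in>V \<inter> B. c < H y b"
          unfolding U_def by blast
        then show "t \<in> ?l" using t \<beta>(2)[of t] x(2)[of t] by blast
      qed
      show "?l \<subseteq> ?r"
      proof
        fix t assume t: "t \<in> ?l"
        from t have "x t \<in> X" "\<beta> t \<in> B" using \<beta>(2) x(2) by blast+
        then have "\<exists>N. open N \<and> (x t, \<beta> t) \<in> N \<and> (\<forall>z\<in>X \<times> B. z \<in> N \<longrightarrow> (\<lambda>(x, b). H x b) z \<in> {c<..})"
          using t by (intro H[unfolded continuous_on_topological, rule_format]) simp_all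
        then obtain N where N: "open N" "(x t, \<beta> t) \<in> N" "\<forall>z\<in>N \<inter> X \<times> B. (\<lambda>(x, b). H x b) z \<in> {c<..}"
          by (metis IntD1 IntD2)
        obtain P V where PV: "open P" "open V" "x t \<in> P" "\<beta> t \<in> V" "P \<times> V \<subseteq> N"
          using open_prod_elim[OF N(1,2)] by (metis mem_Sigma_iff)
        obtain e where e: "e > 0" "ball (x t) e \<subseteq> P"
          using PV(1,3) openE by blast
        obtain p where p: "p \<in> \<rat>" "x t - e < p" "p < x t" using Rats_dense_in_real[of "x t - e" "x t"] e by auto
        obtain q where q: "q \<in> \<rat>" "x t < q" "q < x t + e" using Rats_dense_in_real[of "x t" "x t + e"] e by auto
        have "{p<..<q} \<subseteq> P" using e p q by (intro order_trans[OF _ e(2)]) (auto simp: dist_real_def abs_if)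
        have "c < H y b" if "y \<in> X \<inter> {p<..<q}" "b \<in> V \<inter> B" for y b
        proof -
          have "(y, b) \<in> N \<inter> X \<times> B" using that PV(5) \<open>{p<..<q} \<subseteq> P\<close> by blast
          then show ?thesis using N(3) by force
        qed
        then have "V \<subseteq> U p q"
          unfolding U_def using PV(2) by blast
        then show "t \<in> ?r"
          using p q PV t by auto
      qed
    qed
    have xm: "{t \<in> S. x t \<in> {p<..<q}} \<in> sets lebesgue" for p q
    proof -
      have "x -` {p<..<q} \<inter> space (lebesgue_on S) \<in> sets (lebesgue_on S)"
        by (rule measurable_sets[OF x(1)]) auto
      moreover have "x -` {p<..<q} \<inter> space (lebesgue_on S) = {t \<in> S. x t \<in> {p<..<q}}"
        by auto
      ultimately show ?thesis
        using S by (simp add: sets_restrict_space_iff)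
    qed
    show ?thesis
      unfolding *
    proof (intro sets.countable_UN'' countable_SIGMA countable_rat)
      fix z :: "real \<times> real"
      show "(case z of (p, q) \<Rightarrow> {t \<in> S. x t \<in> {p<..<q}} \<inter> {t \<in> S. \<beta> t \<in> U p q}) \<in> sets lebesgue"
        by (cases z, simp only: prod.case, intro sets.Int xm \<beta>(1) opU)
    qed
  qed
  then show ?thesis
    unfolding borel_measurable_iff_greater using S
    by (auto simp: sets_restrict_space_iff)
qed

section \<open>Open sets of times and their components\<close>

lemma open_real_component_cases:
  fixes U :: "real set"
  assumes "open U" and low: "\<And>t. t \<in> U \<Longrightarrow> a < t" and C: "C \<in> components U"
  shows "(\<exists>u v. u < v \<and> C = {u<..<v} \<and> u \<notin> U \<and> v \<notin> U) \<or> (\<exists>u. C = {u<..} \<and> u \<notin> U)"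
proof -
  have opC: "open C" using open_components assms by blast
  have conC: "connected C" and neC: "C \<noteq> {}" and CU: "C \<subseteq> U"
    using C in_components_connected in_components_nonempty in_components_subset by blast+
  \<comment> \<open>A point of \<open>U\<close> in the closure of a component has a ball inside
    \<open>U\<close> meeting the component, and maximality absorbs the ball; this is what puts the
    end points of \<open>C\<close> outside \<open>U\<close>.\<close>
  have maxC: "t \<in> C" if t: "t \<in> U" "t \<in> closure C" for t
  proof -
    obtain e where e: "e > 0" "ball t e \<subseteq> U"
      using \<open>open U\<close> t(1) unfolding open_contains_ball by blast
    have "C \<inter> ball t e \<noteq> {}"
      using t(2) e(1) open_Int_closure_eq_empty[of "ball t e" C] by force
    then have "ball t e \<subseteq> C"
      using components_maximal[OF C connected_ball e(2)] by blast
    then show ?thesis using e by auto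
  qed
  have bb: "bdd_below C" using low CU by (intro bdd_belowI[of _ a]) (auto intro: less_imp_le)
  define u where "u = Inf C"
  have ucl: "u \<in> closure C" unfolding u_def using neC bb closure_contains_Inf by blast
  have uC: "u \<notin> C"
  proof
    assume "u \<in> C"
    then obtain e where e: "e > 0" "ball u e \<subseteq> C" using opC unfolding open_contains_ball by blast
    moreover have "u - e/2 \<in> ball u e" using e(1) by (simp add: dist_real_def)
    ultimately have "u - e/2 \<in> C" by blast
    then have "u \<le> u - e/2" unfolding u_def using bb cInf_lower by blast
    then show False using e by auto
  qed
  have uU: "u \<notin> U" using uC maxC ucl by blast
  have low': "u < t" if "t \<in> C" for t
    using cInf_lower[OF that bb] uC that unfolding u_def by (metis order_le_less)
  have mid: "t \<in> C" if "r \<in> C" "s \<in> C" "r \<le> t" "t \<le> s" for r s t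
    using connected_contains_Icc[OF conC that(1,2)] that by auto
  show ?thesis
  proof (cases "bdd_above C")
    case True
    define v where "v = Sup C"
    have vcl: "v \<in> closure C" unfolding v_def using neC True closure_contains_Sup by blast
    have vC: "v \<notin> C"
    proof
      assume "v \<in> C"
      then obtain e where e: "e > 0" "ball v e \<subseteq> C" using opC unfolding open_contains_ball by blast
      moreover have "v + e/2 \<in> ball v e" using e(1) by (simp add: dist_real_def)
      ultimately have "v + e/2 \<in> C" by blast
      then have "v + e/2 \<le> v" unfolding v_def using True cSup_upper by blast
      then show False using e by auto
    qed
    have vU: "v \<notin> U" using vC maxC vcl by blast
    have up: "t < v" if "t \<in> C" for t
      using cSup_upper[OF that True] vC that unfolding v_def by (metis order_le_less)
    have "C = {u<..<v}"
    proof (intro equalityI subsetI)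
      fix t assume t: "t \<in> {u<..<v}"
      obtain r where "r \<in> C" "r < t" using t cInf_lessD[OF neC, of t] unfolding u_def by auto
      moreover obtain s where "s \<in> C" "t < s" using t less_cSup_iff[OF neC True, of t] unfolding v_def by auto
      ultimately show "t \<in> C" using mid by (meson less_imp_le)
    qed (use low' up in auto)
    moreover have "u < v" using neC low' up by (meson ex_in_conv less_trans)
    ultimately show ?thesis using uU vU by blast
  next
    case False
    have "C = {u<..}"
    proof (intro equalityI subsetI)
      fix t assume t: "t \<in> {u<..}"
      obtain r where "r \<in> C" "r < t" using t cInf_lessD[OF neC, of t] unfolding u_def by auto
      moreover obtain s where "s \<in> C" "t < s"
        using False unfolding bdd_above_def by (meson not_le)
      ultimately show "t \<in> C" using mid by (meson less_imp_le)
    qed (use low' in auto)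
    then show ?thesis using uU by blast
  qed
qed

text \<open>Countably many components carry the integral, but they need not be ordered like the
  naturals, so the sign on \<open>U\<close> comes from finite unions along an enumeration and
  continuity from below of the Lebesgue integral. The half-line is a separate case because an
  excursion without return has no right end point.\<close>

lemma integral_open_nonneg:
  fixes g :: "real \<Rightarrow> real"
  assumes opU: "open U" and low: "\<And>t. t \<in> U \<Longrightarrow> a < t" and g: "g absolutely_integrable_on U"
    and fin: "\<And>u v. u < v \<Longrightarrow> {u<..<v} \<subseteq> U \<Longrightarrow> u \<notin> U \<Longrightarrow> v \<notin> U \<Longrightarrow> 0 \<le> integral {u..v} g"
    and inf: "\<And>u. {u<..} \<subseteq> U \<Longrightarrow> u \<notin> U \<Longrightarrow> 0 \<le> integral {u..} g"
  shows "0 \<le> integral U g"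
proof -
  define \<C> where "\<C> = components U"
  have disj: "pairwise disjnt \<C>"
    unfolding \<C>_def pairwise_def disjnt_def using components_nonoverlap by blast
  have opC: "open C" if "C \<in> \<C>" for C
    using that open_components opU unfolding \<C>_def by blast
  have cC: "countable \<C>" using countable_disjoint_open_subsets opC disj by blast
  \<comment> \<open>Enumeration of the components, filled up with empty sets if there are only
    finitely many.\<close>
  define S where "S n = (if n \<in> to_nat_on \<C> ` \<C> then from_nat_into \<C> n else {})" for n
  have S_C: "S n \<in> \<C> \<or> S n = {}" for n
    using cC by (auto simp: S_def)
  have Un: "(\<Union>n. S n) = U"
  proof -
    have "C \<subseteq> (\<Union>n. S n)" if "C \<in> \<C>" for C
    proof -
      have "S (to_nat_on \<C> C) = C" using that cC by (simp add: S_def)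
      then show ?thesis by blast
    qed
    then have "(\<Union>n. S n) = \<Union>\<C>" using S_C by blast
    then show ?thesis unfolding \<C>_def by simp
  qed
  have Sdisj: "S m \<inter> S n = {}" if "m \<noteq> n" for m n
  proof (cases "S m = {} \<or> S n = {}")
    case False
    then have "m \<in> to_nat_on \<C> ` \<C>" "n \<in> to_nat_on \<C> ` \<C>" by (auto simp: S_def split: if_splits)
    then obtain C D where "C \<in> \<C>" "D \<in> \<C>" "m = to_nat_on \<C> C" "n = to_nat_on \<C> D" by auto
    moreover then have "S m = C" "S n = D" using cC by (auto simp: S_def)
    ultimately show ?thesis using disj that unfolding pairwise_def disjnt_def by metis
  qed auto
  have Smeas: "S n \<in> sets lebesgue" for n
    using S_C[of n] opC by auto
  have gS: "g absolutely_integrable_on V" if "V \<in> sets lebesgue" "V \<subseteq> U" for V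
    using set_integrable_subset[OF g] that by auto
  have pos: "0 \<le> integral (S n) g" for n
  proof (cases "S n = {}")
    case False
    then have "S n \<in> components U" using S_C[of n] \<C>_def by auto
    then consider (bounded) u v where "u < v" "S n = {u<..<v}" "u \<notin> U" "v \<notin> U"
      | (unbounded) u where "S n = {u<..}" "u \<notin> U"
      using open_real_component_cases[OF opU low, of "S n"] by blast
    then show ?thesis
    proof cases
      case (bounded u v)
      have "S n \<subseteq> U" using Un by auto
      with bounded fin[of u v] show ?thesis by (simp add: integral_open_interval_real)
    next
      case (unbounded u)
      have "S n \<subseteq> U" using Un by auto
      moreover have "integral {u<..} g = integral {u..} g"
        by (rule integral_spike_set) (rule negligible_subset[of "{u}"], auto)+
      ultimately show ?thesis using inf[of u] unbounded by simp
    qed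
  qed auto
  have part: "0 \<le> integral (\<Union>m\<le>n. S m) g" for n
  proof (induction n)
    case 0 then show ?case using pos[of 0] by simp
  next
    case (Suc n)
    have eq: "(\<Union>m\<le>Suc n. S m) = (\<Union>m\<le>n. S m) \<union> S (Suc n)" by (auto simp: le_Suc_eq)
    have "integral (\<Union>m\<le>Suc n. S m) g = integral (\<Union>m\<le>n. S m) g + integral (S (Suc n)) g"
      unfolding eq
    proof (rule integral_Un)
      have "S m \<inter> S (Suc n) = {}" if "m \<le> n" for m using Sdisj[of m "Suc n"] that by simp
      then have "(\<Union>m\<le>n. S m) \<inter> S (Suc n) = {}" by blast
      then show "negligible ((\<Union>m\<le>n. S m) \<inter> S (Suc n))" by simp
      show "g integrable_on (\<Union>m\<le>n. S m)"
        by (intro set_lebesgue_integral_eq_integral(1) gS) (use Smeas Un in auto)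
      show "g integrable_on S (Suc n)"
        by (intro set_lebesgue_integral_eq_integral(1) gS) (use Smeas Un in auto)
    qed
    then show ?case using Suc pos[of "Suc n"] by linarith
  qed
  have "(\<lambda>n. LINT x:(\<Union>m\<le>n. S m)|lebesgue. g x) \<longlonglongrightarrow> (LINT x:(\<Union>n. \<Union>m\<le>n. S m)|lebesgue. g x)"
  proof (rule set_integral_cont_up)
    have "(\<Union>n. \<Union>m\<le>n. S m) = U" using Un by blast
    then show "set_integrable lebesgue (\<Union>n. \<Union>m\<le>n. S m) g" using g by simp
    show "incseq (\<lambda>n. \<Union>m\<le>n. S m)" unfolding incseq_def by (fastforce intro: order_trans)
  qed (use Smeas in auto)
  moreover have "(\<Union>n. \<Union>m\<le>n. S m) = U" using Un by blast
  moreover have "(LINT x:(\<Union>m\<le>n. S m)|lebesgue. g x) = integral (\<Union>m\<le>n. S m) g" for n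
    by (rule set_lebesgue_integral_eq_integral(2)[OF gS]) (use Smeas Un in auto)
  ultimately have "(\<lambda>n. integral (\<Union>m\<le>n. S m) g) \<longlonglongrightarrow> integral U g"
    using set_lebesgue_integral_eq_integral(2)[OF g] by simp
  then show ?thesis
    by (rule LIMSEQ_le_const) (use part in auto)
qed

text \<open>The form in which the trajectories of both problems are given: \<open>x\<close> is an
  indefinite gauge integral of \<open>\<phi>\<close>. The condition is vacuous for
  \<open>b < a\<close>, so solutions can be stated for every end time \<open>T\<close>.\<close>

definition primitive_on :: "real \<Rightarrow> real \<Rightarrow> (real \<Rightarrow> real) \<Rightarrow> (real \<Rightarrow> real) \<Rightarrow> bool" where
  "primitive_on a b \<phi> x \<longleftrightarrow> (\<forall>t\<in>{a..b}. (\<phi> has_integral (x t - x a)) {a..t})"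

lemma primitive_on_integrable: "primitive_on a b \<phi> x \<Longrightarrow> \<phi> integrable_on {a..b}"
  unfolding primitive_on_def integrable_on_def
  by (metis atLeastAtMost_iff atLeastatMost_empty_iff has_integral_empty order_refl)

lemma primitive_on_has_integral:
  assumes "primitive_on a b \<phi> x" "a \<le> s" "s \<le> t" "t \<le> b"
  shows "(\<phi> has_integral (x t - x s)) {s..t}"
proof -
  have int: "\<phi> integrable_on {a..t}" "\<phi> integrable_on {s..t}"
    using primitive_on_integrable[OF assms(1)] integrable_on_subinterval assms by fastforce+
  have "integral {a..t} \<phi> = x t - x a" "integral {a..s} \<phi> = x s - x a"
    using assms unfolding primitive_on_def by (auto intro!: integral_unique)
  then have "integral {s..t} \<phi> = x t - x s"
    using Henstock_Kurzweil_Integration.integral_combine[OF assms(2,3) int(1)] by linarith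
  then show ?thesis using int(2) by (metis integrable_integral)
qed

lemma primitive_on_subinterval:
  "primitive_on a b \<phi> x \<Longrightarrow> a \<le> s \<Longrightarrow> t \<le> b \<Longrightarrow> primitive_on s t \<phi> x"
  unfolding primitive_on_def[of s] by (auto intro: primitive_on_has_integral)

lemma primitive_on_combine:
  assumes "primitive_on a b \<phi> x" "primitive_on b c \<phi> x" "a \<le> b"
  shows "primitive_on a c \<phi> x"
  unfolding primitive_on_def
proof
  fix t assume t: "t \<in> {a..c}"
  show "(\<phi> has_integral x t - x a) {a..t}"
  proof (cases "t \<le> b")
    case True
    then show ?thesis using assms(1) t unfolding primitive_on_def by auto
  next
    case False
    then have "(\<phi> has_integral (x b - x a) + (x t - x b)) {a..t}"
      using assms t unfolding primitive_on_def
      by (intro has_integral_combine[of a b t]) auto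
    then show ?thesis by simp
  qed
qed

lemma primitive_on_shift:
  assumes "primitive_on a b \<phi> x"
  shows "primitive_on (a - c) (b - c) (\<lambda>t. \<phi> (t + c)) (\<lambda>t. x (t + c))"
  unfolding primitive_on_def
proof
  fix t assume "t \<in> {a - c..b - c}"
  then have "(\<phi> has_integral x (t + c) - x a) {a..t + c}"
    using assms unfolding primitive_on_def by auto
  from has_integral_shift_real_ivl[OF this, of c]
  show "((\<lambda>t. \<phi> (t + c)) has_integral x (t + c) - x (a - c + c)) {a - c..t}" by simp
qed

lemma primitive_on_cong:
  assumes "primitive_on a b \<phi> x" "finite N" "\<And>t. t \<in> {a..b} - N \<Longrightarrow> \<psi> t = \<phi> t"
    "\<And>t. t \<in> {a..b} \<Longrightarrow> y t = x t"
  shows "primitive_on a b \<psi> y"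
  unfolding primitive_on_def
proof
  fix t assume t: "t \<in> {a..b}"
  then have "(\<phi> has_integral (y t - y a)) {a..t}"
    using assms(1,4) unfolding primitive_on_def by auto
  then show "(\<psi> has_integral (y t - y a)) {a..t}"
    by (rule has_integral_spike_finite[OF assms(2), rotated]) (use assms(3) t in auto)
qed

lemma primitive_on_continuous:
  assumes "primitive_on a b \<phi> x"
  shows "continuous_on {a..b} x"
proof -
  have "continuous_on {a..b} (\<lambda>t. x a + integral {a..t} \<phi>)"
    by (intro continuous_intros indefinite_integral_continuous_1 primitive_on_integrable[OF assms])
  then show ?thesis
    by (rule continuous_on_eq) (use assms in \<open>auto simp: primitive_on_def dest!: bspec integral_unique\<close>)
qed

lemma primitive_on_lipschitz:
  assumes "primitive_on a b \<phi> x" "\<And>t. t \<in> {a..b} \<Longrightarrow> \<bar>\<phi> t\<bar> \<le> K" "a \<le> s" "s \<le> t" "t \<le> b"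
  shows "\<bar>x t - x s\<bar> \<le> K * (t - s)"
proof -
  have "0 \<le> K" using assms(2)[of s] assms(3-5) by auto
  then show ?thesis
    using has_integral_bound_real[OF _ _ primitive_on_has_integral[OF assms(1,3,4,5)], of K "{}"] assms
    by simp
qed

lemma continuous_on_atLeast_Icc:
  fixes x :: "real \<Rightarrow> 'b::topological_space"
  assumes "\<And>T. a \<le> T \<Longrightarrow> continuous_on {a..T} x"
  shows "continuous_on {a..} x"
  unfolding continuous_on_def
proof
  fix t assume t: "t \<in> {a..}"
  have "at t within {a..} = at t within {a..t + 1}"
    by (rule at_within_nhd[of _ "{..<t + 1}"]) (use t in auto)
  moreover have "(x \<longlongrightarrow> x t) (at t within {a..t + 1})"
    using assms[of "t + 1"] t by (auto simp: continuous_on_def)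
  ultimately show "(x \<longlongrightarrow> x t) (at t within {a..})" by simp
qed

text \<open>The bound makes the derivative vanish at every point. It replaces a product rule almost
  everywhere: \<open>h\<close> may be built from functions that are only Lipschitz, as long as its
  own increments are of second order.\<close>

lemma eq_if_quadratic_increments:
  fixes h :: "real \<Rightarrow> real"
  assumes "a \<le> b" and q: "\<And>s t. a \<le> s \<Longrightarrow> s \<le> t \<Longrightarrow> t \<le> b \<Longrightarrow> \<bar>h t - h s\<bar> \<le> C * (t - s)\<^sup>2"
  shows "h b = h a"
proof -
  have q': "\<bar>h t - h s\<bar> \<le> C * (t - s)\<^sup>2" if "s \<in> {a..b}" "t \<in> {a..b}" for s t
    using q[of s t] q[of t s] that by (cases "s \<le> t") (auto simp: power2_commute abs_minus_commute)
  have "(h has_field_derivative 0) (at s within {a..b})" if s: "s \<in> {a..b}" for s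
    unfolding has_field_derivative_iff
  proof (rule Lim_null_comparison)
    show "\<forall>\<^sub>F t in at s within {a..b}. norm ((h t - h s) / (t - s)) \<le> C * \<bar>t - s\<bar>"
      unfolding eventually_at_filter
    proof (intro always_eventually allI impI)
      fix t assume "t \<noteq> s" "t \<in> {a..b}"
      then show "norm ((h t - h s) / (t - s)) \<le> C * \<bar>t - s\<bar>"
        using q'[OF s, of t] by (simp add: abs_divide divide_le_eq power2_eq_square mult.assoc flip: abs_mult)
    qed
    have "((\<lambda>t. C * \<bar>t - s\<bar>) \<longlongrightarrow> C * \<bar>s - s\<bar>) (at s within {a..b})"
      by (intro tendsto_intros)
    then show "((\<lambda>t. C * \<bar>t - s\<bar>) \<longlongrightarrow> 0) (at s within {a..b})" by simp
  qed
  then obtain c where "\<forall>t\<in>{a..b}. h t = c"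
    using has_field_derivative_zero_constant[of "{a..b}" h] by auto
  then show ?thesis using \<open>a \<le> b\<close> by auto
qed

lemma integrable_on_mult_continuous:
  fixes g \<phi> :: "real \<Rightarrow> real"
  assumes "\<phi> integrable_on {a..b}" "\<And>t. t \<in> {a..b} \<Longrightarrow> \<bar>\<phi> t\<bar> \<le> K" "continuous_on {a..b} g"
  shows "(\<lambda>t. g t * \<phi> t) integrable_on {a..b}"
proof -
  obtain B where B: "\<forall>t\<in>{a..b}. \<bar>g t\<bar> \<le> B"
    using compact_imp_bounded[OF compact_continuous_image[OF assms(3) compact_Icc]] unfolding bounded_iff by auto
  show ?thesis
  proof (rule integrable_on_Icc_bounded_measurable)
    show "(\<lambda>t. g t * \<phi> t) \<in> borel_measurable (lebesgue_on {a..b})"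
      using assms integrable_imp_measurable continuous_imp_measurable_on_sets_lebesgue[OF assms(3)]
      by (intro borel_measurable_times) auto
    fix t assume "t \<in> {a..b}"
    then show "\<bar>g t * \<phi> t\<bar> \<le> B * K"
      using B assms(2)[of t] by (auto simp: abs_mult intro!: mult_mono')
  qed
qed

lemma abs_exp_diff_le:
  fixes lam :: real
  assumes "0 < lam" "0 \<le> s" "s \<le> t"
  shows "\<bar>exp (- lam * t) - exp (- lam * s)\<bar> \<le> lam * (t - s)"
proof -
  have "exp (- lam * s) - exp (- lam * t) = exp (- lam * s) * (1 - exp (- lam * (t - s)))"
    by (simp add: algebra_simps flip: exp_add)
  also have "\<dots> \<le> 1 * (lam * (t - s))"
  proof (rule mult_mono)
    show "1 - exp (- lam * (t - s)) \<le> lam * (t - s)"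
      using exp_ge_add_one_self[of "- lam * (t - s)"] by simp
  qed (use assms in auto)
  finally show ?thesis using assms by (simp add: abs_if)
qed

text \<open>Integration by parts of \<open>exp (- lam * t)\<close> against a primitive with a merely
  bounded derivative. The difference \<open>h\<close> of the two sides, as a function of the end
  point, has increments of second order, so no almost everywhere differentiation is
  involved.\<close>

lemma discounted_primitive:
  fixes lam :: real
  assumes p: "primitive_on a b \<phi> x" and K: "\<And>t. t \<in> {a..b} \<Longrightarrow> \<bar>\<phi> t\<bar> \<le> K"
    and "0 < lam" "0 \<le> a" "a \<le> b"
  shows "((\<lambda>t. exp (- lam * t) * (\<phi> t - lam * (x t - c))) has_integral
           (exp (- lam * b) * (x b - c) - exp (- lam * a) * (x a - c))) {a..b}"
proof -
  define e where "e t = exp (- lam * t)" for t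
  define g where "g t = e t * (\<phi> t - lam * (x t - c))" for t
  define h where "h t = e t * (x t - c) - integral {a..t} g" for t
  have K0: "0 \<le> K" using K[of a] \<open>a \<le> b\<close> by auto
  have e1: "0 \<le> e t" "e t \<le> 1" if "0 \<le> t" for t using that \<open>0 < lam\<close> by (auto simp: e_def)
  have cx: "continuous_on {a..b} x" by (rule primitive_on_continuous[OF p])
  have ce: "continuous_on S e" for S unfolding e_def by (intro continuous_intros)
  have i1: "(\<lambda>t. e t * \<phi> t) integrable_on {a..b}"
    by (rule integrable_on_mult_continuous[OF primitive_on_integrable[OF p] K ce])
  have i2: "(\<lambda>t. e t * (lam * (x t - c))) integrable_on {a..b}"
    by (intro integrable_continuous_interval continuous_intros ce cx)
  have ig: "g integrable_on {a..b}"
    using integrable_diff[OF i1 i2] unfolding g_def by (simp add: right_diff_distrib)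
  have "h b = h a"
  proof (rule eq_if_quadratic_increments[OF \<open>a \<le> b\<close>])
    fix s t assume st: "a \<le> s" "s \<le> t" "t \<le> b"
    have "0 \<le> s" using st \<open>0 \<le> a\<close> by simp
    have ist: "g integrable_on {s..t}" "g integrable_on {a..t}"
      using ig integrable_on_subinterval st by fastforce+
    have hx: "((\<lambda>r. e t * \<phi> r) has_integral e t * (x t - x s)) {s..t}"
      by (rule has_integral_mult_right[OF primitive_on_has_integral[OF p st]])
    have "((\<lambda>r. - lam * e r) has_integral e t - e s) {s..t}"
      unfolding e_def
      by (rule fundamental_theorem_of_calculus[OF st(2)])
         (auto intro!: derivative_eq_intros simp flip: has_real_derivative_iff_has_vector_derivative)
    from has_integral_mult_left[OF this, of "x s - c"]
    have he: "((\<lambda>r. - lam * e r * (x s - c)) has_integral (e t - e s) * (x s - c)) {s..t}" .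
    have "((\<lambda>r. e t * \<phi> r + - lam * e r * (x s - c) - g r) has_integral
        e t * (x t - x s) + (e t - e s) * (x s - c) - integral {s..t} g) {s..t}"
      by (intro has_integral_diff has_integral_add hx he integrable_integral ist)
    moreover have "e t * (x t - x s) + (e t - e s) * (x s - c) - integral {s..t} g = h t - h s"
      unfolding h_def
      using Henstock_Kurzweil_Integration.integral_combine[OF st(1,2) ist(2)] by (simp add: algebra_simps)
    ultimately have "((\<lambda>r. e t * \<phi> r + - lam * e r * (x s - c) - g r) has_integral h t - h s) {s..t}"
      by simp
    then have "norm (h t - h s) \<le> (2 * lam * K * (t - s)) * measure lborel {s..t}"
    proof (rule has_integral_bound_real[rotated 2])
      show "0 \<le> 2 * lam * K * (t - s)" using K0 st \<open>0 < lam\<close> by simp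
      fix r assume "r \<in> {s..t} - {}"
      then have r: "s \<le> r" "r \<le> t" by auto
      \<comment> \<open>Discrete product rule with \<open>e\<close> taken at \<open>t\<close> and
        \<open>x\<close> at \<open>s\<close>: the deviation from \<open>g r\<close> is a sum of two
        products, each with one factor of size O(\<open>t - s\<close>).\<close>
      have "e t * \<phi> r + - lam * e r * (x s - c) - g r = (e t - e r) * \<phi> r + lam * e r * (x r - x s)"
        by (simp add: g_def algebra_simps)
      also have "\<bar>\<dots>\<bar> \<le> \<bar>e t - e r\<bar> * \<bar>\<phi> r\<bar> + lam * e r * \<bar>x r - x s\<bar>"
        using abs_triangle_ineq[of "(e t - e r) * \<phi> r" "lam * e r * (x r - x s)"] \<open>0 < lam\<close>
        by (simp add: abs_mult e_def)
      also have "\<dots> \<le> (lam * (t - r)) * K + lam * 1 * (K * (r - s))"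
        using abs_exp_diff_le[OF \<open>0 < lam\<close>, of r t] K[of r] e1[of r] r st \<open>0 \<le> s\<close> \<open>0 < lam\<close> K0
          primitive_on_lipschitz[OF p K, of s r]
        by (intro add_mono mult_mono) (auto simp: e_def)
      also have "\<dots> = lam * K * (t - s)" by (simp add: algebra_simps)
      also have "\<dots> \<le> 2 * lam * K * (t - s)" using K0 st \<open>0 < lam\<close> by simp
      finally show "norm (e t * \<phi> r + - lam * e r * (x s - c) - g r) \<le> 2 * lam * K * (t - s)" by simp
    qed auto
    then show "\<bar>h t - h s\<bar> \<le> 2 * lam * K * (t - s)\<^sup>2"
      using st by (simp add: power2_eq_square)
  qed
  then have "integral {a..b} g = e b * (x b - c) - e a * (x a - c)"
    by (simp add: h_def)
  with ig have "(g has_integral e b * (x b - c) - e a * (x a - c)) {a..b}"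
    by (metis integrable_integral)
  then show ?thesis unfolding g_def e_def by simp
qed

text \<open>Gronwall: the distance \<open>z\<close> is at most \<open>L\<close> times its own
  integral \<open>Z\<close>, so \<open>exp (- L * s) * Z s\<close> is nonincreasing and starts at
  \<open>0\<close>.\<close>

lemma ode_unique:
  fixes \<Phi> :: "real \<Rightarrow> real \<Rightarrow> real"
  assumes x: "primitive_on a b (\<lambda>t. \<Phi> (x t) t) x" and y: "primitive_on a b (\<lambda>t. \<Phi> (y t) t) y"
    and "x a = y a" and lip: "\<And>t u v. t \<in> {a..b} \<Longrightarrow> \<bar>\<Phi> u t - \<Phi> v t\<bar> \<le> L * \<bar>u - v\<bar>"
    and "0 < L" and t: "t \<in> {a..b}"
  shows "x t = y t"
proof -
  define z where "z t = \<bar>x t - y t\<bar>" for t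
  have cz: "continuous_on {a..b} z"
    unfolding z_def using primitive_on_continuous[OF x] primitive_on_continuous[OF y]
    by (intro continuous_intros)
  have zint: "z integrable_on {a..s}" if "s \<in> {a..b}" for s
    using that by (intro integrable_continuous_interval continuous_on_subset[OF cz]) auto
  define Z where "Z s = integral {a..s} z" for s
  have zle: "z s \<le> L * Z s" if s: "s \<in> {a..b}" for s
  proof -
    have d: "((\<lambda>r. \<Phi> (x r) r - \<Phi> (y r) r) has_integral x s - y s) {a..s}"
      using has_integral_diff[of "\<lambda>r. \<Phi> (x r) r" "x s - x a" "{a..s}" "\<lambda>r. \<Phi> (y r) r" "y s - y a"]
        x y s \<open>x a = y a\<close> unfolding primitive_on_def by auto
    have "norm (integral {a..s} (\<lambda>r. \<Phi> (x r) r - \<Phi> (y r) r)) \<le> integral {a..s} (\<lambda>r. L * z r)"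
    proof (rule integral_norm_bound_integral)
      show "(\<lambda>r. L * z r) integrable_on {a..s}" using has_integral_mult_right[OF integrable_integral[OF zint[OF s]], of L] by (rule has_integral_integrable)
    qed (use d lip s in \<open>auto simp: z_def\<close>)
    then show ?thesis using integral_unique[OF d] by (simp add: Z_def z_def[abs_def])
  qed
  have cZ: "continuous_on {a..b} Z"
    unfolding Z_def by (intro indefinite_integral_continuous_1 integrable_continuous_interval cz)
  have "exp (- L * s) * Z s \<le> exp (- L * a) * Z a" if s: "s \<in> {a..b}" for s
  proof (rule DERIV_nonpos_imp_decreasing_open[of a s "\<lambda>s. exp (- L * s) * Z s"])
    show "continuous_on {a..s} (\<lambda>s. exp (- L * s) * Z s)"
      using s by (intro continuous_intros continuous_on_subset[OF cZ]) auto
    fix r assume r: "a < r" "r < s"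
    have "(Z has_real_derivative z r) (at r within {a..b})"
      using integral_has_real_derivative[OF cz, of r] r s by (auto simp: Z_def[abs_def])
    then have "(Z has_real_derivative z r) (at r)"
      using r s by (simp add: at_within_Icc_at)
    then have "((\<lambda>s. exp (- L * s) * Z s) has_real_derivative exp (- L * r) * (z r - L * Z r)) (at r)"
      by (auto intro!: derivative_eq_intros simp: algebra_simps)
    then show "\<exists>y. ((\<lambda>s. exp (- L * s) * Z s) has_real_derivative y) (at r) \<and> y \<le> 0"
      using zle[of r] r s by (intro exI conjI) (auto simp: mult_le_0_iff)
  qed (use s in auto)
  from this[OF t] have "Z t \<le> 0" by (simp add: Z_def mult_le_0_iff)
  then have "L * Z t \<le> 0" using \<open>0 < L\<close> by (simp add: mult_le_0_iff)
  then have "z t \<le> 0" using zle[OF t] by linarith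
  then show ?thesis by (simp add: z_def)
qed

text \<open>In the norm weighted by \<open>exp (- 2 * L * t)\<close> Picard's map is a contraction
  on the whole half-line at once, so local solutions need not be continued. The right-hand side is
  only required to be integrable along continuous functions, as controls are merely measurable in
  time.\<close>

lemma ode_exists:
  fixes \<Phi> :: "real \<Rightarrow> real \<Rightarrow> real"
  assumes int: "\<And>x T. continuous_on {0..} x \<Longrightarrow> (\<lambda>t. \<Phi> (x t) t) integrable_on {0..T}"
    and M: "\<And>u t. 0 \<le> t \<Longrightarrow> \<bar>\<Phi> u t\<bar> \<le> M"
    and lip: "\<And>t u v. 0 \<le> t \<Longrightarrow> \<bar>\<Phi> u t - \<Phi> v t\<bar> \<le> L * \<bar>u - v\<bar>" and "0 < L"
  obtains x where "x 0 = x0" "\<And>T. primitive_on 0 T (\<lambda>t. \<Phi> (x t) t) x"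
proof -
  define E where "E t = exp (2 * L * t)" for t
  have E: "E t > 0" for t by (simp add: E_def)
  define P where "P z t = x0 + integral {0..t} (\<lambda>r. \<Phi> (E r * z r) r)" for z t
  \<comment> \<open>The unknown is \<open>x / E\<close>, continued constantly to negative times so
    that it lives in the space of bounded continuous functions on the line. The exponent
    \<open>2 * L\<close> of the weight gives the contraction factor 1/2.\<close>
  define Q where "Q z t = P z (max t 0) / E (max t 0)" for z t
  have cE: "continuous_on S E" for S unfolding E_def by (intro continuous_intros)
  have intz: "(\<lambda>r. \<Phi> (E r * apply_bcontfun z r) r) integrable_on {0..T}" for z T
    by (rule int) (intro continuous_intros cE continuous_on_apply_bcontfun)
  have intle: "norm (integral {0..t} (\<lambda>r. \<Phi> (E r * apply_bcontfun z r) r)) \<le> M * t" if "0 \<le> t" for z t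
  proof -
    have "norm (integral {0..t} (\<lambda>r. \<Phi> (E r * apply_bcontfun z r) r)) \<le> integral {0..t} (\<lambda>r. M)"
      by (rule integral_norm_bound_integral[OF intz]) (use M in auto)
    then show ?thesis using that by (simp add: mult.commute)
  qed
  have "0 \<le> M" using M[of 0 0] by auto
  have Qb: "Q z \<in> bcontfun" for z :: "real \<Rightarrow>\<^sub>C real"
  proof (rule bcontfun_normI)
    have cP: "continuous_on {0..} (P z)"
      unfolding P_def
      by (rule continuous_on_atLeast_Icc) (intro continuous_intros indefinite_integral_continuous_1 intz)
    have "continuous_on UNIV (\<lambda>t. P z (max t 0))"
      by (rule continuous_on_compose2[OF cP]) (auto intro!: continuous_intros)
    moreover have "continuous_on UNIV (\<lambda>t. E (max t 0))"
      by (rule continuous_on_compose2[OF cE[of UNIV]]) (auto intro!: continuous_intros)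
    ultimately show "continuous_on UNIV (Q z)"
      unfolding Q_def by (intro continuous_on_divide) (use E less_imp_neq[OF E] in auto)
    fix t :: real
    define \<tau> where "\<tau> = max t 0"
    have "0 \<le> \<tau>" by (simp add: \<tau>_def)
    have "2 * L * \<tau> \<le> E \<tau>" using exp_ge_add_one_self[of "2 * L * \<tau>"] unfolding E_def by linarith
    then have "\<tau> \<le> E \<tau> / (2 * L)" using \<open>0 < L\<close> by (simp add: field_simps)
    then have "M * \<tau> \<le> M * (E \<tau> / (2 * L))" using \<open>0 \<le> M\<close> by (rule mult_left_mono)
    moreover have "\<bar>P z \<tau>\<bar> \<le> \<bar>x0\<bar> + M * \<tau>" using intle[OF \<open>0 \<le> \<tau>\<close>, of z] by (auto simp: P_def)
    moreover have "\<bar>x0\<bar> \<le> \<bar>x0\<bar> * E \<tau>" using \<open>0 \<le> \<tau>\<close> \<open>0 < L\<close> by (simp add: E_def mult_le_cancel_left1)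
    ultimately have "\<bar>P z \<tau>\<bar> \<le> (\<bar>x0\<bar> + M / (2 * L)) * E \<tau>" by (simp add: algebra_simps)
    then show "norm (Q z t) \<le> \<bar>x0\<bar> + M / (2 * L)"
      unfolding Q_def \<tau>_def[symmetric] using E[of \<tau>] by (simp add: abs_divide divide_le_eq)
  qed
  define R where "R z = Bcontfun (Q (apply_bcontfun z))" for z
  have R: "apply_bcontfun (R z) = Q z" for z
    unfolding R_def by (rule Bcontfun_inverse[OF Qb])
  have "dist (R z) (R w) \<le> 1/2 * dist z w" for z w
  proof (rule dist_bound)
    fix t :: real
    define \<tau> where "\<tau> = max t 0"
    have "0 \<le> \<tau>" by (simp add: \<tau>_def)
    have ex: "((\<lambda>r. L * (E r * dist z w)) has_integral dist z w * (E \<tau> - 1) / 2) {0..\<tau>}"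
    proof -
      have "((\<lambda>r. L * (E r * dist z w)) has_integral dist z w * E \<tau> / 2 - dist z w * E 0 / 2) {0..\<tau>}"
        unfolding E_def
        by (rule fundamental_theorem_of_calculus[OF \<open>0 \<le> \<tau>\<close>])
           (auto intro!: derivative_eq_intros simp flip: has_real_derivative_iff_has_vector_derivative)
      then show ?thesis by (simp add: E_def algebra_simps diff_divide_distrib)
    qed
    have "norm (integral {0..\<tau>} (\<lambda>r. \<Phi> (E r * z r) r - \<Phi> (E r * w r) r)) \<le> integral {0..\<tau>} (\<lambda>r. L * (E r * dist z w))"
    proof (rule integral_norm_bound_integral)
      show "(\<lambda>r. \<Phi> (E r * z r) r - \<Phi> (E r * w r) r) integrable_on {0..\<tau>}"
        by (intro integrable_diff intz)
      show "(\<lambda>r. L * (E r * dist z w)) integrable_on {0..\<tau>}" using ex by blast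
      fix r assume "r \<in> {0..\<tau>}"
      then have "\<bar>\<Phi> (E r * z r) r - \<Phi> (E r * w r) r\<bar> \<le> L * \<bar>E r * z r - E r * w r\<bar>"
        by (intro lip) auto
      also have "\<bar>E r * z r - E r * w r\<bar> = E r * dist (z r) (w r)"
        using E[of r] by (simp add: dist_real_def abs_mult flip: right_diff_distrib)
      also have "L * \<dots> \<le> L * (E r * dist z w)"
        using E[of r] \<open>0 < L\<close> dist_bounded[of z r w] by (intro mult_left_mono) auto
      finally show "norm (\<Phi> (E r * z r) r - \<Phi> (E r * w r) r) \<le> L * (E r * dist z w)"
        using \<open>0 < L\<close> by simp
    qed
    also have "integral {0..\<tau>} (\<lambda>r. \<Phi> (E r * z r) r - \<Phi> (E r * w r) r) = P z \<tau> - P w \<tau>"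
      unfolding P_def by (simp add: integral_diff[OF intz intz])
    also have "integral {0..\<tau>} (\<lambda>r. L * (E r * dist z w)) = dist z w * (E \<tau> - 1) / 2"
      using ex by (rule integral_unique)
    also have "\<dots> \<le> 1/2 * dist z w * E \<tau>"
      by (simp add: algebra_simps)
    finally have "\<bar>P z \<tau> - P w \<tau>\<bar> \<le> 1/2 * dist z w * E \<tau>" by simp
    then show "dist (apply_bcontfun (R z) t) (apply_bcontfun (R w) t) \<le> 1/2 * dist z w"
      unfolding R Q_def \<tau>_def[symmetric] dist_real_def
      using E[of \<tau>] by (simp add: abs_divide divide_le_eq flip: diff_divide_distrib)
  qed
  then obtain z where z: "R z = z"
    using banach_fix_type[of "1/2" R] by auto
  define x where "x t = E t * apply_bcontfun z t" for t
  have xP: "x t = P z t" if "0 \<le> t" for t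
  proof -
    have "apply_bcontfun z t = Q z t" using R[of z] z by simp
    then show ?thesis unfolding x_def using that E[of t] by (simp add: Q_def)
  qed
  have "primitive_on 0 T (\<lambda>t. \<Phi> (x t) t) x" for T
    unfolding primitive_on_def
  proof
    fix t assume t: "t \<in> {0..T}"
    have "x t - x 0 = integral {0..t} (\<lambda>r. \<Phi> (x r) r)"
      using t xP[of t] xP[of 0] by (simp add: P_def x_def)
    then show "((\<lambda>t. \<Phi> (x t) t) has_integral x t - x 0) {0..t}"
      using intz[of z t] unfolding x_def by (simp add: has_integral_integral)
  qed
  moreover have "x 0 = x0" using xP[of 0] by (simp add: P_def)
  ultimately show thesis using that by blast
qed

section \<open>Discounted costs\<close>

text \<open>The class of running costs along trajectories. It is closed under gluing in time and, by
  exhaustion of the half-line, implies measurability there, so that the discounted gauge integral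
  agrees with the Lebesgue integral in the definitions of the costs.\<close>

definition bdd_integrable :: "(real \<Rightarrow> real) \<Rightarrow> bool" where
  "bdd_integrable g \<longleftrightarrow> (\<exists>K. \<forall>t\<ge>0. \<bar>g t\<bar> \<le> K) \<and> (\<forall>T. g integrable_on {0..T})"

definition discounted :: "real \<Rightarrow> (real \<Rightarrow> real) \<Rightarrow> real" where
  "discounted lam g = integral {0..} (\<lambda>t. exp (- lam * t) * g t)"

lemma bdd_integrable_measurable:
  assumes "bdd_integrable g"
  shows "g \<in> borel_measurable (lebesgue_on {0..})"
proof -
  have "(\<lambda>t. if t \<in> {0..} then g t else 0) \<in> borel_measurable lebesgue"
  proof (rule borel_measurable_LIMSEQ_real)
    fix n :: nat
    show "(\<lambda>t. if t \<in> {0..real n} then g t else 0) \<in> borel_measurable lebesgue"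
      using assms integrable_imp_measurable[of g "{0..real n}"] unfolding bdd_integrable_def
      by (subst borel_measurable_if) auto
  next
    fix t :: real
    have "\<forall>\<^sub>F n in sequentially. (if t \<in> {0..real n} then g t else 0) = (if t \<in> {0..} then g t else 0)"
      using eventually_ge_at_top[of "nat \<lceil>t\<rceil>"] by eventually_elim (auto simp: nat_le_iff ceiling_le_iff)
    then show "(\<lambda>n. if t \<in> {0..real n} then g t else 0) \<longlonglongrightarrow> (if t \<in> {0..} then g t else 0)"
      by (rule tendsto_eventually)
  qed
  then show ?thesis by (subst (asm) borel_measurable_if) auto
qed

lemma bdd_integrable_absolutely:
  assumes "bdd_integrable g" "0 < lam" "S \<in> sets lebesgue" "S \<subseteq> {0..}"
  shows "(\<lambda>t. exp (- lam * t) * g t) absolutely_integrable_on S"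
proof (rule set_integrable_subset[OF _ assms(3,4)])
  obtain K where K: "\<forall>t\<ge>0. \<bar>g t\<bar> \<le> K" using assms(1) bdd_integrable_def by blast
  show "(\<lambda>t. exp (- lam * t) * g t) absolutely_integrable_on {0..}"
  proof (rule measurable_bounded_by_integrable_imp_absolutely_integrable)
    have "(\<lambda>t. exp (- lam * t)) \<in> borel_measurable (lebesgue_on {0..})"
      by (intro continuous_imp_measurable_on_sets_lebesgue continuous_intros) auto
    then show "(\<lambda>t. exp (- lam * t) * g t) \<in> borel_measurable (lebesgue_on {0..})"
      using bdd_integrable_measurable[OF assms(1)] by (intro borel_measurable_times) auto
    show "(\<lambda>t. exp (- lam * t) * K) integrable_on {0..}"
      using has_integral_mult_left[OF has_integral_exp_minus_to_infinity[OF \<open>0 < lam\<close>, of 0], of K]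
      by (rule has_integral_integrable)
  qed (use K in \<open>auto simp: abs_mult\<close>)
qed

lemma bdd_integrable_discounted_integrable:
  assumes "bdd_integrable g" "0 < lam" "S \<in> sets lebesgue" "S \<subseteq> {0..}"
  shows "(\<lambda>t. exp (- lam * t) * g t) integrable_on S"
  using bdd_integrable_absolutely[OF assms] by (rule set_lebesgue_integral_eq_integral(1))

lemma discounted_eq_LINT:
  assumes "bdd_integrable g" "0 < lam"
  shows "(LINT t:{0..}|lebesgue. exp (- lam * t) * g t) = discounted lam g"
  unfolding discounted_def
  by (rule set_lebesgue_integral_eq_integral(2)[OF bdd_integrable_absolutely[OF assms]]) auto

lemma tendsto_integral_atLeast:
  fixes g :: "real \<Rightarrow> real"
  assumes "g absolutely_integrable_on {a..}"
  shows "((\<lambda>T. integral {a..T} g) \<longlongrightarrow> integral {a..} g) at_top"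
proof -
  have "((\<lambda>T. LINT t:{a..T}|lebesgue. g t) \<longlongrightarrow> (LINT t:{a..}|lebesgue. g t)) at_top"
    by (rule tendsto_set_lebesgue_integral_at_top) (use assms in auto)
  moreover have "(LINT t:{a..T}|lebesgue. g t) = integral {a..T} g" for T
    by (rule set_lebesgue_integral_eq_integral(2)[OF set_integrable_subset[OF assms]]) auto
  ultimately show ?thesis using set_lebesgue_integral_eq_integral(2)[OF assms] by simp
qed

lemma tendsto_discounted:
  assumes "bdd_integrable g" "0 < lam" "0 \<le> a"
  shows "((\<lambda>T. integral {a..T} (\<lambda>t. exp (- lam * t) * g t)) \<longlongrightarrow> integral {a..} (\<lambda>t. exp (- lam * t) * g t)) at_top"
  by (rule tendsto_integral_atLeast, rule bdd_integrable_absolutely) (use assms in auto)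

lemma has_integral_exp_const:
  fixes lam :: real
  assumes "lam \<noteq> 0" "a \<le> b"
  shows "((\<lambda>t. exp (- lam * t) * c) has_integral c / lam * (exp (- lam * a) - exp (- lam * b))) {a..b}"
proof -
  have "((\<lambda>t. exp (- lam * t) * c) has_integral (- c / lam * exp (- lam * b)) - (- c / lam * exp (- lam * a))) {a..b}"
    by (rule fundamental_theorem_of_calculus[OF assms(2)])
       (use assms(1) in \<open>auto intro!: derivative_eq_intros simp flip: has_real_derivative_iff_has_vector_derivative\<close>)
  then show ?thesis by (simp add: algebra_simps)
qed

lemma discounted_integral_split:
  assumes "bdd_integrable g" "0 < lam" "0 \<le> a" "a \<le> b"
  shows "integral {a..} (\<lambda>t. exp (- lam * t) * g t) =
    integral {a..b} (\<lambda>t. exp (- lam * t) * g t) + integral {b..} (\<lambda>t. exp (- lam * t) * g t)"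
proof -
  have "{a..} = {a..b} \<union> {b..}" using \<open>a \<le> b\<close> by auto
  moreover have "integral ({a..b} \<union> {b..}) (\<lambda>t. exp (- lam * t) * g t) =
    integral {a..b} (\<lambda>t. exp (- lam * t) * g t) + integral {b..} (\<lambda>t. exp (- lam * t) * g t)"
    by (intro integral_Un bdd_integrable_discounted_integrable)
       (use assms in \<open>auto intro: negligible_subset[of "{b}"]\<close>)
  ultimately show ?thesis by simp
qed

lemma bdd_integrable_const [simp]: "bdd_integrable (\<lambda>_. c)"
  unfolding bdd_integrable_def by (auto intro: integrable_const_ivl)

lemma bdd_integrable_diff:
  assumes "bdd_integrable g" "bdd_integrable h"
  shows "bdd_integrable (\<lambda>t. g t - h t)"
proof -
  obtain K K' where K: "\<forall>t\<ge>0. \<bar>g t\<bar> \<le> K" "\<forall>t\<ge>0. \<bar>h t\<bar> \<le> K'"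
    using assms unfolding bdd_integrable_def by blast
  have "\<forall>t\<ge>0. \<bar>g t - h t\<bar> \<le> K + K'"
  proof (intro allI impI)
    fix t :: real assume "0 \<le> t"
    then show "\<bar>g t - h t\<bar> \<le> K + K'"
      using K abs_triangle_ineq4[of "g t" "h t"] by (meson add_mono order_trans)
  qed
  then show ?thesis
    using assms unfolding bdd_integrable_def by (blast intro: integrable_diff)
qed

lemma integral_exp_const_atLeast:
  fixes lam :: real
  assumes "0 < lam"
  shows "integral {a..} (\<lambda>t. exp (- lam * t) * c) = c / lam * exp (- lam * a)"
  by (subst integral_unique[OF has_integral_mult_left[OF has_integral_exp_minus_to_infinity[OF assms, of a], of c]])
     (simp add: mult.commute)

lemma discounted_mono:
  assumes "bdd_integrable g" "bdd_integrable h" "0 < lam" "\<And>t. 0 \<le> t \<Longrightarrow> g t \<le> h t"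
  shows "discounted lam g \<le> discounted lam h"
  unfolding discounted_def
  by (intro integral_le bdd_integrable_discounted_integrable) (use assms in auto)

lemma discounted_const: "0 < lam \<Longrightarrow> discounted lam (\<lambda>_. c) = c / lam"
  unfolding discounted_def by (subst integral_exp_const_atLeast) auto

text \<open>Cost of a concatenation at time \<open>d\<close>. For \<open>0 < d\<close> nothing is
  asked of \<open>k 0\<close>, because a control glued on at the junction takes an exceptional value
  at time \<open>0\<close> to name the branch.\<close>

lemma discounted_glue:
  assumes g: "g integrable_on {0..d}" "\<And>t. t \<in> {0..d} \<Longrightarrow> \<bar>g t\<bar> \<le> K" and h: "bdd_integrable h"
    and "0 \<le> d" "0 < lam"
    and k: "\<And>t. 0 < t \<Longrightarrow> t < d \<Longrightarrow> k t = g t" "\<And>t. d \<le> t \<Longrightarrow> k t = h (t - d)"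
  shows "bdd_integrable k"
    and "discounted lam k = integral {0..d} (\<lambda>t. exp (- lam * t) * g t) + exp (- lam * d) * discounted lam h"
proof -
  have k1: "k integrable_on {0..d}"
    by (rule integrable_spike_finite[of "{0, d}" _ _ g]) (use k(1) g(1) in auto)
  have k2: "k integrable_on {d..T}" if "d \<le> T" for T
  proof -
    have "h integrable_on {0..T - d}" using h bdd_integrable_def by blast
    then have "(h has_integral integral {0..T - d} h) {0..T - d}" by blast
    from has_integral_shift_real_ivl[OF this, of "- d"]
    have "(\<lambda>t. h (t - d)) integrable_on {d..T}" by (auto simp: integrable_on_def)
    then show ?thesis
      by (rule integrable_eq) (use k(2) in auto)
  qed
  obtain K' where K': "\<forall>t\<ge>0. \<bar>h t\<bar> \<le> K'" using h bdd_integrable_def by blast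
  show bk: "bdd_integrable k"
    unfolding bdd_integrable_def
  proof (intro conjI allI)
    show "\<exists>K. \<forall>t\<ge>0. \<bar>k t\<bar> \<le> K"
    proof (intro exI allI impI)
      fix t :: real assume "0 \<le> t"
      show "\<bar>k t\<bar> \<le> max (max K K') \<bar>k 0\<bar>"
      proof (cases "t < d")
        case True then show ?thesis using k(1)[of t] g(2)[of t] \<open>0 \<le> t\<close> by (cases "t = 0") auto
      next
        case False then show ?thesis using k(2) K' by (auto simp: le_max_iff_disj)
      qed
    qed
    fix T :: real
    show "k integrable_on {0..T}"
    proof (cases "T \<le> d")
      case True then show ?thesis using integrable_on_subinterval[OF k1] by auto
    next
      case False
      then show ?thesis
        using Henstock_Kurzweil_Integration.integrable_combine[OF \<open>0 \<le> d\<close> _ k1 k2] by simp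
    qed
  qed
  have e1: "integral {0..d} (\<lambda>t. exp (- lam * t) * k t) = integral {0..d} (\<lambda>t. exp (- lam * t) * g t)"
    by (rule integral_spike[of "{0, d}"]) (use k(1) in auto)
  have e2: "integral {d..T} (\<lambda>t. exp (- lam * t) * k t) =
    exp (- lam * d) * integral {0..T - d} (\<lambda>t. exp (- lam * t) * h t)" for T
  proof -
    have "((\<lambda>t. exp (- lam * t) * h t) has_integral integral {0..T - d} (\<lambda>t. exp (- lam * t) * h t)) {0..T - d}"
      by (rule integrable_integral, rule bdd_integrable_discounted_integrable) (use h \<open>0 < lam\<close> in auto)
    from has_integral_mult_right[OF has_integral_shift_real_ivl[OF this, of "- d"], of "exp (- lam * d)"]
    have "((\<lambda>t. exp (- lam * d) * (exp (- lam * (t - d)) * h (t - d))) has_integral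
        exp (- lam * d) * integral {0..T - d} (\<lambda>t. exp (- lam * t) * h t)) {d..T}" by simp
    then have "((\<lambda>t. exp (- lam * t) * k t) has_integral
        exp (- lam * d) * integral {0..T - d} (\<lambda>t. exp (- lam * t) * h t)) {d..T}"
    proof (rule has_integral_eq[rotated])
      fix t assume "t \<in> {d..T}"
      moreover have "exp (- lam * d) * exp (- lam * (t - d)) = exp (- lam * t)"
        by (simp add: algebra_simps flip: exp_add)
      ultimately show "exp (- lam * d) * (exp (- lam * (t - d)) * h (t - d)) = exp (- lam * t) * k t"
        using k(2) by (simp flip: mult.assoc)
    qed
    then show ?thesis by (rule integral_unique)
  qed
  have "((\<lambda>T. integral {0..T - d} (\<lambda>t. exp (- lam * t) * h t)) \<longlongrightarrow> discounted lam h) at_top"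
    unfolding discounted_def
    by (rule filterlim_compose[OF tendsto_discounted[OF h \<open>0 < lam\<close> order_refl]])
       (simp add: filterlim_at_top_add_at_top filterlim_ident filterlim_tendsto_add_at_top[of "\<lambda>_. - d" "- d" at_top "\<lambda>T. T", simplified])
  then have "((\<lambda>T. integral {0..d} (\<lambda>t. exp (- lam * t) * g t) + exp (- lam * d) * integral {0..T - d} (\<lambda>t. exp (- lam * t) * h t))
     \<longlongrightarrow> integral {0..d} (\<lambda>t. exp (- lam * t) * g t) + exp (- lam * d) * discounted lam h) at_top"
    by (intro tendsto_intros)
  moreover have "\<forall>\<^sub>F T in at_top. integral {0..d} (\<lambda>t. exp (- lam * t) * g t) + exp (- lam * d) * integral {0..T - d} (\<lambda>t. exp (- lam * t) * h t)
     = integral {0..T} (\<lambda>t. exp (- lam * t) * k t)"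
    using eventually_ge_at_top[of d]
  proof eventually_elim
    case (elim T)
    have "(\<lambda>t. exp (- lam * t) * k t) integrable_on {0..T}"
      by (rule bdd_integrable_discounted_integrable[OF bk \<open>0 < lam\<close>]) auto
    from Henstock_Kurzweil_Integration.integral_combine[OF \<open>0 \<le> d\<close> elim this] show ?case
      using e1 e2 by simp
  qed
  ultimately have "((\<lambda>T. integral {0..T} (\<lambda>t. exp (- lam * t) * k t)) \<longlongrightarrow>
      integral {0..d} (\<lambda>t. exp (- lam * t) * g t) + exp (- lam * d) * discounted lam h) at_top"
    by (rule Lim_transform_eventually)
  from tendsto_unique[OF _ tendsto_discounted[OF bk \<open>0 < lam\<close> order_refl] this]
  show "discounted lam k = integral {0..d} (\<lambda>t. exp (- lam * t) * g t) + exp (- lam * d) * discounted lam h"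
    by (simp add: discounted_def)
qed

section \<open>First hitting times\<close>

lemma first_hit_up:
  fixes x :: "real \<Rightarrow> real"
  assumes "continuous_on {a..b} x" "a \<le> b" "x a < h" "h \<le> x b"
  obtains \<tau> where "a < \<tau>" "\<tau> \<le> b" "x \<tau> = h" "\<And>t. a \<le> t \<Longrightarrow> t < \<tau> \<Longrightarrow> x t < h"
proof -
  define S where "S = {t \<in> {a..b}. h \<le> x t}"
  have S: "closed S" "S \<noteq> {}" "bdd_below S"
    using assms(2-4) continuous_closed_preimage[OF assms(1) closed_atLeastAtMost closed_atLeast[of h]]
    by (auto simp: S_def vimage_def Int_def bdd_below_def)
  define \<tau> where "\<tau> = Inf S"
  have \<tau>S: "\<tau> \<in> S" unfolding \<tau>_def using S closed_contains_Inf by blast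
  have before: "x t < h" if "a \<le> t" "t < \<tau>" for t
  proof (rule ccontr)
    assume "\<not> x t < h"
    then have "t \<in> S" using that \<tau>S by (auto simp: S_def)
    then have "\<tau> \<le> t" unfolding \<tau>_def using S cInf_lower by blast
    then show False using that by simp
  qed
  have "continuous_on {a..\<tau>} x" using assms(1) \<tau>S by (auto simp: S_def intro: continuous_on_subset)
  then obtain r where r: "a \<le> r" "r \<le> \<tau>" "x r = h"
    using IVT'[of x a h \<tau>] assms(3) \<tau>S by (auto simp: S_def)
  then have "r = \<tau>" using before[of r] by force
  moreover have "a \<noteq> \<tau>" using \<tau>S assms(3) by (auto simp: S_def)
  ultimately show thesis using that[of \<tau>] r \<tau>S before by (auto simp: S_def)
qed

lemma first_hit_down:
  fixes x :: "real \<Rightarrow> real"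
  assumes "continuous_on {a..b} x" "a \<le> b" "h < x a" "x b \<le> h"
  obtains \<tau> where "a < \<tau>" "\<tau> \<le> b" "x \<tau> = h" "\<And>t. a \<le> t \<Longrightarrow> t < \<tau> \<Longrightarrow> h < x t"
proof -
  have "continuous_on {a..b} (\<lambda>t. - x t)" using assms(1) by (intro continuous_intros)
  then obtain \<tau> where "a < \<tau>" "\<tau> \<le> b" "- x \<tau> = - h" "\<And>t. a \<le> t \<Longrightarrow> t < \<tau> \<Longrightarrow> - x t < - h"
    using first_hit_up[of a b "\<lambda>t. - x t" "- h"] assms(2-4) by auto
  then show thesis using that[of \<tau>] by simp
qed

section \<open>Shifting and gluing of measurable controls\<close>

lemma controls_iff:
  "\<beta> \<in> controls A \<longleftrightarrow> (\<forall>t\<ge>0. \<beta> t \<in> A) \<and> (\<forall>U. open U \<longrightarrow> {t. 0 \<le> t \<and> \<beta> t \<in> U} \<in> sets lebesgue)"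
proof -
  have *: "\<beta> -` U \<inter> space (lebesgue_on {0..}) = {t. 0 \<le> t \<and> \<beta> t \<in> U}" for U by auto
  have **: "{t. 0 \<le> t \<and> \<beta> t \<in> U} \<in> sets (lebesgue_on {0..}) \<longleftrightarrow> {t. 0 \<le> t \<and> \<beta> t \<in> U} \<in> sets lebesgue" for U
    by (subst sets_restrict_space_iff) auto
  have "\<beta> \<in> borel_measurable (lebesgue_on {0..}) \<longleftrightarrow> (\<forall>U. open U \<longrightarrow> {t. 0 \<le> t \<and> \<beta> t \<in> U} \<in> sets lebesgue)"
  proof
    assume "\<beta> \<in> borel_measurable (lebesgue_on {0..})"
    then have "\<beta> -` U \<inter> space (lebesgue_on {0..}) \<in> sets (lebesgue_on {0..})" if "open U" for U
      using measurable_sets[OF _ borel_open[OF that]] by blast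
    then show "\<forall>U. open U \<longrightarrow> {t. 0 \<le> t \<and> \<beta> t \<in> U} \<in> sets lebesgue"
      unfolding * ** by blast
  next
    assume "\<forall>U. open U \<longrightarrow> {t. 0 \<le> t \<and> \<beta> t \<in> U} \<in> sets lebesgue"
    then show "\<beta> \<in> borel_measurable (lebesgue_on {0..})"
      by (intro borel_measurableI) (unfold * **, blast)
  qed
  then show ?thesis unfolding controls_def by blast
qed

lemma sets_lebesgue_shift:
  assumes "{t::real. P t} \<in> sets lebesgue"
  shows "{t. P (t + c)} \<in> sets lebesgue"
proof -
  have "(+) (- c) ` {t. P t} \<in> sets lebesgue"
    by (rule lebesgue_sets_translation[OF assms])
  also have "(+) (- c) ` {t. P t} = {t. P (t + c)}"
  proof (intro set_eqI iffI)
    fix t assume "t \<in> {t. P (t + c)}"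
    then show "t \<in> (+) (- c) ` {t. P t}" by (intro image_eqI[of _ _ "t + c"]) auto
  next
    fix t assume "t \<in> (+) (- c) ` {t. P t}"
    then obtain s where "t = - c + s" "P s" by blast
    then show "t \<in> {t. P (t + c)}" by simp
  qed
  finally show ?thesis .
qed

lemma controls_const: "a \<in> A \<Longrightarrow> (\<lambda>_. a) \<in> controls A"
  by (simp add: controls_def)

lemma controls_shift:
  assumes "\<beta> \<in> controls A" "0 \<le> c"
  shows "(\<lambda>t. \<beta> (t + c)) \<in> controls A"
  unfolding controls_iff
proof (intro conjI allI impI)
  fix U :: "'a set" assume "open U"
  then have "{t. 0 \<le> t \<and> \<beta> t \<in> U} \<in> sets lebesgue" using assms(1) controls_iff by blast
  then have "{t. 0 \<le> t + c \<and> \<beta> (t + c) \<in> U} \<in> sets lebesgue" by (rule sets_lebesgue_shift)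
  then have "{t. 0 \<le> t + c \<and> \<beta> (t + c) \<in> U} \<inter> {0..} \<in> sets lebesgue" by (rule sets.Int) auto
  also have "{t. 0 \<le> t + c \<and> \<beta> (t + c) \<in> U} \<inter> {0..} = {t. 0 \<le> t \<and> \<beta> (t + c) \<in> U}"
    using \<open>0 \<le> c\<close> by auto
  finally show "{t. 0 \<le> t \<and> \<beta> (t + c) \<in> U} \<in> sets lebesgue" .
qed (use assms in \<open>auto simp: controls_def\<close>)

lemma controls_glue:
  assumes "\<beta> \<in> controls A" "\<gamma> \<in> controls A" "0 \<le> d"
  shows "(\<lambda>t. if t < d then \<beta> t else \<gamma> (t - d)) \<in> controls A"
  unfolding controls_iff
proof (intro conjI allI impI)
  fix U :: "'a set" assume "open U"
  have "{t. 0 \<le> t \<and> \<beta> t \<in> U} \<inter> {..<d} \<in> sets lebesgue"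
    using assms(1) \<open>open U\<close> controls_iff by (intro sets.Int) auto
  moreover have "{t. 0 \<le> t + - d \<and> \<gamma> (t + - d) \<in> U} \<in> sets lebesgue"
    by (rule sets_lebesgue_shift) (use assms(2) \<open>open U\<close> controls_iff in blast)
  ultimately have "({t. 0 \<le> t \<and> \<beta> t \<in> U} \<inter> {..<d}) \<union> {t. 0 \<le> t + - d \<and> \<gamma> (t + - d) \<in> U} \<in> sets lebesgue"
    by (rule sets.Un)
  also have "({t. 0 \<le> t \<and> \<beta> t \<in> U} \<inter> {..<d}) \<union> {t. 0 \<le> t + - d \<and> \<gamma> (t + - d) \<in> U} =
    {t. 0 \<le> t \<and> (if t < d then \<beta> t else \<gamma> (t - d)) \<in> U}"
    using \<open>0 \<le> d\<close> by auto
  finally show "{t. 0 \<le> t \<and> (if t < d then \<beta> t else \<gamma> (t - d)) \<in> U} \<in> sets lebesgue" .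
qed (use assms in \<open>auto simp: controls_def\<close>)

section \<open>Paths on a single branch\<close>

text \<open>The hypotheses enter through constants common to all branches: \<open>M\<close> bounds
  drifts and costs, \<open>am i\<close> and \<open>ap i\<close> move towards and away from the
  junction with speed at least \<open>c0\<close> as long as \<open>x \<le> h0\<close>, and
  \<open>l_mod\<close> expresses continuity of \<open>l\<close> at the junction, uniformly in the
  control.\<close>

locale junction_data =
  fixes A :: "'a::metric_space set" and f l :: "branch \<Rightarrow> real \<Rightarrow> 'a \<Rightarrow> real"
    and lam M L c0 h0 :: real and am ap :: "branch \<Rightarrow> 'a"
  assumes lam: "0 < lam" and M: "0 < M" and L: "0 < L" and c0: "0 < c0" and h0: "0 < h0"
    and cont_f: "\<And>i. continuous_on ({0..} \<times> A) (\<lambda>(x, a). f i x a)"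
    and cont_l: "\<And>i. continuous_on ({0..} \<times> A) (\<lambda>(x, a). l i x a)"
    and f_bound: "\<And>i x a. 0 \<le> x \<Longrightarrow> a \<in> A \<Longrightarrow> \<bar>f i x a\<bar> \<le> M"
    and l_nonneg: "\<And>i x a. 0 \<le> x \<Longrightarrow> a \<in> A \<Longrightarrow> 0 \<le> l i x a"
    and l_bound: "\<And>i x a. 0 \<le> x \<Longrightarrow> a \<in> A \<Longrightarrow> l i x a \<le> M"
    and f_lip: "\<And>i x y a. 0 \<le> x \<Longrightarrow> 0 \<le> y \<Longrightarrow> a \<in> A \<Longrightarrow> \<bar>f i x a - f i y a\<bar> \<le> L * \<bar>x - y\<bar>"
    and am: "\<And>i. am i \<in> A" "\<And>i x. 0 \<le> x \<Longrightarrow> x \<le> h0 \<Longrightarrow> f i x (am i) \<le> - c0"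
    and ap: "\<And>i. ap i \<in> A" "\<And>i x. 0 \<le> x \<Longrightarrow> x \<le> h0 \<Longrightarrow> c0 \<le> f i x (ap i)"
    and l_mod: "\<And>\<eta>. 0 < \<eta> \<Longrightarrow> \<exists>h>0. \<forall>i x. \<forall>a\<in>A. 0 \<le> x \<longrightarrow> x \<le> h \<longrightarrow> \<bar>l i x a - l i 0 a\<bar> \<le> \<eta>"
begin

abbreviation F :: "branch \<Rightarrow> real \<Rightarrow> 'a \<Rightarrow> real" where "F \<equiv> extend_left f"
abbreviation G :: "branch \<Rightarrow> real \<Rightarrow> 'a \<Rightarrow> real" where "G \<equiv> extend_left l"

lemma F_nonneg [simp]: "0 \<le> x \<Longrightarrow> F i x a = f i x a" and G_nonneg [simp]: "0 \<le> x \<Longrightarrow> G i x a = l i x a"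
  by (auto simp: extend_left_def max_def)

lemma F_nonpos: "x \<le> 0 \<Longrightarrow> F i x a = f i 0 a" and G_nonpos: "x \<le> 0 \<Longrightarrow> G i x a = l i 0 a"
  by (auto simp: extend_left_def max_def)

lemma F_bound: "a \<in> A \<Longrightarrow> \<bar>F i x a\<bar> \<le> M" and G_ge: "a \<in> A \<Longrightarrow> 0 \<le> G i x a" and G_le: "a \<in> A \<Longrightarrow> G i x a \<le> M"
  by (auto simp: extend_left_def intro: f_bound l_nonneg l_bound)

lemma G_bound: "a \<in> A \<Longrightarrow> \<bar>G i x a\<bar> \<le> M"
  using G_ge[of a i x] G_le[of a i x] by simp

lemma F_lip: "a \<in> A \<Longrightarrow> \<bar>F i x a - F i y a\<bar> \<le> L * \<bar>x - y\<bar>"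
proof -
  assume "a \<in> A"
  then have "\<bar>F i x a - F i y a\<bar> \<le> L * \<bar>max x 0 - max y 0\<bar>"
    unfolding extend_left_def by (intro f_lip) auto
  also have "\<dots> \<le> L * \<bar>x - y\<bar>" using L by (intro mult_left_mono) auto
  finally show ?thesis .
qed

lemma continuous_on_extend_left:
  assumes "continuous_on ({0..} \<times> A) (\<lambda>(x, a). g i x a)"
  shows "continuous_on (UNIV \<times> A) (\<lambda>(x, a). extend_left g i x a)"
proof -
  have "continuous_on (UNIV \<times> A) (\<lambda>z. (\<lambda>(x, a). g i x a) (max (fst z) 0, snd z))"
    by (rule continuous_on_compose2[OF assms]) (auto intro!: continuous_intros)
  then show ?thesis by (simp add: extend_left_def case_prod_unfold)
qed

lemma controls_in: "\<beta> \<in> controls A \<Longrightarrow> 0 \<le> t \<Longrightarrow> \<beta> t \<in> A"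
  by (simp add: controls_def)

lemma data_integrable:
  assumes g: "continuous_on ({0..} \<times> A) (\<lambda>(x, a). g i x a)" and K: "\<And>x a. a \<in> A \<Longrightarrow> \<bar>extend_left g i x a\<bar> \<le> K"
    and \<beta>: "\<beta> \<in> controls A" and x: "continuous_on {a..b} x" and "0 \<le> a"
  shows "(\<lambda>t. extend_left g i (x t) (\<beta> t)) integrable_on {a..b}"
proof (rule integrable_on_Icc_bounded_measurable[where K = K])
  show "(\<lambda>t. extend_left g i (x t) (\<beta> t)) \<in> borel_measurable (lebesgue_on {a..b})"
  proof (rule borel_measurable_joint_continuous[where X = UNIV and B = A and H = "extend_left g i"])
    fix U :: "'a set" assume "open U"
    then have "{t. 0 \<le> t \<and> \<beta> t \<in> U} \<inter> {a..b} \<in> sets lebesgue"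
      using \<beta> unfolding controls_iff by (intro sets.Int) auto
    also have "{t. 0 \<le> t \<and> \<beta> t \<in> U} \<inter> {a..b} = {t \<in> {a..b}. \<beta> t \<in> U}" using \<open>0 \<le> a\<close> by auto
    finally show "{t \<in> {a..b}. \<beta> t \<in> U} \<in> sets lebesgue" .
  next
    show "x \<in> borel_measurable (lebesgue_on {a..b})"
      by (rule continuous_imp_measurable_on_sets_lebesgue[OF x]) auto
    show "continuous_on (UNIV \<times> A) (\<lambda>(x, y). extend_left g i x y)"
      using continuous_on_extend_left[of g i] g by simp
  qed (use \<beta> \<open>0 \<le> a\<close> in \<open>auto simp: controls_in\<close>)
qed (use \<beta> \<open>0 \<le> a\<close> in \<open>auto intro!: K controls_in\<close>)

lemma F_integrable: "\<beta> \<in> controls A \<Longrightarrow> continuous_on {a..b} x \<Longrightarrow> 0 \<le> a \<Longrightarrow> (\<lambda>t. F i (x t) (\<beta> t)) integrable_on {a..b}"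
  and G_integrable: "\<beta> \<in> controls A \<Longrightarrow> continuous_on {a..b} x \<Longrightarrow> 0 \<le> a \<Longrightarrow> (\<lambda>t. G i (x t) (\<beta> t)) integrable_on {a..b}"
  by (rule data_integrable[where g = f and K = M, OF cont_f F_bound], assumption+)
     (rule data_integrable[where g = l and K = M, OF cont_l G_bound], assumption+)

lemma G_discounted_integrable:
  assumes "\<beta> \<in> controls A" "continuous_on {a..b} x" "0 \<le> a"
  shows "(\<lambda>t. exp (- lam * t) * G i (x t) (\<beta> t)) integrable_on {a..b}"
proof (rule integrable_on_mult_continuous[OF G_integrable[OF assms]])
  fix t assume "t \<in> {a..b}"
  then show "\<bar>G i (x t) (\<beta> t)\<bar> \<le> M" using assms by (intro G_bound controls_in) auto
qed (intro continuous_intros)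

text \<open>The drift is the extended one, so the same notion covers excursions into a branch, where
  \<open>x\<close> stays nonnegative, and thermostat stages, which run down to
  \<open>- \<epsilon>\<close>.\<close>

definition path :: "branch \<Rightarrow> (real \<Rightarrow> 'a) \<Rightarrow> (real \<Rightarrow> real) \<Rightarrow> real \<Rightarrow> real \<Rightarrow> bool" where
  "path i \<beta> x a b \<longleftrightarrow> primitive_on a b (\<lambda>t. F i (x t) (\<beta> t)) x"

text \<open>Time is discounted from \<open>0\<close>, not from \<open>a\<close>: costs of
  consecutive intervals add, and a shift in time produces a factor.\<close>

definition cost :: "branch \<Rightarrow> (real \<Rightarrow> 'a) \<Rightarrow> (real \<Rightarrow> real) \<Rightarrow> real \<Rightarrow> real \<Rightarrow> real" where
  "cost i \<beta> x a b = integral {a..b} (\<lambda>t. exp (- lam * t) * G i (x t) (\<beta> t))"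

lemma path_continuous: "path i \<beta> x a b \<Longrightarrow> continuous_on {a..b} x"
  unfolding path_def by (rule primitive_on_continuous)

lemma path_subinterval: "path i \<beta> x a b \<Longrightarrow> a \<le> s \<Longrightarrow> t \<le> b \<Longrightarrow> path i \<beta> x s t"
  unfolding path_def by (rule primitive_on_subinterval)

lemma path_combine: "path i \<beta> x a b \<Longrightarrow> path i \<beta> x b c \<Longrightarrow> a \<le> b \<Longrightarrow> path i \<beta> x a c"
  unfolding path_def by (rule primitive_on_combine)

lemma path_shift:
  assumes "path i \<beta> x a b" shows "path i (\<lambda>t. \<beta> (t + c)) (\<lambda>t. x (t + c)) (a - c) (b - c)"
  using primitive_on_shift[OF assms[unfolded path_def], of c] by (simp add: path_def)

lemma path_cong:
  assumes "path i \<beta> x a b" "finite N" "\<And>t. t \<in> {a..b} - N \<Longrightarrow> \<gamma> t = \<beta> t"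
    "\<And>t. t \<in> {a..b} \<Longrightarrow> y t = x t"
  shows "path i \<gamma> y a b"
  unfolding path_def
  by (rule primitive_on_cong[OF assms(1)[unfolded path_def] assms(2)]) (use assms(3,4) in auto)

lemma path_lipschitz:
  assumes "path i \<beta> x a b" "\<beta> \<in> controls A" "0 \<le> a" "a \<le> s" "s \<le> t" "t \<le> b"
  shows "\<bar>x t - x s\<bar> \<le> M * (t - s)"
  by (rule primitive_on_lipschitz[OF assms(1)[unfolded path_def] _ assms(4-6)])
     (use assms in \<open>auto intro!: F_bound controls_in\<close>)

lemma path_unique:
  assumes "path i \<beta> x a b" "path i \<beta> y a b" "x a = y a" "\<beta> \<in> controls A" "0 \<le> a" "t \<in> {a..b}"
  shows "x t = y t"
  by (rule ode_unique[where \<Phi> = "\<lambda>u t. F i u (\<beta> t)" and L = L, OF assms(1,2)[unfolded path_def] assms(3) _ L assms(6)])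
     (use assms in \<open>auto intro!: F_lip controls_in\<close>)

lemma path_exists:
  assumes "\<beta> \<in> controls A" "0 \<le> s"
  obtains x where "x s = x0" "\<And>T. path i \<beta> x s T"
proof -
  define \<gamma> where "\<gamma> t = \<beta> (t + s)" for t
  have \<gamma>: "\<gamma> \<in> controls A" unfolding \<gamma>_def by (rule controls_shift[OF assms])
  obtain y where y: "y 0 = x0" "\<And>T. primitive_on 0 T (\<lambda>t. F i (y t) (\<gamma> t)) y"
  proof (rule ode_exists[where \<Phi> = "\<lambda>u t. F i u (\<gamma> t)" and M = M and L = L and ?x0.0 = x0])
    show "(\<lambda>t. F i (x t) (\<gamma> t)) integrable_on {0..T}" if "continuous_on {0..} x" for x T
      by (rule F_integrable[OF \<gamma>]) (use that in \<open>auto intro: continuous_on_subset\<close>)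
  qed (use \<gamma> L in \<open>auto intro!: F_lip F_bound controls_in\<close>)
  have "path i (\<lambda>t. \<gamma> (t + - s)) (\<lambda>t. y (t + - s)) (0 - - s) ((T - s) - - s)" for T
    by (rule path_shift) (use y in \<open>auto simp: path_def\<close>)
  then have "path i \<beta> (\<lambda>t. y (t - s)) s T" for T by (simp add: \<gamma>_def)
  with y(1) show thesis using that[of "\<lambda>t. y (t - s)"] by simp
qed

lemma path_decrease:
  assumes "path i \<beta> x a b" "a \<le> s" "s \<le> t" "t \<le> b" "\<And>r. s \<le> r \<Longrightarrow> r \<le> t \<Longrightarrow> F i (x r) (\<beta> r) \<le> - c"
  shows "x t \<le> x s - c * (t - s)"
proof -
  have "((\<lambda>r. F i (x r) (\<beta> r)) has_integral x t - x s) {s..t}"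
    using primitive_on_has_integral assms(1-4) unfolding path_def by blast
  moreover have "((\<lambda>r. - c) has_integral - c * (t - s)) {s..t}"
    using has_integral_const_real[of "- c" s t] assms(3) by (simp add: mult.commute)
  ultimately have "x t - x s \<le> - c * (t - s)" by (rule has_integral_le) (use assms(5) in auto)
  then show ?thesis by simp
qed

lemma path_increase:
  assumes "path i \<beta> x a b" "a \<le> s" "s \<le> t" "t \<le> b" "\<And>r. s \<le> r \<Longrightarrow> r \<le> t \<Longrightarrow> c \<le> F i (x r) (\<beta> r)"
  shows "x s + c * (t - s) \<le> x t"
proof -
  have 1: "((\<lambda>r. F i (x r) (\<beta> r)) has_integral x t - x s) {s..t}"
    using primitive_on_has_integral assms(1-4) unfolding path_def by blast
  have 2: "((\<lambda>r. c) has_integral c * (t - s)) {s..t}"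
    using has_integral_const_real[of "c" s t] assms(3) by (simp add: mult.commute)
  have "c * (t - s) \<le> x t - x s" by (rule has_integral_le[OF 2 1]) (use assms(5) in auto)
  then show ?thesis by simp
qed

text \<open>Up to the first time at level \<open>h\<close> the drift is at most \<open>- c\<close>,
  so the path would arrive there below its starting value.\<close>

lemma path_stays_below:
  assumes p: "path i \<beta> x s T" and "0 < c" "x s < h"
    and neg: "\<And>y t. t \<in> {s..T} \<Longrightarrow> y \<le> h \<Longrightarrow> F i y (\<beta> t) \<le> - c" and t: "s \<le> t" "t \<le> T"
  shows "x t < h"
proof (rule ccontr)
  assume "\<not> x t < h"
  then obtain \<tau> where \<tau>: "s < \<tau>" "\<tau> \<le> t" "x \<tau> = h" "\<And>r. s \<le> r \<Longrightarrow> r < \<tau> \<Longrightarrow> x r < h"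
    using first_hit_up[of s t x h] path_continuous[OF path_subinterval[OF p order_refl t(2)]] t \<open>x s < h\<close> by auto
  have "x \<tau> \<le> x s - c * (\<tau> - s)"
  proof (rule path_decrease[OF p])
    fix r assume r: "s \<le> r" "r \<le> \<tau>"
    then have "x r \<le> h" using \<tau>(3) \<tau>(4)[of r] by (cases "r = \<tau>") auto
    then show "F i (x r) (\<beta> r) \<le> - c" using neg[of r "x r"] r \<tau>(2) t by simp
  qed (use \<tau> t in auto)
  moreover have "0 < c * (\<tau> - s)" using \<tau> \<open>0 < c\<close> by simp
  ultimately show False using \<tau>(3) \<open>x s < h\<close> by linarith
qed

text \<open>The bound on the drift is assumed on all of \<open>y \<le> h\<close>, including negative
  positions, since the extension keeps the drift at its junction value there; \<open>lo\<close> may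
  therefore be \<open>- \<epsilon>\<close>. The duration is at most distance over speed.\<close>

lemma descend:
  assumes "a \<in> A" "0 < c" and neg: "\<And>y. y \<le> h \<Longrightarrow> F i y a \<le> - c" and "x0 < h" "lo \<le> x0"
  obtains x \<tau> where "0 \<le> \<tau>" "\<tau> \<le> (x0 - lo) / c" "path i (\<lambda>_. a) x 0 \<tau>" "x 0 = x0" "x \<tau> = lo"
    "\<And>t. 0 \<le> t \<Longrightarrow> t < \<tau> \<Longrightarrow> lo < x t" "\<And>t. 0 \<le> t \<Longrightarrow> t \<le> \<tau> \<Longrightarrow> x t \<le> x0"
proof -
  obtain x where x: "x 0 = x0" "\<And>T. path i (\<lambda>_. a) x 0 T"
    using path_exists[OF controls_const[OF \<open>a \<in> A\<close>] order_refl] by metis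
  have below: "x t < h" if "0 \<le> t" for t
    by (rule path_stays_below[OF x(2)[of t] \<open>0 < c\<close>]) (use x that \<open>x0 < h\<close> neg in auto)
  have le: "x t \<le> x0 - c * t" if "0 \<le> t" for t
    using path_decrease[OF x(2)[of t] order_refl that order_refl, of c] neg below x(1) by (auto simp: less_imp_le)
  show thesis
  proof (cases "lo = x0")
    case True
    show ?thesis
      by (rule that[of 0 x]) (use True x path_subinterval[OF x(2)] in auto)
  next
    case False
    define T where "T = (x0 - lo) / c"
    have T: "0 < T" using False \<open>lo \<le> x0\<close> \<open>0 < c\<close> by (auto simp: T_def)
    have "x T \<le> lo" using le[of T] T \<open>0 < c\<close> by (auto simp: T_def)
    then obtain \<tau> where \<tau>: "0 < \<tau>" "\<tau> \<le> T" "x \<tau> = lo" "\<And>t. 0 \<le> t \<Longrightarrow> t < \<tau> \<Longrightarrow> lo < x t"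
      using first_hit_down[OF path_continuous[OF x(2)[of T]], of lo] T False \<open>lo \<le> x0\<close> x(1) by auto
    show ?thesis
    proof (rule that[of \<tau> x])
      show "x t \<le> x0" if "0 \<le> t" "t \<le> \<tau>" for t
      proof -
        have "0 \<le> c * t" using that \<open>0 < c\<close> by simp
        then show ?thesis using le[OF that(1)] by linarith
      qed
    qed (use \<tau> x T_def in auto)
  qed
qed

lemma ascend:
  assumes "a \<in> A" "0 < c" and pos: "\<And>y. y \<le> h \<Longrightarrow> c \<le> F i y a" and "0 \<le> hi" "hi \<le> h"
  obtains x \<tau> where "0 \<le> \<tau>" "\<tau> \<le> hi / c" "path i (\<lambda>_. a) x 0 \<tau>" "x 0 = 0" "x \<tau> = hi"
    "\<And>t. 0 < t \<Longrightarrow> t \<le> \<tau> \<Longrightarrow> 0 < x t" "\<And>t. 0 \<le> t \<Longrightarrow> t \<le> \<tau> \<Longrightarrow> x t \<le> hi"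
proof -
  obtain x where x: "x 0 = 0" "\<And>T. path i (\<lambda>_. a) x 0 T"
    using path_exists[OF controls_const[OF \<open>a \<in> A\<close>] order_refl] by metis
  show thesis
  proof (cases "hi = 0")
    case True
    show ?thesis by (rule that[of 0 x]) (use True x in auto)
  next
    case False
    define T where "T = hi / c"
    have T: "0 < T" using False \<open>0 \<le> hi\<close> \<open>0 < c\<close> by (auto simp: T_def)
    have "\<exists>t\<in>{0..T}. hi \<le> x t"
    proof (rule ccontr)
      assume *: "\<not> (\<exists>t\<in>{0..T}. hi \<le> x t)"
      have "x 0 + c * (T - 0) \<le> x T"
        by (rule path_increase[OF x(2)]) (use T * \<open>hi \<le> h\<close> in \<open>auto intro!: pos\<close>, force)
      moreover have "c * T = hi" using \<open>0 < c\<close> by (simp add: T_def)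
      ultimately show False using * T x(1) by auto
    qed
    then obtain t where t: "0 \<le> t" "t \<le> T" "hi \<le> x t" by auto
    then obtain \<tau> where \<tau>: "0 < \<tau>" "\<tau> \<le> t" "x \<tau> = hi" "\<And>t. 0 \<le> t \<Longrightarrow> t < \<tau> \<Longrightarrow> x t < hi"
      using first_hit_up[OF path_continuous[OF x(2)[of t]], of hi] False \<open>0 \<le> hi\<close> x(1) by auto
    have le: "x r \<le> hi" if "0 \<le> r" "r \<le> \<tau>" for r
      using \<tau>(3) \<tau>(4)[of r] that by (cases "r = \<tau>") auto
    show ?thesis
    proof (rule that[of \<tau> x])
      show "0 < x t" if "0 < t" "t \<le> \<tau>" for t
      proof -
        have "x 0 + c * (t - 0) \<le> x t"
        proof (rule path_increase[OF x(2)[of t]])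
          fix r assume "0 \<le> r" "r \<le> t"
          then show "c \<le> F i (x r) a" using le[of r] that \<open>hi \<le> h\<close> by (intro pos) auto
        qed (use that in auto)
        moreover have "0 < c * t" using that \<open>0 < c\<close> by simp
        ultimately show ?thesis using x(1) by simp
      qed
    qed (use \<tau> t x T_def le in auto)
  qed
qed

lemma am_neg: "y \<le> h0 \<Longrightarrow> F i y (am i) \<le> - c0"
  using am(2)[of "max y 0" i] h0 by (auto simp: extend_left_def)

lemma ap_pos: "y \<le> h0 \<Longrightarrow> c0 \<le> F i y (ap i)"
  using ap(2)[of "max y 0" i] h0 by (auto simp: extend_left_def)

lemma cost_nonneg: "\<beta> \<in> controls A \<Longrightarrow> continuous_on {a..b} x \<Longrightarrow> 0 \<le> a \<Longrightarrow> 0 \<le> cost i \<beta> x a b"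
  unfolding cost_def
  by (rule integral_nonneg[OF G_discounted_integrable]) (auto intro!: mult_nonneg_nonneg G_ge controls_in)

lemma cost_le:
  assumes "\<beta> \<in> controls A" "continuous_on {a..b} x" "0 \<le> a" "a \<le> b"
  shows "cost i \<beta> x a b \<le> M * (b - a)"
proof -
  have "cost i \<beta> x a b \<le> integral {a..b} (\<lambda>_. M)"
    unfolding cost_def
  proof (rule integral_le[OF G_discounted_integrable[OF assms(1-3)]])
    fix t assume "t \<in> {a..b}"
    then have "exp (- lam * t) * G i (x t) (\<beta> t) \<le> 1 * M"
      using assms lam M by (intro mult_mono G_le controls_in G_ge) auto
    then show "exp (- lam * t) * G i (x t) (\<beta> t) \<le> M" by simp
  qed auto
  then show ?thesis using \<open>a \<le> b\<close> by (simp add: mult.commute)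
qed

lemma cost_shift: "cost i (\<lambda>t. \<beta> (t + c)) (\<lambda>t. x (t + c)) (a - c) (b - c) = exp (lam * c) * cost i \<beta> x a b"
proof -
  have "cost i (\<lambda>t. \<beta> (t + c)) (\<lambda>t. x (t + c)) (a - c) (b - c) =
     integral {a - c..b - c} (\<lambda>t. exp (lam * c) * (exp (- lam * (t + c)) * G i (x (t + c)) (\<beta> (t + c))))"
    unfolding cost_def by (intro integral_cong) (simp add: algebra_simps flip: exp_add mult.assoc)
  also have "\<dots> = exp (lam * c) * integral {a - c..b - c} (\<lambda>t. exp (- lam * (t + c)) * G i (x (t + c)) (\<beta> (t + c)))"
    by simp
  also have "integral {a - c..b - c} (\<lambda>t. exp (- lam * (t + c)) * G i (x (t + c)) (\<beta> (t + c))) = cost i \<beta> x a b"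
    unfolding cost_def
    using integral_shift_cbox[of a c b "\<lambda>t. exp (- lam * t) * G i (x t) (\<beta> t)"] by simp
  finally show ?thesis .
qed

end

section \<open>Junction trajectories\<close>

lemma UNIV_branch: "UNIV = {B1, B2, B3}"
  using branch.exhaust by auto

instance branch :: finite
  by standard (simp add: UNIV_branch)

lemma borel_measurable_lebesgue_on_finite_UN:
  fixes g :: "real \<Rightarrow> real"
  assumes "finite I" "\<And>k. k \<in> I \<Longrightarrow> S k \<in> sets lebesgue" "\<And>k. k \<in> I \<Longrightarrow> g \<in> borel_measurable (lebesgue_on (S k))"
  shows "g \<in> borel_measurable (lebesgue_on (\<Union>k\<in>I. S k))"
proof -
  have U: "(\<Union>k\<in>I. S k) \<in> sets lebesgue" using assms(1,2) by (intro sets.finite_UN) auto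
  have "{t \<in> (\<Union>k\<in>I. S k). c < g t} \<in> sets lebesgue" for c
  proof -
    have "{t \<in> S k. c < g t} \<in> sets lebesgue" if k: "k \<in> I" for k
    proof -
      have "{t \<in> space (lebesgue_on (S k)). c < g t} \<in> sets (lebesgue_on (S k))"
        using assms(3)[OF k] unfolding borel_measurable_iff_greater by blast
      then show ?thesis using assms(2)[OF k] by (simp add: sets_restrict_space_iff)
    qed
    then have "(\<Union>k\<in>I. {t \<in> S k. c < g t}) \<in> sets lebesgue"
      using assms(1) by (intro sets.finite_UN) auto
    also have "(\<Union>k\<in>I. {t \<in> S k. c < g t}) = {t \<in> (\<Union>k\<in>I. S k). c < g t}" by auto
    finally show ?thesis .
  qed
  then show ?thesis
    unfolding borel_measurable_iff_greater using U by (auto simp: sets_restrict_space_iff)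
qed

lemma same_point_sym: "same_point x i y j \<Longrightarrow> same_point y j x i"
  and same_point_trans: "same_point x i y j \<Longrightarrow> same_point y j z k \<Longrightarrow> same_point x i z k"
  by (auto simp: same_point_def)

definition jf :: "'a data \<Rightarrow> (real \<Rightarrow> 'a + 'a junction_control) \<Rightarrow> (real \<Rightarrow> real) \<Rightarrow> (real \<Rightarrow> branch) \<Rightarrow> real \<Rightarrow> real" where
  "jf f \<alpha> x i t = (if x t > 0 then f (i t) (x t) (projl (\<alpha> t)) else f0 f (projr (\<alpha> t)))"

definition jl :: "'a data \<Rightarrow> 'a data \<Rightarrow> (real \<Rightarrow> 'a + 'a junction_control) \<Rightarrow> (real \<Rightarrow> real) \<Rightarrow> (real \<Rightarrow> branch) \<Rightarrow> real \<Rightarrow> real" where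
  "jl f l \<alpha> x i t = (if x t > 0 then l (i t) (x t) (projl (\<alpha> t)) else l0 f l (projr (\<alpha> t)))"

lemma junction_trajectory_primitive:
  assumes "junction_trajectory f \<alpha> x0 i0 x i"
  shows "primitive_on 0 T (jf f \<alpha> x i) x"
proof -
  have "x 0 = x0" using assms unfolding junction_trajectory_def same_point_def by blast
  with assms show ?thesis
    unfolding junction_trajectory_def primitive_on_def jf_def by auto
qed

lemma junction_trajectoryI:
  assumes "same_point (x 0) (i 0) x0 i0" "\<And>t. 0 \<le> t \<Longrightarrow> 0 \<le> x t"
    "\<And>T. 0 \<le> T \<Longrightarrow> primitive_on 0 T (jf f \<alpha> x i) x"
    "\<And>s t. 0 \<le> s \<Longrightarrow> s \<le> t \<Longrightarrow> \<forall>r\<in>{s<..t}. 0 < x r \<Longrightarrow> i t = i s"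
    "\<And>t. 0 \<le> t \<Longrightarrow> 0 < x t \<Longrightarrow> isl (\<alpha> t)"
    "\<And>t. 0 \<le> t \<Longrightarrow> x t = 0 \<Longrightarrow> \<not> isl (\<alpha> t)"
    "\<And>t a j. 0 \<le> t \<Longrightarrow> x t = 0 \<Longrightarrow> \<alpha> t = Inr (Inr (a, j)) \<Longrightarrow> i t = j"
  shows "junction_trajectory f \<alpha> x0 i0 x i"
proof -
  have "x 0 = x0" using assms(1) by (simp add: same_point_def)
  have "\<forall>t\<ge>0. (jf f \<alpha> x i has_integral (x t - x0)) {0..t}"
    using assms(3) \<open>x 0 = x0\<close> unfolding primitive_on_def by auto
  then have c3: "\<forall>t\<ge>0. ((\<lambda>r. if x r > 0 then f (i r) (x r) (projl (\<alpha> r)) else f0 f (projr (\<alpha> r)))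
      has_integral (x t - x0)) {0..t}"
    unfolding jf_def[abs_def] .
  have c2: "\<forall>t\<ge>0. 0 \<le> x t" using assms(2) by blast
  have c4: "\<forall>s t. 0 \<le> s \<and> s \<le> t \<and> (\<forall>r\<in>{s<..t}. 0 < x r) \<longrightarrow> i t = i s" using assms(4) by blast
  have c5: "\<forall>t\<ge>0. 0 < x t \<longrightarrow> isl (\<alpha> t)" using assms(5) by blast
  have c6: "\<forall>t\<ge>0. x t = 0 \<longrightarrow> \<not> isl (\<alpha> t)" using assms(6) by blast
  have c7: "\<forall>t\<ge>0. \<forall>a j. x t = 0 \<and> \<alpha> t = Inr (Inr (a, j)) \<longrightarrow> i t = j" using assms(7) by blast
  show ?thesis
    unfolding junction_trajectory_def by (intro conjI assms(1) c2 c3 c4 c5 c6 c7)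
qed

lemma junction_trajectoryD:
  assumes "junction_trajectory f \<alpha> x0 i0 x i"
  shows "same_point (x 0) (i 0) x0 i0" "x 0 = x0" "0 \<le> t \<Longrightarrow> 0 \<le> x t"
    "0 \<le> s \<Longrightarrow> s \<le> t \<Longrightarrow> \<forall>r\<in>{s<..t}. 0 < x r \<Longrightarrow> i t = i s"
    "0 \<le> t \<Longrightarrow> 0 < x t \<Longrightarrow> isl (\<alpha> t)"
    "0 \<le> t \<Longrightarrow> x t = 0 \<Longrightarrow> \<not> isl (\<alpha> t)"
    "0 \<le> t \<Longrightarrow> x t = 0 \<Longrightarrow> \<alpha> t = Inr (Inr (a, j)) \<Longrightarrow> i t = j"
proof -
  note d = assms[unfolded junction_trajectory_def]
  show 1: "same_point (x 0) (i 0) x0 i0" using d by (rule conjunct1)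
  then show "x 0 = x0" by (simp add: same_point_def)
  note d2 = d[THEN conjunct2]
  show "0 \<le> t \<Longrightarrow> 0 \<le> x t" using d2[THEN conjunct1] by blast
  note d4 = d2[THEN conjunct2, THEN conjunct2]
  show "0 \<le> s \<Longrightarrow> s \<le> t \<Longrightarrow> \<forall>r\<in>{s<..t}. 0 < x r \<Longrightarrow> i t = i s" using d4[THEN conjunct1] by blast
  note d5 = d4[THEN conjunct2]
  show "0 \<le> t \<Longrightarrow> 0 < x t \<Longrightarrow> isl (\<alpha> t)" using d5[THEN conjunct1] by blast
  note d6 = d5[THEN conjunct2]
  show "0 \<le> t \<Longrightarrow> x t = 0 \<Longrightarrow> \<not> isl (\<alpha> t)" using d6[THEN conjunct1] by blast
  show "0 \<le> t \<Longrightarrow> x t = 0 \<Longrightarrow> \<alpha> t = Inr (Inr (a, j)) \<Longrightarrow> i t = j" using d6[THEN conjunct2] by blast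
qed

context junction_data
begin

text \<open>At least two of the three nonpositive drifts are nonzero, so one pairwise product is
  positive and the others are nonnegative. This is the purpose of allowing at most one vanishing
  drift in \<open>A0\<close>.\<close>

lemma A0_denominator_pos:
  assumes "(a1, a2, a3) \<in> A0 A f"
  shows "0 < f B2 0 a2 * f B3 0 a3 + f B1 0 a1 * f B3 0 a3 + f B1 0 a1 * f B2 0 a2"
proof -
  define p q r where "p = - f B1 0 a1" "q = - f B2 0 a2" "r = - f B3 0 a3"
  have h: "0 \<le> p" "0 \<le> q" "0 \<le> r" "\<not> (p = 0 \<and> q = 0)" "\<not> (p = 0 \<and> r = 0)" "\<not> (q = 0 \<and> r = 0)"
    using assms by (auto simp: A0_def p_q_r_def)
  have nn: "0 \<le> q * r" "0 \<le> p * r" "0 \<le> p * q" using h by simp_all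
  have "0 < q * r \<or> 0 < p * r \<or> 0 < p * q"
  proof (cases "p = 0")
    case True then show ?thesis using h by (simp add: order_le_less)
  next
    case False
    then have "0 < q \<or> 0 < r" using h by auto
    then show ?thesis using False h(1) by auto
  qed
  then have "0 < q * r + p * r + p * q" using nn by linarith
  then show ?thesis by (simp add: p_q_r_def)
qed

text \<open>The weights are the \<open>\<mu>\<close> of the definition; that they form a convex
  combination carries bounds of \<open>l\<close> over to \<open>l0\<close>.\<close>

lemma l0_weights:
  assumes "(a1, a2, a3) \<in> A0 A f"
  obtains m1 m2 m3 where "0 \<le> m1" "0 \<le> m2" "0 \<le> m3" "m1 + m2 + m3 = 1"
    "l0 f l (Inl (a1, a2, a3)) = m1 * l B1 0 a1 + m2 * l B2 0 a2 + m3 * l B3 0 a3"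
proof -
  define D where "D = f B2 0 a2 * f B3 0 a3 + f B1 0 a1 * f B3 0 a3 + f B1 0 a1 * f B2 0 a2"
  have D: "0 < D" unfolding D_def by (rule A0_denominator_pos[OF assms])
  have nn: "0 \<le> f B2 0 a2 * f B3 0 a3" "0 \<le> f B1 0 a1 * f B3 0 a3" "0 \<le> f B1 0 a1 * f B2 0 a2"
    using assms by (auto simp: A0_def mult_nonpos_nonpos)
  show thesis
  proof (rule that)
    show "f B2 0 a2 * f B3 0 a3 / D + f B1 0 a1 * f B3 0 a3 / D + f B1 0 a1 * f B2 0 a2 / D = 1"
      using D by (simp add: D_def flip: add_divide_distrib)
    show "l0 f l (Inl (a1, a2, a3)) = f B2 0 a2 * f B3 0 a3 / D * l B1 0 a1 +
      f B1 0 a1 * f B3 0 a3 / D * l B2 0 a2 + f B1 0 a1 * f B2 0 a2 / D * l B3 0 a3"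
      by (simp add: Let_def D_def)
  qed (use D nn in simp_all)
qed

lemma junction_controls_bounds:
  assumes "b \<in> junction_controls A f"
  shows "0 \<le> f0 f b" "f0 f b \<le> M" "0 \<le> l0 f l b" "l0 f l b \<le> M"
proof -
  have "0 \<le> f0 f b \<and> f0 f b \<le> M \<and> 0 \<le> l0 f l b \<and> l0 f l b \<le> M"
  proof (cases b)
    case (Inl c)
    obtain a1 a2 a3 where c: "c = (a1, a2, a3)" by (cases c)
    then have A: "(a1, a2, a3) \<in> A0 A f" using assms Inl by (auto simp: junction_controls_def)
    then have a: "a1 \<in> A" "a2 \<in> A" "a3 \<in> A" by (auto simp: A0_def)
    obtain m1 m2 m3 where m: "0 \<le> m1" "0 \<le> m2" "0 \<le> m3" "m1 + m2 + m3 = 1"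
      "l0 f l (Inl (a1, a2, a3)) = m1 * l B1 0 a1 + m2 * l B2 0 a2 + m3 * l B3 0 a3"
      by (rule l0_weights[OF A])
    have "m1 * l B1 0 a1 + m2 * l B2 0 a2 + m3 * l B3 0 a3 \<le> m1 * M + m2 * M + m3 * M"
      using m a by (intro add_mono mult_left_mono l_bound) auto
    also have "\<dots> = M" using m(4) by (simp flip: distrib_right)
    finally have "l0 f l b \<le> M" using m(5) Inl c by simp
    moreover have "0 \<le> l0 f l b"
      unfolding Inl c m(5) using m a l_nonneg by simp
    ultimately show ?thesis using Inl c M by simp
  next
    case (Inr c)
    then obtain a i where c: "c = (a, i)" "a \<in> A" "0 \<le> f i 0 a"
      using assms by (auto simp: junction_controls_def A_tilde_def)
    then show ?thesis using Inr f_bound[of 0 a i] l_nonneg l_bound by auto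
  qed
  then show "0 \<le> f0 f b" "f0 f b \<le> M" "0 \<le> l0 f l b" "l0 f l b \<le> M" by auto
qed

lemma mixed_controls_projl: "\<alpha> \<in> mixed_controls A f \<Longrightarrow> 0 \<le> t \<Longrightarrow> isl (\<alpha> t) \<Longrightarrow> projl (\<alpha> t) \<in> A"
  and mixed_controls_projr: "\<alpha> \<in> mixed_controls A f \<Longrightarrow> 0 \<le> t \<Longrightarrow> \<not> isl (\<alpha> t) \<Longrightarrow> projr (\<alpha> t) \<in> junction_controls A f"
  by (auto simp: mixed_controls_def Plus_def)+

lemma jf_bound:
  assumes "\<alpha> \<in> mixed_controls A f" "junction_trajectory f \<alpha> x0 i0 x i" "0 \<le> t"
  shows "\<bar>jf f \<alpha> x i t\<bar> \<le> M"
proof (cases "0 < x t")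
  case True
  then show ?thesis
    using f_bound mixed_controls_projl[OF assms(1,3)] junction_trajectoryD(5)[OF assms(2,3)] by (simp add: jf_def)
next
  case False
  then have "x t = 0" using junction_trajectoryD(3)[OF assms(2,3)] by simp
  then show ?thesis
    using junction_controls_bounds(1,2)[OF mixed_controls_projr[OF assms(1,3)]] junction_trajectoryD(6)[OF assms(2,3)]
    by (simp add: jf_def)
qed

lemma jl_bounds:
  assumes "\<alpha> \<in> mixed_controls A f" "junction_trajectory f \<alpha> x0 i0 x i" "0 \<le> t"
  shows "0 \<le> jl f l \<alpha> x i t" "jl f l \<alpha> x i t \<le> M"
proof -
  have "0 \<le> jl f l \<alpha> x i t \<and> jl f l \<alpha> x i t \<le> M"
  proof (cases "0 < x t")
    case True
    then show ?thesis
      using l_nonneg l_bound mixed_controls_projl[OF assms(1,3)] junction_trajectoryD(5)[OF assms(2,3)] by (simp add: jl_def)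
  next
    case False
    then have "x t = 0" using junction_trajectoryD(3)[OF assms(2,3)] by simp
    then show ?thesis
      using junction_controls_bounds(3,4)[OF mixed_controls_projr[OF assms(1,3)]] junction_trajectoryD(6)[OF assms(2,3)]
      by (simp add: jl_def)
  qed
  then show "0 \<le> jl f l \<alpha> x i t" "jl f l \<alpha> x i t \<le> M" by auto
qed

lemma junction_trajectory_continuous:
  "junction_trajectory f \<alpha> x0 i0 x i \<Longrightarrow> continuous_on {0..} x"
  by (rule continuous_on_atLeast_Icc) (rule primitive_on_continuous[OF junction_trajectory_primitive])

lemma junction_trajectory_branch_const:
  assumes "junction_trajectory f \<alpha> x0 i0 x i" "0 \<le> a" "\<And>t. a < t \<Longrightarrow> t < b \<Longrightarrow> 0 < x t"
    "s \<in> {a<..<b}" "t \<in> {a<..<b}"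
  shows "i s = i t"
proof (cases "s \<le> t")
  case True
  then show ?thesis using junction_trajectoryD(4)[OF assms(1), of s t] assms(2-5) by force
next
  case False
  then show ?thesis using junction_trajectoryD(4)[OF assms(1), of t s] assms(2-5) by force
qed

text \<open>Off the junction the label is locally constant, so the times on a given branch form an
  open set. This is where measurability of the label comes from.\<close>

lemma open_branch_times:
  assumes tr: "junction_trajectory f \<alpha> x0 i0 x i"
  shows "open {t. 0 < t \<and> 0 < x t \<and> i t = j}"
  unfolding open_contains_ball
proof
  fix t assume t: "t \<in> {t. 0 < t \<and> 0 < x t \<and> i t = j}"
  have op: "open ({0<..} \<inter> x -` {0<..})"
    by (intro continuous_open_preimage continuous_on_subset[OF junction_trajectory_continuous[OF tr]]) auto
  moreover have "t \<in> {0<..} \<inter> x -` {0<..}" using t by auto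
  ultimately obtain e where e: "e > 0" "ball t e \<subseteq> {0<..} \<inter> x -` {0<..}"
    unfolding open_contains_ball by blast
  have ball: "ball t e = {t - e<..<t + e}" by (auto simp: dist_real_def)
  have "t - e/2 \<in> ball t e" using e by (simp add: dist_real_def)
  have pos: "0 < r \<and> 0 < x r" if "r \<in> ball t e" for r using e that by auto
  have const: "i v = i u" if uv: "u \<in> ball t e" "v \<in> ball t e" "u \<le> v" for u v
  proof (rule junction_trajectoryD(4)[OF tr])
    show "0 \<le> u" using pos[OF uv(1)] by simp
    show "\<forall>r\<in>{u<..v}. 0 < x r"
    proof
      fix r assume "r \<in> {u<..v}"
      then have "r \<in> ball t e" using uv unfolding ball by simp
      then show "0 < x r" using pos by blast
    qed
  qed (rule uv(3))
  have tb: "t \<in> ball t e" using e(1) by simp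
  have "i r = j" if r: "r \<in> ball t e" for r
    using const[OF r tb] const[OF tb r] t by (cases "r \<le> t") auto
  with pos e(1) show "\<exists>e>0. ball t e \<subseteq> {t. 0 < t \<and> 0 < x t \<and> i t = j}" by blast
qed

text \<open>Measurability is shown separately on the times inside each branch, on those at the
  junction with a control \<open>(a, j)\<close>, and on those with a triple; on each kind the
  integrand is a continuous function of measurable data. Time \<open>0\<close> may belong to none of
  them and is negligible.\<close>

lemma jl_bdd_integrable:
  assumes \<alpha>: "\<alpha> \<in> mixed_controls A f" and tr: "junction_trajectory f \<alpha> x0 i0 x i"
  shows "bdd_integrable (jl f l \<alpha> x i)"
proof -
  have mm: "measurable_mixed \<alpha>" using \<alpha> by (simp add: mixed_controls_def)
  have cx: "continuous_on {0..} x" by (rule junction_trajectory_continuous[OF tr])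
  have cZ: "{t. 0 \<le> t \<and> x t = 0} \<in> sets lebesgue"
  proof -
    have "closed ({0..} \<inter> x -` {0})" by (intro continuous_closed_preimage cx) auto
    moreover have "{0..} \<inter> x -` {0} = {t. 0 \<le> t \<and> x t = 0}" by auto
    ultimately show ?thesis by simp
  qed
  \<comment> \<open>The type \<open>branch\<close> also serves as a three-element index here:
    \<open>k\<close> distinguishes the kinds of times, \<open>j\<close> is the branch. For triples
    the second index is idle.\<close>
  define S where "S k j = (case k of B1 \<Rightarrow> {t. 0 < t \<and> 0 < x t \<and> i t = j}
     | B2 \<Rightarrow> {t. 0 \<le> t \<and> x t = 0} \<inter> {t. 0 \<le> t \<and> \<alpha> t \<in> Inr ` Inr ` (UNIV \<times> {j})}
     | B3 \<Rightarrow> {t. 0 \<le> t \<and> x t = 0} \<inter> {t. 0 \<le> t \<and> \<alpha> t \<in> Inr ` Inl ` UNIV})" for k j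
  have mU: "{t. 0 \<le> t \<and> \<alpha> t \<in> Inr ` Inr ` (UNIV \<times> {j})} \<in> sets lebesgue"
    "{t. 0 \<le> t \<and> \<alpha> t \<in> Inr ` Inl ` UNIV} \<in> sets lebesgue" for j
    using mm open_UNIV unfolding measurable_mixed_def by blast+
  have SB1: "S B1 j \<in> sets lebesgue" for j
    using open_branch_times[OF tr, of j] by (simp add: S_def)
  have SB2: "S B2 j \<in> sets lebesgue" for j
    unfolding S_def branch.case by (intro sets.Int cZ mU)
  have SB3: "S B3 j \<in> sets lebesgue" for j
    unfolding S_def branch.case by (intro sets.Int cZ mU)
  note SB = SB1 SB2 SB3
  have S: "S k j \<in> sets lebesgue" for k j using SB by (cases k) auto
  have m1: "jl f l \<alpha> x i \<in> borel_measurable (lebesgue_on (S B1 j))" for j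
  proof -
    have isl: "isl (\<alpha> t)" if "t \<in> S B1 j" for t
      using junction_trajectoryD(5)[OF tr, of t] that by (auto simp: S_def)
    have "(\<lambda>t. l j (x t) (projl (\<alpha> t))) \<in> borel_measurable (lebesgue_on (S B1 j))"
    proof (rule borel_measurable_joint_continuous[where X = "{0..}" and B = A and H = "l j"])
      fix U :: "'a set" assume "open U"
      then have "S B1 j \<inter> {t. 0 \<le> t \<and> \<alpha> t \<in> Inl ` U} \<in> sets lebesgue"
        using mm SB(1) unfolding measurable_mixed_def by (intro sets.Int) auto
      also have "S B1 j \<inter> {t. 0 \<le> t \<and> \<alpha> t \<in> Inl ` U} = {t \<in> S B1 j. projl (\<alpha> t) \<in> U}"
      proof (intro set_eqI iffI)
        fix t assume t: "t \<in> {t \<in> S B1 j. projl (\<alpha> t) \<in> U}"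
        then have "\<alpha> t = Inl (projl (\<alpha> t))" using isl[of t] by simp
        moreover have "projl (\<alpha> t) \<in> U" "0 \<le> t" using t by (simp_all add: S_def)
        ultimately have "\<alpha> t \<in> Inl ` U" by (metis imageI)
        with t \<open>0 \<le> t\<close> show "t \<in> S B1 j \<inter> {t. 0 \<le> t \<and> \<alpha> t \<in> Inl ` U}"
          by (intro IntI CollectI conjI) simp_all
      next
        fix t assume "t \<in> S B1 j \<inter> {t. 0 \<le> t \<and> \<alpha> t \<in> Inl ` U}"
        then obtain a where "t \<in> S B1 j" "\<alpha> t = Inl a" "a \<in> U" by blast
        then show "t \<in> {t \<in> S B1 j. projl (\<alpha> t) \<in> U}" by simp
      qed
      finally show "{t \<in> S B1 j. projl (\<alpha> t) \<in> U} \<in> sets lebesgue" .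
    next
      show "x \<in> borel_measurable (lebesgue_on (S B1 j))"
        by (rule continuous_imp_measurable_on_sets_lebesgue[OF continuous_on_subset[OF cx] SB(1)]) (auto simp: S_def)
      fix t assume t: "t \<in> S B1 j"
      then show "projl (\<alpha> t) \<in> A" using mixed_controls_projl[OF \<alpha> _ isl[OF t]] by (auto simp: S_def)
    qed (use SB(1) cont_l in \<open>auto simp: S_def\<close>)
    then show ?thesis
      by (rule measurable_cong[THEN iffD1, rotated]) (auto simp: S_def jl_def)
  qed
  have m2: "jl f l \<alpha> x i \<in> borel_measurable (lebesgue_on (S B2 j))" for j
  proof -
    have isr: "\<exists>a. \<alpha> t = Inr (Inr (a, j)) \<and> a \<in> A" if "t \<in> S B2 j" for t
      using that mixed_controls_projr[OF \<alpha>, of t] by (auto simp: S_def junction_controls_def A_tilde_def Plus_def)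
    have "(\<lambda>t. l j 0 (fst (projr (projr (\<alpha> t))))) \<in> borel_measurable (lebesgue_on (S B2 j))"
    proof (rule borel_measurable_joint_continuous[where X = "{0..}" and B = A and H = "l j"])
      fix U :: "'a set" assume "open U"
      then have "S B2 j \<inter> {t. 0 \<le> t \<and> \<alpha> t \<in> Inr ` Inr ` (U \<times> {j})} \<in> sets lebesgue"
        using mm SB(2) unfolding measurable_mixed_def by (intro sets.Int) auto
      also have "S B2 j \<inter> {t. 0 \<le> t \<and> \<alpha> t \<in> Inr ` Inr ` (U \<times> {j})} = {t \<in> S B2 j. fst (projr (projr (\<alpha> t))) \<in> U}"
        using isr by (force simp: S_def)
      finally show "{t \<in> S B2 j. fst (projr (projr (\<alpha> t))) \<in> U} \<in> sets lebesgue" .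
    next
      fix t assume t: "t \<in> S B2 j"
      then show "fst (projr (projr (\<alpha> t))) \<in> A" using isr[OF t] by auto
    qed (use SB(2) cont_l in auto)
    then show ?thesis
    proof (rule measurable_cong[THEN iffD1, rotated])
      fix t assume "t \<in> space (lebesgue_on (S B2 j))"
      then have t: "t \<in> S B2 j" by simp
      then show "l j 0 (fst (projr (projr (\<alpha> t)))) = jl f l \<alpha> x i t"
        using isr[OF t] by (auto simp: S_def jl_def)
    qed
  qed
  have m3: "jl f l \<alpha> x i \<in> borel_measurable (lebesgue_on (S B3 j))" for j
  proof -
    have isr: "\<exists>b. \<alpha> t = Inr (Inl b) \<and> b \<in> A0 A f" if "t \<in> S B3 j" for t
      using that mixed_controls_projr[OF \<alpha>, of t] by (auto simp: S_def junction_controls_def Plus_def)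
    have cg: "continuous_on ({0::real} \<times> A0 A f) (\<lambda>z. g k 0 (p (snd z)))"
      if g: "continuous_on ({0..} \<times> A) (\<lambda>(x, a). g k x a)" and p: "continuous_on (A0 A f) p" "p ` A0 A f \<subseteq> A" for g :: "'a data" and k p
    proof -
      have "continuous_on ({0::real} \<times> A0 A f) (\<lambda>z. p (snd z))"
        by (rule continuous_on_compose2[OF p(1)]) (auto intro!: continuous_intros)
      then have "continuous_on ({0::real} \<times> A0 A f) (\<lambda>z. (\<lambda>(x, a). g k x a) (0, p (snd z)))"
        by (intro continuous_on_compose2[OF g]) (use p in \<open>auto intro!: continuous_intros\<close>)
      then show ?thesis by simp
    qed
    have pr: "fst ` A0 A f \<subseteq> A" "(\<lambda>z. fst (snd z)) ` A0 A f \<subseteq> A" "(\<lambda>z. snd (snd z)) ` A0 A f \<subseteq> A"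
      by (auto simp: A0_def)
    have cH: "continuous_on ({0::real} \<times> A0 A f) (\<lambda>(x, b). l0 f l (Inl b))"
    proof -
      have eq: "(\<lambda>(x::real, b). l0 f l (Inl b)) = (\<lambda>z. let f1 = f B1 0 (fst (snd z)); f2 = f B2 0 (fst (snd (snd z))); f3 = f B3 0 (snd (snd (snd z)));
         D = f2 * f3 + f1 * f3 + f1 * f2
         in f2 * f3 / D * l B1 0 (fst (snd z)) + f1 * f3 / D * l B2 0 (fst (snd (snd z))) + f1 * f2 / D * l B3 0 (snd (snd (snd z))))"
        by (auto simp: fun_eq_iff Let_def)
      have ne: "f B2 0 (fst (snd (snd z))) * f B3 0 (snd (snd (snd z))) + f B1 0 (fst (snd z)) * f B3 0 (snd (snd (snd z))) +
         f B1 0 (fst (snd z)) * f B2 0 (fst (snd (snd z))) \<noteq> 0" if "z \<in> {0::real} \<times> A0 A f" for z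
        using A0_denominator_pos[of "fst (snd z)" "fst (snd (snd z))" "snd (snd (snd z))"] that by auto
      have c: "continuous_on ({0::real} \<times> A0 A f) (\<lambda>z. f k 0 (fst (snd z)))"
        "continuous_on ({0::real} \<times> A0 A f) (\<lambda>z. f k 0 (fst (snd (snd z))))"
        "continuous_on ({0::real} \<times> A0 A f) (\<lambda>z. f k 0 (snd (snd (snd z))))"
        "continuous_on ({0::real} \<times> A0 A f) (\<lambda>z. l k 0 (fst (snd z)))"
        "continuous_on ({0::real} \<times> A0 A f) (\<lambda>z. l k 0 (fst (snd (snd z))))"
        "continuous_on ({0::real} \<times> A0 A f) (\<lambda>z. l k 0 (snd (snd (snd z))))" for k
        using pr by (auto intro!: cg[OF cont_f] cg[OF cont_l] continuous_intros)
      show ?thesis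
        unfolding eq Let_def using ne by (intro continuous_intros c) auto
    qed
    have "(\<lambda>t. l0 f l (Inl (projl (projr (\<alpha> t))))) \<in> borel_measurable (lebesgue_on (S B3 j))"
    proof (rule borel_measurable_joint_continuous[where X = "{0}" and x = "\<lambda>_. 0" and B = "A0 A f" and H = "\<lambda>x b. l0 f l (Inl b)"])
      fix U :: "('a \<times> 'a \<times> 'a) set" assume "open U"
      then have "S B3 j \<inter> {t. 0 \<le> t \<and> \<alpha> t \<in> Inr ` Inl ` U} \<in> sets lebesgue"
        using mm SB(3) unfolding measurable_mixed_def by (intro sets.Int) auto
      also have "S B3 j \<inter> {t. 0 \<le> t \<and> \<alpha> t \<in> Inr ` Inl ` U} = {t \<in> S B3 j. projl (projr (\<alpha> t)) \<in> U}"
        using isr by (force simp: S_def)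
      finally show "{t \<in> S B3 j. projl (projr (\<alpha> t)) \<in> U} \<in> sets lebesgue" .
    next
      fix t assume t: "t \<in> S B3 j"
      then show "projl (projr (\<alpha> t)) \<in> A0 A f" using isr[OF t] by auto
    qed (use SB(3) cH in auto)
    then show ?thesis
    proof (rule measurable_cong[THEN iffD1, rotated])
      fix t assume "t \<in> space (lebesgue_on (S B3 j))"
      then have t: "t \<in> S B3 j" by simp
      then show "l0 f l (Inl (projl (projr (\<alpha> t)))) = jl f l \<alpha> x i t"
        using isr[OF t] by (auto simp: S_def jl_def simp del: l0.simps)
    qed
  qed
  have "jl f l \<alpha> x i \<in> borel_measurable (lebesgue_on (S k j))" for k j
    using m1 m2 m3 by (cases k) auto
  then have "jl f l \<alpha> x i \<in> borel_measurable (lebesgue_on (\<Union>kj\<in>UNIV. S (fst kj) (snd kj)))"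
    by (intro borel_measurable_lebesgue_on_finite_UN S) auto
  moreover have cover: "{0<..} \<subseteq> (\<Union>kj\<in>UNIV. S (fst kj) (snd kj))"
  proof
    fix t :: real assume t: "t \<in> {0<..}"
    show "t \<in> (\<Union>kj\<in>UNIV. S (fst kj) (snd kj))"
    proof (cases "0 < x t")
      case True
      then have "t \<in> S B1 (i t)" using t by (simp add: S_def)
      then show ?thesis by force
    next
      case False
      then have x: "x t = 0" using junction_trajectoryD(3)[OF tr, of t] t by simp
      then obtain b where b: "\<alpha> t = Inr b" using junction_trajectoryD(6)[OF tr, of t] t by (cases "\<alpha> t") auto
      show ?thesis
      proof (cases b)
        case (Inl c)
        then have "t \<in> S B3 B1" using t x b by (simp add: S_def)
        then show ?thesis by force
      next
        case (Inr c)
        then have "t \<in> S B2 (snd c)" using t x b by (cases c) (auto simp: S_def)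
        then show ?thesis by force
      qed
    qed
  qed
  ultimately have m: "jl f l \<alpha> x i \<in> borel_measurable (lebesgue_on {0<..})"
    using measurable_restrict_mono by blast
  show ?thesis
    unfolding bdd_integrable_def
  proof (intro conjI allI exI impI)
    show "\<bar>jl f l \<alpha> x i t\<bar> \<le> M" if "0 \<le> t" for t
      using jl_bounds[OF \<alpha> tr that] by simp
    fix T
    have "jl f l \<alpha> x i integrable_on {0<..T}"
    proof (rule measurable_bounded_by_integrable_imp_integrable_real)
      show "jl f l \<alpha> x i \<in> borel_measurable (lebesgue_on {0<..T})"
        by (rule measurable_restrict_mono[OF m]) auto
      show "(\<lambda>_. M) integrable_on {0<..T}"
        by (rule integrable_spike_set[of _ "{0..T}"]) (auto intro: integrable_const_ivl negligible_subset[of "{0}"])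
      show "{0<..T} \<in> sets lebesgue" by simp
    qed (use jl_bounds[OF \<alpha> tr] in auto)
    then show "jl f l \<alpha> x i integrable_on {0..T}"
      by (rule integrable_spike_set) (auto intro: negligible_subset[of "{0}"])
  qed
qed

lemma junction_cost_eq:
  assumes "\<alpha> \<in> mixed_controls A f" "junction_trajectory f \<alpha> x0 i0 x i"
  shows "junction_cost f l lam \<alpha> x i = discounted lam (jl f l \<alpha> x i)"
  using discounted_eq_LINT[OF jl_bdd_integrable[OF assms] lam]
  unfolding junction_cost_def jl_def .


section \<open>The junction value function and its dynamic programming\<close>

abbreviation V :: "real \<Rightarrow> branch \<Rightarrow> real" where "V \<equiv> V_junction A f l lam"

text \<open>The value \<open>am B1\<close> is a dummy for the times with a junction control; it
  makes the result a control with values in \<open>A\<close> and is never seen in the interior of an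
  excursion.\<close>

definition inner_control :: "(real \<Rightarrow> 'a + 'a junction_control) \<Rightarrow> real \<Rightarrow> 'a" where
  "inner_control \<alpha> t = (if isl (\<alpha> t) then projl (\<alpha> t) else am B1)"

lemma inner_control_in_controls:
  assumes "\<alpha> \<in> mixed_controls A f"
  shows "inner_control \<alpha> \<in> controls A"
  unfolding controls_iff
proof (intro conjI allI impI)
  fix t :: real assume "0 \<le> t"
  then show "inner_control \<alpha> t \<in> A"
    using mixed_controls_projl[OF assms] am(1) by (simp add: inner_control_def)
next
  fix U :: "'a set" assume "open U"
  have mm: "measurable_mixed \<alpha>" using assms by (simp add: mixed_controls_def)
  have s: "{t. 0 \<le> t \<and> \<alpha> t \<in> Inl ` W} \<in> sets lebesgue" if "open W" for W
    using mm that unfolding measurable_mixed_def by blast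
  have "{t. 0 \<le> t \<and> \<alpha> t \<in> Inl ` U} \<union> ({0..} - {t. 0 \<le> t \<and> \<alpha> t \<in> Inl ` UNIV}) \<inter> {t. am B1 \<in> U} \<in> sets lebesgue"
    using s[OF \<open>open U\<close>] s[OF open_UNIV] by (intro sets.Un sets.Int sets.Diff) auto
  also have "{t. 0 \<le> t \<and> \<alpha> t \<in> Inl ` U} \<union> ({0..} - {t. 0 \<le> t \<and> \<alpha> t \<in> Inl ` UNIV}) \<inter> {t. am B1 \<in> U}
     = {t. 0 \<le> t \<and> inner_control \<alpha> t \<in> U}"
  proof (intro set_eqI)
    fix t
    show "t \<in> {t. 0 \<le> t \<and> \<alpha> t \<in> Inl ` U} \<union> ({0..} - {t. 0 \<le> t \<and> \<alpha> t \<in> Inl ` UNIV}) \<inter> {t. am B1 \<in> U}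
      \<longleftrightarrow> t \<in> {t. 0 \<le> t \<and> inner_control \<alpha> t \<in> U}"
      by (cases "\<alpha> t") (auto simp: inner_control_def)
  qed
  finally show "{t. 0 \<le> t \<and> inner_control \<alpha> t \<in> U} \<in> sets lebesgue" .
qed

text \<open>During an excursion the trajectory is a path on a single branch. The end points are
  exempt from the comparison because the control there may be a junction control.\<close>

lemma junction_trajectory_path:
  assumes \<alpha>: "\<alpha> \<in> mixed_controls A f" and tr: "junction_trajectory f \<alpha> x0 i0 x i"
    and "0 \<le> a" "a < b" and pos: "\<And>t. a < t \<Longrightarrow> t < b \<Longrightarrow> 0 < x t"
  obtains j where "\<And>t. a < t \<Longrightarrow> t < b \<Longrightarrow> i t = j" "path j (inner_control \<alpha>) x a b"
    "integral {a..b} (\<lambda>t. exp (- lam * t) * jl f l \<alpha> x i t) = cost j (inner_control \<alpha>) x a b"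
proof -
  define j where "j = i ((a + b) / 2)"
  have ij: "i t = j" if "a < t" "t < b" for t
    unfolding j_def
    by (rule junction_trajectory_branch_const[OF tr \<open>0 \<le> a\<close> pos]) (use that \<open>a < b\<close> in auto)
  have isl: "isl (\<alpha> t)" if "a < t" "t < b" for t
    using junction_trajectoryD(5)[OF tr, of t] pos[OF that] that \<open>0 \<le> a\<close> by simp
  have "path j (inner_control \<alpha>) x a b"
    unfolding path_def
  proof (rule primitive_on_cong)
    show "primitive_on a b (jf f \<alpha> x i) x"
      using primitive_on_subinterval[OF junction_trajectory_primitive[OF tr]] \<open>0 \<le> a\<close> by blast
    fix t assume "t \<in> {a..b} - {a, b}"
    then have "a < t" "t < b" by auto
    then show "F j (x t) (inner_control \<alpha> t) = jf f \<alpha> x i t"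
      using pos[of t] ij[of t] isl[of t] by (simp add: jf_def inner_control_def)
  qed auto
  moreover have "integral {a..b} (\<lambda>t. exp (- lam * t) * jl f l \<alpha> x i t) = cost j (inner_control \<alpha>) x a b"
    unfolding cost_def
  proof (rule integral_spike[of "{a, b}"])
    fix t assume "t \<in> {a..b} - {a, b}"
    then have "a < t" "t < b" by auto
    then show "exp (- lam * t) * G j (x t) (inner_control \<alpha> t) = exp (- lam * t) * jl f l \<alpha> x i t"
      using pos[of t] ij[of t] isl[of t] by (simp add: jl_def inner_control_def)
  qed auto
  ultimately show thesis using that ij by blast
qed

lemma admissible_witness:
  assumes "\<alpha> \<in> admissible_controls A f x0 i0" "junction_trajectory f \<alpha> x0 i0 x i"
    "junction_trajectory f \<alpha> x0 i0 y j" "0 \<le> t"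
  shows "same_point (x t) (i t) (y t) (j t)"
  using assms unfolding admissible_controls_def by (blast intro: same_point_sym same_point_trans)

lemma admissibleI:
  assumes "\<alpha> \<in> mixed_controls A f" "junction_trajectory f \<alpha> x0 i0 x i"
    "\<And>y j t. junction_trajectory f \<alpha> x0 i0 y j \<Longrightarrow> 0 \<le> t \<Longrightarrow> same_point (x t) (i t) (y t) (j t)"
  shows "\<alpha> \<in> admissible_controls A f x0 i0"
  using assms unfolding admissible_controls_def by blast

lemma admissible_mixed: "\<alpha> \<in> admissible_controls A f x0 i0 \<Longrightarrow> \<alpha> \<in> mixed_controls A f"
  by (simp add: admissible_controls_def)

lemma junction_cost_bounds:
  assumes "\<alpha> \<in> mixed_controls A f" "junction_trajectory f \<alpha> x0 i0 x i"
  shows "0 \<le> junction_cost f l lam \<alpha> x i" "junction_cost f l lam \<alpha> x i \<le> M / lam"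
proof -
  note b = jl_bdd_integrable[OF assms]
  show "0 \<le> junction_cost f l lam \<alpha> x i"
    unfolding junction_cost_eq[OF assms]
    using discounted_mono[OF bdd_integrable_const[of 0] b lam jl_bounds(1)[OF assms]] lam by (simp add: discounted_const)
  show "junction_cost f l lam \<alpha> x i \<le> M / lam"
    unfolding junction_cost_eq[OF assms]
    using discounted_mono[OF b bdd_integrable_const[of M] lam jl_bounds(2)[OF assms]] lam by (simp add: discounted_const)
qed

lemma V_le_cost:
  assumes "\<alpha> \<in> admissible_controls A f x0 i0" "junction_trajectory f \<alpha> x0 i0 x i"
  shows "V x0 i0 \<le> junction_cost f l lam \<alpha> x i"
  unfolding V_junction_def
proof (rule cInf_lower)
  show "bdd_below {junction_cost f l lam \<alpha> x i |\<alpha> x i. \<alpha> \<in> admissible_controls A f x0 i0 \<and> junction_trajectory f \<alpha> x0 i0 x i}"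
    by (rule bdd_belowI[of _ 0]) (auto intro!: junction_cost_bounds(1) dest: admissible_mixed)
qed (use assms in blast)

text \<open>The control never takes a value in \<open>A\<close>, which by the constraints imposed at
  every time keeps any trajectory at the junction; this gives uniqueness.\<close>

lemma constant_junction_control:
  assumes "b \<in> junction_controls A f" "f0 f b = 0"
  obtains i where "(\<lambda>_. Inr b) \<in> admissible_controls A f 0 i0" "junction_trajectory f (\<lambda>_. Inr b) 0 i0 (\<lambda>_. 0) i"
    "junction_cost f l lam (\<lambda>_. Inr b) (\<lambda>_. 0) i = l0 f l b / lam"
proof -
  define i :: "real \<Rightarrow> branch" where "i = (\<lambda>_. case b of Inl _ \<Rightarrow> i0 | Inr (a, j) \<Rightarrow> j)"
  have mx: "(\<lambda>_. Inr b) \<in> mixed_controls A f"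
    using assms(1) by (auto simp: mixed_controls_def measurable_mixed_def)
  have tr: "junction_trajectory f (\<lambda>_. Inr b) 0 i0 (\<lambda>_. 0) i"
    by (rule junction_trajectoryI)
       (use assms(2) in \<open>auto simp: same_point_def primitive_on_def jf_def[abs_def] i_def\<close>)
  have "(\<lambda>_. Inr b) \<in> admissible_controls A f 0 i0"
  proof (rule admissibleI[OF mx tr])
    fix y j and t :: real assume y: "junction_trajectory f (\<lambda>_. Inr b) 0 i0 y j" "0 \<le> t"
    have "y t = 0" using junction_trajectoryD(3,5)[OF y] by force
    then show "same_point 0 (i t) (y t) (j t)" by (simp add: same_point_def)
  qed
  moreover have "junction_cost f l lam (\<lambda>_. Inr b) (\<lambda>_. 0) i = l0 f l b / lam"
    unfolding junction_cost_eq[OF mx tr] by (simp add: jl_def[abs_def] discounted_const lam)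
  ultimately show thesis using that tr by blast
qed

text \<open>If the path starts at the junction, the control at time \<open>0\<close> has to name the branch to be entered.\<close>

lemma prepend_path_admissible:
  assumes \<beta>: "\<beta> \<in> controls A" and "0 < d" and p: "path i \<beta> z 0 d"
    and pos: "\<And>t. 0 < t \<Longrightarrow> t < d \<Longrightarrow> 0 < z t" and z0: "0 \<le> z 0" and zd: "0 \<le> z d"
    and \<alpha>': "\<alpha>' \<in> admissible_controls A f (z d) i" and tr': "junction_trajectory f \<alpha>' (z d) i x' i'"
  obtains \<alpha> x ii where "\<alpha> \<in> admissible_controls A f (z 0) i" "junction_trajectory f \<alpha> (z 0) i x ii"
    "junction_cost f l lam \<alpha> x ii = cost i \<beta> z 0 d + exp (- lam * d) * junction_cost f l lam \<alpha>' x' i'"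
proof -
  have mx': "\<alpha>' \<in> mixed_controls A f" by (rule admissible_mixed[OF \<alpha>'])
  define \<alpha> where "\<alpha> t = (if t < d then (if t = 0 \<and> z 0 = 0 then Inr (Inr (ap i, i)) else Inl (\<beta> t)) else \<alpha>' (t - d))" for t
  define x where "x t = (if t < d then z t else x' (t - d))" for t
  define ii where "ii t = (if t < d then i else i' (t - d))" for t
  have xd: "x' 0 = z d" by (rule junction_trajectoryD(2)[OF tr'])
  have fap: "0 \<le> f i 0 (ap i)" using ap(2)[of 0 i] h0 c0 by simp
  have mx: "\<alpha> \<in> mixed_controls A f"
    unfolding mixed_controls_def
  proof (intro CollectI conjI allI impI)
    fix t :: real assume "0 \<le> t"
    show "\<alpha> t \<in> A <+> junction_controls A f"
    proof (cases "t < d")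
      case True
      then show ?thesis
        using controls_in[OF \<beta> \<open>0 \<le> t\<close>] ap(1) fap by (auto simp: \<alpha>_def junction_controls_def A_tilde_def)
    next
      case False
      then show ?thesis using mx' by (auto simp: \<alpha>_def mixed_controls_def)
    qed
  next
    have mm': "measurable_mixed \<alpha>'" using mx' by (simp add: mixed_controls_def)
    have sh: "{t. d \<le> t \<and> \<alpha>' (t - d) \<in> W} \<in> sets lebesgue" if "{t. 0 \<le> t \<and> \<alpha>' t \<in> W} \<in> sets lebesgue" for W
      using sets_lebesgue_shift[OF that, of "- d"] by simp
    show "measurable_mixed \<alpha>"
      unfolding measurable_mixed_def
    proof (intro conjI allI impI)
      fix U :: "'a set" assume "open U"
      have "({t. 0 \<le> t \<and> \<beta> t \<in> U} \<inter> {..<d} - (if z 0 = 0 then {0} else {})) \<union> {t. d \<le> t \<and> \<alpha>' (t - d) \<in> Inl ` U} \<in> sets lebesgue"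
      proof -
        have "{t. 0 \<le> t \<and> \<beta> t \<in> U} \<in> sets lebesgue"
          using \<beta> \<open>open U\<close> by (simp only: controls_iff)
        moreover have "{t. 0 \<le> t \<and> \<alpha>' t \<in> Inl ` U} \<in> sets lebesgue"
          using mm' \<open>open U\<close> by (simp only: measurable_mixed_def)
        ultimately show ?thesis by (intro sets.Un sets.Diff sets.Int sh) simp_all
      qed
      also have "({t. 0 \<le> t \<and> \<beta> t \<in> U} \<inter> {..<d} - (if z 0 = 0 then {0} else {})) \<union> {t. d \<le> t \<and> \<alpha>' (t - d) \<in> Inl ` U}
        = {t. 0 \<le> t \<and> \<alpha> t \<in> Inl ` U}" (is "?l = ?r")
      proof (intro set_eqI)
        fix t
        show "t \<in> ?l \<longleftrightarrow> t \<in> ?r"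
          using \<open>0 < d\<close> by (cases "t < d"; cases "t = 0 \<and> z 0 = 0") (auto simp: \<alpha>_def inj_image_mem_iff)
      qed
      finally show "{t. 0 \<le> t \<and> \<alpha> t \<in> Inl ` U} \<in> sets lebesgue" .
    next
      fix U :: "('a \<times> 'a \<times> 'a) set" assume "open U"
      then have "{t. d \<le> t \<and> \<alpha>' (t - d) \<in> Inr ` Inl ` U} \<in> sets lebesgue"
        using mm' unfolding measurable_mixed_def by (intro sh) blast
      also have "{t. d \<le> t \<and> \<alpha>' (t - d) \<in> Inr ` Inl ` U} = {t. 0 \<le> t \<and> \<alpha> t \<in> Inr ` Inl ` U}"
        using \<open>0 < d\<close> by (auto simp: \<alpha>_def split: if_splits)
      finally show "{t. 0 \<le> t \<and> \<alpha> t \<in> Inr ` Inl ` U} \<in> sets lebesgue" .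
    next
      fix U :: "'a set" and j assume "open U"
      then have "{t. d \<le> t \<and> \<alpha>' (t - d) \<in> Inr ` Inr ` (U \<times> {j})} \<in> sets lebesgue"
        using mm' unfolding measurable_mixed_def by (intro sh) blast
      then have "(if z 0 = 0 \<and> ap i \<in> U \<and> i = j then {0} else {}) \<union> {t. d \<le> t \<and> \<alpha>' (t - d) \<in> Inr ` Inr ` (U \<times> {j})} \<in> sets lebesgue"
        by (intro sets.Un) auto
      also have "(if z 0 = 0 \<and> ap i \<in> U \<and> i = j then {0} else {}) \<union> {t. d \<le> t \<and> \<alpha>' (t - d) \<in> Inr ` Inr ` (U \<times> {j})}
         = {t. 0 \<le> t \<and> \<alpha> t \<in> Inr ` Inr ` (U \<times> {j})}"
        using \<open>0 < d\<close> by (auto simp: \<alpha>_def split: if_splits)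
      finally show "{t. 0 \<le> t \<and> \<alpha> t \<in> Inr ` Inr ` (U \<times> {j})} \<in> sets lebesgue" .
    qed
  qed
  have xz: "x t = z t" if "t \<le> d" for t using that xd by (auto simp: x_def)
  have shift: "jf f \<alpha> x ii t = jf f \<alpha>' x' i' (t - d)" "jl f l \<alpha> x ii t = jl f l \<alpha>' x' i' (t - d)" if "d \<le> t" for t
    using that by (simp_all add: jf_def jl_def \<alpha>_def x_def ii_def)
  have early: "jf f \<alpha> x ii t = F i (z t) (\<beta> t)" "jl f l \<alpha> x ii t = G i (z t) (\<beta> t)" if "0 < t" "t < d" for t
    using that pos[OF that] by (simp_all add: jf_def jl_def \<alpha>_def x_def ii_def)
  have tr: "junction_trajectory f \<alpha> (z 0) i x ii"
  proof (rule junction_trajectoryI)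
    show "same_point (x 0) (ii 0) (z 0) i" using \<open>0 < d\<close> by (simp add: x_def ii_def same_point_def)
    show "0 \<le> x t" if "0 \<le> t" for t
      using that pos[of t] z0 junction_trajectoryD(3)[OF tr', of "t - d"] by (cases "t = 0") (auto simp: x_def intro: less_imp_le)
    show "primitive_on 0 T (jf f \<alpha> x ii) x" for T
    proof (rule primitive_on_subinterval[OF primitive_on_combine[of 0 d _ _ "max T d"]])
      show "primitive_on 0 d (jf f \<alpha> x ii) x"
        by (rule primitive_on_cong[OF p[unfolded path_def], of "{0, d}"]) (use early xz in auto)
      have "primitive_on (0 - - d) (max T d - d - - d) (\<lambda>t. jf f \<alpha>' x' i' (t + - d)) (\<lambda>t. x' (t + - d))"
        by (rule primitive_on_shift[OF junction_trajectory_primitive[OF tr']])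
      then have "primitive_on d (max T d) (\<lambda>t. jf f \<alpha>' x' i' (t - d)) (\<lambda>t. x' (t - d))" by simp
      then show "primitive_on d (max T d) (jf f \<alpha> x ii) x"
        by (rule primitive_on_cong[of _ _ _ _ "{}"]) (use shift in \<open>auto simp: x_def\<close>)
    qed (use \<open>0 < d\<close> in auto)
    show "ii t = ii s" if st: "0 \<le> s" "s \<le> t" "\<forall>r\<in>{s<..t}. 0 < x r" for s t
    proof (cases "d \<le> s")
      case True
      have "i' (t - d) = i' (s - d)"
      proof (rule junction_trajectoryD(4)[OF tr'])
        show "\<forall>r\<in>{s - d<..t - d}. 0 < x' r"
        proof
          fix r assume "r \<in> {s - d<..t - d}"
          then show "0 < x' r" using st(3)[rule_format, of "r + d"] True by (simp add: x_def)
        qed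
      qed (use st True in auto)
      then show ?thesis using True st by (simp add: ii_def)
    next
      case sd: False
      show ?thesis
      proof (cases "t < d")
        case True then show ?thesis using sd by (simp add: ii_def)
      next
        case False
        have "0 < x d" using st(3)[rule_format, of d] sd False by simp
        then have "0 < x' 0" by (simp add: x_def)
        then have "i' 0 = i" using junction_trajectoryD(1)[OF tr'] by (simp add: same_point_def)
        moreover have "i' (t - d) = i' 0"
        proof (rule junction_trajectoryD(4)[OF tr'])
          show "\<forall>r\<in>{0<..t - d}. 0 < x' r"
          proof
            fix r assume "r \<in> {0<..t - d}"
            then show "0 < x' r" using st(3)[rule_format, of "r + d"] sd by (simp add: x_def)
          qed
        qed (use False in auto)
        ultimately show ?thesis using False sd by (simp add: ii_def)
      qed
    qed
    show "isl (\<alpha> t)" if "0 \<le> t" "0 < x t" for t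
      using that junction_trajectoryD(5)[OF tr', of "t - d"] by (auto simp: \<alpha>_def x_def split: if_splits)
    show "\<not> isl (\<alpha> t)" if "0 \<le> t" "x t = 0" for t
      using that junction_trajectoryD(6)[OF tr', of "t - d"] pos[of t] by (cases "t = 0") (auto simp: \<alpha>_def x_def split: if_splits)
    show "ii t = j" if "0 \<le> t" "x t = 0" "\<alpha> t = Inr (Inr (a, j))" for t a j
      using that junction_trajectoryD(7)[OF tr', of "t - d" a j] by (auto simp: \<alpha>_def x_def ii_def split: if_splits)
  qed
  have "\<alpha> \<in> admissible_controls A f (z 0) i"
  proof (rule admissibleI[OF mx tr])
    \<comment> \<open>Uniqueness: the values in \<open>A\<close> strictly between \<open>0\<close>
      and \<open>d\<close> keep a competitor off the junction there, and its label is
      \<open>i\<close> from time \<open>0\<close> on, so it follows the same path up to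
      \<open>d\<close>. What remains is a trajectory of \<open>\<alpha>'\<close>, for which
      uniqueness is given.\<close>
    fix y j and t :: real assume y: "junction_trajectory f \<alpha> (z 0) i y j" and "0 \<le> t"
    have y0: "y 0 = z 0" by (rule junction_trajectoryD(2)[OF y])
    have j0: "j 0 = i"
    proof (cases "z 0 = 0")
      case True
      then show ?thesis using junction_trajectoryD(7)[OF y, of 0 "ap i" i] y0 \<open>0 < d\<close> by (simp add: \<alpha>_def)
    next
      case False
      then show ?thesis using junction_trajectoryD(1)[OF y] z0 by (simp add: same_point_def)
    qed
    have ypos: "0 < y r" if "0 < r" "r < d" for r
    proof (rule ccontr)
      assume "\<not> 0 < y r"
      then have "y r = 0" using junction_trajectoryD(3)[OF y, of r] that by simp
      then show False using junction_trajectoryD(6)[OF y, of r] that by (simp add: \<alpha>_def)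
    qed
    have jr: "j r = i" if "0 \<le> r" "r < d" for r
      using junction_trajectoryD(4)[OF y order_refl that(1)] ypos that j0 by auto
    have py: "path i \<beta> y 0 d"
      unfolding path_def
    proof (rule primitive_on_cong[OF junction_trajectory_primitive[OF y, of d]])
      fix r assume "r \<in> {0..d} - {0, d}"
      then have r: "0 < r" "r < d" by auto
      then show "F i (y r) (\<beta> r) = jf f \<alpha> y j r"
        using ypos[OF r] jr[of r] by (simp add: jf_def \<alpha>_def)
    qed auto
    have yz: "y r = z r" if "0 \<le> r" "r \<le> d" for r
      by (rule path_unique[of i \<beta> y 0 d z]) (use that py p y0 \<beta> in auto)
    show "same_point (x t) (ii t) (y t) (j t)"
    proof (cases "t < d")
      case True
      then show ?thesis using \<open>0 \<le> t\<close> yz[of t] jr[of t] by (simp add: x_def ii_def same_point_def)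
    next
      case False
      have "junction_trajectory f \<alpha>' (z d) i (\<lambda>t. y (t + d)) (\<lambda>t. j (t + d))"
      proof (rule junction_trajectoryI)
        have "j d = i" if "0 < z d"
        proof -
          have "\<forall>r\<in>{0<..d}. 0 < y r"
          proof
            fix r assume "r \<in> {0<..d}"
            then show "0 < y r" using ypos[of r] yz[of d] that by (cases "r = d") auto
          qed
          then show ?thesis using junction_trajectoryD(4)[OF y order_refl, of d] j0 \<open>0 < d\<close> by simp
        qed
        then show "same_point (y (0 + d)) (j (0 + d)) (z d) i"
          using yz[of d] \<open>0 < d\<close> by (simp add: same_point_def)
        show "0 \<le> y (r + d)" if "0 \<le> r" for r using junction_trajectoryD(3)[OF y, of "r + d"] that \<open>0 < d\<close> by simp
        show "primitive_on 0 T (jf f \<alpha>' (\<lambda>t. y (t + d)) (\<lambda>t. j (t + d))) (\<lambda>t. y (t + d))" for T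
        proof -
          have "primitive_on d (T + d) (jf f \<alpha> y j) y"
            using primitive_on_subinterval[OF junction_trajectory_primitive[OF y, of "T + d"]] \<open>0 < d\<close> by simp
          from primitive_on_shift[OF this, of d]
          have "primitive_on 0 T (\<lambda>t. jf f \<alpha> y j (t + d)) (\<lambda>t. y (t + d))" by simp
          then show ?thesis
            by (rule primitive_on_cong[of _ _ _ _ "{}"]) (auto simp: jf_def \<alpha>_def)
        qed
        show "j (t + d) = j (s + d)" if "0 \<le> s" "s \<le> t" "\<forall>r\<in>{s<..t}. 0 < y (r + d)" for s t
        proof (rule junction_trajectoryD(4)[OF y])
          show "\<forall>r\<in>{s + d<..t + d}. 0 < y r"
          proof
            fix r assume "r \<in> {s + d<..t + d}"
            then show "0 < y r" using that(3)[rule_format, of "r - d"] by auto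
          qed
        qed (use that \<open>0 < d\<close> in auto)
        show "isl (\<alpha>' r)" if "0 \<le> r" "0 < y (r + d)" for r
          using junction_trajectoryD(5)[OF y, of "r + d"] that \<open>0 < d\<close> by (simp add: \<alpha>_def)
        show "\<not> isl (\<alpha>' r)" if "0 \<le> r" "y (r + d) = 0" for r
          using junction_trajectoryD(6)[OF y, of "r + d"] that \<open>0 < d\<close> by (simp add: \<alpha>_def)
        show "j (r + d) = k" if "0 \<le> r" "y (r + d) = 0" "\<alpha>' r = Inr (Inr (a, k))" for r a k
          using junction_trajectoryD(7)[OF y, of "r + d" a k] that \<open>0 < d\<close> by (simp add: \<alpha>_def)
      qed
      from admissible_witness[OF \<alpha>' tr' this, of "t - d"] False show ?thesis
        by (simp add: x_def ii_def)
    qed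
  qed
  moreover have "junction_cost f l lam \<alpha> x ii = cost i \<beta> z 0 d + exp (- lam * d) * junction_cost f l lam \<alpha>' x' i'"
    unfolding junction_cost_eq[OF mx tr] junction_cost_eq[OF mx' tr'] cost_def
  proof (rule discounted_glue(2)[OF _ _ jl_bdd_integrable[OF mx' tr'] _ lam])
    show "(\<lambda>t. G i (z t) (\<beta> t)) integrable_on {0..d}"
      by (rule G_integrable[OF \<beta> path_continuous[OF p] order_refl])
    show "\<bar>G i (z t) (\<beta> t)\<bar> \<le> M" if "t \<in> {0..d}" for t
      using that by (intro G_bound controls_in[OF \<beta>]) auto
  qed (use early shift \<open>0 < d\<close> in auto)
  ultimately show thesis using that tr by blast
qed

text \<open>A constant control is kept until the junction is reached, if ever, and the triple
  \<open>(am B1, am B2, am B3)\<close> holds the state there. The infimum defining \<open>V\<close>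
  is thus over a nonempty set.\<close>

lemma admissible_exists:
  assumes "0 \<le> x0"
  obtains \<alpha> x i where "\<alpha> \<in> admissible_controls A f x0 i0" "junction_trajectory f \<alpha> x0 i0 x i"
proof -
  have b: "Inl (am B1, am B2, am B3) \<in> junction_controls A f"
  proof -
    have "f i 0 (am i) < 0" for i using am(2)[of 0 i] h0 c0 by simp
    from this[of B1] this[of B2] this[of B3] show ?thesis
      using am(1) by (auto simp: junction_controls_def A0_def)
  qed
  obtain i1 where 0: "(\<lambda>_. Inr (Inl (am B1, am B2, am B3))) \<in> admissible_controls A f 0 i0"
    "junction_trajectory f (\<lambda>_. Inr (Inl (am B1, am B2, am B3))) 0 i0 (\<lambda>_. 0) i1"
    by (rule constant_junction_control[OF b]) auto
  show thesis
  proof (cases "x0 = 0")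
    case True
    then show ?thesis using that 0 by blast
  next
    case False
    define a where "a = am B1"
    have a: "a \<in> A" by (simp add: a_def am)
    have ca: "(\<lambda>_. a) \<in> controls A" by (rule controls_const[OF a])
    obtain z where z: "z 0 = x0" "\<And>T. path i0 (\<lambda>_. a) z 0 T"
      using path_exists[OF ca order_refl] by metis
    show ?thesis
    proof (cases "\<exists>t\<ge>0. z t \<le> 0")
      case True
      then obtain t where "0 \<le> t" "z t \<le> 0" by blast
      then obtain d where d: "0 < d" "z d = 0" "\<And>t. 0 \<le> t \<Longrightarrow> t < d \<Longrightarrow> 0 < z t"
      proof -
        have "0 < z 0" using \<open>x0 \<noteq> 0\<close> assms z(1) by simp
        then show ?thesis
          using first_hit_down[OF path_continuous[OF z(2)[of t]] \<open>0 \<le> t\<close> _ \<open>z t \<le> 0\<close>] that by metis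
      qed
      have tr0: "(\<lambda>_. Inr (Inl (am B1, am B2, am B3))) \<in> admissible_controls A f (z d) i0"
        "junction_trajectory f (\<lambda>_. Inr (Inl (am B1, am B2, am B3))) (z d) i0 (\<lambda>_. 0) i1"
        using 0 d by auto
      show ?thesis
        by (rule prepend_path_admissible[OF ca d(1) z(2) d(3) _ _ tr0]) (use that z d assms in auto)
    next
      case False
      then have zpos: "0 < z t" if "0 \<le> t" for t using that by force
      have mx: "(\<lambda>_. Inl a) \<in> mixed_controls A f"
        using a by (auto simp: mixed_controls_def measurable_mixed_def)
      have tr: "junction_trajectory f (\<lambda>_. Inl a) x0 i0 z (\<lambda>_. i0)"
      proof (rule junction_trajectoryI)
        show "primitive_on 0 T (jf f (\<lambda>_. Inl a) z (\<lambda>_. i0)) z" for T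
          by (rule primitive_on_cong[OF z(2)[of T, unfolded path_def], of "{}"]) (use zpos in \<open>auto simp: jf_def less_imp_le\<close>)
      qed (use z zpos in \<open>force simp: same_point_def less_imp_le\<close>)+
      have "(\<lambda>_. Inl a) \<in> admissible_controls A f x0 i0"
      proof (rule admissibleI[OF mx tr])
        fix y j and t :: real assume y: "junction_trajectory f (\<lambda>_. Inl a) x0 i0 y j" and "0 \<le> t"
        have ypos: "0 < y r" if "0 \<le> r" for r
          using junction_trajectoryD(3,6)[OF y that] by force
        have j: "j r = i0" if "0 \<le> r" for r
          using junction_trajectoryD(4)[OF y order_refl that] junction_trajectoryD(1)[OF y] ypos that
          by (auto simp: same_point_def)
        have py: "path i0 (\<lambda>_. a) y 0 t"
          unfolding path_def
          by (rule primitive_on_cong[OF junction_trajectory_primitive[OF y, of t], of "{}"])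
             (use ypos j in \<open>auto simp: jf_def less_imp_le\<close>)
        have "y t = z t"
          by (rule path_unique[of i0 "\<lambda>_. a" y 0 t z]) (use py z ca \<open>0 \<le> t\<close> junction_trajectoryD(2)[OF y] in auto)
        then show "same_point (z t) i0 (y t) (j t)" using j[OF \<open>0 \<le> t\<close>] by (simp add: same_point_def)
      qed
      then show ?thesis using that tr by blast
    qed
  qed
qed

lemma V_greatest:
  assumes "0 \<le> x0" "\<And>\<alpha> x i. \<alpha> \<in> admissible_controls A f x0 i0 \<Longrightarrow> junction_trajectory f \<alpha> x0 i0 x i \<Longrightarrow> c \<le> junction_cost f l lam \<alpha> x i"
  shows "c \<le> V x0 i0"
  unfolding V_junction_def
proof (rule cInf_greatest)
  show "{junction_cost f l lam \<alpha> x i |\<alpha> x i. \<alpha> \<in> admissible_controls A f x0 i0 \<and> junction_trajectory f \<alpha> x0 i0 x i} \<noteq> {}"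
    by (rule admissible_exists[OF assms(1), of i0]) blast
qed (use assms(2) in blast)

lemma V_bounds:
  assumes "0 \<le> x0"
  shows "0 \<le> V x0 i0" "V x0 i0 \<le> M / lam"
proof -
  show "0 \<le> V x0 i0" by (rule V_greatest[OF assms]) (blast intro: junction_cost_bounds(1) admissible_mixed)
  obtain \<alpha> x i where "\<alpha> \<in> admissible_controls A f x0 i0" "junction_trajectory f \<alpha> x0 i0 x i"
    by (rule admissible_exists[OF assms])
  then show "V x0 i0 \<le> M / lam"
    using V_le_cost junction_cost_bounds(2) admissible_mixed by (meson order_trans)
qed

text \<open>\<open>same_point\<close> ignores labels at \<open>x = 0\<close>, so both starting
  points have literally the same trajectories.\<close>

lemma V_zero_branch: "V 0 i = V 0 j"
proof -
  have "junction_trajectory f \<alpha> 0 i = junction_trajectory f \<alpha> 0 j" for \<alpha>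
    unfolding junction_trajectory_def same_point_def by (intro ext) auto
  then show ?thesis unfolding V_junction_def admissible_controls_def by simp
qed

text \<open>Compares with the cost of holding the state at the junction forever.\<close>

lemma V_zero_le_stationary:
  assumes "b \<in> junction_controls A f" "f0 f b = 0"
  shows "lam * V 0 i \<le> l0 f l b"
proof -
  obtain i1 where "(\<lambda>_. Inr b) \<in> admissible_controls A f 0 i" "junction_trajectory f (\<lambda>_. Inr b) 0 i (\<lambda>_. 0) i1"
    "junction_cost f l lam (\<lambda>_. Inr b) (\<lambda>_. 0) i1 = l0 f l b / lam"
    by (rule constant_junction_control[OF assms])
  then have "V 0 i \<le> l0 f l b / lam" using V_le_cost by metis
  then show ?thesis using lam by (simp add: pos_le_divide_eq mult.commute)
qed

text \<open>Only the inequality obtained from a possibly suboptimal beginning: the path is prepended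
  to an arbitrary admissible control from its end point. Both ends of the path may be the
  junction.\<close>

lemma V_dynamic_programming:
  assumes \<beta>: "\<beta> \<in> controls A" and "0 \<le> c" "c \<le> d" and p: "path i \<beta> z c d"
    and pos: "\<And>t. c < t \<Longrightarrow> t < d \<Longrightarrow> 0 < z t" and zc: "0 \<le> z c" and zd: "0 \<le> z d"
  shows "exp (- lam * c) * V (z c) i \<le> cost i \<beta> z c d + exp (- lam * d) * V (z d) i"
proof (cases "c = d")
  case True
  then show ?thesis by (simp add: cost_def)
next
  case False
  define \<gamma> y where "\<gamma> t = \<beta> (t + c)" "y t = z (t + c)" for t
  have \<gamma>: "\<gamma> \<in> controls A" unfolding \<gamma>_y_def by (rule controls_shift[OF \<beta> \<open>0 \<le> c\<close>])
  have py: "path i \<gamma> y 0 (d - c)" using path_shift[OF p, of c] by (simp add: \<gamma>_y_def[abs_def])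
  have ey: "y 0 = z c" "y (d - c) = z d" by (simp_all add: \<gamma>_y_def)
  have "(V (z c) i - cost i \<gamma> y 0 (d - c)) * exp (lam * (d - c)) \<le> V (z d) i"
  proof (rule V_greatest[OF zd])
    fix \<alpha>' x' i' assume a': "\<alpha>' \<in> admissible_controls A f (z d) i" "junction_trajectory f \<alpha>' (z d) i x' i'"
    have "0 < d - c" using False \<open>c \<le> d\<close> by simp
    moreover have "0 < y t" if "0 < t" "t < d - c" for t using that pos[of "t + c"] by (simp add: \<gamma>_y_def)
    moreover have "0 \<le> y 0" "0 \<le> y (d - c)" using zc zd ey by auto
    moreover note a'[folded ey(2)]
    ultimately obtain \<alpha> x ii where *: "\<alpha> \<in> admissible_controls A f (y 0) i" "junction_trajectory f \<alpha> (y 0) i x ii"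
      "junction_cost f l lam \<alpha> x ii = cost i \<gamma> y 0 (d - c) + exp (- lam * (d - c)) * junction_cost f l lam \<alpha>' x' i'"
      by (rule prepend_path_admissible[OF \<gamma> _ py])
    have "V (z c) i \<le> cost i \<gamma> y 0 (d - c) + exp (- lam * (d - c)) * junction_cost f l lam \<alpha>' x' i'"
      using V_le_cost[OF *(1,2)] *(3) ey by simp
    then have "(V (z c) i - cost i \<gamma> y 0 (d - c)) * exp (lam * (d - c)) \<le>
       exp (- lam * (d - c)) * junction_cost f l lam \<alpha>' x' i' * exp (lam * (d - c))"
      by (intro mult_right_mono) auto
    also have "\<dots> = junction_cost f l lam \<alpha>' x' i'" by (simp flip: exp_add)
    finally show "(V (z c) i - cost i \<gamma> y 0 (d - c)) * exp (lam * (d - c)) \<le> junction_cost f l lam \<alpha>' x' i'" .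
  qed
  then have "(V (z c) i - cost i \<gamma> y 0 (d - c)) * exp (lam * (d - c)) * exp (- lam * d) \<le> V (z d) i * exp (- lam * d)"
    by (intro mult_right_mono) auto
  also have "(V (z c) i - cost i \<gamma> y 0 (d - c)) * exp (lam * (d - c)) * exp (- lam * d) =
    (V (z c) i - cost i \<gamma> y 0 (d - c)) * exp (- lam * c)"
  proof -
    have "exp (lam * (d - c)) * exp (- lam * d) = exp (- lam * c)" by (simp add: algebra_simps flip: exp_add)
    then show ?thesis by (simp only: mult.assoc)
  qed
  also have "cost i \<gamma> y 0 (d - c) = exp (lam * c) * cost i \<beta> z c d"
    using cost_shift[of i \<beta> c z c d] by (simp add: \<gamma>_y_def[abs_def])
  also have "(V (z c) i - exp (lam * c) * cost i \<beta> z c d) * exp (- lam * c) = exp (- lam * c) * V (z c) i - cost i \<beta> z c d"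
    by (simp add: algebra_simps flip: exp_add)
  finally show ?thesis by (simp add: mult.commute)
qed

end

section \<open>The value at the junction\<close>

lemma absolutely_integrable_bounded:
  fixes g :: "real \<Rightarrow> real"
  assumes "g integrable_on {a..b}" "\<And>t. t \<in> {a..b} \<Longrightarrow> \<bar>g t\<bar> \<le> K"
  shows "g absolutely_integrable_on {a..b}"
  by (rule measurable_bounded_by_integrable_imp_absolutely_integrable[OF integrable_imp_measurable[OF assms(1)]])
     (use assms(2) in \<open>auto intro: integrable_const_ivl\<close>)

lemma negligible_nonneg_integral_zero:
  fixes g :: "real \<Rightarrow> real"
  assumes "g absolutely_integrable_on S" "S \<in> sets lebesgue" "\<And>t. t \<in> S \<Longrightarrow> 0 \<le> g t" "integral S g = 0"
  shows "negligible {t \<in> S. g t \<noteq> 0}"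
proof -
  define h where "h t = indicator S t *\<^sub>R g t" for t
  have h: "integrable lebesgue h" using assms(1) unfolding set_integrable_def h_def .
  have "integral\<^sup>L lebesgue h = 0"
    using set_lebesgue_integral_eq_integral(2)[OF assms(1)] assms(4)
    by (simp add: h_def[abs_def] set_lebesgue_integral_def)
  moreover have "AE t in lebesgue. 0 \<le> h t" using assms(3) by (intro AE_I2) (auto simp: h_def indicator_def)
  ultimately have "AE t in lebesgue. h t = 0" using integral_nonneg_eq_0_iff_AE[OF h] by simp
  moreover have m: "{t \<in> space lebesgue. \<not> h t = 0} \<in> sets lebesgue"
    using borel_measurable_integrable[OF h] by measurable
  ultimately have "{t \<in> space lebesgue. \<not> h t = 0} \<in> null_sets lebesgue"
    using AE_iff_null[OF m] by simp
  moreover have "{t \<in> space lebesgue. \<not> h t = 0} = {t \<in> S. g t \<noteq> 0}"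
    by (auto simp: h_def indicator_def)
  ultimately show ?thesis by (simp add: negligible_iff_null_sets)
qed

lemma tendsto_exp_minus_at_top:
  fixes lam :: real
  assumes "0 < lam" shows "((\<lambda>T. K * exp (- lam * T)) \<longlongrightarrow> 0) at_top"
proof -
  have "filterlim (\<lambda>T. lam * T) at_top at_top"
    by (rule filterlim_tendsto_pos_mult_at_top[OF tendsto_const assms filterlim_ident])
  then have "filterlim (\<lambda>T. - lam * T) at_bot at_top"
    by (simp add: filterlim_uminus_at_bot)
  then have "((\<lambda>T. exp (- lam * T)) \<longlongrightarrow> 0) at_top"
    by (rule filterlim_compose[OF exp_at_bot])
  from tendsto_mult_right_zero[OF this, of K] show ?thesis by simp
qed

context junction_data
begin

abbreviation W :: real where "W \<equiv> V 0 B1"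

lemma V_zero: "V 0 i = W"
  by (rule V_zero_branch)

text \<open>On the open set \<open>U\<close> of times off the junction, \<open>ex\<close> signs each
  excursion. At the junction the drift \<open>f0\<close> is nonnegative, while it integrates to zero
  between two visits and over every excursion in between; so it vanishes almost everywhere on
  \<open>Z\<close>, only stationary junction controls count there, and \<open>st\<close> applies.
  The term with \<open>K\<close> stands for the value left over when an excursion is cut off at
  \<open>d\<close>.\<close>

lemma junction_tail_ge:
  assumes \<alpha>: "\<alpha> \<in> mixed_controls A f" and tr: "junction_trajectory f \<alpha> x0 i0 x i" and "0 \<le> \<tau>" "x \<tau> = 0" "0 \<le> K"
    and st: "\<And>b. b \<in> junction_controls A f \<Longrightarrow> f0 f b = 0 \<Longrightarrow> R \<le> l0 f l b"
    and ex: "\<And>j \<beta> z c d. \<beta> \<in> controls A \<Longrightarrow> 0 \<le> c \<Longrightarrow> c < d \<Longrightarrow> path j \<beta> z c d \<Longrightarrow> z c = 0 \<Longrightarrow>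
      (\<And>t. c < t \<Longrightarrow> t < d \<Longrightarrow> 0 < z t) \<Longrightarrow> 0 \<le> z d \<Longrightarrow>
      R / lam * (exp (- lam * c) - exp (- lam * d)) \<le> cost j \<beta> z c d + (if z d = 0 then 0 else K * exp (- lam * d))"
  shows "R / lam * exp (- lam * \<tau>) \<le> integral {\<tau>..} (\<lambda>t. exp (- lam * t) * jl f l \<alpha> x i t)"
proof -
  note bl = jl_bdd_integrable[OF \<alpha> tr]
  define g where "g t = exp (- lam * t) * (jl f l \<alpha> x i t - R)" for t
  have gabs: "g absolutely_integrable_on S" if "S \<in> sets lebesgue" "S \<subseteq> {0..}" for S
    unfolding g_def
    by (rule bdd_integrable_absolutely[OF bdd_integrable_diff[OF bl bdd_integrable_const] lam that])
  have gint: "g integrable_on S" if "S \<in> sets lebesgue" "S \<subseteq> {0..}" for S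
    using gabs[OF that] by (rule set_lebesgue_integral_eq_integral(1))
  have cx: "continuous_on {0..} x" by (rule junction_trajectory_continuous[OF tr])
  define U where "U = {\<tau><..} \<inter> x -` {0<..}"
  define Z where "Z = {\<tau>..} \<inter> x -` {0}"
  have opU: "open U" unfolding U_def
    by (intro continuous_open_preimage continuous_on_subset[OF cx]) (use \<open>0 \<le> \<tau>\<close> in auto)
  have clZ: "closed Z" unfolding Z_def
    by (intro continuous_closed_preimage continuous_on_subset[OF cx]) (use \<open>0 \<le> \<tau>\<close> in auto)
  have xnn: "0 \<le> x t" if "\<tau> \<le> t" for t using junction_trajectoryD(3)[OF tr, of t] that \<open>0 \<le> \<tau>\<close> by simp
  have UZ1: "{\<tau>..} = U \<union> Z"
  proof (intro set_eqI iffI)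
    fix t assume "t \<in> {\<tau>..}"
    then have t: "\<tau> \<le> t" by simp
    show "t \<in> U \<union> Z"
    proof (cases "x t = 0")
      case True then show ?thesis using t by (simp add: Z_def)
    next
      case False
      then have "0 < x t" using xnn[OF t] by simp
      moreover have "\<tau> < t" using False \<open>x \<tau> = 0\<close> t by (cases "t = \<tau>") auto
      ultimately show ?thesis by (simp add: U_def)
    qed
  qed (auto simp: U_def Z_def)
  have UZ2: "U \<inter> Z = {}" by (auto simp: U_def Z_def)
  note UZ = UZ1 UZ2
  have low: "\<tau> \<le> u" if "{u<..<v} \<subseteq> U" "u < v" for u v
  proof (rule ccontr)
    assume "\<not> \<tau> \<le> u"
    then have "(u + min \<tau> v) / 2 \<in> {u<..<v}" using that(2) by (auto simp: min_def)
    then have "(u + min \<tau> v) / 2 \<in> U" using that(1) by blast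
    then show False using \<open>\<not> \<tau> \<le> u\<close> that(2) by (auto simp: U_def min_def split: if_splits)
  qed
  have zero: "x u = 0" if "\<tau> \<le> u" "u \<notin> U" for u
    using that xnn[of u] \<open>x \<tau> = 0\<close> by (cases "u = \<tau>") (auto simp: U_def)
  \<comment> \<open>One excursion from \<open>u\<close>, possibly cut off at \<open>v\<close> before
    its return; \<open>g\<close> is the discounted excess of the running cost over
    \<open>R\<close>.\<close>
  have exc: "- (if x v = 0 then 0 else K * exp (- lam * v)) \<le> integral {u..v} g"
    if uv: "u < v" "{u<..<v} \<subseteq> U" "u \<notin> U" for u v
  proof -
    have u: "\<tau> \<le> u" "x u = 0" using low uv zero by auto
    have pos: "0 < x t" if "u < t" "t < v" for t using uv(2) that by (auto simp: U_def)
    have "0 \<le> u" using u \<open>0 \<le> \<tau>\<close> by simp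
    obtain j where p: "path j (inner_control \<alpha>) x u v"
      and c: "integral {u..v} (\<lambda>t. exp (- lam * t) * jl f l \<alpha> x i t) = cost j (inner_control \<alpha>) x u v"
      by (rule junction_trajectory_path[OF \<alpha> tr \<open>0 \<le> u\<close> uv(1) pos]) blast
    have "R / lam * (exp (- lam * u) - exp (- lam * v)) \<le> cost j (inner_control \<alpha>) x u v + (if x v = 0 then 0 else K * exp (- lam * v))"
      by (rule ex[OF inner_control_in_controls[OF \<alpha>] \<open>0 \<le> u\<close> uv(1) p u(2) pos xnn]) (use u uv in auto)
    moreover have "integral {u..v} g = cost j (inner_control \<alpha>) x u v - R / lam * (exp (- lam * u) - exp (- lam * v))"
    proof -
      have "(\<lambda>t. exp (- lam * t) * jl f l \<alpha> x i t) integrable_on {u..v}"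
        by (rule bdd_integrable_discounted_integrable[OF bl lam]) (use \<open>0 \<le> u\<close> in auto)
      moreover have "((\<lambda>t. exp (- lam * t) * R) has_integral R / lam * (exp (- lam * u) - exp (- lam * v))) {u..v}"
        by (rule has_integral_exp_const) (use lam uv in auto)
      ultimately have "integral {u..v} (\<lambda>t. exp (- lam * t) * jl f l \<alpha> x i t - exp (- lam * t) * R) =
         cost j (inner_control \<alpha>) x u v - R / lam * (exp (- lam * u) - exp (- lam * v))"
        using c by (subst integral_diff) (auto dest: integral_unique)
      then show ?thesis by (simp add: g_def[abs_def] right_diff_distrib)
    qed
    ultimately show ?thesis by linarith
  qed
  have U0: "U \<subseteq> {0..}" and Z0: "Z \<subseteq> {0..}" using \<open>0 \<le> \<tau>\<close> by (auto simp: U_def Z_def)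
  have "0 \<le> integral U g"
  proof (rule integral_open_nonneg[OF opU, of \<tau>])
    show "\<tau> < t" if "t \<in> U" for t using that by (simp add: U_def)
    show "g absolutely_integrable_on U" by (rule gabs) (use opU U0 in auto)
    show "0 \<le> integral {u..v} g" if uv: "u < v" "{u<..<v} \<subseteq> U" "u \<notin> U" "v \<notin> U" for u v
      using exc[OF uv(1-3)] zero[of v] low[OF uv(2,1)] uv by simp
    \<comment> \<open>An excursion without return is cut off at \<open>T\<close>, and the cut-off
      term vanishes as \<open>T\<close> grows.\<close>
    show "0 \<le> integral {u..} g" if u: "{u<..} \<subseteq> U" "u \<notin> U" for u
    proof -
      have "\<tau> \<le> u" by (rule low[of u "u + 1"]) (use u in auto)
      have "((\<lambda>T. integral {u..T} g) \<longlongrightarrow> integral {u..} g) at_top"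
        by (rule tendsto_integral_atLeast, rule gabs) (use \<open>\<tau> \<le> u\<close> \<open>0 \<le> \<tau>\<close> in auto)
      moreover have "((\<lambda>T. - (K * exp (- lam * T))) \<longlongrightarrow> - 0) at_top"
        by (rule tendsto_minus[OF tendsto_exp_minus_at_top[OF lam]])
      moreover have "\<forall>\<^sub>F T in at_top. - (K * exp (- lam * T)) \<le> integral {u..T} g"
        using eventually_gt_at_top[of u]
      proof eventually_elim
        case (elim T)
        have "- (K * exp (- lam * T)) \<le> - (if x T = 0 then 0 else K * exp (- lam * T))" using \<open>0 \<le> K\<close> by simp
        also have "\<dots> \<le> integral {u..T} g" by (rule exc[OF elim _ u(2)]) (use u in auto)
        finally show ?case .
      qed
      ultimately have "- 0 \<le> integral {u..} g" by (intro tendsto_le[OF trivial_limit_at_top_linorder])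
      then show ?thesis by simp
    qed
  qed
  moreover have "0 \<le> integral Z g"
  proof -
    define \<phi> where "\<phi> = jf f \<alpha> x i"
    have \<phi>Z: "\<phi> t = f0 f (projr (\<alpha> t))" "projr (\<alpha> t) \<in> junction_controls A f" if "t \<in> Z" for t
    proof -
      have t: "0 \<le> t" "x t = 0" using that Z0 by (auto simp: Z_def)
      then show "\<phi> t = f0 f (projr (\<alpha> t))" by (simp add: \<phi>_def jf_def)
      show "projr (\<alpha> t) \<in> junction_controls A f"
        by (rule mixed_controls_projr[OF \<alpha> t(1) junction_trajectoryD(6)[OF tr t]])
    qed
    have negT: "negligible {t \<in> Z \<inter> {..T}. \<phi> t \<noteq> 0}" for T
    proof (cases "Z \<inter> {..T} = {}")
      case True
      then show ?thesis by simp
    next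
      case False
      \<comment> \<open>\<open>S\<close> is the last visit to the junction up to \<open>T\<close>;
        the drift is known to integrate to zero up to \<open>S\<close>, not up to
        \<open>T\<close>.\<close>
      define S where "S = Sup (Z \<inter> {..T})"
      have "S \<in> Z \<inter> {..T}"
        unfolding S_def by (rule closed_contains_Sup[OF False]) (use clZ in \<open>auto simp: bdd_above_def\<close>)
      then have S: "\<tau> \<le> S" "x S = 0" by (auto simp: Z_def)
      have ZT: "Z \<inter> {..T} = Z \<inter> {..S}"
        using \<open>S \<in> Z \<inter> {..T}\<close> cSup_upper[of _ "Z \<inter> {..T}"] by (fastforce simp: S_def[symmetric] bdd_above_def)
      have prim: "primitive_on \<tau> S \<phi> x"
        using primitive_on_subinterval[OF junction_trajectory_primitive[OF tr, of S]] \<open>0 \<le> \<tau>\<close> by (simp add: \<phi>_def)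
      have \<phi>abs: "\<phi> absolutely_integrable_on {\<tau>..S}"
        by (rule absolutely_integrable_bounded[OF primitive_on_integrable[OF prim], of M])
           (use jf_bound[OF \<alpha> tr] \<open>0 \<le> \<tau>\<close> in \<open>auto simp: \<phi>_def\<close>)
      have \<phi>abs': "\<phi> absolutely_integrable_on Y" if "Y \<in> sets lebesgue" "Y \<subseteq> {\<tau>..S}" for Y
        by (rule set_integrable_subset[OF \<phi>abs that])
      define Y where "Y = U \<inter> {..<S}"
      have opY: "open Y" unfolding Y_def using opU by auto
      have YS: "Y \<subseteq> {\<tau>..S}" by (auto simp: Y_def U_def)
      have comp: "integral {u..v} \<phi> = 0" if uv: "u < v" "{u<..<v} \<subseteq> Y" "u \<notin> Y" "v \<notin> Y" for u v
      proof -
        have u: "\<tau> \<le> u" by (rule low[OF _ uv(1)]) (use uv in \<open>auto simp: Y_def\<close>)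
        have v: "v \<le> S"
        proof (rule ccontr)
          assume "\<not> v \<le> S"
          then have "(max u S + v) / 2 \<in> {u<..<v}" using uv(1) by (auto simp: max_def)
          then have "(max u S + v) / 2 \<in> Y" using uv(2) by blast
          then have "(max u S + v) / 2 < S" by (simp add: Y_def)
          then show False using \<open>\<not> v \<le> S\<close> by (auto simp: max_def split: if_splits)
        qed
        have "x u = 0" using zero[OF u] uv(1,3) v by (auto simp: Y_def)
        moreover have "x v = 0"
        proof (cases "v = S")
          case False
          then have "v \<notin> U" using uv(4) v by (auto simp: Y_def)
          then show ?thesis using zero[of v] u uv(1) by simp
        qed (use S in simp)
        ultimately show ?thesis
          using primitive_on_has_integral[OF prim u less_imp_le[OF uv(1)] v] by (simp add: integral_unique)
      qed
      have noinf: "\<not> {u<..} \<subseteq> Y" for u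
      proof
        assume "{u<..} \<subseteq> Y"
        then have "max u S + 1 \<in> Y" by auto
        then show False by (auto simp: Y_def)
      qed
      have Ylow: "\<tau> < t" if "t \<in> Y" for t using that by (simp add: Y_def U_def)
      have aY: "\<phi> absolutely_integrable_on Y" by (rule \<phi>abs') (use opY YS in auto)
      then have aY': "(\<lambda>t. - 1 * \<phi> t) absolutely_integrable_on Y"
        by (intro set_integrable_mult_right)
      \<comment> \<open>Summation over components yields inequalities only; both signs together show
        that the excursions before \<open>S\<close> contribute nothing to the integral of the
        drift.\<close>
      have "0 \<le> integral Y \<phi>"
        by (rule integral_open_nonneg[OF opY Ylow aY]) (use noinf comp in auto)
      moreover have "0 \<le> integral Y (\<lambda>t. - 1 * \<phi> t)"
        by (rule integral_open_nonneg[OF opY Ylow aY']) (use noinf comp in auto)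
      ultimately have "integral Y \<phi> = 0" by simp
      have Sset: "{\<tau>..S} = Y \<union> (Z \<inter> {..S})" "Y \<inter> (Z \<inter> {..S}) = {}"
      proof -
        have "S \<notin> U" using S(2) by (simp add: U_def)
        then have "U \<inter> {..S} = Y" by (auto simp: Y_def order_le_less)
        moreover have "{\<tau>..S} = {\<tau>..} \<inter> {..S}" by auto
        ultimately show "{\<tau>..S} = Y \<union> (Z \<inter> {..S})" "Y \<inter> (Z \<inter> {..S}) = {}" using UZ by blast+
      qed
      have mZ: "Z \<inter> {..S} \<in> sets lebesgue" using clZ by auto
      have ZS: "Z \<inter> {..S} \<subseteq> {\<tau>..S}" by (auto simp: Z_def)
      have "integral {\<tau>..S} \<phi> = integral Y \<phi> + integral (Z \<inter> {..S}) \<phi>"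
        unfolding Sset(1)
        by (rule integral_Un) (use Sset(2) opY YS mZ ZS in \<open>auto intro!: set_lebesgue_integral_eq_integral(1) \<phi>abs'\<close>)
      moreover have "integral {\<tau>..S} \<phi> = 0"
        using primitive_on_has_integral[OF prim order_refl S(1) order_refl] S(2) \<open>x \<tau> = 0\<close> by (simp add: integral_unique)
      ultimately have "integral (Z \<inter> {..S}) \<phi> = 0" using \<open>integral Y \<phi> = 0\<close> by simp
      then have "negligible {t \<in> Z \<inter> {..S}. \<phi> t \<noteq> 0}"
        by (intro negligible_nonneg_integral_zero[OF \<phi>abs'[OF mZ ZS] mZ])
           (auto simp: \<phi>Z junction_controls_bounds(1))
      then show ?thesis unfolding ZT .
    qed
    define N where "N = {t \<in> Z. \<phi> t \<noteq> 0}"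
    have "N = (\<Union>n::nat. {t \<in> Z \<inter> {..real n}. \<phi> t \<noteq> 0})"
      using real_arch_simple by (auto simp: N_def)
    then have "negligible N" using negT by (auto intro!: negligible_countable_Union)
    have ZN: "Z - N \<in> sets lebesgue"
      by (rule sets.Diff) (use clZ \<open>negligible N\<close> in \<open>auto simp: negligible_iff_null_sets\<close>)
    have "0 \<le> integral (Z - N) g"
    proof (rule integral_nonneg)
      show "g integrable_on Z - N" by (rule gint[OF ZN]) (use Z0 in auto)
      fix t assume "t \<in> Z - N"
      then have t: "t \<in> Z" "\<phi> t = 0" by (auto simp: N_def)
      then have "R \<le> l0 f l (projr (\<alpha> t))" using st \<phi>Z by simp
      then show "0 \<le> g t" using t by (simp add: g_def jl_def Z_def)
    qed
    also have "integral (Z - N) g = integral Z g"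
      by (rule integral_spike_set) (auto intro: negligible_subset[OF \<open>negligible N\<close>])
    finally show ?thesis .
  qed
  moreover have "integral {\<tau>..} g = integral U g + integral Z g"
    unfolding UZ(1) by (rule integral_Un) (use gint opU clZ U0 Z0 UZ(2) in auto)
  moreover have "integral {\<tau>..} g = integral {\<tau>..} (\<lambda>t. exp (- lam * t) * jl f l \<alpha> x i t) - R / lam * exp (- lam * \<tau>)"
  proof -
    have "integral {\<tau>..} (\<lambda>t. exp (- lam * t) * jl f l \<alpha> x i t - exp (- lam * t) * R) =
       integral {\<tau>..} (\<lambda>t. exp (- lam * t) * jl f l \<alpha> x i t) - integral {\<tau>..} (\<lambda>t. exp (- lam * t) * R)"
      by (intro integral_diff bdd_integrable_discounted_integrable[OF bl lam]
           bdd_integrable_discounted_integrable[OF bdd_integrable_const lam]) (use \<open>0 \<le> \<tau>\<close> in auto)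
    then show ?thesis using integral_exp_const_atLeast[OF lam, of \<tau> R] by (simp add: g_def[abs_def] right_diff_distrib)
  qed
  ultimately show ?thesis by linarith
qed

lemma exp_le_one: "0 \<le> t \<Longrightarrow> exp (- lam * t) \<le> 1"
  using lam by simp

text \<open>The bound holds for every trajectory of a mixed control, unique or not, so the question
  whether the control shifted by \<open>\<tau>\<close> is again admissible does not arise.\<close>

lemma junction_tail_ge_W:
  assumes "\<alpha> \<in> mixed_controls A f" "junction_trajectory f \<alpha> x0 i0 x i" "0 \<le> \<tau>" "x \<tau> = 0"
  shows "W * exp (- lam * \<tau>) \<le> integral {\<tau>..} (\<lambda>t. exp (- lam * t) * jl f l \<alpha> x i t)"
proof -
  have "lam * W / lam * exp (- lam * \<tau>) \<le> integral {\<tau>..} (\<lambda>t. exp (- lam * t) * jl f l \<alpha> x i t)"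
  proof (rule junction_tail_ge[OF assms, of "M / lam"])
    show "lam * W \<le> l0 f l b" if "b \<in> junction_controls A f" "f0 f b = 0" for b
      by (rule V_zero_le_stationary[OF that])
    fix j \<beta> z c d
    assume *: "\<beta> \<in> controls A" "0 \<le> c" "c < d" "path j \<beta> z c d" "z c = 0" "\<And>t. c < t \<Longrightarrow> t < d \<Longrightarrow> 0 < z t" "0 \<le> z d"
    have "exp (- lam * c) * W \<le> cost j \<beta> z c d + exp (- lam * d) * V (z d) j"
      using V_dynamic_programming[OF *(1,2) less_imp_le[OF *(3)] *(4,6) _ *(7)] *(5) V_zero[of j] by simp
    moreover have "exp (- lam * d) * V (z d) j \<le> (if z d = 0 then exp (- lam * d) * W else M / lam * exp (- lam * d))"
      using mult_left_mono[OF V_bounds(2)[OF *(7), of j], of "exp (- lam * d)"] V_zero[of j] by (simp add: mult.commute)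
    moreover have "0 \<le> exp (- lam * d) * W" using V_bounds(1)[of 0 B1] by simp
    ultimately show "lam * W / lam * (exp (- lam * c) - exp (- lam * d)) \<le> cost j \<beta> z c d + (if z d = 0 then 0 else M / lam * exp (- lam * d))"
      using lam by (simp add: right_diff_distrib mult.commute V_zero[of j] split: if_splits)
  qed (use lam M in simp)
  then show ?thesis using lam by simp
qed

text \<open>With \<open>am i\<close> the junction is reached from \<open>x\<close>, and with
  \<open>ap i\<close> the position \<open>x\<close> is reached from the junction, in time at most
  \<open>x / c0\<close> and hence at a cost of at most \<open>M / c0 * x\<close>.\<close>

lemma V_near_zero:
  assumes "0 \<le> x" "x < h0"
  shows "V x i \<le> W + M / c0 * x" "W \<le> V x i + M / c0 * x"
proof -
  obtain z \<tau> where z: "0 \<le> \<tau>" "\<tau> \<le> (x - 0) / c0" "path i (\<lambda>_. am i) z 0 \<tau>" "z 0 = x" "z \<tau> = 0"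
    "\<And>t. 0 \<le> t \<Longrightarrow> t < \<tau> \<Longrightarrow> 0 < z t"
    using descend[OF am(1) c0 am_neg assms(2,1)] by metis
  have "V x i \<le> cost i (\<lambda>_. am i) z 0 \<tau> + exp (- lam * \<tau>) * W"
    using V_dynamic_programming[OF controls_const[OF am(1)] order_refl z(1,3)] z assms V_zero[of i] by simp
  also have "cost i (\<lambda>_. am i) z 0 \<tau> \<le> M * (\<tau> - 0)"
    by (rule cost_le[OF controls_const[OF am(1)] path_continuous[OF z(3)]]) (use z in auto)
  also have "M * (\<tau> - 0) \<le> M / c0 * x" using mult_left_mono[OF z(2), of M] M by simp
  also have "exp (- lam * \<tau>) * W \<le> W"
    using exp_le_one[OF z(1)] V_bounds(1)[of 0 B1] by (simp add: mult_left_le_one_le)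
  finally show "V x i \<le> W + M / c0 * x" by simp
  obtain y \<sigma> where y: "0 \<le> \<sigma>" "\<sigma> \<le> x / c0" "path i (\<lambda>_. ap i) y 0 \<sigma>" "y 0 = 0" "y \<sigma> = x"
    "\<And>t. 0 < t \<Longrightarrow> t \<le> \<sigma> \<Longrightarrow> 0 < y t"
    using ascend[OF ap(1) c0 ap_pos assms(1) less_imp_le[OF assms(2)]] by metis
  have "W \<le> cost i (\<lambda>_. ap i) y 0 \<sigma> + exp (- lam * \<sigma>) * V x i"
    using V_dynamic_programming[OF controls_const[OF ap(1)] order_refl y(1,3)] y assms V_zero[of i] by simp
  also have "cost i (\<lambda>_. ap i) y 0 \<sigma> \<le> M * (\<sigma> - 0)"
    by (rule cost_le[OF controls_const[OF ap(1)] path_continuous[OF y(3)]]) (use y in auto)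
  also have "M * (\<sigma> - 0) \<le> M / c0 * x" using mult_left_mono[OF y(2), of M] M by simp
  also have "exp (- lam * \<sigma>) * V x i \<le> V x i"
    using exp_le_one[OF y(1)] V_bounds(1)[OF assms(1)] by (simp add: mult_left_le_one_le)
  finally show "W \<le> V x i + M / c0 * x" by simp
qed

text \<open>The function \<open>p * (x - c)\<close> serves as a linear corrector: its discounted derivative along a path
  integrates to boundary terms, so a pointwise bound on the corrected running cost bounds the cost.\<close>

lemma corrected_cost:
  assumes \<beta>: "\<beta> \<in> controls A" and p: "path i \<beta> z a b" and "0 \<le> a" "a \<le> b"
  shows corrected_cost_has_integral: "((\<lambda>t. exp (- lam * t) * (G i (z t) (\<beta> t) - R + p * (F i (z t) (\<beta> t) - lam * (z t - c)))) has_integral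
     (cost i \<beta> z a b - R / lam * (exp (- lam * a) - exp (- lam * b)) + p * (exp (- lam * b) * (z b - c) - exp (- lam * a) * (z a - c)))) {a..b}"
    and corrected_cost_le: "(\<And>t. a \<le> t \<Longrightarrow> t \<le> b \<Longrightarrow> G i (z t) (\<beta> t) - R + p * (F i (z t) (\<beta> t) - lam * (z t - c)) \<le> \<kappa>) \<Longrightarrow>
      cost i \<beta> z a b \<le> (R + \<kappa>) / lam * (exp (- lam * a) - exp (- lam * b)) - p * (exp (- lam * b) * (z b - c) - exp (- lam * a) * (z a - c))"
    and corrected_cost_ge: "(\<And>t. a \<le> t \<Longrightarrow> t \<le> b \<Longrightarrow> \<kappa> \<le> G i (z t) (\<beta> t) - R + p * (F i (z t) (\<beta> t) - lam * (z t - c))) \<Longrightarrow>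
      (R + \<kappa>) / lam * (exp (- lam * a) - exp (- lam * b)) - p * (exp (- lam * b) * (z b - c) - exp (- lam * a) * (z a - c)) \<le> cost i \<beta> z a b"
proof -
  have 1: "((\<lambda>t. exp (- lam * t) * G i (z t) (\<beta> t)) has_integral cost i \<beta> z a b) {a..b}"
    unfolding cost_def by (rule integrable_integral[OF G_discounted_integrable[OF \<beta> path_continuous[OF p] \<open>0 \<le> a\<close>]])
  have k: "((\<lambda>t. exp (- lam * t) * k) has_integral k / lam * (exp (- lam * a) - exp (- lam * b))) {a..b}" for k
    by (rule has_integral_exp_const) (use lam \<open>a \<le> b\<close> in auto)
  have 2: "((\<lambda>t. exp (- lam * t) * (F i (z t) (\<beta> t) - lam * (z t - c))) has_integral
      (exp (- lam * b) * (z b - c) - exp (- lam * a) * (z a - c))) {a..b}"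
    by (rule discounted_primitive[OF p[unfolded path_def] _ lam \<open>0 \<le> a\<close> \<open>a \<le> b\<close>, where K = M])
       (use \<beta> \<open>0 \<le> a\<close> in \<open>auto intro!: F_bound controls_in\<close>)
  have "((\<lambda>t. exp (- lam * t) * G i (z t) (\<beta> t) - exp (- lam * t) * R + p * (exp (- lam * t) * (F i (z t) (\<beta> t) - lam * (z t - c)))) has_integral
     (cost i \<beta> z a b - R / lam * (exp (- lam * a) - exp (- lam * b)) + p * (exp (- lam * b) * (z b - c) - exp (- lam * a) * (z a - c)))) {a..b}"
    by (intro has_integral_add has_integral_diff 1 k has_integral_mult_right 2)
  then show 3: "((\<lambda>t. exp (- lam * t) * (G i (z t) (\<beta> t) - R + p * (F i (z t) (\<beta> t) - lam * (z t - c)))) has_integral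
     (cost i \<beta> z a b - R / lam * (exp (- lam * a) - exp (- lam * b)) + p * (exp (- lam * b) * (z b - c) - exp (- lam * a) * (z a - c)))) {a..b}"
    by (rule has_integral_eq[rotated]) (simp add: algebra_simps)
  { assume *: "\<And>t. a \<le> t \<Longrightarrow> t \<le> b \<Longrightarrow> G i (z t) (\<beta> t) - R + p * (F i (z t) (\<beta> t) - lam * (z t - c)) \<le> \<kappa>"
    have "cost i \<beta> z a b - R / lam * (exp (- lam * a) - exp (- lam * b)) + p * (exp (- lam * b) * (z b - c) - exp (- lam * a) * (z a - c))
      \<le> \<kappa> / lam * (exp (- lam * a) - exp (- lam * b))"
      by (rule has_integral_le[OF 3 k]) (use * in \<open>auto intro!: mult_left_mono\<close>)
    then show "cost i \<beta> z a b \<le> (R + \<kappa>) / lam * (exp (- lam * a) - exp (- lam * b)) - p * (exp (- lam * b) * (z b - c) - exp (- lam * a) * (z a - c))"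
      by (simp add: add_divide_distrib distrib_right) }
  { assume *: "\<And>t. a \<le> t \<Longrightarrow> t \<le> b \<Longrightarrow> \<kappa> \<le> G i (z t) (\<beta> t) - R + p * (F i (z t) (\<beta> t) - lam * (z t - c))"
    have "\<kappa> / lam * (exp (- lam * a) - exp (- lam * b)) \<le> cost i \<beta> z a b - R / lam * (exp (- lam * a) - exp (- lam * b)) +
        p * (exp (- lam * b) * (z b - c) - exp (- lam * a) * (z a - c))"
      by (rule has_integral_le[OF k 3]) (use * in \<open>auto intro!: mult_left_mono\<close>)
    then show "(R + \<kappa>) / lam * (exp (- lam * a) - exp (- lam * b)) - p * (exp (- lam * b) * (z b - c) - exp (- lam * a) * (z a - c)) \<le> cost i \<beta> z a b"
      by (simp add: add_divide_distrib distrib_right) }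
qed

text \<open>Freezing at the junction: for positions and centres of size at most \<open>h\<close> the
  corrected running cost differs from its value at the junction by the modulus of \<open>l\<close>
  and a Lipschitz error of the drift. It holds on both sides of \<open>0\<close>, the extension
  being constant on the left.\<close>

lemma near_zero_uniform:
  assumes "0 < \<eta>"
  obtains h where "0 < h" "\<And>i x a c. a \<in> A \<Longrightarrow> - h \<le> x \<Longrightarrow> x \<le> h \<Longrightarrow> \<bar>c\<bar> \<le> h \<Longrightarrow>
    \<bar>(G i x a - R + p * (F i x a - lam * (x - c))) - (l i 0 a - R + p * f i 0 a)\<bar> \<le> \<eta>"
proof -
  obtain h1 where h1: "0 < h1" "\<And>i x a. a \<in> A \<Longrightarrow> 0 \<le> x \<Longrightarrow> x \<le> h1 \<Longrightarrow> \<bar>l i x a - l i 0 a\<bar> \<le> \<eta> / 2"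
    using l_mod[of "\<eta> / 2"] assms by auto
  \<comment> \<open>Half of \<open>\<eta>\<close> is reserved for \<open>l\<close>; the drift and
    the linear term together contribute at most \<open>\<bar>p\<bar> * (L + 2 * lam) * h\<close>,
    since \<open>\<bar>x - c\<bar> \<le> 2 * h\<close>.\<close>
  define h where "h = min h1 (\<eta> / 2 / (\<bar>p\<bar> * (L + 2 * lam) + 1))"
  have D: "0 < \<bar>p\<bar> * (L + 2 * lam) + 1" using L lam by (intro add_nonneg_pos mult_nonneg_nonneg) auto
  have h: "0 < h" using h1(1) D assms by (simp add: h_def)
  have hD: "h * (\<bar>p\<bar> * (L + 2 * lam)) \<le> \<eta> / 2"
  proof -
    have "h * (\<bar>p\<bar> * (L + 2 * lam)) \<le> h * (\<bar>p\<bar> * (L + 2 * lam) + 1)" using h by simp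
    also have "\<dots> \<le> \<eta> / 2"
    proof -
      have "h \<le> \<eta> / 2 / (\<bar>p\<bar> * (L + 2 * lam) + 1)" unfolding h_def by (rule min.cobounded2)
      then show ?thesis by (simp only: pos_le_divide_eq[OF D])
    qed
    finally show ?thesis .
  qed
  show thesis
  proof (rule that[OF h])
    fix i x a c assume *: "a \<in> A" "- h \<le> x" "x \<le> h" "\<bar>c\<bar> \<le> h"
    have g: "\<bar>G i x a - l i 0 a\<bar> \<le> \<eta> / 2"
      using h1(2)[of a "max x 0" i] * h h1(1) by (auto simp: extend_left_def h_def)
    have "\<bar>F i x a - F i 0 a\<bar> \<le> L * \<bar>x - 0\<bar>" by (rule F_lip[OF *(1)])
    also have "\<dots> \<le> L * h" using * L by (intro mult_left_mono) auto
    finally have fb: "\<bar>F i x a - f i 0 a\<bar> \<le> L * h" by simp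
    have "\<bar>x - c\<bar> \<le> 2 * h" using * by linarith
    then have "\<bar>lam * (x - c)\<bar> \<le> lam * (2 * h)" using lam by (simp add: abs_mult)
    with fb have "\<bar>(F i x a - lam * (x - c)) - f i 0 a\<bar> \<le> h * (L + 2 * lam)" by (simp add: algebra_simps)
    then have "\<bar>p * ((F i x a - lam * (x - c)) - f i 0 a)\<bar> \<le> \<bar>p\<bar> * (h * (L + 2 * lam))"
      by (simp add: abs_mult mult_left_mono)
    also have "\<dots> = h * (\<bar>p\<bar> * (L + 2 * lam))" by (simp only: mult.left_commute)
    finally have pb: "\<bar>p * ((F i x a - lam * (x - c)) - f i 0 a)\<bar> \<le> \<eta> / 2" using hD by linarith
    have eq: "(G i x a - R + p * (F i x a - lam * (x - c))) - (l i 0 a - R + p * f i 0 a) =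
      (G i x a - l i 0 a) + p * ((F i x a - lam * (x - c)) - f i 0 a)"
      by (simp add: algebra_simps)
    show "\<bar>(G i x a - R + p * (F i x a - lam * (x - c))) - (l i 0 a - R + p * f i 0 a)\<bar> \<le> \<eta>"
      unfolding eq using g pb abs_triangle_ineq[of "G i x a - l i 0 a" "p * ((F i x a - lam * (x - c)) - f i 0 a)"] by linarith
  qed
qed

text \<open>Otherwise some slope \<open>p\<close> makes the corrected running costs of both controls
  negative at the junction. Going out with \<open>a\<close> to a small height \<open>hi\<close> and
  back with \<open>b\<close> would then beat the running cost \<open>lam * W\<close>, as the
  boundary terms \<open>p * hi\<close> of the two pieces cancel up to discounting that dynamic
  programming accounts for.\<close>

lemma opposite_drifts:
  assumes a: "a \<in> A" "0 < f i 0 a" and b: "b \<in> A" "f i 0 b < 0"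
  shows "- (l i 0 a - lam * W) / f i 0 a \<le> (l i 0 b - lam * W) / (- f i 0 b)"
proof (rule ccontr)
  define R where "R = lam * W"
  assume "\<not> ?thesis"
  then obtain p where p: "(l i 0 b - R) / (- f i 0 b) < p" "p < - (l i 0 a - R) / f i 0 a"
    unfolding R_def using dense by (meson not_le)
  have pa: "l i 0 a - R + p * f i 0 a < 0" using p(2) a(2) by (simp add: field_simps)
  have pb: "l i 0 b - R + p * f i 0 b < 0" using p(1) b(2) by (simp add: field_simps)
  \<comment> \<open>Half of the smaller deficit: after a freezing error \<open>\<kappa>\<close> the
    corrected cost is still at most \<open>- \<kappa>\<close>.\<close>
  define \<kappa> where "\<kappa> = min (- (l i 0 a - R + p * f i 0 a)) (- (l i 0 b - R + p * f i 0 b)) / 2"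
  have \<kappa>: "0 < \<kappa>" using pa pb by (simp add: \<kappa>_def)
  obtain h where h: "0 < h" "\<And>i x a c. a \<in> A \<Longrightarrow> - h \<le> x \<Longrightarrow> x \<le> h \<Longrightarrow> \<bar>c\<bar> \<le> h \<Longrightarrow>
    \<bar>(G i x a - R + p * (F i x a - lam * (x - c))) - (l i 0 a - R + p * f i 0 a)\<bar> \<le> \<kappa>"
    by (rule near_zero_uniform[OF \<kappa>, where R = R and p = p]) blast
  define c1 where "c1 = min (f i 0 a) (- f i 0 b) / 2"
  have c1: "0 < c1" using a b by (simp add: c1_def)
  have c1': "2 * c1 \<le> f i 0 a" "2 * c1 \<le> - f i 0 b" by (simp_all add: c1_def)
  define hi where "hi = min h (c1 / L) / 2"
  have hi: "0 < hi" "hi \<le> h" "hi < c1 / L" using h c1 L by (auto simp: hi_def min_def field_simps)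
  have near: "\<bar>F i y u - f i 0 u\<bar> \<le> c1" if "u \<in> A" "y \<le> c1 / L" for y u
  proof (cases "0 \<le> y")
    case True
    have "\<bar>F i y u - F i 0 u\<bar> \<le> L * \<bar>y - 0\<bar>" by (rule F_lip[OF that(1)])
    also have "\<dots> \<le> L * (c1 / L)" using that True L by (intro mult_left_mono) auto
    finally show ?thesis using L by simp
  next
    case False
    then show ?thesis using c1 by (simp add: F_nonpos)
  qed
  have up: "c1 \<le> F i y a" if "y \<le> c1 / L" for y using near[OF a(1) that] c1' unfolding abs_le_iff by linarith
  have down: "F i y b \<le> - c1" if "y \<le> c1 / L" for y using near[OF b(1) that] c1' unfolding abs_le_iff by linarith
  obtain z \<tau> where z: "0 \<le> \<tau>" "path i (\<lambda>_. a) z 0 \<tau>" "z 0 = 0" "z \<tau> = hi"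
    "\<And>t. 0 < t \<Longrightarrow> t \<le> \<tau> \<Longrightarrow> 0 < z t" "\<And>t. 0 \<le> t \<Longrightarrow> t \<le> \<tau> \<Longrightarrow> z t \<le> hi"
    using ascend[OF a(1) c1 up less_imp_le[OF hi(1)] less_imp_le[OF hi(3)]] by metis
  obtain y \<sigma> where y: "0 \<le> \<sigma>" "path i (\<lambda>_. b) y 0 \<sigma>" "y 0 = hi" "y \<sigma> = 0"
    "\<And>t. 0 \<le> t \<Longrightarrow> t < \<sigma> \<Longrightarrow> 0 < y t" "\<And>t. 0 \<le> t \<Longrightarrow> t \<le> \<sigma> \<Longrightarrow> y t \<le> hi"
    using descend[OF b(1) c1 down hi(3) less_imp_le[OF hi(1)]] by metis
  define e1 e2 where "e1 = exp (- lam * \<tau>)" "e2 = exp (- lam * \<sigma>)"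
  have "W \<le> cost i (\<lambda>_. a) z 0 \<tau> + e1 * V hi i"
    using V_dynamic_programming[OF controls_const[OF a(1)] order_refl z(1,2)] z hi(1) V_zero[of i] by (simp add: e1_e2_def)
  moreover have "V hi i \<le> cost i (\<lambda>_. b) y 0 \<sigma> + e2 * W"
    using V_dynamic_programming[OF controls_const[OF b(1)] order_refl y(1,2)] y hi(1) V_zero[of i] by (simp add: e1_e2_def)
  moreover have "cost i (\<lambda>_. a) z 0 \<tau> \<le> (R + - \<kappa>) / lam * (exp (- lam * 0) - exp (- lam * \<tau>)) - p * (exp (- lam * \<tau>) * (z \<tau> - 0) - exp (- lam * 0) * (z 0 - 0))"
  proof (rule corrected_cost_le[OF controls_const[OF a(1)] z(2) order_refl z(1)])
    fix t assume t: "0 \<le> t" "t \<le> \<tau>"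
    have "0 \<le> z t" using z(3,5) t by (cases "t = 0") (auto simp: less_imp_le)
    then have "\<bar>(G i (z t) a - R + p * (F i (z t) a - lam * (z t - 0))) - (l i 0 a - R + p * f i 0 a)\<bar> \<le> \<kappa>"
      by (intro h(2)[OF a(1)]) (use z(6)[OF t] hi h(1) in auto)
    moreover have "l i 0 a - R + p * f i 0 a \<le> - 2 * \<kappa>" by (simp add: \<kappa>_def)
    ultimately show "G i (z t) a - R + p * (F i (z t) a - lam * (z t - 0)) \<le> - \<kappa>" by linarith
  qed
  moreover have "cost i (\<lambda>_. b) y 0 \<sigma> \<le> (R + - \<kappa>) / lam * (exp (- lam * 0) - exp (- lam * \<sigma>)) - p * (exp (- lam * \<sigma>) * (y \<sigma> - 0) - exp (- lam * 0) * (y 0 - 0))"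
  proof (rule corrected_cost_le[OF controls_const[OF b(1)] y(2) order_refl y(1)])
    fix t assume t: "0 \<le> t" "t \<le> \<sigma>"
    have "0 \<le> y t" using y(4,5) t by (cases "t = \<sigma>") (auto simp: less_imp_le)
    then have "\<bar>(G i (y t) b - R + p * (F i (y t) b - lam * (y t - 0))) - (l i 0 b - R + p * f i 0 b)\<bar> \<le> \<kappa>"
      by (intro h(2)[OF b(1)]) (use y(6)[OF t] hi h(1) in auto)
    moreover have "l i 0 b - R + p * f i 0 b \<le> - 2 * \<kappa>" by (simp add: \<kappa>_def)
    ultimately show "G i (y t) b - R + p * (F i (y t) b - lam * (y t - 0)) \<le> - \<kappa>" by linarith
  qed
  ultimately have 1: "W \<le> (R - \<kappa>) / lam * (1 - e1) - p * (e1 * hi) + e1 * V hi i"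
    and 2: "V hi i \<le> (R - \<kappa>) / lam * (1 - e2) + p * hi + e2 * W"
    using z(3,4) y(3,4) by (simp_all add: e1_e2_def)
  define k k' where k: "k = (R - \<kappa>) / lam" "k' = \<kappa> / lam"
  \<comment> \<open>Eliminating \<open>V hi i\<close> removes \<open>p * hi\<close> exactly and
    leads to \<open>k' * (1 - e1 * e2) \<le> 0\<close>, impossible for an excursion of positive
    duration.\<close>
  have "e1 * V hi i \<le> e1 * (k * (1 - e2) + p * hi + e2 * W)"
    using 2 unfolding k by (intro mult_left_mono) (simp_all add: e1_e2_def)
  with 1[folded k] have "W \<le> k * (1 - e1 * e2) + e1 * e2 * W" by (simp add: algebra_simps)
  moreover have "k = W - k'" using lam by (simp add: R_def diff_divide_distrib k)
  ultimately have "k' * (1 - e1 * e2) \<le> 0" by (simp add: algebra_simps)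
  moreover have "e1 * e2 < 1"
  proof -
    have "0 < \<tau>" using z(1,3,4) hi(1) by (cases "\<tau> = 0") auto
    then have "e1 < 1" using lam by (simp add: e1_e2_def)
    moreover have "0 \<le> e1" "0 \<le> e2" "e2 \<le> 1" using lam y(1) by (simp_all add: e1_e2_def)
    ultimately show ?thesis by (meson mult_left_le order_le_less_trans)
  qed
  moreover have "0 < k'" using \<kappa> lam by (simp add: k)
  ultimately show False by (simp add: mult_le_0_iff)
qed

text \<open>The infimum over the controls moving towards the junction is the largest slope
  compatible with all of them. Triples make the sum of the three infima nonnegative, controls moving
  away are compatible by the comparison of opposite drifts, and a control without drift is
  stationary, so the slope does not matter for it.\<close>

lemma slopes_exist:
  obtains q :: "branch \<Rightarrow> real" where "0 \<le> q B1 + q B2 + q B3"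
    "\<And>i a. a \<in> A \<Longrightarrow> 0 \<le> l i 0 a - lam * W + q i * f i 0 a"
proof -
  define R where "R = lam * W"
  define s where "s i a = (l i 0 a - R) / (- f i 0 a)" for i a
  define Q where "Q i = {s i a | a. a \<in> A \<and> f i 0 a < 0}" for i
  have amn: "f i 0 (am i) < 0" for i using am(2)[of 0 i] h0 c0 by simp
  have ne: "Q i \<noteq> {}" for i using am(1) amn[of i] by (auto simp: Q_def)
  have triple: "0 \<le> s1 + s2 + s3" if "s1 \<in> Q B1" "s2 \<in> Q B2" "s3 \<in> Q B3" for s1 s2 s3
  proof -
    obtain a1 a2 a3 where a: "a1 \<in> A" "f B1 0 a1 < 0" "s1 = s B1 a1" "a2 \<in> A" "f B2 0 a2 < 0" "s2 = s B2 a2"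
      "a3 \<in> A" "f B3 0 a3 < 0" "s3 = s B3 a3"
    proof -
      obtain a1 where "a1 \<in> A" "f B1 0 a1 < 0" "s1 = s B1 a1" using \<open>s1 \<in> Q B1\<close> unfolding Q_def by blast
      moreover obtain a2 where "a2 \<in> A" "f B2 0 a2 < 0" "s2 = s B2 a2" using \<open>s2 \<in> Q B2\<close> unfolding Q_def by blast
      moreover obtain a3 where "a3 \<in> A" "f B3 0 a3 < 0" "s3 = s B3 a3" using \<open>s3 \<in> Q B3\<close> unfolding Q_def by blast
      ultimately show thesis by (rule that)
    qed
    define g1 g2 g3 where g: "g1 = f B1 0 a1" "g2 = f B2 0 a2" "g3 = f B3 0 a3"
    define D where "D = g2 * g3 + g1 * g3 + g1 * g2"
    have gn: "g1 < 0" "g2 < 0" "g3 < 0" using a g by auto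
    have D: "0 < D" using gn by (auto simp: D_def intro!: add_pos_pos mult_neg_neg)
    have "Inl (a1, a2, a3) \<in> junction_controls A f" using a by (auto simp: junction_controls_def A0_def)
    then have "R \<le> l0 f l (Inl (a1, a2, a3))" unfolding R_def by (rule V_zero_le_stationary) simp
    also have "\<dots> = (g2 * g3 * l B1 0 a1 + g1 * g3 * l B2 0 a2 + g1 * g2 * l B3 0 a3) / D"
      by (simp add: Let_def g D_def add_divide_distrib)
    finally have "R * D \<le> g2 * g3 * l B1 0 a1 + g1 * g3 * l B2 0 a2 + g1 * g2 * l B3 0 a3"
      using D by (simp add: pos_le_divide_eq)
    then have "0 \<le> g2 * g3 * (l B1 0 a1 - R) + g1 * g3 * (l B2 0 a2 - R) + g1 * g2 * (l B3 0 a3 - R)"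
      by (simp add: D_def algebra_simps)
    \<comment> \<open>Over the common denominator, the numerator is \<open>D\<close> times the
      excess of the cost of the triple over \<open>R\<close>; this is where the weights
      \<open>\<mu>\<close> match the sum of the slopes.\<close>
    moreover have "s1 + s2 + s3 = (g2 * g3 * (l B1 0 a1 - R) + g1 * g3 * (l B2 0 a2 - R) + g1 * g2 * (l B3 0 a3 - R)) / (- (g1 * g2 * g3))"
      using gn by (simp add: a s_def g[symmetric] field_simps)
    moreover have "0 \<le> - (g1 * g2 * g3)" using mult_pos_neg[OF mult_neg_neg[OF gn(1,2)] gn(3)] by simp
    ultimately show ?thesis by (simp only: divide_nonneg_nonneg)
  qed
  have el: "\<exists>s. s \<in> Q i" for i using ne by blast
  \<comment> \<open>Fixed elements on the other two branches bound the third summand from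
    below.\<close>
  have bb: "bdd_below (Q i)" for i
  proof -
    obtain s1 s2 s3 where s: "s1 \<in> Q B1" "s2 \<in> Q B2" "s3 \<in> Q B3" using el by meson
    have "- \<bar>s1\<bar> - \<bar>s2\<bar> - \<bar>s3\<bar> \<le> x" if "x \<in> Q i" for x
      using triple[of x s2 s3] triple[of s1 x s3] triple[of s1 s2 x] s that by (cases i) auto
    then show ?thesis by (rule bdd_belowI)
  qed
  define q where "q i = Inf (Q i)" for i
  have 1: "- s2 - s3 \<le> q B1" if "s2 \<in> Q B2" "s3 \<in> Q B3" for s2 s3
    unfolding q_def using triple[OF _ that] by (intro cInf_greatest[OF ne]) force
  have 2: "- q B1 - s3 \<le> q B2" if "s3 \<in> Q B3" for s3
    unfolding q_def[of B2] using 1[OF _ that] by (intro cInf_greatest[OF ne]) force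
  have 3: "- q B1 - q B2 \<le> q B3"
    unfolding q_def[of B3] using 2 by (intro cInf_greatest[OF ne]) force
  show thesis
  proof (rule that[of q])
    show "0 \<le> q B1 + q B2 + q B3" using 3 by simp
    fix i a assume a: "a \<in> A"
    consider "f i 0 a < 0" | "f i 0 a = 0" | "0 < f i 0 a" by linarith
    then show "0 \<le> l i 0 a - lam * W + q i * f i 0 a"
    proof cases
      case 1
      then have "q i \<le> s i a" unfolding q_def using a by (intro cInf_lower[OF _ bb]) (auto simp: Q_def)
      then show ?thesis using 1 by (simp add: s_def R_def field_simps)
    next
      case 2
      then have "Inr (a, i) \<in> junction_controls A f" using a by (auto simp: junction_controls_def A_tilde_def)
      then have "lam * W \<le> l0 f l (Inr (a, i))" by (rule V_zero_le_stationary) (use 2 in simp)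
      then show ?thesis using 2 by simp
    next
      case 3
      have "- (l i 0 a - R) / f i 0 a \<le> q i"
        unfolding q_def using opposite_drifts[OF a 3] by (intro cInf_greatest[OF ne]) (auto simp: Q_def s_def R_def)
      then show ?thesis using 3 by (simp add: R_def field_simps)
    qed
  qed
qed

end

section \<open>Thermostat trajectories\<close>

text \<open>Covers also the case of no crossing time, where the infimum is infinite; it moves
  switching times along with a shifted trajectory.\<close>

lemma Inf_ereal_shift:
  "Inf (ereal ` {t. P (t - c)}) = Inf (ereal ` {t. P t}) + ereal c"
proof (rule antisym)
  show "Inf (ereal ` {t. P t}) + ereal c \<le> Inf (ereal ` {t. P (t - c)})"
  proof (rule Inf_greatest)
    fix u assume "u \<in> ereal ` {t. P (t - c)}"
    then obtain t where t: "u = ereal t" "P (t - c)" by blast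
    then have "Inf (ereal ` {t. P t}) \<le> ereal (t - c)" by (intro Inf_lower) auto
    then have "Inf (ereal ` {t. P t}) + ereal c \<le> ereal (t - c) + ereal c" by (rule add_right_mono)
    then show "Inf (ereal ` {t. P t}) + ereal c \<le> u" using t by simp
  qed
  have "Inf (ereal ` {t. P (t - c)}) - ereal c \<le> Inf (ereal ` {t. P t})"
  proof (rule Inf_greatest)
    fix u assume "u \<in> ereal ` {t. P t}"
    then obtain t where t: "u = ereal t" "P t" by blast
    then have "Inf (ereal ` {t. P (t - c)}) \<le> ereal (t + c)" by (intro Inf_lower) auto
    then show "Inf (ereal ` {t. P (t - c)}) - ereal c \<le> u" using t by (simp add: ereal_minus_le)
  qed
  then show "Inf (ereal ` {t. P (t - c)}) \<le> Inf (ereal ` {t. P t}) + ereal c"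
    by (simp add: ereal_minus_le)
qed

context junction_data
begin

text \<open>The conditions on switching times and stage solutions for equal thresholds, with the
  integral equation split into a starting value and a path. A stage starting at time infinity is
  unconstrained.\<close>

definition stages :: "real \<Rightarrow> (real \<Rightarrow> 'a) \<Rightarrow> real \<Rightarrow> branch \<Rightarrow> (nat \<Rightarrow> ereal) \<Rightarrow> (nat \<Rightarrow> real \<Rightarrow> real) \<Rightarrow> bool" where
  "stages \<epsilon> \<alpha> x0 i0 s y \<longleftrightarrow> s 0 = 0 \<and>
    (\<forall>k a. s k = ereal a \<longrightarrow> y k a = (if k = 0 then x0 else \<epsilon>) \<and> (\<forall>T. path ((succ_branch ^^ k) i0) \<alpha> (y k) a T)) \<and>
    (\<forall>k. s (Suc k) = Inf (ereal ` {t. s k \<le> ereal t \<and> y k t < - \<epsilon>}))"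

lemma stage_times_mono:
  assumes "s 0 = 0" "\<And>k. s (Suc k) = Inf (ereal ` {t. s k \<le> ereal t \<and> y k t < - \<epsilon>})"
  shows "s k \<le> s (Suc k)" "0 \<le> s k"
proof -
  show 1: "s k \<le> s (Suc k)" for k unfolding assms(2) by (rule Inf_greatest) auto
  show "0 \<le> s k" by (induction k) (use assms(1) 1 in \<open>auto intro: order_trans\<close>)
qed

lemma thermostat_trajectory_stages:
  "thermostat_trajectory f (\<lambda>_. \<epsilon>) \<alpha> x0 i0 x i \<longleftrightarrow>
    (\<exists>s y. stages \<epsilon> \<alpha> x0 i0 s y \<and>
      (\<forall>k t. s k \<le> ereal t \<and> ereal t < s (Suc k) \<longrightarrow> x t = y k t \<and> i t = (succ_branch ^^ k) i0))"
proof -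
  have "(\<forall>k t. s k \<le> ereal t \<longrightarrow> ((\<lambda>r. F ((succ_branch ^^ k) i0) (y k r) (\<alpha> r))
             has_integral (y k t - stage_start (\<lambda>_. \<epsilon>) x0 i0 k)) {real_of_ereal (s k)..t}) \<longleftrightarrow>
     (\<forall>k a. s k = ereal a \<longrightarrow> y k a = (if k = 0 then x0 else \<epsilon>) \<and> (\<forall>T. path ((succ_branch ^^ k) i0) \<alpha> (y k) a T))"
    (is "?L \<longleftrightarrow> ?R")
    if s: "s 0 = 0" "\<And>k. s (Suc k) = Inf (ereal ` {t. s k \<le> ereal t \<and> y k t < - \<epsilon>})" for s y
  proof
    assume L: ?L
    show ?R
    proof (intro allI impI conjI)
      fix k a assume k: "s k = ereal a"
      have *: "((\<lambda>r. F ((succ_branch ^^ k) i0) (y k r) (\<alpha> r)) has_integral (y k t - stage_start (\<lambda>_. \<epsilon>) x0 i0 k)) {a..t}" if "a \<le> t" for t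
        using L[rule_format, of k t] k that by simp
      \<comment> \<open>At the start of the stage the interval of integration is a single point,
        which forces the starting value.\<close>
      have "((\<lambda>r. F ((succ_branch ^^ k) i0) (y k r) (\<alpha> r)) has_integral (y k a - stage_start (\<lambda>_. \<epsilon>) x0 i0 k)) {a}"
        using *[OF order_refl] by simp
      from has_integral_unique[OF this has_integral_refl(2)]
      have "y k a - stage_start (\<lambda>_. \<epsilon>) x0 i0 k = 0" .
      then show ya: "y k a = (if k = 0 then x0 else \<epsilon>)" by (simp add: stage_start_def)
      show "path ((succ_branch ^^ k) i0) \<alpha> (y k) a T" for T
        unfolding path_def primitive_on_def using * ya by (auto simp: stage_start_def)
    qed
  next
    assume R: ?R
    show ?L
    proof (intro allI impI)
      fix k t assume t: "s k \<le> ereal t"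
      have "0 \<le> s k" by (rule stage_times_mono(2)[of s y \<epsilon>]) (use s in auto)
      with t obtain a where a: "s k = ereal a" "a \<le> t" by (cases "s k") auto
      then have "y k a = (if k = 0 then x0 else \<epsilon>)" "path ((succ_branch ^^ k) i0) \<alpha> (y k) a t" using R by auto
      then show "((\<lambda>r. F ((succ_branch ^^ k) i0) (y k r) (\<alpha> r)) has_integral (y k t - stage_start (\<lambda>_. \<epsilon>) x0 i0 k)) {real_of_ereal (s k)..t}"
        using a unfolding path_def primitive_on_def by (simp add: stage_start_def)
    qed
  qed
  then show ?thesis
    unfolding thermostat_trajectory_def stages_def by (intro iff_exI) blast
qed

lemma stagesD:
  assumes "stages \<epsilon> \<alpha> x0 i0 s y"
  shows "s 0 = 0" "s (Suc k) = Inf (ereal ` {t. s k \<le> ereal t \<and> y k t < - \<epsilon>})"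
    "s k \<le> s (Suc k)" "0 \<le> s k"
    "s k = ereal a \<Longrightarrow> y k a = (if k = 0 then x0 else \<epsilon>)"
    "s k = ereal a \<Longrightarrow> path ((succ_branch ^^ k) i0) \<alpha> (y k) a T"
proof -
  show 1: "s 0 = 0" and 2: "s (Suc k) = Inf (ereal ` {t. s k \<le> ereal t \<and> y k t < - \<epsilon>})" for k
    using assms unfolding stages_def by blast+
  show "s k \<le> s (Suc k)" "0 \<le> s k"
    by (rule stage_times_mono[of s y \<epsilon>], rule 1, rule 2)+
  show "s k = ereal a \<Longrightarrow> y k a = (if k = 0 then x0 else \<epsilon>)"
    "s k = ereal a \<Longrightarrow> path ((succ_branch ^^ k) i0) \<alpha> (y k) a T"
    using assms unfolding stages_def by blast+
qed

lemma stages_mono: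
  assumes "stages \<epsilon> \<alpha> x0 i0 s y" "m \<le> n"
  shows "s m \<le> s n"
  using assms(2) by (induction rule: dec_induct) (auto intro: order_trans stagesD(3)[OF assms(1)])

lemma stage_above:
  assumes "stages \<epsilon> \<alpha> x0 i0 s y" "s k \<le> ereal t" "ereal t < s (Suc k)"
  shows "- \<epsilon> \<le> y k t"
proof (rule ccontr)
  assume "\<not> - \<epsilon> \<le> y k t"
  then have "s (Suc k) \<le> ereal t"
    unfolding stagesD(2)[OF assms(1)] using assms(2) by (intro Inf_lower) auto
  then show False using assms(3) by simp
qed

text \<open>The solution is at least \<open>- \<epsilon>\<close> before \<open>b\<close> and hence
  at \<open>b\<close>; were it larger there, continuity would delay the infimum of the times
  strictly below. A first stage of length zero is covered by the starting value.\<close>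

lemma stage_end:
  assumes st: "stages \<epsilon> \<alpha> x0 i0 s y" and "0 < \<epsilon>" "- \<epsilon> \<le> x0" and a: "s k = ereal a" and b: "s (Suc k) = ereal b"
  shows "0 \<le> a" "a \<le> b" "y k b = - \<epsilon>" "\<And>t. a \<le> t \<Longrightarrow> t \<le> b \<Longrightarrow> - \<epsilon> \<le> y k t"
proof -
  show "0 \<le> a" using stagesD(4)[OF st, of k] a by simp
  show ab: "a \<le> b" using stagesD(3)[OF st, of k] a b by simp
  have cont: "continuous_on {a..b + 1} (y k)" by (rule path_continuous[OF stagesD(6)[OF st a]])
  have above: "- \<epsilon> \<le> y k t" if "a \<le> t" "t < b" for t
    using stage_above[OF st, of k t] a b that by simp
  have "- \<epsilon> \<le> y k b"
  proof (cases "a = b")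
    case True
    then show ?thesis using stagesD(5)[OF st a] assms(2,3) by auto
  next
    case False
    have "((y k) \<longlongrightarrow> y k b) (at b within {a..<b})"
    proof (rule tendsto_within_subset)
      show "((y k) \<longlongrightarrow> y k b) (at b within {a..b + 1})" using cont ab by (simp add: continuous_on_def)
    qed auto
    moreover have "at b within {a..<b} \<noteq> bot"
      using False ab by (simp add: at_within_eq_bot_iff)
    moreover have "\<forall>\<^sub>F t in at b within {a..<b}. - \<epsilon> \<le> y k t"
      using above by (auto simp: eventually_at_filter)
    ultimately show ?thesis using tendsto_lowerbound by blast
  qed
  moreover have "y k b \<le> - \<epsilon>"
  proof (rule ccontr)
    assume "\<not> y k b \<le> - \<epsilon>"
    then have "y k b \<in> {- \<epsilon><..}" by simp
    then have "\<forall>\<^sub>F t in at b within {a..b + 1}. y k t \<in> {- \<epsilon><..}"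
      using cont ab by (intro topological_tendstoD[of "y k" "y k b"]) (auto simp: continuous_on_def)
    then obtain d where d: "0 < d" "\<And>t. t \<in> {a..b + 1} \<Longrightarrow> t \<noteq> b \<Longrightarrow> dist t b < d \<Longrightarrow> - \<epsilon> < y k t"
      unfolding eventually_at by auto
    have "ereal (b + min d 1) \<le> s (Suc k)"
      unfolding stagesD(2)[OF st]
    proof (rule Inf_greatest)
      fix u assume "u \<in> ereal ` {t. s k \<le> ereal t \<and> y k t < - \<epsilon>}"
      then obtain t where t: "u = ereal t" "a \<le> t" "y k t < - \<epsilon>" using a by auto
      then have "b < t" using above[of t] \<open>\<not> y k b \<le> - \<epsilon>\<close> by (cases "t = b"; cases "t < b") auto
      have "b + min d 1 \<le> t"
      proof (rule ccontr)
        assume "\<not> b + min d 1 \<le> t"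
        then have "- \<epsilon> < y k t" using \<open>b < t\<close> t(2) by (intro d(2)) (auto simp: dist_real_def)
        then show False using t(3) by simp
      qed
      then show "ereal (b + min d 1) \<le> u" using t by simp
    qed
    then show False using b d(1) by simp
  qed
  ultimately show yb: "y k b = - \<epsilon>" by simp
  fix t assume "a \<le> t" "t \<le> b"
  then show "- \<epsilon> \<le> y k t" using above yb by (cases "t = b") auto
qed

text \<open>From the reset position \<open>\<epsilon>\<close> down to \<open>- \<epsilon>\<close> at
  speed at most \<open>M\<close>. Stage \<open>0\<close> is left out, since it may start at the
  threshold.\<close>

lemma stage_duration:
  assumes st: "stages \<epsilon> \<alpha> x0 i0 s y" and "0 < \<epsilon>" "- \<epsilon> \<le> x0" "\<alpha> \<in> controls A"
    and a: "s (Suc k) = ereal a" and b: "s (Suc (Suc k)) = ereal b"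
  shows "a + 2 * \<epsilon> / M \<le> b"
proof -
  note e = stage_end[OF st assms(2,3) a b]
  have "\<bar>y (Suc k) b - y (Suc k) a\<bar> \<le> M * (b - a)"
    by (rule path_lipschitz[OF stagesD(6)[OF st a] assms(4) e(1)]) (use e in auto)
  moreover have "y (Suc k) a = \<epsilon>" using stagesD(5)[OF st a] by simp
  ultimately have "2 * \<epsilon> \<le> M * (b - a)" using e(3) by simp
  then show ?thesis using M by (simp add: field_simps)
qed

text \<open>Switching times grow at least linearly, so they do not accumulate and every time belongs
  to a stage.\<close>

lemma stages_exhaust:
  assumes st: "stages \<epsilon> \<alpha> x0 i0 s y" and "0 < \<epsilon>" "- \<epsilon> \<le> x0" "\<alpha> \<in> controls A" "0 \<le> T"
  obtains n where "s n \<le> ereal T" "ereal T < s (Suc n)"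
proof -
  have low: "ereal (real k * (2 * \<epsilon> / M)) \<le> s (Suc k)" for k
  proof (induction k)
    case 0
    then show ?case using stagesD(4)[OF st, of "Suc 0"] by (simp add: zero_ereal_def)
  next
    case (Suc k)
    show ?case
    proof (cases "s (Suc (Suc k))")
      case (real b)
      then obtain a where a: "s (Suc k) = ereal a"
        using stagesD(3)[OF st, of "Suc k"] stagesD(4)[OF st, of "Suc k"] by (cases "s (Suc k)") auto
      have "a + 2 * \<epsilon> / M \<le> b" by (rule stage_duration[OF st assms(2-4) a real])
      moreover have "real k * (2 * \<epsilon> / M) \<le> a" using Suc a by simp
      moreover have "real (Suc k) * (2 * \<epsilon> / M) = real k * (2 * \<epsilon> / M) + 2 * \<epsilon> / M" by (simp add: algebra_simps add_divide_distrib)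
      ultimately show ?thesis using real by simp
    next
      case MInf
      then show ?thesis using stagesD(4)[OF st, of "Suc (Suc k)"] by simp
    qed simp
  qed
  obtain N where "T < real N * (2 * \<epsilon> / M)"
    using reals_Archimedean3[of "2 * \<epsilon> / M"] \<open>0 < \<epsilon>\<close> M by auto
  then have ex: "ereal T < s (Suc N)" using low[of N] by (meson less_ereal.simps(1) order_less_le_trans)
  define n where "n = (LEAST n. ereal T < s (Suc n))"
  have "ereal T < s (Suc n)" unfolding n_def using ex by (rule LeastI)
  moreover have "s n \<le> ereal T"
  proof (cases n)
    case 0
    then show ?thesis using stagesD(1)[OF st] \<open>0 \<le> T\<close> by (simp add: zero_ereal_def)
  next
    case (Suc m)
    then have "\<not> ereal T < s (Suc m)" using not_less_Least[of m "\<lambda>n. ereal T < s (Suc n)"] by (simp add: n_def)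
    then show ?thesis using Suc by simp
  qed
  ultimately show thesis using that by blast
qed

lemma stage_integral_eq:
  assumes st: "stages \<epsilon> \<alpha> x0 i0 s y" and "\<alpha> \<in> controls A"
    and xi: "\<And>k t. s k \<le> ereal t \<Longrightarrow> ereal t < s (Suc k) \<Longrightarrow> x t = y k t \<and> i t = (succ_branch ^^ k) i0"
    and a: "s k \<le> ereal a" and b: "ereal b \<le> s (Suc k)"
  shows "(\<lambda>t. G (i t) (x t) (\<alpha> t)) integrable_on {a..b}"
    "integral {a..b} (\<lambda>t. exp (- lam * t) * G (i t) (x t) (\<alpha> t)) = cost ((succ_branch ^^ k) i0) \<alpha> (y k) a b"
proof -
  obtain a' where a': "s k = ereal a'" "a' \<le> a" "0 \<le> a'"
    using a stagesD(4)[OF st, of k] by (cases "s k") auto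
  have c: "continuous_on {a..b} (y k)"
    by (rule path_continuous[OF path_subinterval[OF stagesD(6)[OF st a'(1)]]]) (use a' in auto)
  have eq: "x t = y k t \<and> i t = (succ_branch ^^ k) i0" if "t \<in> {a..b} - {b}" for t
  proof (rule xi)
    have "s k \<le> ereal a" by (rule a)
    also have "ereal a \<le> ereal t" using that by simp
    finally show "s k \<le> ereal t" .
    have "ereal t < ereal b" using that by simp
    then show "ereal t < s (Suc k)" using b by (rule less_le_trans)
  qed
  have "(\<lambda>t. G ((succ_branch ^^ k) i0) (y k t) (\<alpha> t)) integrable_on {a..b}"
    by (rule G_integrable[OF assms(2) c]) (use a' in simp)
  then show "(\<lambda>t. G (i t) (x t) (\<alpha> t)) integrable_on {a..b}"
    by (rule integrable_spike_finite[of "{b}", rotated 2]) (use eq in auto)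
  show "integral {a..b} (\<lambda>t. exp (- lam * t) * G (i t) (x t) (\<alpha> t)) = cost ((succ_branch ^^ k) i0) \<alpha> (y k) a b"
    unfolding cost_def by (rule integral_spike[of "{b}"]) (use eq in auto)
qed

lemma thermostat_bdd_integrable:
  assumes tr: "thermostat_trajectory f (\<lambda>_. \<epsilon>) \<alpha> x0 i0 x i" and "0 < \<epsilon>" "- \<epsilon> \<le> x0" "\<alpha> \<in> controls A"
  shows "bdd_integrable (\<lambda>t. G (i t) (x t) (\<alpha> t))"
  unfolding bdd_integrable_def
proof (intro conjI exI allI impI)
  show "\<bar>G (i t) (x t) (\<alpha> t)\<bar> \<le> M" if "0 \<le> t" for t using that assms(4) by (intro G_bound controls_in)
  obtain s y where st: "stages \<epsilon> \<alpha> x0 i0 s y"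
    and xi: "\<And>k t. s k \<le> ereal t \<Longrightarrow> ereal t < s (Suc k) \<Longrightarrow> x t = y k t \<and> i t = (succ_branch ^^ k) i0"
    using tr unfolding thermostat_trajectory_stages by blast
  note si = stage_integral_eq[OF st assms(4) xi]
  have fin: "(\<lambda>t. G (i t) (x t) (\<alpha> t)) integrable_on {0..a}" if "s n = ereal a" for n a
    using that
  proof (induction n arbitrary: a)
    case 0
    then show ?case using stagesD(1)[OF st] by (auto simp: zero_ereal_def intro: has_integral_integrable[OF has_integral_refl(2)])
  next
    case (Suc n)
    then obtain a' where a': "s n = ereal a'" "0 \<le> a'" "a' \<le> a"
      using stagesD(3,4)[OF st, of n] by (cases "s n") auto
    have "(\<lambda>t. G (i t) (x t) (\<alpha> t)) integrable_on {a'..a}" by (rule si(1)[of n]) (use a' Suc in auto)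
    with Suc.IH[OF a'(1)] show ?case
      by (rule Henstock_Kurzweil_Integration.integrable_combine[OF a'(2,3)])
  qed
  fix T :: real
  show "(\<lambda>t. G (i t) (x t) (\<alpha> t)) integrable_on {0..T}"
  proof (cases "0 \<le> T")
    case True
    then obtain n where n: "s n \<le> ereal T" "ereal T < s (Suc n)" by (rule stages_exhaust[OF st assms(2-4)])
    then obtain a where a: "s n = ereal a" "0 \<le> a" "a \<le> T"
      using stagesD(4)[OF st, of n] by (cases "s n") auto
    have "(\<lambda>t. G (i t) (x t) (\<alpha> t)) integrable_on {a..T}" by (rule si(1)[of n]) (use a n in auto)
    with fin[OF a(1)] show ?thesis
      by (rule Henstock_Kurzweil_Integration.integrable_combine[OF a(2,3)])
  qed auto
qed

lemma thermostat_cost_eq: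
  assumes "thermostat_trajectory f (\<lambda>_. \<epsilon>) \<alpha> x0 i0 x i" "0 < \<epsilon>" "- \<epsilon> \<le> x0" "\<alpha> \<in> controls A"
  shows "thermostat_cost l lam \<alpha> x i = discounted lam (\<lambda>t. G (i t) (x t) (\<alpha> t))"
  unfolding thermostat_cost_def by (rule discounted_eq_LINT[OF thermostat_bdd_integrable[OF assms] lam])

lemma thermostat_cost_bounds:
  assumes "thermostat_trajectory f (\<lambda>_. \<epsilon>) \<alpha> x0 i0 x i" "0 < \<epsilon>" "- \<epsilon> \<le> x0" "\<alpha> \<in> controls A"
  shows "0 \<le> thermostat_cost l lam \<alpha> x i" "thermostat_cost l lam \<alpha> x i \<le> M / lam"
proof -
  note b = thermostat_bdd_integrable[OF assms]
  have "discounted lam (\<lambda>_. 0) \<le> discounted lam (\<lambda>t. G (i t) (x t) (\<alpha> t))"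
    by (rule discounted_mono[OF bdd_integrable_const b lam]) (use assms(4) in \<open>auto intro!: G_ge controls_in\<close>)
  then show "0 \<le> thermostat_cost l lam \<alpha> x i" unfolding thermostat_cost_eq[OF assms] by (simp add: discounted_const lam)
  have "discounted lam (\<lambda>t. G (i t) (x t) (\<alpha> t)) \<le> discounted lam (\<lambda>_. M)"
    by (rule discounted_mono[OF b bdd_integrable_const lam]) (use assms(4) in \<open>auto intro!: G_le controls_in\<close>)
  then show "thermostat_cost l lam \<alpha> x i \<le> M / lam" unfolding thermostat_cost_eq[OF assms] by (simp add: discounted_const lam)
qed

text \<open>The switching times come from a recursion, each determined by the previous one and a
  chosen solution of its stage; \<open>N t\<close> is the stage containing \<open>t\<close>.\<close>

lemma thermostat_trajectory_exists:
  assumes \<alpha>: "\<alpha> \<in> controls A"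
  obtains x i where "thermostat_trajectory f (\<lambda>_. \<epsilon>) \<alpha> x0 i0 x i"
proof -
  have ex: "\<exists>z. z a = v \<and> (\<forall>T. path j \<alpha> z a T)" if "0 \<le> a" for a v j
    by (rule path_exists[OF \<alpha> that, of v j]) blast
  define Y where "Y j v a = (SOME z. z a = v \<and> (\<forall>T. path j \<alpha> z a T))" for j v a
  have Y: "Y j v a a = v \<and> (\<forall>T. path j \<alpha> (Y j v a) a T)" if "0 \<le> a" for j v a
    unfolding Y_def by (rule someI_ex[OF ex[OF that]])
  define yy where "yy k u = Y ((succ_branch ^^ k) i0) (if k = 0 then x0 else \<epsilon>) (real_of_ereal u)" for k u
  define s where "s = rec_nat 0 (\<lambda>k u. Inf (ereal ` {t. u \<le> ereal t \<and> yy k u t < - \<epsilon>}))"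
  define y where "y k = yy k (s k)" for k
  have s: "s 0 = 0" "s (Suc k) = Inf (ereal ` {t. s k \<le> ereal t \<and> y k t < - \<epsilon>})" for k
    by (simp_all add: s_def y_def)
  have nn: "0 \<le> s k" for k by (rule stage_times_mono(2)[of s y \<epsilon>]) (use s in auto)
  have st: "stages \<epsilon> \<alpha> x0 i0 s y"
    unfolding stages_def
  proof (intro conjI allI impI s)
    fix k a assume a: "s k = ereal a"
    then have "0 \<le> a" using nn[of k] by simp
    from Y[OF this] show "y k a = (if k = 0 then x0 else \<epsilon>)" "path ((succ_branch ^^ k) i0) \<alpha> (y k) a T" for T
      using a by (simp_all add: y_def yy_def)
  qed
  define N where "N t = (LEAST n. ereal t < s (Suc n))" for t
  have N: "N t = k" if "s k \<le> ereal t" "ereal t < s (Suc k)" for t k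
    unfolding N_def
  proof (rule Least_equality[where P = "\<lambda>n. ereal t < s (Suc n)"])
    fix n assume n: "ereal t < s (Suc n)"
    show "k \<le> n"
    proof (rule ccontr)
      assume "\<not> k \<le> n"
      then have "s (Suc n) \<le> s k" by (intro stages_mono[OF st]) simp
      then show False using n that(1) by (meson leD order_trans)
    qed
  qed (rule that)
  have "thermostat_trajectory f (\<lambda>_. \<epsilon>) \<alpha> x0 i0 (\<lambda>t. y (N t) t) (\<lambda>t. (succ_branch ^^ N t) i0)"
    unfolding thermostat_trajectory_stages using st N by blast
  then show thesis by (rule that)
qed

section \<open>The thermostat value function and its dynamic programming\<close>

abbreviation Vt :: "real \<Rightarrow> real \<Rightarrow> branch \<Rightarrow> real" where
  "Vt \<epsilon> x i \<equiv> V_thermostat A f l lam (\<lambda>_. \<epsilon>) x i"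

lemma Vt_le:
  assumes "thermostat_trajectory f (\<lambda>_. \<epsilon>) \<alpha> x0 i0 x i" "0 < \<epsilon>" "- \<epsilon> \<le> x0" "\<alpha> \<in> controls A"
  shows "Vt \<epsilon> x0 i0 \<le> thermostat_cost l lam \<alpha> x i"
  unfolding V_thermostat_def
proof (rule cInf_lower)
  show "bdd_below {thermostat_cost l lam \<alpha> x i |\<alpha> x i. \<alpha> \<in> controls A \<and> thermostat_trajectory f (\<lambda>_. \<epsilon>) \<alpha> x0 i0 x i}"
    by (rule bdd_belowI[of _ 0]) (use assms(2,3) in \<open>auto intro!: thermostat_cost_bounds(1)\<close>)
qed (use assms in blast)

lemma Vt_greatest:
  assumes "\<And>\<alpha> x i. \<alpha> \<in> controls A \<Longrightarrow> thermostat_trajectory f (\<lambda>_. \<epsilon>) \<alpha> x0 i0 x i \<Longrightarrow> c \<le> thermostat_cost l lam \<alpha> x i"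
  shows "c \<le> Vt \<epsilon> x0 i0"
  unfolding V_thermostat_def
proof (rule cInf_greatest)
  obtain x i where "thermostat_trajectory f (\<lambda>_. \<epsilon>) (\<lambda>_. am B1) x0 i0 x i"
    by (rule thermostat_trajectory_exists[OF controls_const[OF am(1)]])
  then show "{thermostat_cost l lam \<alpha> x i |\<alpha> x i. \<alpha> \<in> controls A \<and> thermostat_trajectory f (\<lambda>_. \<epsilon>) \<alpha> x0 i0 x i} \<noteq> {}"
    using controls_const[OF am(1)] by blast
qed (use assms in blast)

lemma Vt_bounds:
  assumes "0 < \<epsilon>" "- \<epsilon> \<le> x0"
  shows "0 \<le> Vt \<epsilon> x0 i0" "Vt \<epsilon> x0 i0 \<le> M / lam"
proof -
  show "0 \<le> Vt \<epsilon> x0 i0" by (rule Vt_greatest) (rule thermostat_cost_bounds(1)[OF _ assms])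
  obtain x i where tr: "thermostat_trajectory f (\<lambda>_. \<epsilon>) (\<lambda>_. am B1) x0 i0 x i"
    by (rule thermostat_trajectory_exists[OF controls_const[OF am(1)]])
  show "Vt \<epsilon> x0 i0 \<le> M / lam"
    using Vt_le[OF tr assms controls_const[OF am(1)]] thermostat_cost_bounds(2)[OF tr assms controls_const[OF am(1)]] by linarith
qed

lemma glued_thermostat_cost:
  assumes \<beta>: "\<beta> \<in> controls A" "\<gamma> \<in> controls A" and "0 \<le> T" "0 < \<epsilon>" and p: "path i \<beta> z 0 T"
    and tr: "thermostat_trajectory f (\<lambda>_. \<epsilon>) (\<lambda>t. if t < T then \<beta> t else \<gamma> (t - T)) (z 0) i
       (\<lambda>t. if t < T then z t else x' (t - T)) (\<lambda>t. if t < T then i else i' (t - T))"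
    and "- \<epsilon> \<le> z 0" and tr': "thermostat_trajectory f (\<lambda>_. \<epsilon>) \<gamma> v j x' i'" "- \<epsilon> \<le> v"
  shows "thermostat_cost l lam (\<lambda>t. if t < T then \<beta> t else \<gamma> (t - T)) (\<lambda>t. if t < T then z t else x' (t - T)) (\<lambda>t. if t < T then i else i' (t - T))
    = cost i \<beta> z 0 T + exp (- lam * T) * thermostat_cost l lam \<gamma> x' i'"
  unfolding thermostat_cost_eq[OF tr \<open>0 < \<epsilon>\<close> \<open>- \<epsilon> \<le> z 0\<close> controls_glue[OF \<beta> \<open>0 \<le> T\<close>]]
    thermostat_cost_eq[OF tr'(1) \<open>0 < \<epsilon>\<close> tr'(2) \<beta>(2)] cost_def
proof (rule discounted_glue(2)[OF _ _ thermostat_bdd_integrable[OF tr'(1) \<open>0 < \<epsilon>\<close> tr'(2) \<beta>(2)] \<open>0 \<le> T\<close> lam])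
  show "(\<lambda>t. G i (z t) (\<beta> t)) integrable_on {0..T}"
    by (rule G_integrable[OF \<beta>(1) path_continuous[OF p] order_refl])
  show "\<bar>G i (z t) (\<beta> t)\<bar> \<le> M" if "t \<in> {0..T}" for t
    using that by (intro G_bound controls_in[OF \<beta>(1)]) auto
qed auto

text \<open>As \<open>z\<close> never goes below the threshold, the prefix merely lengthens stage
  \<open>0\<close>, and all later switching times are shifted by \<open>T\<close>.\<close>

lemma thermostat_prefix:
  assumes \<beta>: "\<beta> \<in> controls A" "\<gamma> \<in> controls A" and "0 \<le> T" "0 < \<epsilon>" and p: "path i \<beta> z 0 T"
    and z: "\<And>t. 0 \<le> t \<Longrightarrow> t \<le> T \<Longrightarrow> - \<epsilon> \<le> z t"
    and tr: "thermostat_trajectory f (\<lambda>_. \<epsilon>) \<gamma> (z T) i x' i'"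
  shows "thermostat_trajectory f (\<lambda>_. \<epsilon>) (\<lambda>t. if t < T then \<beta> t else \<gamma> (t - T)) (z 0) i
       (\<lambda>t. if t < T then z t else x' (t - T)) (\<lambda>t. if t < T then i else i' (t - T))" (is "thermostat_trajectory f _ ?\<alpha> _ _ ?x ?i")
proof -
  obtain s' y' where st: "stages \<epsilon> \<gamma> (z T) i s' y'"
    and xi: "\<And>k t. s' k \<le> ereal t \<Longrightarrow> ereal t < s' (Suc k) \<Longrightarrow> x' t = y' k t \<and> i' t = (succ_branch ^^ k) i"
    using tr unfolding thermostat_trajectory_stages by blast
  define s where "s k = (if k = 0 then 0 else s' k + ereal T)" for k
  define y where "y k = (if k = 0 then (\<lambda>t. if t < T then z t else y' 0 (t - T)) else (\<lambda>t. y' k (t - T)))" for k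
  have s'0: "s' 0 = ereal 0" using stagesD(1)[OF st] by (simp add: zero_ereal_def)
  have y'0: "y' 0 0 = z T" using stagesD(5)[OF st s'0] by simp
  have shift: "path ((succ_branch ^^ k) i) ?\<alpha> (\<lambda>t. y' k (t - T)) (a + T) R" if "s' k = ereal a" for k a R
  proof -
    have a: "0 \<le> a" using stagesD(4)[OF st, of k] that by simp
    have "path ((succ_branch ^^ k) i) (\<lambda>t. \<gamma> (t + - T)) (\<lambda>t. y' k (t + - T)) (a - - T) (R - T - - T)"
      by (rule path_shift[OF stagesD(6)[OF st that]])
    then have "path ((succ_branch ^^ k) i) (\<lambda>t. \<gamma> (t - T)) (\<lambda>t. y' k (t - T)) (a + T) R" by simp
    then show ?thesis
      by (rule path_cong[where N = "{}"]) (use a in auto)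
  qed
  have ge_shift: "s' k + ereal T \<le> ereal t \<longleftrightarrow> s' k \<le> ereal (t - T)" for k t
    by (cases "s' k") auto
  have "stages \<epsilon> ?\<alpha> (z 0) i s y"
    unfolding stages_def
  proof (intro conjI allI impI)
    show "s 0 = 0" by (simp add: s_def)
    fix k a assume a: "s k = ereal a"
    show "y k a = (if k = 0 then z 0 else \<epsilon>)"
    proof (cases "k = 0")
      case True
      then show ?thesis using a y'0 \<open>0 \<le> T\<close> by (auto simp: s_def y_def)
    next
      case False
      then have "s' k = ereal (a - T)" using a by (cases "s' k") (auto simp: s_def)
      then show ?thesis using stagesD(5)[OF st] False by (simp add: y_def)
    qed
    fix R
    show "path ((succ_branch ^^ k) i) ?\<alpha> (y k) a R"
    proof (cases "k = 0")
      case True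
      have "path i ?\<alpha> (y 0) 0 T"
        by (rule path_cong[OF p, of "{T}"]) (use y'0 in \<open>auto simp: y_def\<close>)
      moreover have "path i ?\<alpha> (y 0) T (max R T)"
      proof (rule path_cong[where N = "{}"])
        show "path i ?\<alpha> (\<lambda>t. y' 0 (t - T)) T (max R T)" using shift[OF s'0, of "max R T"] by simp
      qed (auto simp: y_def)
      ultimately have "path i ?\<alpha> (y 0) 0 (max R T)" using \<open>0 \<le> T\<close> by (rule path_combine)
      then show ?thesis using True a by (auto simp: s_def intro: path_subinterval)
    next
      case False
      then have "s' k = ereal (a - T)" using a by (cases "s' k") (auto simp: s_def)
      then show ?thesis using shift[of k "a - T" R] False by (simp add: y_def)
    qed
  next
    fix k
    show "s (Suc k) = Inf (ereal ` {t. s k \<le> ereal t \<and> y k t < - \<epsilon>})"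
    proof -
      have "{t. s k \<le> ereal t \<and> y k t < - \<epsilon>} = {t. s' k \<le> ereal (t - T) \<and> y' k (t - T) < - \<epsilon>}"
      proof (cases "k = 0")
        case True
        have "0 \<le> t \<and> y 0 t < - \<epsilon> \<longleftrightarrow> 0 \<le> t - T \<and> y' 0 (t - T) < - \<epsilon>" for t
          using z[of t] \<open>0 \<le> T\<close> by (auto simp: y_def)
        then show ?thesis using True s'0 by (simp add: s_def)
      next
        case False
        then show ?thesis using ge_shift by (simp add: s_def y_def)
      qed
      then have "Inf (ereal ` {t. s k \<le> ereal t \<and> y k t < - \<epsilon>}) = Inf (ereal ` {t. s' k \<le> ereal t \<and> y' k t < - \<epsilon>}) + ereal T"
        using Inf_ereal_shift[of "\<lambda>t. s' k \<le> ereal t \<and> y' k t < - \<epsilon>" T] by simp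
      then show ?thesis using stagesD(2)[OF st, of k] by (simp add: s_def)
    qed
  qed
  moreover have "?x t = y k t \<and> ?i t = (succ_branch ^^ k) i" if "s k \<le> ereal t" "ereal t < s (Suc k)" for k t
  proof (cases "t < T")
    case True
    have "k = 0"
    proof (rule ccontr)
      assume "k \<noteq> 0"
      then have "s' k \<le> ereal (t - T)" using that ge_shift by (simp add: s_def)
      moreover have "0 \<le> s' k" by (rule stagesD(4)[OF st])
      ultimately have "0 \<le> ereal (t - T)" by (rule order_trans[rotated])
      then show False using True by simp
    qed
    then show ?thesis using True by (simp add: y_def)
  next
    case False
    have "s' k \<le> ereal (t - T)"
    proof (cases "k = 0")
      case True
      then show ?thesis using False s'0 by simp
    qed (use that ge_shift in \<open>simp add: s_def\<close>)
    moreover have "ereal (t - T) < s' (Suc k)"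
      using that(2) by (cases "s' (Suc k)") (auto simp: s_def)
    ultimately show ?thesis using xi[of k "t - T"] False by (simp add: y_def)
  qed
  ultimately show ?thesis unfolding thermostat_trajectory_stages by blast
qed

text \<open>Being at \<open>- \<epsilon>\<close> at time \<open>T\<close> does not end the stage.
  Holding \<open>a\<close> a little longer does: the solution continued on the old branch falls
  strictly below \<open>- \<epsilon>\<close> right after \<open>T\<close>, so the infimum of such
  times is \<open>T\<close>. The same piece of control acts on the new branch from
  \<open>\<epsilon>\<close>.\<close>

lemma thermostat_switch:
  assumes \<beta>: "\<beta> \<in> controls A" "\<gamma> \<in> controls A" and "0 \<le> T" "0 < \<epsilon>" and p: "path i \<beta> z 0 T"
    and z: "\<And>t. 0 \<le> t \<Longrightarrow> t \<le> T \<Longrightarrow> - \<epsilon> \<le> z t" "z T = - \<epsilon>"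
    and a: "a \<in> A" "f i 0 a < 0" and "0 < \<theta>" and \<gamma>: "\<And>t. 0 \<le> t \<Longrightarrow> t < \<theta> \<Longrightarrow> \<gamma> t = a"
    and tr: "thermostat_trajectory f (\<lambda>_. \<epsilon>) \<gamma> \<epsilon> (succ_branch i) x' i'"
  shows "thermostat_trajectory f (\<lambda>_. \<epsilon>) (\<lambda>t. if t < T then \<beta> t else \<gamma> (t - T)) (z 0) i
       (\<lambda>t. if t < T then z t else x' (t - T)) (\<lambda>t. if t < T then i else i' (t - T))" (is "thermostat_trajectory f _ ?\<alpha> _ _ ?x ?i")
proof -
  obtain s' y' where st: "stages \<epsilon> \<gamma> \<epsilon> (succ_branch i) s' y'"
    and xi: "\<And>k t. s' k \<le> ereal t \<Longrightarrow> ereal t < s' (Suc k) \<Longrightarrow> x' t = y' k t \<and> i' t = (succ_branch ^^ k) (succ_branch i)"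
    using tr unfolding thermostat_trajectory_stages by blast
  obtain w where w: "w 0 = - \<epsilon>" "\<And>R. path i \<gamma> w 0 R"
    using path_exists[OF \<beta>(2) order_refl] by metis
  \<comment> \<open>Below \<open>0\<close> the extended drift is the constant
    \<open>f i 0 a\<close>, so this virtual continuation on the old branch is an explicit
    line.\<close>
  have w_lin: "w t = - \<epsilon> + f i 0 a * t" if "0 \<le> t" "t < \<theta>" for t
  proof (rule path_unique[of i \<gamma> w 0 t])
    show "path i \<gamma> (\<lambda>t. - \<epsilon> + f i 0 a * t) 0 t"
      unfolding path_def
    proof (rule primitive_on_cong[of _ _ "\<lambda>_. f i 0 a" _ "{}"])
      show "primitive_on 0 t (\<lambda>_. f i 0 a) (\<lambda>t. - \<epsilon> + f i 0 a * t)"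
        unfolding primitive_on_def
      proof
        fix r assume "r \<in> {0..t}"
        then show "((\<lambda>_. f i 0 a) has_integral - \<epsilon> + f i 0 a * r - (- \<epsilon> + f i 0 a * 0)) {0..r}"
          using has_integral_const_real[of "f i 0 a" 0 r] by (simp add: mult.commute)
      qed
      fix r assume "r \<in> {0..t} - {}"
      then have r: "0 \<le> r" "r < \<theta>" using that by auto
      then have "- \<epsilon> + f i 0 a * r \<le> 0" using \<open>0 < \<epsilon>\<close> a(2) mult_nonpos_nonneg[of "f i 0 a" r] by linarith
      then show "F i (- \<epsilon> + f i 0 a * r) (\<gamma> r) = f i 0 a" using \<gamma>[OF r] by (simp add: F_nonpos)
    qed auto
  qed (use w \<beta> that in auto)
  define s where "s k = (case k of 0 \<Rightarrow> 0 | Suc k \<Rightarrow> s' k + ereal T)" for k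
  define y where "y k = (case k of 0 \<Rightarrow> (\<lambda>t. if t < T then z t else w (t - T)) | Suc k \<Rightarrow> (\<lambda>t. y' k (t - T)))" for k
  have s'0: "s' 0 = ereal 0" using stagesD(1)[OF st] by (simp add: zero_ereal_def)
  have br: "(succ_branch ^^ Suc k) i = (succ_branch ^^ k) (succ_branch i)" for k
    by (simp add: funpow_swap1)
  have sh: "path j ?\<alpha> (\<lambda>t. u (t - T)) (a + T) R" if "0 \<le> a" "\<And>R. path j \<gamma> u a R" for j u a R
  proof -
    have "path j (\<lambda>t. \<gamma> (t + - T)) (\<lambda>t. u (t + - T)) (a - - T) (R - T - - T)"
      by (rule path_shift[OF that(2)])
    then have "path j (\<lambda>t. \<gamma> (t - T)) (\<lambda>t. u (t - T)) (a + T) R" by simp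
    then show ?thesis by (rule path_cong[where N = "{}"]) (use that(1) in auto)
  qed
  have ge_shift: "s' k + ereal T \<le> ereal t \<longleftrightarrow> s' k \<le> ereal (t - T)" for k t
    by (cases "s' k") auto
  have "stages \<epsilon> ?\<alpha> (z 0) i s y"
    unfolding stages_def
  proof (intro conjI allI impI)
    show "s 0 = 0" by (simp add: s_def)
    fix k a assume a: "s k = ereal a"
    show "y k a = (if k = 0 then z 0 else \<epsilon>)"
    proof (cases k)
      case 0
      then show ?thesis using a w(1) z(2) \<open>0 \<le> T\<close> by (auto simp: s_def y_def zero_ereal_def)
    next
      case (Suc m)
      then have "s' m = ereal (a - T)" using a by (cases "s' m") (auto simp: s_def)
      then show ?thesis using stagesD(5)[OF st] Suc by (simp add: y_def)
    qed
    fix R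
    show "path ((succ_branch ^^ k) i) ?\<alpha> (y k) a R"
    proof (cases k)
      case 0
      have "path i ?\<alpha> (y 0) 0 T"
        by (rule path_cong[OF p, of "{T}"]) (use w(1) z(2) in \<open>auto simp: y_def\<close>)
      moreover have "path i ?\<alpha> (y 0) T (max R T)"
      proof (rule path_cong[where N = "{}"])
        show "path i ?\<alpha> (\<lambda>t. w (t - T)) T (max R T)" using sh[of 0 i w "max R T", OF order_refl w(2)] by simp
      qed (auto simp: y_def)
      ultimately have "path i ?\<alpha> (y 0) 0 (max R T)" using \<open>0 \<le> T\<close> by (rule path_combine)
      then show ?thesis using 0 a by (auto simp: s_def zero_ereal_def intro: path_subinterval)
    next
      case (Suc m)
      then have m: "s' m = ereal (a - T)" using a by (cases "s' m") (auto simp: s_def)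
      have "0 \<le> a - T" using stagesD(4)[OF st, of m] m by simp
      from sh[OF this stagesD(6)[OF st m], of R] show ?thesis
        unfolding Suc br by (simp add: y_def)
    qed
  next
    fix k
    show "s (Suc k) = Inf (ereal ` {t. s k \<le> ereal t \<and> y k t < - \<epsilon>})"
    proof (cases k)
      case 0
      have "Inf (ereal ` {t. 0 \<le> t \<and> y 0 t < - \<epsilon>}) = ereal T"
      proof (rule antisym)
        show "ereal T \<le> Inf (ereal ` {t. 0 \<le> t \<and> y 0 t < - \<epsilon>})"
        proof (rule Inf_greatest)
          fix u assume "u \<in> ereal ` {t. 0 \<le> t \<and> y 0 t < - \<epsilon>}"
          then obtain t where "u = ereal t" "0 \<le> t" "y 0 t < - \<epsilon>" by auto
          moreover from this have "T \<le> t" using z(1)[of t] by (auto simp: y_def not_less split: if_splits)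
          ultimately show "ereal T \<le> u" by simp
        qed
        show "Inf (ereal ` {t. 0 \<le> t \<and> y 0 t < - \<epsilon>}) \<le> ereal T"
        proof (rule ccontr)
          assume "\<not> ?thesis"
          then have "ereal T < Inf (ereal ` {t. 0 \<le> t \<and> y 0 t < - \<epsilon>})" by (simp add: not_le)
          then obtain u where u: "ereal T < ereal u" "ereal u < Inf (ereal ` {t. 0 \<le> t \<and> y 0 t < - \<epsilon>})"
            using ereal_dense2 by blast
          define r where "r = min (u - T) \<theta> / 2"
          have r: "0 < r" "r < \<theta>" "T + r < u" using u(1) \<open>0 < \<theta>\<close> by (auto simp: r_def min_def field_simps)
          have "f i 0 a * r < 0" using r(1) a(2) by (intro mult_neg_pos)
          then have "y 0 (T + r) < - \<epsilon>" using w_lin[of r] r by (simp add: y_def)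
          then have "Inf (ereal ` {t. 0 \<le> t \<and> y 0 t < - \<epsilon>}) \<le> ereal (T + r)"
            using r \<open>0 \<le> T\<close> by (intro Inf_lower) auto
          then show False using u(2) r(3) by (meson ereal_less_eq(3) leD less_imp_le order_trans)
        qed
      qed
      then show ?thesis using 0 s'0 by (simp add: s_def zero_ereal_def[symmetric])
    next
      case (Suc m)
      have "{t. s k \<le> ereal t \<and> y k t < - \<epsilon>} = {t. s' m \<le> ereal (t - T) \<and> y' m (t - T) < - \<epsilon>}"
        using ge_shift Suc by (simp add: s_def y_def)
      then have "Inf (ereal ` {t. s k \<le> ereal t \<and> y k t < - \<epsilon>}) = Inf (ereal ` {t. s' m \<le> ereal t \<and> y' m t < - \<epsilon>}) + ereal T"
        using Inf_ereal_shift[of "\<lambda>t. s' m \<le> ereal t \<and> y' m t < - \<epsilon>" T] by simp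
      then show ?thesis using stagesD(2)[OF st, of m] Suc by (simp add: s_def)
    qed
  qed
  moreover have "?x t = y k t \<and> ?i t = (succ_branch ^^ k) i" if "s k \<le> ereal t" "ereal t < s (Suc k)" for k t
  proof (cases k)
    case 0
    then have "t < T" using that s'0 by (simp add: s_def)
    then show ?thesis using 0 by (simp add: y_def)
  next
    case (Suc m)
    have 1: "s' m \<le> ereal (t - T)" using that(1) ge_shift Suc by (simp add: s_def)
    have "0 \<le> ereal (t - T)" using stagesD(4)[OF st, of m] 1 by (rule order_trans)
    then have "\<not> t < T" by simp
    moreover have "ereal (t - T) < s' (Suc m)"
      using that(2) Suc by (cases "s' (Suc m)") (auto simp: s_def)
    ultimately show ?thesis using xi[OF 1] unfolding Suc br by (simp add: y_def)
  qed
  ultimately show ?thesis unfolding thermostat_trajectory_stages by blast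
qed


text \<open>Isolates the tail cost \<open>y\<close>, so that an inequality valid for every tail
  passes to the infimum.\<close>

lemma le_discounted_iff:
  "x \<le> c + exp (- lam * d) * y \<longleftrightarrow> (x - c) * exp (lam * d) \<le> y"
proof -
  have "exp (- lam * d) * y = y / exp (lam * d)" by (simp add: exp_minus divide_inverse mult.commute)
  then show ?thesis unfolding pos_le_divide_eq[OF exp_gt_zero, symmetric] by linarith
qed

lemma Vt_dynamic_programming:
  assumes \<beta>: "\<beta> \<in> controls A" and "0 \<le> c" "c \<le> d" and p: "path i \<beta> z c d" and "0 < \<epsilon>"
    and z: "\<And>t. c \<le> t \<Longrightarrow> t \<le> d \<Longrightarrow> - \<epsilon> \<le> z t"
  shows "exp (- lam * c) * Vt \<epsilon> (z c) i \<le> cost i \<beta> z c d + exp (- lam * d) * Vt \<epsilon> (z d) i"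
proof -
  define \<gamma> y where "\<gamma> t = \<beta> (t + c)" "y t = z (t + c)" for t
  have \<gamma>: "\<gamma> \<in> controls A" unfolding \<gamma>_y_def by (rule controls_shift[OF \<beta> \<open>0 \<le> c\<close>])
  have py: "path i \<gamma> y 0 (d - c)" using path_shift[OF p, of c] by (simp add: \<gamma>_y_def[abs_def])
  have ey: "y 0 = z c" "y (d - c) = z d" by (simp_all add: \<gamma>_y_def)
  have zy: "- \<epsilon> \<le> y t" if "0 \<le> t" "t \<le> d - c" for t using that z[of "t + c"] by (simp add: \<gamma>_y_def)
  have dc: "0 \<le> d - c" using \<open>c \<le> d\<close> by simp
  have "(Vt \<epsilon> (y 0) i - cost i \<gamma> y 0 (d - c)) * exp (lam * (d - c)) \<le> Vt \<epsilon> (y (d - c)) i"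
  proof (rule Vt_greatest)
    fix \<alpha> x' i' assume \<alpha>: "\<alpha> \<in> controls A" and tr: "thermostat_trajectory f (\<lambda>_. \<epsilon>) \<alpha> (y (d - c)) i x' i'"
    note tr2 = thermostat_prefix[OF \<gamma> \<alpha> dc \<open>0 < \<epsilon>\<close> py zy tr]
    have "Vt \<epsilon> (y 0) i \<le> cost i \<gamma> y 0 (d - c) + exp (- lam * (d - c)) * thermostat_cost l lam \<alpha> x' i'"
      using Vt_le[OF tr2 \<open>0 < \<epsilon>\<close> zy[OF order_refl dc] controls_glue[OF \<gamma> \<alpha> dc]]
        glued_thermostat_cost[OF \<gamma> \<alpha> dc \<open>0 < \<epsilon>\<close> py tr2 zy[OF order_refl dc] tr zy[OF dc order_refl]] by simp
    then show "(Vt \<epsilon> (y 0) i - cost i \<gamma> y 0 (d - c)) * exp (lam * (d - c)) \<le> thermostat_cost l lam \<alpha> x' i'"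
      by (simp only: le_discounted_iff)
  qed
  then have "Vt \<epsilon> (z c) i \<le> exp (lam * c) * cost i \<beta> z c d + exp (- lam * (d - c)) * Vt \<epsilon> (z d) i"
    using cost_shift[of i \<beta> c z c d] by (simp only: le_discounted_iff[symmetric] ey) (simp add: \<gamma>_y_def[abs_def])
  then have "exp (- lam * c) * Vt \<epsilon> (z c) i \<le> exp (- lam * c) * (exp (lam * c) * cost i \<beta> z c d + exp (- lam * (d - c)) * Vt \<epsilon> (z d) i)"
    by (intro mult_left_mono) auto
  also have "\<dots> = (exp (- lam * c) * exp (lam * c)) * cost i \<beta> z c d + (exp (- lam * c) * exp (- lam * (d - c))) * Vt \<epsilon> (z d) i"
    by (simp only: distrib_left mult.assoc)
  also have "exp (- lam * c) * exp (lam * c) = 1" by (simp flip: exp_add)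
  also have "exp (- lam * c) * exp (- lam * (d - c)) = exp (- lam * d)" by (simp add: algebra_simps flip: exp_add)
  finally show ?thesis by simp
qed

text \<open>Dynamic programming across one switch. The beginning on the new branch is run with the
  control \<open>a\<close> that forces the switch, which is why the value appears at
  \<open>w \<theta>\<close> and not at \<open>\<epsilon>\<close>.\<close>

lemma Vt_switch:
  assumes \<beta>: "\<beta> \<in> controls A" and "0 \<le> T" "0 < \<epsilon>" and p: "path i \<beta> z 0 T"
    and z: "\<And>t. 0 \<le> t \<Longrightarrow> t \<le> T \<Longrightarrow> - \<epsilon> \<le> z t" "z T = - \<epsilon>"
    and a: "a \<in> A" "f i 0 a < 0" and "0 < \<theta>"
    and w: "path (succ_branch i) (\<lambda>_. a) w 0 \<theta>" "w 0 = \<epsilon>" "\<And>t. 0 \<le> t \<Longrightarrow> t \<le> \<theta> \<Longrightarrow> - \<epsilon> \<le> w t"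
  shows "Vt \<epsilon> (z 0) i \<le> cost i \<beta> z 0 T + exp (- lam * T) *
    (cost (succ_branch i) (\<lambda>_. a) w 0 \<theta> + exp (- lam * \<theta>) * Vt \<epsilon> (w \<theta>) (succ_branch i))"
proof -
  note ca = controls_const[OF a(1)]
  have \<theta>: "0 \<le> \<theta>" using \<open>0 < \<theta>\<close> by simp
  have "((Vt \<epsilon> (z 0) i - cost i \<beta> z 0 T) * exp (lam * T) - cost (succ_branch i) (\<lambda>_. a) w 0 \<theta>) * exp (lam * \<theta>) \<le> Vt \<epsilon> (w \<theta>) (succ_branch i)"
  proof (rule Vt_greatest)
    fix \<alpha> x' i' assume \<alpha>: "\<alpha> \<in> controls A" and tr: "thermostat_trajectory f (\<lambda>_. \<epsilon>) \<alpha> (w \<theta>) (succ_branch i) x' i'"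
    define \<gamma> x2 i2 where "\<gamma> = (\<lambda>t. if t < \<theta> then a else \<alpha> (t - \<theta>))" "x2 = (\<lambda>t. if t < \<theta> then w t else x' (t - \<theta>))"
      "i2 = (\<lambda>t. if t < \<theta> then succ_branch i else i' (t - \<theta>))"
    have \<gamma>: "\<gamma> \<in> controls A" using controls_glue[OF ca \<alpha> \<theta>] by (simp add: \<gamma>_x2_i2_def)
    have tr2: "thermostat_trajectory f (\<lambda>_. \<epsilon>) \<gamma> \<epsilon> (succ_branch i) x2 i2"
      using thermostat_prefix[OF ca \<alpha> \<theta> \<open>0 < \<epsilon>\<close> w(1,3) tr] w(2) by (simp add: \<gamma>_x2_i2_def)
    have c2: "thermostat_cost l lam \<gamma> x2 i2 = cost (succ_branch i) (\<lambda>_. a) w 0 \<theta> + exp (- lam * \<theta>) * thermostat_cost l lam \<alpha> x' i'"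
      unfolding \<gamma>_x2_i2_def
      by (rule glued_thermostat_cost[OF ca \<alpha> \<theta> \<open>0 < \<epsilon>\<close> w(1) _ _ tr])
         (use tr2 w \<theta> \<open>0 < \<epsilon>\<close> in \<open>auto simp: \<gamma>_x2_i2_def\<close>)
    have \<gamma>a: "\<gamma> t = a" if "0 \<le> t" "t < \<theta>" for t using that by (simp add: \<gamma>_x2_i2_def)
    note tr3 = thermostat_switch[OF \<beta> \<gamma> \<open>0 \<le> T\<close> \<open>0 < \<epsilon>\<close> p z a \<open>0 < \<theta>\<close> \<gamma>a tr2]
    have "Vt \<epsilon> (z 0) i \<le> cost i \<beta> z 0 T + exp (- lam * T) * thermostat_cost l lam \<gamma> x2 i2"
      using Vt_le[OF tr3 \<open>0 < \<epsilon>\<close> z(1)[OF order_refl \<open>0 \<le> T\<close>] controls_glue[OF \<beta> \<gamma> \<open>0 \<le> T\<close>]]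
        glued_thermostat_cost[OF \<beta> \<gamma> \<open>0 \<le> T\<close> \<open>0 < \<epsilon>\<close> p tr3 z(1)[OF order_refl \<open>0 \<le> T\<close>] tr2] \<open>0 < \<epsilon>\<close> by simp
    then show "((Vt \<epsilon> (z 0) i - cost i \<beta> z 0 T) * exp (lam * T) - cost (succ_branch i) (\<lambda>_. a) w 0 \<theta>) * exp (lam * \<theta>)
        \<le> thermostat_cost l lam \<alpha> x' i'"
      by (simp only: le_discounted_iff[symmetric] c2)
  qed
  then show ?thesis by (simp only: le_discounted_iff[symmetric])
qed

lemma exp_decreasing: "a \<le> b \<Longrightarrow> exp (- lam * b) \<le> exp (- lam * a)"
  using lam by simp

lemma cost_combine:
  assumes "\<beta> \<in> controls A" "continuous_on {a..c} z" "0 \<le> a" "a \<le> b" "b \<le> c"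
  shows "cost i \<beta> z a c = cost i \<beta> z a b + cost i \<beta> z b c"
  unfolding cost_def
  using Henstock_Kurzweil_Integration.integral_combine[OF assms(4,5) G_discounted_integrable[OF assms(1-3)]] by simp

end

section \<open>The lower bound\<close>

text \<open>\<open>near\<close> is the corrector inequality with centre \<open>\<epsilon>\<close>,
  so that the corrector vanishes at the reset position and at the ends of excursions above it.
  \<open>long\<close> lets the loss \<open>\<eta>\<close> over a time \<open>h / (2 * M)\<close> pay
  for two comparisons of \<open>V\<close> at \<open>\<epsilon>\<close> with
  \<open>W\<close>.\<close>

locale small_threshold = junction_data +
  fixes q :: "branch \<Rightarrow> real" and \<eta> h \<epsilon> :: real
  assumes \<eta>: "0 < \<eta>" and h: "0 < h" and \<epsilon>: "0 < \<epsilon>" "\<epsilon> < h0" "2 * \<epsilon> \<le> h"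
    and near: "\<And>i x a. a \<in> A \<Longrightarrow> - h \<le> x \<Longrightarrow> x \<le> h \<Longrightarrow>
      - \<eta> \<le> G i x a - lam * W + q i * (F i x a - lam * (x - \<epsilon>))"
    and long: "2 * (M / c0) * \<epsilon> \<le> \<eta> / lam * (1 - exp (- lam * (h / (2 * M))))"
    and q_sum: "0 \<le> q B1 + q B2 + q B3"
begin

text \<open>An excursion up to height \<open>h\<close> is estimated by the corrector, whose boundary
  terms vanish. One that exceeds \<open>h\<close> travels at least
  \<open>h - \<epsilon> \<ge> h / 2\<close> and so lasts at least \<open>h / (2 * M)\<close>; there
  dynamic programming for \<open>V\<close> is precise enough.\<close>

lemma excursion_lower:
  assumes \<beta>: "\<beta> \<in> controls A" and "0 \<le> u" "u < v" and p: "path i \<beta> z u v" and zu: "z u = \<epsilon>" and zv: "z v = \<epsilon>"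
    and pos: "\<And>t. u < t \<Longrightarrow> t < v \<Longrightarrow> \<epsilon> < z t"
  shows "(lam * W - \<eta>) / lam * (exp (- lam * u) - exp (- lam * v)) \<le> cost i \<beta> z u v"
proof (cases "\<forall>t\<in>{u..v}. z t \<le> h")
  case True
  have "- h \<le> z t" if "u \<le> t" "t \<le> v" for t
    using pos[of t] zu zv that \<epsilon> h by (cases "t = u"; cases "t = v") auto
  then have "(lam * W + - \<eta>) / lam * (exp (- lam * u) - exp (- lam * v)) - q i * (exp (- lam * v) * (z v - \<epsilon>) - exp (- lam * u) * (z u - \<epsilon>)) \<le> cost i \<beta> z u v"
    by (intro corrected_cost_ge[OF \<beta> p] near) (use assms True controls_in[OF \<beta>] in auto)
  then show ?thesis using zu zv by simp
next
  case False
  then obtain t where t: "u \<le> t" "t \<le> v" "h < z t" by force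
  have "h - \<epsilon> \<le> M * (t - u)" using path_lipschitz[OF p \<beta> \<open>0 \<le> u\<close> order_refl t(1,2)] t(3) zu by simp
  also have "\<dots> \<le> M * (v - u)" using t M by simp
  finally have "h \<le> 2 * M * (v - u)" using \<epsilon> by simp
  then have "h / (2 * M) \<le> v - u" using M by (simp add: field_simps)
  then have "exp (- lam * (v - u)) \<le> exp (- lam * (h / (2 * M)))" by (rule exp_decreasing)
  then have "\<eta> / lam * (1 - exp (- lam * (h / (2 * M)))) \<le> \<eta> / lam * (1 - exp (- lam * (v - u)))"
    using \<eta> lam by (intro mult_left_mono) auto
  with long have "2 * (M / c0) * \<epsilon> \<le> \<eta> / lam * (1 - exp (- lam * (v - u)))" by linarith
  then have "exp (- lam * u) * (2 * (M / c0) * \<epsilon>) \<le> exp (- lam * u) * (\<eta> / lam * (1 - exp (- lam * (v - u))))"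
    by (intro mult_left_mono) auto
  also have "\<dots> = \<eta> / lam * (exp (- lam * u) - exp (- lam * u) * exp (- lam * (v - u)))" by (simp add: algebra_simps)
  also have "exp (- lam * u) * exp (- lam * (v - u)) = exp (- lam * v)" by (simp add: algebra_simps flip: exp_add)
  finally have 1: "exp (- lam * u) * (2 * (M / c0) * \<epsilon>) \<le> \<eta> / lam * (exp (- lam * u) - exp (- lam * v))" .
  have "exp (- lam * u) * V (z u) i \<le> cost i \<beta> z u v + exp (- lam * v) * V (z v) i"
    by (rule V_dynamic_programming[OF \<beta> \<open>0 \<le> u\<close> less_imp_le[OF \<open>u < v\<close>] p])
       (use pos zu zv \<epsilon> in \<open>auto intro: less_trans\<close>)
  moreover have "exp (- lam * u) * (W - M / c0 * \<epsilon>) \<le> exp (- lam * u) * V (z u) i"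
    using V_near_zero(2)[of \<epsilon> i] \<epsilon> zu by (intro mult_left_mono) auto
  moreover have "exp (- lam * v) * V (z v) i \<le> exp (- lam * v) * (W + M / c0 * \<epsilon>)"
    using V_near_zero(1)[of \<epsilon> i] \<epsilon> zv by (intro mult_left_mono) auto
  moreover have "exp (- lam * v) * (M / c0 * \<epsilon>) \<le> exp (- lam * u) * (M / c0 * \<epsilon>)"
    using M c0 \<epsilon> \<open>u < v\<close> by (intro mult_right_mono exp_decreasing) auto
  moreover have "(W - r) * (eu - ev) \<le> c"
    if "eu * Vu \<le> c + ev * Vv" "eu * (W - k) \<le> eu * Vu" "ev * Vv \<le> ev * (W + k)" "ev * k \<le> eu * k" "eu * (2 * k) \<le> r * (eu - ev)"
    for eu ev Vu Vv c k r :: real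
    using that by (simp add: algebra_simps)
  moreover have "(lam * W - \<eta>) / lam = W - \<eta> / lam" using lam by (simp add: diff_divide_distrib)
  ultimately show ?thesis using 1 by (simp only: mult.assoc)
qed

text \<open>Times above \<open>\<epsilon>\<close> form complete excursions because both ends of the
  stage are at most \<open>\<epsilon>\<close>; at all other times the position lies between
  \<open>- \<epsilon>\<close> and \<open>\<epsilon>\<close>, where the corrected running cost has a
  sign pointwise.\<close>

lemma stage_lower:
  assumes \<beta>: "\<beta> \<in> controls A" and ab: "0 \<le> a" "a \<le> b" and p: "path i \<beta> z a b" and za: "z a \<le> \<epsilon>" and zb: "z b \<le> \<epsilon>"
    and low: "\<And>t. a \<le> t \<Longrightarrow> t \<le> b \<Longrightarrow> - \<epsilon> \<le> z t"
  shows "(lam * W - \<eta>) / lam * (exp (- lam * a) - exp (- lam * b)) - q i * (exp (- lam * b) * (z b - \<epsilon>) - exp (- lam * a) * (z a - \<epsilon>))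
    \<le> cost i \<beta> z a b"
proof -
  define g where "g t = exp (- lam * t) * (G i (z t) (\<beta> t) - (lam * W - \<eta>) + q i * (F i (z t) (\<beta> t) - lam * (z t - \<epsilon>)))" for t
  have cz: "continuous_on {a..b} z" by (rule path_continuous[OF p])
  have gi: "(g has_integral (cost i \<beta> z u v - (lam * W - \<eta>) / lam * (exp (- lam * u) - exp (- lam * v)) +
      q i * (exp (- lam * v) * (z v - \<epsilon>) - exp (- lam * u) * (z u - \<epsilon>)))) {u..v}" if "a \<le> u" "u \<le> v" "v \<le> b" for u v
    unfolding g_def
    by (rule corrected_cost_has_integral[OF \<beta> path_subinterval[OF p that(1,3)]]) (use that ab in auto)
  obtain B where B: "\<forall>t\<in>{a..b}. \<bar>z t\<bar> \<le> B"
    using compact_imp_bounded[OF compact_continuous_image[OF cz compact_Icc]] unfolding bounded_iff by auto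
  have gabs: "g absolutely_integrable_on {a..b}"
  proof (rule absolutely_integrable_bounded[OF has_integral_integrable[OF gi[OF order_refl ab(2) order_refl]]])
    fix t assume t: "t \<in> {a..b}"
    have in_A: "\<beta> t \<in> A" using controls_in[OF \<beta>] t ab by auto
    have "\<bar>z t\<bar> \<le> B" using B t by blast
    then have "\<bar>z t - \<epsilon>\<bar> \<le> B + \<epsilon>" using \<epsilon>(1) by linarith
    then have "\<bar>lam * (z t - \<epsilon>)\<bar> \<le> lam * (B + \<epsilon>)" using lam by (simp add: abs_mult)
    then have "\<bar>F i (z t) (\<beta> t) - lam * (z t - \<epsilon>)\<bar> \<le> M + lam * (B + \<epsilon>)" using F_bound[OF in_A, of i "z t"] by linarith
    then have "\<bar>q i * (F i (z t) (\<beta> t) - lam * (z t - \<epsilon>))\<bar> \<le> \<bar>q i\<bar> * (M + lam * (B + \<epsilon>))"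
      by (simp add: abs_mult mult_left_mono)
    then have "\<bar>G i (z t) (\<beta> t) - (lam * W - \<eta>) + q i * (F i (z t) (\<beta> t) - lam * (z t - \<epsilon>))\<bar> \<le> M + \<bar>lam * W - \<eta>\<bar> + \<bar>q i\<bar> * (M + lam * (B + \<epsilon>))"
      using G_bound[OF in_A, of i "z t"] by linarith
    then have "exp (- lam * t) * \<bar>G i (z t) (\<beta> t) - (lam * W - \<eta>) + q i * (F i (z t) (\<beta> t) - lam * (z t - \<epsilon>))\<bar> \<le> 1 * (M + \<bar>lam * W - \<eta>\<bar> + \<bar>q i\<bar> * (M + lam * (B + \<epsilon>)))"
      using t ab exp_le_one[of t] by (intro mult_mono) auto
    then show "\<bar>g t\<bar> \<le> M + \<bar>lam * W - \<eta>\<bar> + \<bar>q i\<bar> * (M + lam * (B + \<epsilon>))"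
      by (simp add: g_def abs_mult)
  qed
  have gabs': "g absolutely_integrable_on S" if "S \<in> sets lebesgue" "S \<subseteq> {a..b}" for S
    by (rule set_integrable_subset[OF gabs that])
  define U where "U = {a<..<b} \<inter> z -` {\<epsilon><..}"
  have opU: "open U" unfolding U_def
    by (intro continuous_open_preimage continuous_on_subset[OF cz]) auto
  have Uab: "U \<subseteq> {a..b}" by (auto simp: U_def)
  have "0 \<le> integral U g"
  proof (rule integral_open_nonneg[OF opU, of a])
    show "a < t" if "t \<in> U" for t using that by (simp add: U_def)
    show "g absolutely_integrable_on U" by (rule gabs') (use opU Uab in auto)
    show "0 \<le> integral {u..} g" if "{u<..} \<subseteq> U" for u
    proof -
      have "max u b + 1 \<in> U" using that by auto
      then have "max u b + 1 < b" by (simp add: U_def)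
      then show ?thesis using max.cobounded2[of b u] by linarith
    qed
    show "0 \<le> integral {u..v} g" if uv: "u < v" "{u<..<v} \<subseteq> U" "u \<notin> U" "v \<notin> U" for u v
    proof -
      have "closure {u<..<v} \<subseteq> {a..b}" using uv(2) Uab by (intro closure_minimal) auto
      then have uvab: "a \<le> u" "v \<le> b" "u \<in> {a..b}" "v \<in> {a..b}" using uv(1) by auto
      have pos: "\<epsilon> < z t" if "u < t" "t < v" for t using uv(2) that by (auto simp: U_def)
      have cuv: "continuous_on {u..v} z" by (rule continuous_on_subset[OF cz]) (use uvab in auto)
      have cl: "closure {u<..<v} = {u..v}" using uv(1) by simp
      have ge: "\<epsilon> \<le> z t" if "t \<in> {u..v}" for t
        by (rule continuous_ge_on_closure[of "{u<..<v}" z]) (use cuv that pos in \<open>auto simp: cl less_imp_le\<close>)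
      have le: "z t \<le> \<epsilon>" if "t \<in> {a..b}" "t \<notin> U" for t
        using that za zb by (cases "t = a"; cases "t = b") (auto simp: U_def)
      have zu: "z u = \<epsilon>" using ge[of u] le[OF uvab(3) uv(3)] uv(1) by simp
      have zv: "z v = \<epsilon>" using ge[of v] le[OF uvab(4) uv(4)] uv(1) by simp
      have "(lam * W - \<eta>) / lam * (exp (- lam * u) - exp (- lam * v)) \<le> cost i \<beta> z u v"
        by (rule excursion_lower[OF \<beta> _ uv(1) path_subinterval[OF p uvab(1,2)] zu zv pos]) (use uvab ab in auto)
      then show ?thesis
        using integral_unique[OF gi[OF uvab(1) less_imp_le[OF uv(1)] uvab(2)]] zu zv by simp
    qed
  qed
  moreover have "0 \<le> integral ({a..b} - U) g"
  proof (rule integral_nonneg)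
    show "g integrable_on {a..b} - U"
      by (rule set_lebesgue_integral_eq_integral(1), rule gabs') (use opU in auto)
    fix t assume t: "t \<in> {a..b} - U"
    then have "z t \<le> \<epsilon>" using za zb by (cases "t = a"; cases "t = b") (auto simp: U_def)
    then have "- \<eta> \<le> G i (z t) (\<beta> t) - lam * W + q i * (F i (z t) (\<beta> t) - lam * (z t - \<epsilon>))"
      using low[of t] t \<epsilon> ab by (intro near controls_in[OF \<beta>]) auto
    then show "0 \<le> g t" unfolding g_def by (intro mult_nonneg_nonneg) auto
  qed
  moreover have "integral {a..b} g = integral U g + integral ({a..b} - U) g"
  proof -
    have "{a..b} = U \<union> ({a..b} - U)" using Uab by auto
    moreover have "integral (U \<union> ({a..b} - U)) g = integral U g + integral ({a..b} - U) g"
      by (rule integral_Un) (use opU Uab in \<open>auto intro!: set_lebesgue_integral_eq_integral(1) gabs'\<close>)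
    ultimately show ?thesis by simp
  qed
  ultimately show ?thesis using integral_unique[OF gi[OF order_refl ab(2) order_refl]] by linarith
qed

definition qm :: real where "qm = \<bar>q B1\<bar> + \<bar>q B2\<bar> + \<bar>q B3\<bar>"

lemma q_le_qm: "\<bar>q i\<bar> \<le> qm" and qm_nonneg: "0 \<le> qm"
  by (cases i; simp add: qm_def) (simp add: qm_def)

lemma q_boundary_le:
  assumes "0 \<le> e" "e \<le> 1" "- \<epsilon> \<le> x" "x \<le> \<epsilon>"
  shows "\<bar>q i * (e * (x - \<epsilon>))\<bar> \<le> 2 * qm * \<epsilon>"
proof -
  have "\<bar>q i * (e * (x - \<epsilon>))\<bar> = \<bar>q i\<bar> * (e * \<bar>x - \<epsilon>\<bar>)" using assms by (simp add: abs_mult)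
  also have "\<dots> \<le> qm * (1 * (2 * \<epsilon>))"
    using assms q_le_qm[of i] qm_nonneg by (intro mult_mono) auto
  finally show ?thesis by simp
qed

text \<open>The stage is observed up to a time \<open>b\<close> that may fall inside an excursion.
  That excursion begins at the last time \<open>c\<close> at level \<open>\<epsilon>\<close> and is
  compared with \<open>W\<close> only once; the value left at \<open>b\<close> costs
  \<open>M / lam * exp (- lam * b)\<close>, which disappears as \<open>b\<close> grows.\<close>

lemma stage_lower_open:
  assumes \<beta>: "\<beta> \<in> controls A" and ab: "0 \<le> a" "a \<le> b" and p: "path i \<beta> z a b" and za: "z a \<le> \<epsilon>"
    and low: "\<And>t. a \<le> t \<Longrightarrow> t \<le> b \<Longrightarrow> - \<epsilon> \<le> z t"
  shows "(lam * W - \<eta>) / lam * (exp (- lam * a) - exp (- lam * b)) - (4 * qm + M / c0) * \<epsilon> - M / lam * exp (- lam * b) \<le> cost i \<beta> z a b"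
proof (cases "z b \<le> \<epsilon>")
  case True
  have 1: "(lam * W - \<eta>) / lam * (exp (- lam * a) - exp (- lam * b)) - q i * (exp (- lam * b) * (z b - \<epsilon>) - exp (- lam * a) * (z a - \<epsilon>)) \<le> cost i \<beta> z a b"
    by (rule stage_lower[OF \<beta> ab p za True]) (rule low)
  have "\<bar>q i * (exp (- lam * b) * (z b - \<epsilon>))\<bar> \<le> 2 * qm * \<epsilon>"
    by (rule q_boundary_le[OF exp_ge_zero exp_le_one]) (use ab True low in auto)
  moreover have "\<bar>q i * (exp (- lam * a) * (z a - \<epsilon>))\<bar> \<le> 2 * qm * \<epsilon>"
    by (rule q_boundary_le[OF exp_ge_zero exp_le_one]) (use ab za low in auto)
  moreover have "0 \<le> M / c0 * \<epsilon>" "0 \<le> M / lam * exp (- lam * b)" using M c0 \<epsilon> lam by auto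
  ultimately show ?thesis
    using 1 by (simp only: right_diff_distrib[of "q i"] distrib_right; linarith)
next
  case False
  have cz: "continuous_on {a..b} z" by (rule path_continuous[OF p])
  define S where "S = {t \<in> {a..b}. z t \<le> \<epsilon>}"
  have "closed S"
    using continuous_closed_preimage[OF cz closed_atLeastAtMost closed_atMost[of \<epsilon>]] by (simp add: S_def vimage_def Int_def)
  moreover have "a \<in> S" using za ab by (simp add: S_def)
  moreover have bS: "bdd_above S" by (auto simp: S_def bdd_above_def)
  ultimately have c: "Sup S \<in> S" by (intro closed_contains_Sup) auto
  define c where "c = Sup S"
  have c: "a \<le> c" "c \<le> b" "z c \<le> \<epsilon>" using c by (auto simp: S_def c_def)
  have after: "\<epsilon> < z t" if "c < t" "t \<le> b" for t
  proof (rule ccontr)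
    assume "\<not> \<epsilon> < z t"
    then have "t \<in> S" using that c by (simp add: S_def)
    then have "t \<le> c" unfolding c_def using bS by (rule cSup_upper)
    then show False using that by simp
  qed
  have "c < b" using c False by (cases "c = b") auto
  have ccb: "continuous_on {c..b} z" by (rule continuous_on_subset[OF cz]) (use c in auto)
  have cl: "closure {c<..<b} = {c..b}" using \<open>c < b\<close> by simp
  have "\<epsilon> \<le> z c"
    by (rule continuous_ge_on_closure[of "{c<..<b}" z]) (use ccb after \<open>c < b\<close> in \<open>auto simp: cl less_imp_le\<close>)
  then have zc: "z c = \<epsilon>" using c by simp
  have 1: "(lam * W - \<eta>) / lam * (exp (- lam * a) - exp (- lam * c)) - q i * (exp (- lam * c) * (z c - \<epsilon>) - exp (- lam * a) * (z a - \<epsilon>)) \<le> cost i \<beta> z a c"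
    by (rule stage_lower[OF \<beta> ab(1) c(1) path_subinterval[OF p order_refl c(2)] za]) (use zc low c in auto)
  have 2: "\<bar>q i * (exp (- lam * a) * (z a - \<epsilon>))\<bar> \<le> 2 * qm * \<epsilon>"
    by (rule q_boundary_le[OF exp_ge_zero exp_le_one]) (use ab za low in auto)
  have "exp (- lam * c) * V (z c) i \<le> cost i \<beta> z c b + exp (- lam * b) * V (z b) i"
    by (rule V_dynamic_programming[OF \<beta> _ c(2) path_subinterval[OF p c(1) order_refl]])
       (use after zc \<epsilon> False ab c in \<open>auto intro: less_trans\<close>)
  moreover have "exp (- lam * c) * (W - M / c0 * \<epsilon>) \<le> exp (- lam * c) * V (z c) i"
    using V_near_zero(2)[of \<epsilon> i] \<epsilon> zc by (intro mult_left_mono) auto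
  moreover have "exp (- lam * b) * V (z b) i \<le> exp (- lam * b) * (M / lam)"
    using V_bounds(2)[of "z b" i] False \<epsilon> by (intro mult_left_mono) auto
  moreover have "exp (- lam * c) * (M / c0 * \<epsilon>) \<le> 1 * (M / c0 * \<epsilon>)"
    using M c0 \<epsilon> ab c by (intro mult_right_mono exp_le_one) auto
  moreover have "0 \<le> W * exp (- lam * b)" using V_bounds(1)[of 0 B1] by simp
  moreover have "0 \<le> \<eta> / lam * (exp (- lam * c) - exp (- lam * b))" using \<eta> lam c by (intro mult_nonneg_nonneg) auto
  moreover have "(lam * W - \<eta>) / lam = W - \<eta> / lam" using lam by (simp add: diff_divide_distrib)
  moreover have "0 \<le> qm * \<epsilon>" using qm_nonneg \<epsilon> by simp
  ultimately have "(lam * W - \<eta>) / lam * (exp (- lam * c) - exp (- lam * b)) - M / c0 * \<epsilon> - M / lam * exp (- lam * b) \<le> cost i \<beta> z c b"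
    by (simp only: left_diff_distrib[of W "\<eta> / lam"] right_diff_distrib[of W] right_diff_distrib[of "exp (- lam * c)"]
          mult.commute[of "exp (- lam * b)" "M / lam"] mult.commute[of "exp (- lam * c)" W] mult_1_left; linarith)
  moreover have "cost i \<beta> z a b = cost i \<beta> z a c + cost i \<beta> z c b"
    by (rule cost_combine[OF \<beta> cz ab(1) c(1,2)])
  moreover have "(lam * W - \<eta>) / lam * (exp (- lam * a) - exp (- lam * b)) =
     (lam * W - \<eta>) / lam * (exp (- lam * a) - exp (- lam * c)) + (lam * W - \<eta>) / lam * (exp (- lam * c) - exp (- lam * b))"
    by (simp only: right_diff_distrib; linarith)
  moreover have "q i * (exp (- lam * c) * (z c - \<epsilon>) - exp (- lam * a) * (z a - \<epsilon>)) = - (q i * (exp (- lam * a) * (z a - \<epsilon>)))"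
    using zc by simp
  ultimately show ?thesis using 1 2 \<open>0 \<le> qm * \<epsilon>\<close> by (simp only: distrib_right mult.assoc; linarith)
qed

text \<open>A potential on the cycle of branches whose increments are at most \<open>q\<close>; \<open>q_sum\<close> is what makes the
  step closing the cycle possible.\<close>

definition offset :: "branch \<Rightarrow> real" where
  "offset i = (case i of B1 \<Rightarrow> 0 | B2 \<Rightarrow> q B1 | B3 \<Rightarrow> q B1 + q B2) + qm"

lemma offset_step: "offset (succ_branch i) - offset i \<le> q i"
  using q_sum by (cases i) (auto simp: offset_def)

lemma offset_bounds: "0 \<le> offset i" "offset i \<le> 2 * qm"
  by (cases i; auto simp: offset_def qm_def)+

text \<open>The boundary terms \<open>2 * \<epsilon> * q j\<close> carry different discount factors,
  so they are summed by parts with \<open>offset\<close>: the discount decreases and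
  \<open>offset\<close> is nonnegative, hence replacing the old factor by the new one goes in the
  right direction, and the total error does not depend on the number of switches. The starting time
  \<open>a0\<close> inside stage \<open>0\<close> allows for initial positions above
  \<open>\<epsilon>\<close>.\<close>

lemma thermostat_tail_lower:
  assumes tr: "thermostat_trajectory f (\<lambda>_. \<epsilon>) \<alpha> x0 i0 x i" and st: "stages \<epsilon> \<alpha> x0 i0 s y"
    and xi: "\<And>k t. s k \<le> ereal t \<Longrightarrow> ereal t < s (Suc k) \<Longrightarrow> x t = y k t \<and> i t = (succ_branch ^^ k) i0"
    and \<alpha>: "\<alpha> \<in> controls A" and x0: "- \<epsilon> \<le> x0"
    and a0: "0 \<le> a0" "ereal a0 \<le> s (Suc 0)" "y 0 a0 \<le> \<epsilon>"
  shows "(lam * W - \<eta>) / lam * exp (- lam * a0) - (10 * qm + M / c0) * \<epsilon> \<le> integral {a0..} (\<lambda>t. exp (- lam * t) * G (i t) (x t) (\<alpha> t))"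
proof -
  define g where "g t = exp (- lam * t) * G (i t) (x t) (\<alpha> t)" for t
  define R' where "R' = (lam * W - \<eta>) / lam"
  define e where "e t = exp (- lam * t)" for t
  have e1: "0 \<le> e t" "0 \<le> t \<Longrightarrow> e t \<le> 1" for t using exp_le_one[of t] by (auto simp: e_def)
  note bi = thermostat_bdd_integrable[OF tr \<epsilon>(1) x0 \<alpha>]
  have gint: "g integrable_on {u..v}" if "0 \<le> u" for u v
    unfolding g_def by (rule bdd_integrable_discounted_integrable[OF bi lam]) (use that in auto)
  have gcost: "integral {u..v} g = cost ((succ_branch ^^ k) i0) \<alpha> (y k) u v" if "s k \<le> ereal u" "ereal v \<le> s (Suc k)" for k u v
    unfolding g_def by (rule stage_integral_eq(2)[OF st \<alpha> xi that]) 
  have s0: "s 0 = ereal 0" using stagesD(1)[OF st] by (simp add: zero_ereal_def)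
  have y0: "- \<epsilon> \<le> y 0 0" using stagesD(5)[OF st s0] x0 by simp
  have m\<epsilon>: "0 \<le> qm * \<epsilon>" using qm_nonneg \<epsilon> by simp
  \<comment> \<open>Invariant at the switching time \<open>b\<close>, with a reserve for the branch
    about to be entered. Of \<open>6 * qm * \<epsilon>\<close>, two parts are the boundary term at
    \<open>a0\<close> and four the initial \<open>offset\<close>, which is at most
    \<open>2 * qm\<close>.\<close>
  have full: "R' * (e a0 - e b) - 6 * qm * \<epsilon> + 2 * \<epsilon> * (e b * offset ((succ_branch ^^ Suc n) i0)) \<le> integral {a0..b} g \<and> a0 \<le> b"
    if "s (Suc n) = ereal b" for n b
    using that
  proof (induction n arbitrary: b)
    case 0
    note se = stage_end[OF st \<epsilon>(1) x0 s0 0]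
    have ab: "a0 \<le> b" using a0(2) 0 by simp
    have p: "path i0 \<alpha> (y 0) a0 b" using path_subinterval[OF stagesD(6)[OF st s0, of b] a0(1) order_refl] by simp
    have "R' * (e a0 - e b) - q i0 * (e b * (y 0 b - \<epsilon>) - e a0 * (y 0 a0 - \<epsilon>)) \<le> cost i0 \<alpha> (y 0) a0 b"
      unfolding R'_def e_def
      by (rule stage_lower[OF \<alpha> a0(1) ab p a0(3)]) (use se a0 \<epsilon> in auto)
    moreover have "\<bar>q i0 * (e a0 * (y 0 a0 - \<epsilon>))\<bar> \<le> 2 * qm * \<epsilon>"
      by (rule q_boundary_le) (use e1 a0 se(4)[of a0] ab in auto)
    moreover have "cost i0 \<alpha> (y 0) a0 b = integral {a0..b} g"
      using gcost[of 0 a0 b] s0 0 a0(1) by simp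
    moreover have "q i0 * (e b * (y 0 b - \<epsilon>)) = - (2 * \<epsilon> * (e b * q i0))" using se(3) by (simp add: algebra_simps)
    moreover have "2 * \<epsilon> * (e b * (offset (succ_branch i0) - offset i0)) \<le> 2 * \<epsilon> * (e b * q i0)"
      using \<epsilon> e1(1) offset_step by (intro mult_left_mono) auto
    moreover have "2 * \<epsilon> * (e b * offset i0) \<le> 2 * \<epsilon> * (1 * (2 * qm))"
      using \<epsilon> e1[of b] offset_bounds[of i0] ab a0(1) by (intro mult_left_mono mult_mono) auto
    ultimately show ?case using ab by (simp add: right_diff_distrib algebra_simps)
  next
    case (Suc n)
    obtain a where a: "s (Suc n) = ereal a"
      using stagesD(3)[OF st, of "Suc n"] stagesD(4)[OF st, of "Suc n"] Suc.prems by (cases "s (Suc n)") auto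
    define j where "j = (succ_branch ^^ Suc n) i0"
    have jS: "(succ_branch ^^ Suc (Suc n)) i0 = succ_branch j" by (simp add: j_def)
    note IH = Suc.IH[OF a]
    note se = stage_end[OF st \<epsilon>(1) x0 a Suc.prems]
    have ya: "y (Suc n) a = \<epsilon>" using stagesD(5)[OF st a] by simp
    have "R' * (e a - e b) - q j * (e b * (y (Suc n) b - \<epsilon>) - e a * (y (Suc n) a - \<epsilon>)) \<le> cost j \<alpha> (y (Suc n)) a b"
      unfolding R'_def e_def j_def
      by (rule stage_lower[OF \<alpha> se(1,2) stagesD(6)[OF st a]]) (use se ya \<epsilon> in auto)
    moreover have "cost j \<alpha> (y (Suc n)) a b = integral {a..b} g"
      using gcost[of "Suc n" a b] a Suc.prems by (simp add: j_def)
    moreover have "integral {a0..b} g = integral {a0..a} g + integral {a..b} g"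
      using Henstock_Kurzweil_Integration.integral_combine[of a0 a b g] IH se(2) gint[OF a0(1)] by simp
    moreover have "q j * (e b * (y (Suc n) b - \<epsilon>) - e a * (y (Suc n) a - \<epsilon>)) = - (2 * \<epsilon> * (e b * q j))"
      using se(3) ya by (simp add: algebra_simps)
    moreover have "2 * \<epsilon> * (e b * (offset (succ_branch j) - offset j)) \<le> 2 * \<epsilon> * (e b * q j)"
      using \<epsilon> e1(1) offset_step by (intro mult_left_mono) auto
    moreover have "2 * \<epsilon> * (e b * offset j) \<le> 2 * \<epsilon> * (e a * offset j)"
      using \<epsilon> offset_bounds(1)[of j] exp_decreasing[OF se(2)] by (intro mult_left_mono mult_right_mono) (auto simp: e_def)
    moreover have "a0 \<le> b" using IH se(2) by simp
    moreover have "R' * (e a0 - e a) - 6 * qm * \<epsilon> + 2 * \<epsilon> * (e a * offset j) \<le> integral {a0..a} g" using IH by (simp add: j_def)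
    moreover have "R' * (e0 - eb) - 6 * qm * \<epsilon> + 2 * \<epsilon> * (eb * oS) \<le> I"
      if "R' * (ea - eb) - Q \<le> c" "c = I2" "I = I1 + I2" "Q = - (2 * \<epsilon> * (eb * qj))" "2 * \<epsilon> * (eb * (oS - oj)) \<le> 2 * \<epsilon> * (eb * qj)"
        "2 * \<epsilon> * (eb * oj) \<le> 2 * \<epsilon> * (ea * oj)" "R' * (e0 - ea) - 6 * qm * \<epsilon> + 2 * \<epsilon> * (ea * oj) \<le> I1"
      for e0 ea eb Q c I I1 I2 qj oS oj :: real
    proof -
      have "2 * \<epsilon> * (eb * oS) - 2 * \<epsilon> * (eb * oj) \<le> 2 * \<epsilon> * (eb * qj)" using that(5) by (simp only: right_diff_distrib)
      moreover have "R' * (e0 - eb) = R' * (e0 - ea) + R' * (ea - eb)" by (simp only: right_diff_distrib; linarith)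
      ultimately show ?thesis using that by linarith
    qed
    ultimately show ?case unfolding jS by blast
  qed
  \<comment> \<open>The stage containing \<open>T\<close> is incomplete; it adds the error
    \<open>(4 * qm + M / c0) * \<epsilon>\<close>, which makes \<open>10 * qm\<close> in total, and
    a term vanishing as \<open>T\<close> grows.\<close>
  have bound: "R' * (e a0 - e T) - (10 * qm + M / c0) * \<epsilon> - M / lam * e T \<le> integral {a0..T} g" if T: "a0 \<le> T" for T
  proof -
    have "0 \<le> T" using T a0 by simp
    then obtain n where n: "s n \<le> ereal T" "ereal T < s (Suc n)" by (rule stages_exhaust[OF st \<epsilon>(1) x0 \<alpha>])
    show ?thesis
    proof (cases n)
      case 0
      have p: "path i0 \<alpha> (y 0) a0 T" using path_subinterval[OF stagesD(6)[OF st s0, of T] a0(1) order_refl] by simp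
      have "R' * (e a0 - e T) - (4 * qm + M / c0) * \<epsilon> - M / lam * e T \<le> cost i0 \<alpha> (y 0) a0 T"
        unfolding R'_def e_def
      proof (rule stage_lower_open[OF \<alpha> a0(1) T p a0(3)])
        fix t assume t: "a0 \<le> t" "t \<le> T"
        have "ereal t < s (Suc 0)" using n(2) 0 t by (metis ereal_less_eq(3) order_le_less_trans)
        then show "- \<epsilon> \<le> y 0 t" using stage_above[OF st, of 0 t] s0 t a0(1) by simp
      qed
      moreover have "cost i0 \<alpha> (y 0) a0 T = integral {a0..T} g"
        using gcost[of 0 a0 T] s0 n(2) 0 a0(1) by simp
      ultimately show ?thesis using m\<epsilon> by (simp add: distrib_right)
    next
      case (Suc m)
      obtain b where b: "s (Suc m) = ereal b" "0 \<le> b"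
        using stagesD(4)[OF st, of "Suc m"] n(1) Suc by (cases "s (Suc m)") auto
      have bT: "b \<le> T" using n(1) b Suc by simp
      define j where "j = (succ_branch ^^ Suc m) i0"
      have F: "R' * (e a0 - e b) - 6 * qm * \<epsilon> + 2 * \<epsilon> * (e b * offset j) \<le> integral {a0..b} g" "a0 \<le> b"
        using full[OF b(1)] by (auto simp: j_def)
      have yb: "y (Suc m) b = \<epsilon>" using stagesD(5)[OF st b(1)] by simp
      have "R' * (e b - e T) - (4 * qm + M / c0) * \<epsilon> - M / lam * e T \<le> cost j \<alpha> (y (Suc m)) b T"
        unfolding R'_def e_def j_def
      proof (rule stage_lower_open[OF \<alpha> b(2) bT stagesD(6)[OF st b(1)]])
        fix t assume t: "b \<le> t" "t \<le> T"
        have "ereal t < s (Suc (Suc m))" using n(2) Suc t by (metis ereal_less_eq(3) order_le_less_trans)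
        then show "- \<epsilon> \<le> y (Suc m) t" using stage_above[OF st, of "Suc m" t] b t by simp
      qed (use yb in simp)
      moreover have "cost j \<alpha> (y (Suc m)) b T = integral {b..T} g"
        using gcost[of "Suc m" b T] b n(2) Suc by (simp add: j_def)
      moreover have "integral {a0..T} g = integral {a0..b} g + integral {b..T} g"
        using Henstock_Kurzweil_Integration.integral_combine[of a0 b T g] F(2) bT gint[OF a0(1)] by simp
      moreover have "0 \<le> 2 * \<epsilon> * (e b * offset j)" using \<epsilon> e1(1) offset_bounds(1) by simp
      ultimately show ?thesis using F(1) by (simp add: distrib_right right_diff_distrib)
    qed
  qed
  have "((\<lambda>T. R' * e a0 - (10 * qm + M / c0) * \<epsilon> - (R' + M / lam) * e T) \<longlongrightarrow> R' * e a0 - (10 * qm + M / c0) * \<epsilon> - 0) at_top"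
    unfolding e_def by (intro tendsto_diff tendsto_const tendsto_exp_minus_at_top lam)
  moreover have "((\<lambda>T. integral {a0..T} g) \<longlongrightarrow> integral {a0..} g) at_top"
    unfolding g_def by (rule tendsto_discounted[OF bi lam a0(1)])
  moreover have "\<forall>\<^sub>F T in at_top. R' * e a0 - (10 * qm + M / c0) * \<epsilon> - (R' + M / lam) * e T \<le> integral {a0..T} g"
    using eventually_ge_at_top[of a0]
  proof eventually_elim
    case (elim T)
    then show ?case using bound[OF elim] by (simp only: right_diff_distrib[of R'] distrib_right[of R']; linarith)
  qed
  ultimately have "R' * e a0 - (10 * qm + M / c0) * \<epsilon> - 0 \<le> integral {a0..} g"
    by (intro tendsto_le[OF trivial_limit_at_top_linorder])
  then show ?thesis by (simp add: R'_def e_def g_def[abs_def])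
qed

text \<open>From above \<open>\<epsilon>\<close> the tail estimate starts at the first time at level
  \<open>\<epsilon>\<close>, the path until then belonging to the junction problem as well; a path
  that never comes down is compared with \<open>V\<close> alone. The second \<open>M / c0\<close> is
  the difference between \<open>V\<close> near the junction and \<open>W\<close>.\<close>

lemma thermostat_lower:
  assumes "0 \<le> x0"
  shows "V x0 i0 - (\<eta> / lam + (10 * qm + 2 * (M / c0)) * \<epsilon>) \<le> Vt \<epsilon> x0 i0"
proof (rule Vt_greatest)
  fix \<alpha> x i assume \<alpha>: "\<alpha> \<in> controls A" and tr: "thermostat_trajectory f (\<lambda>_. \<epsilon>) \<alpha> x0 i0 x i"
  obtain s y where st: "stages \<epsilon> \<alpha> x0 i0 s y"
    and xi: "\<And>k t. s k \<le> ereal t \<Longrightarrow> ereal t < s (Suc k) \<Longrightarrow> x t = y k t \<and> i t = (succ_branch ^^ k) i0"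
    using tr unfolding thermostat_trajectory_stages by blast
  have x0: "- \<epsilon> \<le> x0" using assms \<epsilon> by simp
  note bi = thermostat_bdd_integrable[OF tr \<epsilon>(1) x0 \<alpha>]
  define g where "g t = exp (- lam * t) * G (i t) (x t) (\<alpha> t)" for t
  have ceq: "thermostat_cost l lam \<alpha> x i = integral {0..} g"
    unfolding thermostat_cost_eq[OF tr \<epsilon>(1) x0 \<alpha>] discounted_def g_def ..
  have s0: "s 0 = ereal 0" using stagesD(1)[OF st] by (simp add: zero_ereal_def)
  have y0: "y 0 0 = x0" using stagesD(5)[OF st s0] by simp
  have p0: "path i0 \<alpha> (y 0) 0 T" for T using stagesD(6)[OF st s0, of T] by simp
  have s1: "ereal T \<le> s (Suc 0)" if "\<And>t. 0 \<le> t \<Longrightarrow> t < T \<Longrightarrow> - \<epsilon> \<le> y 0 t" for T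
    unfolding stagesD(2)[OF st, of 0]
  proof (rule Inf_greatest)
    fix u assume "u \<in> ereal ` {t. s 0 \<le> ereal t \<and> y 0 t < - \<epsilon>}"
    then obtain t where "u = ereal t" "0 \<le> t" "y 0 t < - \<epsilon>" using s0 by auto
    then show "ereal T \<le> u" using that[of t] by (cases "t < T") auto
  qed
  have tail: "(lam * W - \<eta>) / lam * exp (- lam * a0) - (10 * qm + M / c0) * \<epsilon> \<le> integral {a0..} g"
    if "0 \<le> a0" "ereal a0 \<le> s (Suc 0)" "y 0 a0 \<le> \<epsilon>" for a0
    unfolding g_def by (rule thermostat_tail_lower[OF tr st xi \<alpha> x0 that])
  have initial: "integral {0..T} g = cost i0 \<alpha> (y 0) 0 T" if "ereal T \<le> s (Suc 0)" for T
    unfolding g_def using stage_integral_eq(2)[OF st \<alpha> xi, of 0 0 T] s0 that by simp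
  have m\<epsilon>: "0 \<le> qm * \<epsilon>" "0 \<le> M / c0 * \<epsilon>" using qm_nonneg \<epsilon> M c0 by auto
  have We: "(lam * W - \<eta>) / lam = W - \<eta> / lam" using lam by (simp add: diff_divide_distrib)
  show "V x0 i0 - (\<eta> / lam + (10 * qm + 2 * (M / c0)) * \<epsilon>) \<le> thermostat_cost l lam \<alpha> x i"
  proof (cases "x0 \<le> \<epsilon>")
    case True
    have "(lam * W - \<eta>) / lam * exp (- lam * 0) - (10 * qm + M / c0) * \<epsilon> \<le> integral {0..} g"
      by (rule tail) (use s1[of 0] True y0 in \<open>auto simp: zero_ereal_def\<close>)
    moreover have "V x0 i0 \<le> W + M / c0 * x0" by (rule V_near_zero(1)) (use assms True \<epsilon> in auto)
    moreover have "M / c0 * x0 \<le> M / c0 * \<epsilon>" using True M c0 by (intro mult_left_mono) auto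
    ultimately show ?thesis unfolding ceq We by (simp add: distrib_right)
  next
    case big: False
    show ?thesis
    proof (cases "\<exists>t\<ge>0. y 0 t \<le> \<epsilon>")
      case True
      then obtain t where t: "0 \<le> t" "y 0 t \<le> \<epsilon>" by blast
      have "\<epsilon> < y 0 0" using big y0 by simp
      then obtain \<tau> where \<tau>: "0 < \<tau>" "y 0 \<tau> = \<epsilon>" "\<And>r. 0 \<le> r \<Longrightarrow> r < \<tau> \<Longrightarrow> \<epsilon> < y 0 r"
        using first_hit_down[OF path_continuous[OF p0[of t]] t(1) _ t(2)] by metis
      have \<tau>s: "ereal \<tau> \<le> s (Suc 0)"
      proof (rule s1)
        fix r assume "0 \<le> r" "r < \<tau>"
        then have "\<epsilon> < y 0 r" by (rule \<tau>(3))
        then show "- \<epsilon> \<le> y 0 r" using \<epsilon>(1) by linarith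
      qed
      have "exp (- lam * 0) * V (y 0 0) i0 \<le> cost i0 \<alpha> (y 0) 0 \<tau> + exp (- lam * \<tau>) * V (y 0 \<tau>) i0"
      proof (rule V_dynamic_programming[OF \<alpha> order_refl less_imp_le[OF \<tau>(1)] p0])
        fix r assume "0 < r" "r < \<tau>"
        then show "0 < y 0 r" using \<tau>(3)[of r] \<epsilon>(1) by linarith
      qed (use y0 assms \<tau> \<epsilon> in auto)
      moreover have "exp (- lam * \<tau>) * V (y 0 \<tau>) i0 \<le> exp (- lam * \<tau>) * (W + M / c0 * \<epsilon>)"
        using V_near_zero(1)[of \<epsilon> i0] \<epsilon> \<tau>(2) by (intro mult_left_mono) auto
      moreover have "exp (- lam * \<tau>) * (M / c0 * \<epsilon>) \<le> 1 * (M / c0 * \<epsilon>)"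
        using m\<epsilon> \<tau>(1) by (intro mult_right_mono exp_le_one) auto
      moreover have "exp (- lam * \<tau>) * (\<eta> / lam) \<le> 1 * (\<eta> / lam)"
        using \<eta> lam \<tau>(1) by (intro mult_right_mono exp_le_one) auto
      moreover have "(lam * W - \<eta>) / lam * exp (- lam * \<tau>) - (10 * qm + M / c0) * \<epsilon> \<le> integral {\<tau>..} g"
        by (rule tail) (use \<tau> \<tau>s in auto)
      moreover have "integral {0..} g = integral {0..\<tau>} g + integral {\<tau>..} g"
        unfolding g_def by (rule discounted_integral_split[OF bi lam]) (use \<tau> in auto)
      moreover have "v - (r + (10 * qm + 2 * k) * \<epsilon>) \<le> I"
        if "v \<le> c + e * v'" "e * v' \<le> e * (W + k * \<epsilon>)" "e * (k * \<epsilon>) \<le> 1 * (k * \<epsilon>)" "e * r \<le> 1 * r"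
          "(W - r) * e - (10 * qm + k) * \<epsilon> \<le> I2" "I = c + I2" for v r k c e v' I I2 :: real
        using that by (simp add: algebra_simps)
      ultimately show ?thesis unfolding ceq We initial[OF \<tau>s, symmetric] using y0
        by (simp only: mult_zero_right exp_zero mult_1_left)
    next
      case False
      have never: "\<epsilon> < y 0 t" if "0 \<le> t" for t using False that by force
      have "((\<lambda>T. V x0 i0 - M / lam * exp (- lam * T)) \<longlongrightarrow> V x0 i0 - 0) at_top"
        by (intro tendsto_diff tendsto_const tendsto_exp_minus_at_top lam)
      moreover have "((\<lambda>T. integral {0..T} g) \<longlongrightarrow> integral {0..} g) at_top"
        unfolding g_def by (rule tendsto_discounted[OF bi lam order_refl])
      moreover have "\<forall>\<^sub>F T in at_top. V x0 i0 - M / lam * exp (- lam * T) \<le> integral {0..T} g"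
        using eventually_ge_at_top[of 0]
      proof eventually_elim
        case (elim T)
        have pos: "0 < y 0 t" if "0 \<le> t" for t using never[OF that] \<epsilon>(1) by linarith
        have Ts: "ereal T \<le> s (Suc 0)" by (rule s1) (use pos \<epsilon>(1) in force)
        have "exp (- lam * 0) * V (y 0 0) i0 \<le> cost i0 \<alpha> (y 0) 0 T + exp (- lam * T) * V (y 0 T) i0"
          by (rule V_dynamic_programming[OF \<alpha> order_refl elim p0]) (use pos elim in \<open>auto simp: less_imp_le\<close>)
        moreover have "exp (- lam * T) * V (y 0 T) i0 \<le> exp (- lam * T) * (M / lam)"
          using pos[OF elim] by (intro mult_left_mono V_bounds) auto
        ultimately show ?case using y0 initial[OF Ts] by (simp add: mult.commute)
      qed
      ultimately have "V x0 i0 - 0 \<le> integral {0..} g"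
        by (intro tendsto_le[OF trivial_limit_at_top_linorder])
      moreover have "0 \<le> \<eta> / lam" using \<eta> lam by simp
      ultimately show ?thesis unfolding ceq using m\<epsilon> by (simp add: distrib_right)
    qed
  qed
qed

end

lemma eventually_at_right_small:
  "0 < b \<Longrightarrow> \<forall>\<^sub>F \<epsilon> in at_right (0::real). 0 < \<epsilon> \<and> \<epsilon> < b"
  unfolding eventually_at_right_field by auto

context junction_data
begin

lemma lower_bound_eventually:
  assumes "0 < \<delta>"
  shows "\<forall>\<^sub>F \<epsilon> in at_right 0. \<forall>x\<ge>0. \<forall>i. V x i - \<delta> \<le> Vt \<epsilon> x i"
proof -
  obtain q where q: "0 \<le> q B1 + q B2 + q B3" "\<And>i a. a \<in> A \<Longrightarrow> 0 \<le> l i 0 a - lam * W + q i * f i 0 a"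
    by (rule slopes_exist) blast
  \<comment> \<open>Half of \<open>\<delta>\<close> is for the loss \<open>\<eta> / lam\<close>,
    half for the terms of order \<open>\<epsilon>\<close>.\<close>
  define \<eta> where "\<eta> = \<delta> * lam / 2"
  have \<eta>: "0 < \<eta>" using assms lam by (simp add: \<eta>_def)
  have "\<exists>h>0. \<forall>k x a c. a \<in> A \<longrightarrow> - h \<le> x \<longrightarrow> x \<le> h \<longrightarrow> \<bar>c\<bar> \<le> h \<longrightarrow>
    \<bar>(G k x a - lam * W + q i * (F k x a - lam * (x - c))) - (l k 0 a - lam * W + q i * f k 0 a)\<bar> \<le> \<eta>" for i
    by (rule near_zero_uniform[OF \<eta>, where R = "lam * W" and p = "q i"]) blast
  then obtain hh where hh: "\<And>i. 0 < hh i" "\<And>i x a c. a \<in> A \<Longrightarrow> - hh i \<le> x \<Longrightarrow> x \<le> hh i \<Longrightarrow> \<bar>c\<bar> \<le> hh i \<Longrightarrow>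
    \<bar>(G i x a - lam * W + q i * (F i x a - lam * (x - c))) - (l i 0 a - lam * W + q i * f i 0 a)\<bar> \<le> \<eta>"
    by metis
  define h where "h = min (hh B1) (min (hh B2) (hh B3))"
  have h: "0 < h" "h \<le> hh i" for i using hh(1) by (auto simp: h_def) (cases i; simp)
  define C where "C = \<eta> / lam * (1 - exp (- lam * (h / (2 * M))))"
  have C: "0 < C" using \<eta> lam h(1) M by (simp add: C_def)
  define Q where "Q = \<bar>q B1\<bar> + \<bar>q B2\<bar> + \<bar>q B3\<bar>"
  define K where "K = 10 * Q + 2 * (M / c0) + 1"
  have K: "0 < K" "2 * (M / c0) \<le> K" using M c0 by (auto simp: K_def Q_def intro!: add_nonneg_pos)
  define b where "b = min h0 (min (h / 2) (min (C / K) (\<delta> / 2 / K)))"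
  have b: "0 < b" using h0 h(1) C K assms by (simp add: b_def)
  show ?thesis
    using eventually_at_right_small[OF b]
  proof eventually_elim
    case (elim \<epsilon>)
    have e: "\<epsilon> < h0" "2 * \<epsilon> \<le> h" "\<epsilon> < C / K" "\<epsilon> < \<delta> / 2 / K" using elim by (auto simp: b_def)
    have e': "\<epsilon> * K < C" "\<epsilon> * K < \<delta> / 2" using e(3,4) by (simp_all only: pos_less_divide_eq[OF K(1)])
    interpret st: small_threshold A f l lam M L c0 h0 am ap q \<eta> h \<epsilon>
    proof unfold_locales
      show "0 < \<eta>" "0 < h" "0 < \<epsilon>" "\<epsilon> < h0" "2 * \<epsilon> \<le> h" using \<eta> h elim e by auto
      show "0 \<le> q B1 + q B2 + q B3" by (rule q(1))
      have "2 * (M / c0) * \<epsilon> \<le> K * \<epsilon>" using K elim by (intro mult_right_mono) auto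
      also have "\<dots> \<le> C" using e'(1) by (simp add: mult.commute)
      finally show "2 * (M / c0) * \<epsilon> \<le> \<eta> / lam * (1 - exp (- lam * (h / (2 * M))))" unfolding C_def .
      show "- \<eta> \<le> G i x a - lam * W + q i * (F i x a - lam * (x - \<epsilon>))" if "a \<in> A" "- h \<le> x" "x \<le> h" for i x a
      proof -
        have "\<bar>(G i x a - lam * W + q i * (F i x a - lam * (x - \<epsilon>))) - (l i 0 a - lam * W + q i * f i 0 a)\<bar> \<le> \<eta>"
          by (rule hh(2)) (use that h(2)[of i] e elim in auto)
        then show ?thesis using q(2)[OF that(1), of i] by linarith
      qed
    qed
    have err: "\<eta> / lam + (10 * st.qm + 2 * (M / c0)) * \<epsilon> \<le> \<delta>"
    proof -
      have "(10 * st.qm + 2 * (M / c0)) * \<epsilon> \<le> K * \<epsilon>"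
        using elim by (intro mult_right_mono) (auto simp: K_def Q_def st.qm_def)
      then show ?thesis using e'(2) lam by (simp add: \<eta>_def mult.commute)
    qed
    have "V x i - \<delta> \<le> Vt \<epsilon> x i" if "0 \<le> x" for x i
      using order_trans[OF diff_left_mono[OF err] st.thermostat_lower[OF that]] .
    then show ?case by blast
  qed
qed

section \<open>The upper bound\<close>

text \<open>Descend to \<open>- \<epsilon>\<close> with \<open>am i\<close>, keep it for the time
  \<open>\<epsilon> / M\<close> so that the switch takes place, and return to \<open>0\<close> on
  the next branch from at most \<open>2 * \<epsilon>\<close>; the three costs are at most
  \<open>M / c0 * \<epsilon>\<close>, \<open>\<epsilon>\<close> and
  \<open>2 * M / c0 * \<epsilon>\<close>. One direction of the cycle suffices to compare any two
  branches.\<close>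

lemma Vt_zero_succ:
  assumes "0 < \<epsilon>" "2 * \<epsilon> < h0"
  shows "Vt \<epsilon> 0 i \<le> Vt \<epsilon> 0 (succ_branch i) + (3 * M / c0 + 1) * \<epsilon>"
proof -
  have d0: "(0::real) < h0" "- \<epsilon> \<le> 0" using h0 assms by auto
  obtain z \<tau> where z: "0 \<le> \<tau>" "\<tau> \<le> (0 - - \<epsilon>) / c0" "path i (\<lambda>_. am i) z 0 \<tau>" "z 0 = 0" "z \<tau> = - \<epsilon>"
    "\<And>t. 0 \<le> t \<Longrightarrow> t < \<tau> \<Longrightarrow> - \<epsilon> < z t"
    using descend[OF am(1) c0 am_neg d0] by metis
  have zlow: "- \<epsilon> \<le> z t" if "0 \<le> t" "t \<le> \<tau>" for t using z(5,6) that by (cases "t = \<tau>") (auto simp: less_imp_le)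
  note ci = controls_const[OF am(1)]
  obtain w where w: "w 0 = \<epsilon>" "\<And>T. path (succ_branch i) (\<lambda>_. am i) w 0 T"
    using path_exists[OF ci order_refl] by metis
  define \<theta> where "\<theta> = \<epsilon> / M"
  have \<theta>: "0 < \<theta>" using assms M by (simp add: \<theta>_def)
  have wb: "\<bar>w t - \<epsilon>\<bar> \<le> \<epsilon>" if "0 \<le> t" "t \<le> \<theta>" for t
  proof -
    have "\<bar>w t - w 0\<bar> \<le> M * (t - 0)" by (rule path_lipschitz[OF w(2)[of t] ci]) (use that in auto)
    also have "\<dots> \<le> M * \<theta>" using that M by simp
    finally show ?thesis using w(1) M by (simp add: \<theta>_def)
  qed
  have w\<theta>: "0 \<le> w \<theta>" "w \<theta> \<le> 2 * \<epsilon>" using wb[of \<theta>] \<theta> by auto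
  have d1: "w \<theta> < h0" using w\<theta> assms by simp
  obtain y \<sigma> where y: "0 \<le> \<sigma>" "\<sigma> \<le> (w \<theta> - 0) / c0" "path (succ_branch i) (\<lambda>_. am (succ_branch i)) y 0 \<sigma>" "y 0 = w \<theta>" "y \<sigma> = 0"
    "\<And>t. 0 \<le> t \<Longrightarrow> t < \<sigma> \<Longrightarrow> 0 < y t"
    using descend[OF am(1) c0 am_neg d1 w\<theta>(1)] by metis
  have ylow: "- \<epsilon> \<le> y t" if "0 \<le> t" "t \<le> \<sigma>" for t using y(5) y(6)[OF that(1)] that assms(1) by (cases "t = \<sigma>") auto
  have fneg: "f i 0 (am i) < 0" using am(2)[of 0 i] h0 c0 by simp
  have wlow: "- \<epsilon> \<le> w t" if "0 \<le> t" "t \<le> \<theta>" for t using wb[OF that] assms(1) by linarith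
  have "Vt \<epsilon> (z 0) i \<le> cost i (\<lambda>_. am i) z 0 \<tau> + exp (- lam * \<tau>) *
      (cost (succ_branch i) (\<lambda>_. am i) w 0 \<theta> + exp (- lam * \<theta>) * Vt \<epsilon> (w \<theta>) (succ_branch i))"
    by (rule Vt_switch[OF ci z(1) assms(1) z(3) zlow z(5) am(1) fneg \<theta> w(2,1) wlow])
  also have "\<dots> \<le> M * (\<tau> - 0) + 1 * (M * (\<theta> - 0) + 1 * Vt \<epsilon> (w \<theta>) (succ_branch i))"
    using w\<theta>(1) assms(1) \<theta> z(1)
    by (intro add_mono mult_mono cost_le[OF ci] path_continuous[OF z(3)] path_continuous[OF w(2)] exp_le_one
         add_nonneg_nonneg mult_nonneg_nonneg cost_nonneg[OF ci] Vt_bounds) auto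
  finally have 1: "Vt \<epsilon> 0 i \<le> M * \<tau> + M * \<theta> + Vt \<epsilon> (w \<theta>) (succ_branch i)" using z(4) by simp
  have "exp (- lam * 0) * Vt \<epsilon> (y 0) (succ_branch i) \<le> cost (succ_branch i) (\<lambda>_. am (succ_branch i)) y 0 \<sigma> + exp (- lam * \<sigma>) * Vt \<epsilon> (y \<sigma>) (succ_branch i)"
    by (rule Vt_dynamic_programming[OF controls_const[OF am(1)] order_refl y(1,3) assms(1) ylow])
  also have "\<dots> \<le> M * (\<sigma> - 0) + 1 * Vt \<epsilon> (y \<sigma>) (succ_branch i)"
    using y(1,5) assms(1)
    by (intro add_mono mult_right_mono cost_le[OF controls_const[OF am(1)]] path_continuous[OF y(3)] exp_le_one Vt_bounds) auto
  finally have 2: "Vt \<epsilon> (w \<theta>) (succ_branch i) \<le> M * \<sigma> + Vt \<epsilon> 0 (succ_branch i)" using y(4,5) by simp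
  have "M * \<tau> \<le> M * (\<epsilon> / c0)" using z(2) M by (intro mult_left_mono) auto
  moreover have "\<sigma> \<le> 2 * \<epsilon> / c0" using y(2) w\<theta>(2) c0 by (simp add: field_simps)
  then have "M * \<sigma> \<le> M * (2 * \<epsilon> / c0)" using M by (intro mult_left_mono) auto
  moreover have "M * \<theta> = \<epsilon>" using M by (simp add: \<theta>_def)
  moreover have "(3 * M / c0 + 1) * \<epsilon> = M * (\<epsilon> / c0) + M * (2 * \<epsilon> / c0) + \<epsilon>" by (simp add: field_simps)
  ultimately show ?thesis using 1 2 by linarith
qed

text \<open>The label switches only when the state goes strictly below \<open>- \<epsilon>\<close>. The proof therefore keeps the
  control \<open>a i\<close> for a further time \<open>\<epsilon>\<^sup>2\<close> after \<open>- \<epsilon>\<close> is reached, that is, on the next branch, at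
  the price of the term \<open>K * \<epsilon>\<^sup>2\<close>.\<close>

lemma triple_step:
  assumes a: "\<And>i. a i \<in> A" "\<And>i. f i 0 (a i) < 0" and "0 < \<kappa>" "0 \<le> R"
    and base: "\<And>i. l i 0 (a i) - R + p i * f i 0 (a i) \<le> - 2 * \<kappa>"
  obtains b K where "0 < b"
    "\<And>\<epsilon> i. 0 < \<epsilon> \<Longrightarrow> \<epsilon> < b \<Longrightarrow> (\<And>j. R / lam \<le> Vt \<epsilon> 0 j) \<Longrightarrow>
       Vt \<epsilon> 0 i \<le> Vt \<epsilon> 0 (succ_branch i) + (p i + p (succ_branch i)) * \<epsilon> + K * \<epsilon>\<^sup>2 - \<kappa> / (2 * M) * \<epsilon>"
proof -
  \<comment> \<open>Half of the smallest speed at the junction; by the Lipschitz bound each control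
    keeps at least the speed \<open>c1\<close> up to height \<open>c1 / L\<close>.\<close>
  define c1 where "c1 = min (- f B1 0 (a B1)) (min (- f B2 0 (a B2)) (- f B3 0 (a B3))) / 2"
  have c1: "0 < c1" using a(2) by (simp add: c1_def)
  have c1': "f i 0 (a i) \<le> - 2 * c1" for i by (cases i) (auto simp: c1_def)
  have down: "F i y (a i) \<le> - c1" if "y \<le> c1 / L" for y i
  proof (cases "0 \<le> y")
    case True
    have "\<bar>F i y (a i) - F i 0 (a i)\<bar> \<le> L * \<bar>y - 0\<bar>" by (rule F_lip[OF a(1)])
    also have "\<dots> \<le> L * (c1 / L)" using that True L by (intro mult_left_mono) auto
    finally show ?thesis using L c1'[of i] by simp
  next
    case False
    then show ?thesis using c1 c1'[of i] by (simp add: F_nonpos)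
  qed
  have "\<exists>h>0. \<forall>k x a c. a \<in> A \<longrightarrow> - h \<le> x \<longrightarrow> x \<le> h \<longrightarrow> \<bar>c\<bar> \<le> h \<longrightarrow>
    \<bar>(G k x a - R + p i * (F k x a - lam * (x - c))) - (l k 0 a - R + p i * f k 0 a)\<bar> \<le> \<kappa>" for i
    by (rule near_zero_uniform[OF \<open>0 < \<kappa>\<close>, where R = R and p = "p i"]) blast
  then obtain hh where hh: "\<And>i. 0 < hh i" "\<And>i x a c. a \<in> A \<Longrightarrow> - hh i \<le> x \<Longrightarrow> x \<le> hh i \<Longrightarrow> \<bar>c\<bar> \<le> hh i \<Longrightarrow>
    \<bar>(G i x a - R + p i * (F i x a - lam * (x - c))) - (l i 0 a - R + p i * f i 0 a)\<bar> \<le> \<kappa>"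
    by metis
  define h where "h = min (hh B1) (min (hh B2) (hh B3))"
  have h: "0 < h" "h \<le> hh i" for i using hh(1) by (auto simp: h_def) (cases i; simp)
  have corr: "G i x (a i) - R + p i * (F i x (a i) - lam * (x - 0)) \<le> - \<kappa>" if "- h \<le> x" "x \<le> h" for i x
  proof -
    have "\<bar>(G i x (a i) - R + p i * (F i x (a i) - lam * (x - 0))) - (l i 0 (a i) - R + p i * f i 0 (a i))\<bar> \<le> \<kappa>"
      by (rule hh(2)[OF a(1)]) (use that h(2)[of i] h(1) in auto)
    then show ?thesis using base[of i] by linarith
  qed
  define pm where "pm = \<bar>p B1\<bar> + \<bar>p B2\<bar> + \<bar>p B3\<bar>"
  have pm: "\<bar>p i\<bar> \<le> pm" "0 \<le> pm" for i by (cases i; simp add: pm_def) (simp add: pm_def)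
  \<comment> \<open>The summands are the second order errors: discounting of the boundary term on
    branch \<open>i\<close>, cost of the overshoot \<open>\<theta>\<close>, and overshoot and
    discounting on the next branch.\<close>
  define K where "K = pm * (lam / c1) + M + pm * (M + lam * (1 / c1 + 1))"
  define b where "b = min (min 1 (1 / M)) (min (h / 2) (min (c1 / L / 2) (M / lam)))"
  have b: "0 < b" using M h(1) c1 L lam by (simp add: b_def)
  show thesis
  proof (rule that[OF b])
    fix \<epsilon> i assume e0: "0 < \<epsilon>" and eb: "\<epsilon> < b" and vj: "\<And>j. R / lam \<le> Vt \<epsilon> 0 j"
    have e: "\<epsilon> < 1" "\<epsilon> * M < 1" "2 * \<epsilon> < h" "2 * \<epsilon> < c1 / L" "\<epsilon> * lam < M"
      using eb M lam by (simp_all add: b_def pos_less_divide_eq)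
    define \<theta> where "\<theta> = \<epsilon>\<^sup>2"
    have \<theta>: "0 < \<theta>" "\<theta> \<le> \<epsilon>" "M * \<theta> \<le> \<epsilon>"
    proof -
      show "0 < \<theta>" using e0 by (simp add: \<theta>_def)
      show "\<theta> \<le> \<epsilon>" using mult_left_mono[of \<epsilon> 1 \<epsilon>] e0 e(1) by (simp add: \<theta>_def power2_eq_square)
      show "M * \<theta> \<le> \<epsilon>" using mult_left_mono[of "\<epsilon> * M" 1 \<epsilon>] e0 e(2) by (simp add: \<theta>_def power2_eq_square mult_ac)
    qed
    define j where "j = succ_branch i"
    have z0: "(0::real) < c1 / L" "- \<epsilon> \<le> 0" using c1 L e0 by auto
    obtain z \<tau> where z: "0 \<le> \<tau>" "\<tau> \<le> (0 - - \<epsilon>) / c1" "path i (\<lambda>_. a i) z 0 \<tau>" "z 0 = 0" "z \<tau> = - \<epsilon>"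
      "\<And>t. 0 \<le> t \<Longrightarrow> t < \<tau> \<Longrightarrow> - \<epsilon> < z t" "\<And>t. 0 \<le> t \<Longrightarrow> t \<le> \<tau> \<Longrightarrow> z t \<le> 0"
      using descend[OF a(1) c1 down z0] by metis
    have zlow: "- \<epsilon> \<le> z t" if "0 \<le> t" "t \<le> \<tau>" for t using z(5,6) that by (cases "t = \<tau>") (auto simp: less_imp_le)
    note ci = controls_const[OF a(1)]
    obtain w where w: "w 0 = \<epsilon>" "\<And>T. path j (\<lambda>_. a i) w 0 T"
      using path_exists[OF ci order_refl] by metis
    have wb: "\<bar>w t - \<epsilon>\<bar> \<le> M * \<theta>" if "0 \<le> t" "t \<le> \<theta>" for t
    proof -
      have "\<bar>w t - w 0\<bar> \<le> M * (t - 0)" by (rule path_lipschitz[OF w(2)[of t] ci]) (use that in auto)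
      also have "\<dots> \<le> M * \<theta>" using that M by simp
      finally show ?thesis using w(1) by simp
    qed
    have wlow: "- \<epsilon> \<le> w t" if "0 \<le> t" "t \<le> \<theta>" for t using wb[OF that] \<theta>(3) e0 by linarith
    have w\<theta>: "\<bar>w \<theta> - \<epsilon>\<bar> \<le> M * \<theta>" "0 \<le> w \<theta>" "w \<theta> \<le> 2 * \<epsilon>" using wb[of \<theta>] \<theta> by auto
    have "w \<theta> < c1 / L" using w\<theta> e by simp
    then obtain y \<sigma> where y: "0 \<le> \<sigma>" "\<sigma> \<le> (w \<theta> - 0) / c1" "path j (\<lambda>_. a j) y 0 \<sigma>" "y 0 = w \<theta>" "y \<sigma> = 0"
      "\<And>t. 0 \<le> t \<Longrightarrow> t < \<sigma> \<Longrightarrow> 0 < y t" "\<And>t. 0 \<le> t \<Longrightarrow> t \<le> \<sigma> \<Longrightarrow> y t \<le> w \<theta>"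
      using descend[OF a(1) c1 down _ w\<theta>(2)] by metis
    have ylow: "0 \<le> y t" if "0 \<le> t" "t \<le> \<sigma>" for t using y(5) y(6)[OF that(1)] that by (cases "t = \<sigma>") auto
    define e1 e2 e3 where ee: "e1 = exp (- lam * \<tau>)" "e2 = exp (- lam * \<theta>)" "e3 = exp (- lam * \<sigma>)"
    have e01: "0 \<le> e1" "e1 \<le> 1" "0 \<le> e2" "e2 \<le> 1" "0 \<le> e3" "e3 \<le> 1"
      using exp_le_one z(1) y(1) \<theta>(1) by (auto simp: ee simp del: mult_minus_left)
    define v v' r where vv: "v = Vt \<epsilon> 0 i" "v' = Vt \<epsilon> 0 j" "r = R / lam"
    have r: "0 \<le> r" "r \<le> v'" using \<open>0 \<le> R\<close> lam vj by (simp_all add: vv)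
    have 1: "v \<le> cost i (\<lambda>_. a i) z 0 \<tau> + e1 * (cost j (\<lambda>_. a i) w 0 \<theta> + e2 * Vt \<epsilon> (w \<theta>) j)"
      using Vt_switch[OF ci z(1) e0 z(3) zlow z(5) a(1,2) \<theta>(1) w(2)[unfolded j_def] w(1) wlow] z(4)
      by (simp add: vv ee j_def)
    \<comment> \<open>With centre \<open>0\<close> the corrector contributes
      \<open>p i * \<epsilon>\<close> from \<open>0\<close> down to \<open>- \<epsilon>\<close> and
      later \<open>p j * \<epsilon>\<close> from about \<open>\<epsilon>\<close> down to
      \<open>0\<close>, up to second order; along the cycle each slope is counted twice.\<close>
    have "cost i (\<lambda>_. a i) z 0 \<tau> \<le> (R + - \<kappa>) / lam * (exp (- lam * 0) - exp (- lam * \<tau>)) - p i * (exp (- lam * \<tau>) * (z \<tau> - 0) - exp (- lam * 0) * (z 0 - 0))"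
    proof (rule corrected_cost_le[OF ci z(3) order_refl z(1)])
      fix t assume t: "0 \<le> t" "t \<le> \<tau>"
      show "G i (z t) (a i) - R + p i * (F i (z t) (a i) - lam * (z t - 0)) \<le> - \<kappa>"
        by (rule corr) (use zlow[OF t] z(7)[OF t] e h in auto)
    qed
    then have c1b: "cost i (\<lambda>_. a i) z 0 \<tau> \<le> (r - \<kappa> / lam) * (1 - e1) + p i * (e1 * \<epsilon>)"
      using z(4,5) by (simp add: ee vv diff_divide_distrib)
    have c2b: "cost j (\<lambda>_. a i) w 0 \<theta> \<le> M * \<theta>"
      using cost_le[OF ci path_continuous[OF w(2)] order_refl less_imp_le[OF \<theta>(1)]] by simp
    have "cost j (\<lambda>_. a j) y 0 \<sigma> \<le> (R + - \<kappa>) / lam * (exp (- lam * 0) - exp (- lam * \<sigma>)) - p j * (exp (- lam * \<sigma>) * (y \<sigma> - 0) - exp (- lam * 0) * (y 0 - 0))"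
    proof (rule corrected_cost_le[OF ci y(3) order_refl y(1)])
      fix t assume t: "0 \<le> t" "t \<le> \<sigma>"
      show "G j (y t) (a j) - R + p j * (F j (y t) (a j) - lam * (y t - 0)) \<le> - \<kappa>"
        by (rule corr) (use ylow[OF t] y(7)[OF t] w\<theta> e h(1) in auto)
    qed
    then have "cost j (\<lambda>_. a j) y 0 \<sigma> \<le> (r - \<kappa> / lam) * (1 - e3) + p j * w \<theta>"
      using y(4,5) by (simp add: ee vv diff_divide_distrib)
    \<comment> \<open>The deficit \<open>\<kappa>\<close> is given up on this piece; the gain on the
      piece before the switch is already of order \<open>\<epsilon>\<close>.\<close>
    moreover have "0 \<le> \<kappa> / lam * (1 - e3)" using \<open>0 < \<kappa>\<close> lam e01 by (intro mult_nonneg_nonneg) auto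
    ultimately have c3b: "cost j (\<lambda>_. a j) y 0 \<sigma> \<le> r * (1 - e3) + p j * w \<theta>" by (simp only: left_diff_distrib[of r]; linarith)
    have "exp (- lam * 0) * Vt \<epsilon> (y 0) j \<le> cost j (\<lambda>_. a j) y 0 \<sigma> + exp (- lam * \<sigma>) * Vt \<epsilon> (y \<sigma>) j"
      by (rule Vt_dynamic_programming[OF ci order_refl y(1,3) e0]) (use ylow e0 in force)
    then have "Vt \<epsilon> (w \<theta>) j \<le> cost j (\<lambda>_. a j) y 0 \<sigma> + e3 * v'" using y(4,5) by (simp add: ee vv)
    moreover have "r * (1 - e3) + e3 * v' \<le> v'"
    proof -
      have "r * (1 - e3) \<le> v' * (1 - e3)" using r e01 by (intro mult_right_mono) auto
      then show ?thesis by (simp add: algebra_simps)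
    qed
    ultimately have 2: "Vt \<epsilon> (w \<theta>) j \<le> v' + p j * w \<theta>" using c3b by linarith
    have "e1 * (cost j (\<lambda>_. a i) w 0 \<theta> + e2 * Vt \<epsilon> (w \<theta>) j) \<le> e1 * (M * \<theta> + e2 * (v' + p j * w \<theta>))"
      using c2b 2 e01 by (intro mult_left_mono add_mono) auto
    moreover have "e1 * (M * \<theta>) \<le> 1 * (M * \<theta>)" using e01 M \<theta> by (intro mult_right_mono) auto
    moreover have "r * (1 - e1) \<le> v' * (1 - e1)" using r e01 by (intro mult_right_mono) auto
    moreover have "e1 * (e2 * v') \<le> e1 * (1 * v')" using r e01 by (intro mult_left_mono mult_right_mono) auto
    ultimately have 3: "v \<le> v' - \<kappa> / lam * (1 - e1) + p i * (e1 * \<epsilon>) + M * \<theta> + e1 * e2 * (p j * w \<theta>)"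
      using 1 c1b by (simp only: left_diff_distrib[of r] distrib_left mult.assoc right_diff_distrib[of v'] mult_1_left mult.commute[of v' e1] mult_1_right; linarith)
    have e1low: "1 - e1 \<le> lam * (\<epsilon> / c1)"
    proof -
      have "1 - e1 \<le> lam * \<tau>" using exp_ge_add_one_self[of "- lam * \<tau>"] by (simp add: ee)
      also have "\<dots> \<le> lam * (\<epsilon> / c1)" using z(2) lam by (intro mult_left_mono) auto
      finally show ?thesis .
    qed
    have e12low: "1 - e1 * e2 \<le> lam * (1 / c1 + 1) * \<epsilon>"
    proof -
      have "e1 * e2 = exp (- lam * (\<tau> + \<theta>))" by (simp add: ee algebra_simps flip: exp_add)
      then have "1 - e1 * e2 \<le> lam * (\<tau> + \<theta>)" using exp_ge_add_one_self[of "- lam * (\<tau> + \<theta>)"] by simp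
      also have "\<dots> \<le> lam * (\<epsilon> / c1 + \<epsilon>)" using z(2) \<theta>(2) lam by (intro mult_left_mono add_mono) auto
      finally show ?thesis by (simp add: algebra_simps)
    qed
    have 4: "p i * (e1 * \<epsilon>) \<le> p i * \<epsilon> + pm * (lam / c1) * \<epsilon>\<^sup>2"
    proof -
      have "p i * (e1 * \<epsilon>) - p i * \<epsilon> = - (p i * ((1 - e1) * \<epsilon>))" by (simp add: algebra_simps)
      also have "\<dots> \<le> \<bar>p i\<bar> * ((1 - e1) * \<epsilon>)"
        using abs_le_D2[of "p i * ((1 - e1) * \<epsilon>)"] e01 e0 by (simp add: abs_mult)
      also have "\<dots> \<le> pm * ((lam * (\<epsilon> / c1)) * \<epsilon>)"
      proof (rule mult_mono[OF pm(1) _ pm(2)])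
        show "(1 - e1) * \<epsilon> \<le> lam * (\<epsilon> / c1) * \<epsilon>" using e1low e0 by (intro mult_right_mono) auto
      qed (use e0 e01 in auto)
      finally show ?thesis by (simp add: power2_eq_square)
    qed
    have 5: "e1 * e2 * (p j * w \<theta>) \<le> p j * \<epsilon> + pm * (M + lam * (1 / c1 + 1)) * \<epsilon>\<^sup>2"
    proof -
      have e12: "0 \<le> e1 * e2" "e1 * e2 \<le> 1" using e01 by (auto intro: mult_le_one)
      have "e1 * e2 * (p j * w \<theta>) - p j * \<epsilon> = p j * (e1 * e2 * (w \<theta> - \<epsilon>) - (1 - e1 * e2) * \<epsilon>)" by (simp add: algebra_simps)
      also have "\<dots> \<le> \<bar>p j\<bar> * \<bar>e1 * e2 * (w \<theta> - \<epsilon>) - (1 - e1 * e2) * \<epsilon>\<bar>" by (simp flip: abs_mult)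
      also have "\<dots> \<le> pm * (M * \<theta> + lam * (1 / c1 + 1) * \<epsilon> * \<epsilon>)"
      proof (intro mult_mono pm)
        have "\<bar>e1 * e2 * (w \<theta> - \<epsilon>)\<bar> \<le> 1 * (M * \<theta>)"
          using e12 w\<theta>(1) by (simp only: abs_mult) (intro mult_mono, auto)
        moreover have "\<bar>(1 - e1 * e2) * \<epsilon>\<bar> \<le> lam * (1 / c1 + 1) * \<epsilon> * \<epsilon>"
          using e12 e12low e0 by (simp add: abs_mult)
        ultimately show "\<bar>e1 * e2 * (w \<theta> - \<epsilon>) - (1 - e1 * e2) * \<epsilon>\<bar> \<le> M * \<theta> + lam * (1 / c1 + 1) * \<epsilon> * \<epsilon>" by linarith
      qed auto
      finally show ?thesis by (simp add: \<theta>_def power2_eq_square algebra_simps)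
    qed
    \<comment> \<open>The gain of one step: reaching \<open>- \<epsilon>\<close> takes at least the
      time \<open>\<epsilon> / M\<close>, and \<open>1 - exp (- u) \<ge> u / 2\<close> for
      \<open>0 < u \<le> 1\<close>.\<close>
    have 6: "\<kappa> / (2 * M) * \<epsilon> \<le> \<kappa> / lam * (1 - e1)"
    proof -
      define u where "u = lam * \<epsilon> / M"
      have u: "0 < u" "u \<le> 1" using lam e0 M e(5) by (simp_all add: u_def mult.commute)
      have "\<epsilon> \<le> M * (\<tau> - 0)" using path_lipschitz[OF z(3) ci order_refl order_refl z(1) order_refl] z(4,5) e0 by simp
      then have "u \<le> lam * \<tau>" using lam M by (simp add: u_def field_simps)
      then have "e1 \<le> exp (- u)" by (simp add: ee)
      also have "exp (- u) \<le> 1 / (1 + u)"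
        using exp_ge_add_one_self[of u] u by (simp add: exp_minus inverse_eq_divide frac_le)
      also have "\<dots> \<le> 1 - u / 2" using u by (simp add: field_simps power2_eq_square)
      finally have "\<kappa> / lam * (u / 2) \<le> \<kappa> / lam * (1 - e1)" using \<open>0 < \<kappa>\<close> lam by (intro mult_left_mono) auto
      then show ?thesis using lam by (simp add: u_def)
    qed
    have "v \<le> v' + (p i + p j) * \<epsilon> + K * \<epsilon>\<^sup>2 - \<kappa> / (2 * M) * \<epsilon>"
      using 3 4 5 6 unfolding K_def \<theta>_def[symmetric] by (simp only: distrib_right; linarith)
    then show "Vt \<epsilon> 0 i \<le> Vt \<epsilon> 0 (succ_branch i) + (p i + p (succ_branch i)) * \<epsilon> + K * \<epsilon>\<^sup>2 - \<kappa> / (2 * M) * \<epsilon>"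
      by (simp add: vv j_def)
  qed
qed

text \<open>With \<open>\<rho>\<close> the cost of the triple, the slopes \<open>p i\<close> that
  level the three corrected running costs to \<open>\<rho>\<close> at the junction have sum zero,
  which characterises the weights \<open>\<mu>\<close>. Adding the step inequality over the cycle
  cancels values and slopes and leaves a contradiction for small \<open>\<epsilon>\<close>.\<close>

lemma triple_upper:
  assumes fr: "\<exists>\<^sub>F \<epsilon> in at_right 0. \<forall>j. R / lam \<le> Vt \<epsilon> 0 j" and "0 \<le> R"
    and a: "a1 \<in> A" "a2 \<in> A" "a3 \<in> A" "f B1 0 a1 < 0" "f B2 0 a2 < 0" "f B3 0 a3 < 0"
  shows "R \<le> l0 f l (Inl (a1, a2, a3))"
proof (rule ccontr)
  define g1 g2 g3 where g: "g1 = f B1 0 a1" "g2 = f B2 0 a2" "g3 = f B3 0 a3"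
  define D where "D = g2 * g3 + g1 * g3 + g1 * g2"
  have gn: "g1 < 0" "g2 < 0" "g3 < 0" using a g by auto
  have D: "0 < D" using gn by (auto simp: D_def intro!: add_pos_pos mult_neg_neg)
  define \<rho> where "\<rho> = (g2 * g3 * l B1 0 a1 + g1 * g3 * l B2 0 a2 + g1 * g2 * l B3 0 a3) / D"
  have "l0 f l (Inl (a1, a2, a3)) = \<rho>" by (simp add: Let_def g D_def add_divide_distrib \<rho>_def)
  moreover assume "\<not> R \<le> l0 f l (Inl (a1, a2, a3))"
  ultimately have "\<rho> < R" by simp
  define \<kappa> where "\<kappa> = (R - \<rho>) / 2"
  have \<kappa>: "0 < \<kappa>" using \<open>\<rho> < R\<close> by (simp add: \<kappa>_def)
  define a where "a i = (case i of B1 \<Rightarrow> a1 | B2 \<Rightarrow> a2 | B3 \<Rightarrow> a3)" for i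
  define p where "p i = (l i 0 (a i) - \<rho>) / (- f i 0 (a i))" for i
  have aA: "a i \<in> A" "f i 0 (a i) < 0" for i using assms(3-8) by (cases i; simp add: a_def)+
  have base: "l i 0 (a i) - R + p i * f i 0 (a i) \<le> - 2 * \<kappa>" for i
  proof -
    have "p i * f i 0 (a i) = - (l i 0 (a i) - \<rho>)" using aA(2)[of i] by (simp add: p_def)
    then show ?thesis by (simp add: \<kappa>_def)
  qed
  have psum: "p B1 + p B2 + p B3 = 0"
  proof -
    have "\<rho> * D = g2 * g3 * l B1 0 a1 + g1 * g3 * l B2 0 a2 + g1 * g2 * l B3 0 a3" using D by (simp add: \<rho>_def)
    then have "g2 * g3 * (l B1 0 a1 - \<rho>) + g1 * g3 * (l B2 0 a2 - \<rho>) + g1 * g2 * (l B3 0 a3 - \<rho>) = 0"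
      by (simp add: D_def algebra_simps)
    moreover have "p B1 + p B2 + p B3 = (g2 * g3 * (l B1 0 a1 - \<rho>) + g1 * g3 * (l B2 0 a2 - \<rho>) + g1 * g2 * (l B3 0 a3 - \<rho>)) / (- (g1 * g2 * g3))"
      using gn by (simp add: p_def a_def g[symmetric] field_simps)
    ultimately show ?thesis by simp
  qed
  obtain b K where b: "0 < b" and step: "\<And>\<epsilon> i. 0 < \<epsilon> \<Longrightarrow> \<epsilon> < b \<Longrightarrow> (\<And>j. R / lam \<le> Vt \<epsilon> 0 j) \<Longrightarrow>
       Vt \<epsilon> 0 i \<le> Vt \<epsilon> 0 (succ_branch i) + (p i + p (succ_branch i)) * \<epsilon> + K * \<epsilon>\<^sup>2 - \<kappa> / (2 * M) * \<epsilon>"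
    by (rule triple_step[OF aA \<kappa> \<open>0 \<le> R\<close> base]) blast
  \<comment> \<open>Makes \<open>K * \<epsilon>\<^sup>2\<close> smaller than the gain
    \<open>\<kappa> / (2 * M) * \<epsilon>\<close>.\<close>
  define b' where "b' = min b (\<kappa> / (2 * M) / (\<bar>K\<bar> + 1))"
  have "0 < b'" using b \<kappa> M by (simp add: b'_def)
  then have "\<exists>\<^sub>F \<epsilon> in at_right 0. (\<forall>j. R / lam \<le> Vt \<epsilon> 0 j) \<and> (0 < \<epsilon> \<and> \<epsilon> < b')"
    by (intro frequently_eventually_frequently[OF fr] eventually_at_right_small)
  then obtain \<epsilon> where e: "\<And>j. R / lam \<le> Vt \<epsilon> 0 j" "0 < \<epsilon>" "\<epsilon> < b'" using frequently_ex by blast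
  have eb: "\<epsilon> < b" "\<epsilon> * (\<bar>K\<bar> + 1) < \<kappa> / (2 * M)"
  proof -
    have "\<epsilon> < b \<and> \<epsilon> < \<kappa> / (2 * M) / (\<bar>K\<bar> + 1)" using e(3) unfolding b'_def min_less_iff_conj .
    moreover have "0 < \<bar>K\<bar> + 1" by simp
    ultimately show "\<epsilon> < b" "\<epsilon> * (\<bar>K\<bar> + 1) < \<kappa> / (2 * M)" by (simp_all only: pos_less_divide_eq)
  qed
  have "K * \<epsilon> \<le> \<epsilon> * (\<bar>K\<bar> + 1)" using e(2) by (simp add: algebra_simps abs_if)
  then have "K * \<epsilon> < \<kappa> / (2 * M)" using eb(2) by linarith
  then have "(K * \<epsilon>) * \<epsilon> < \<kappa> / (2 * M) * \<epsilon>" using e(2) by (rule mult_strict_right_mono)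
  then have "K * \<epsilon>\<^sup>2 - \<kappa> / (2 * M) * \<epsilon> < 0" by (simp add: power2_eq_square)
  moreover have "(p B1 + p B2) * \<epsilon> + (p B2 + p B3) * \<epsilon> + (p B3 + p B1) * \<epsilon> = 2 * (p B1 + p B2 + p B3) * \<epsilon>"
    by (simp add: algebra_simps)
  moreover note step[OF e(2) eb(1) e(1), of B1] step[OF e(2) eb(1) e(1), of B2] step[OF e(2) eb(1) e(1), of B3]
  ultimately show False using psum by simp
qed

text \<open>Dynamic programming along the constant path at \<open>0\<close> up to time
  \<open>1\<close>; the time is arbitrary, as both sides carry the factor
  \<open>1 - exp (- lam)\<close>.\<close>

lemma stationary_upper:
  assumes "0 < \<epsilon>" "a \<in> A" "f i 0 a = 0"
  shows "lam * Vt \<epsilon> 0 i \<le> l i 0 a"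
proof -
  have p: "path i (\<lambda>_. a) (\<lambda>_. 0) 0 1"
    unfolding path_def primitive_on_def using assms(3) by simp
  have "exp (- lam * 0) * Vt \<epsilon> 0 i \<le> cost i (\<lambda>_. a) (\<lambda>_. 0) 0 1 + exp (- lam * 1) * Vt \<epsilon> 0 i"
    using Vt_dynamic_programming[OF controls_const[OF assms(2)] order_refl _ p assms(1)] assms(1) by simp
  moreover have "cost i (\<lambda>_. a) (\<lambda>_. 0) 0 1 = l i 0 a / lam * (exp (- lam * 0) - exp (- lam * 1))"
    unfolding cost_def using integral_unique[OF has_integral_exp_const[of lam 0 1 "l i 0 a"]] lam by simp
  ultimately have "Vt \<epsilon> 0 i * (1 - exp (- lam)) \<le> l i 0 a / lam * (1 - exp (- lam))" by (simp add: algebra_simps)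
  moreover have "0 < 1 - exp (- lam)" using lam by simp
  ultimately have "Vt \<epsilon> 0 i \<le> l i 0 a / lam" by (rule mult_right_le_imp_le)
  then show ?thesis using lam by (simp add: pos_le_divide_eq mult.commute)
qed

text \<open>A triple with one vanishing drift puts its whole weight on that branch, so it costs as
  much as a stationary control there; all other triples in \<open>A0\<close> have three negative
  drifts.\<close>

lemma junction_stationary_upper:
  assumes fr: "\<exists>\<^sub>F \<epsilon> in at_right 0. \<forall>j. R / lam \<le> Vt \<epsilon> 0 j" and "0 \<le> R"
    and b: "b \<in> junction_controls A f" "f0 f b = 0"
  shows "R \<le> l0 f l b"
proof -
  have "\<exists>\<^sub>F \<epsilon> in at_right 0. (\<forall>j. R / lam \<le> Vt \<epsilon> 0 j) \<and> (0 < \<epsilon> \<and> \<epsilon> < 1)"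
    by (intro frequently_eventually_frequently[OF fr] eventually_at_right_small) simp
  then obtain \<epsilon> where e: "\<And>j. R / lam \<le> Vt \<epsilon> 0 j" "0 < \<epsilon>" using frequently_ex by blast
  have st: "R \<le> l i 0 a" if "a \<in> A" "f i 0 a = 0" for i a
  proof -
    have "lam * (R / lam) \<le> lam * Vt \<epsilon> 0 i" using lam e(1) by (intro mult_left_mono) auto
    then show ?thesis using stationary_upper[OF e(2) that] lam by simp
  qed
  show ?thesis
  proof (cases b)
    case (Inr c)
    then obtain a i where c: "c = (a, i)" "a \<in> A" using b(1) by (auto simp: junction_controls_def A_tilde_def)
    then show ?thesis using st[of a i] b(2) Inr by simp
  next
    case (Inl c)
    obtain a1 a2 a3 where c: "c = (a1, a2, a3)" by (cases c)
    have A0: "(a1, a2, a3) \<in> A0 A f" using b(1) Inl c by (auto simp: junction_controls_def)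
    then have a: "a1 \<in> A" "a2 \<in> A" "a3 \<in> A" "f B1 0 a1 \<le> 0" "f B2 0 a2 \<le> 0" "f B3 0 a3 \<le> 0" by (auto simp: A0_def)
    have D: "0 < f B2 0 a2 * f B3 0 a3 + f B1 0 a1 * f B3 0 a3 + f B1 0 a1 * f B2 0 a2" by (rule A0_denominator_pos[OF A0])
    consider "f B1 0 a1 = 0" | "f B2 0 a2 = 0" | "f B3 0 a3 = 0" | "f B1 0 a1 < 0" "f B2 0 a2 < 0" "f B3 0 a3 < 0"
      using a by linarith
    then show ?thesis
    proof cases
      case 1
      moreover from this have "f B2 0 a2 \<noteq> 0" "f B3 0 a3 \<noteq> 0" using D by auto
      ultimately show ?thesis using st[OF a(1)] Inl c by (simp add: Let_def)
    next
      case 2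
      moreover from this have "f B1 0 a1 \<noteq> 0" "f B3 0 a3 \<noteq> 0" using D by auto
      ultimately show ?thesis using st[OF a(2)] Inl c by (simp add: Let_def)
    next
      case 3
      moreover from this have "f B1 0 a1 \<noteq> 0" "f B2 0 a2 \<noteq> 0" using D by auto
      ultimately show ?thesis using st[OF a(3)] Inl c by (simp add: Let_def)
    next
      case 4
      then show ?thesis using triple_upper[OF fr \<open>0 \<le> R\<close> a(1-3)] Inl c by simp
    qed
  qed
qed

text \<open>Inside a branch the two problems have the same paths, and no switch occurs since
  \<open>z\<close> stays nonnegative.\<close>

lemma excursion_upper:
  assumes "0 < \<epsilon>" "0 \<le> R" and v: "\<And>j. R / lam \<le> Vt \<epsilon> 0 j"
    and "\<beta> \<in> controls A" "0 \<le> c" "c < d" and p: "path j \<beta> z c d" and zc: "z c = 0"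
    and pos: "\<And>t. c < t \<Longrightarrow> t < d \<Longrightarrow> 0 < z t" and zd: "0 \<le> z d"
  shows "R / lam * (exp (- lam * c) - exp (- lam * d)) \<le> cost j \<beta> z c d + (if z d = 0 then 0 else M / lam * exp (- lam * d))"
proof -
  have low: "- \<epsilon> \<le> z t" if "c \<le> t" "t \<le> d" for t
  proof -
    have "0 \<le> z t" using pos[of t] zc zd that by (cases "t = c"; cases "t = d") auto
    then show ?thesis using assms(1) by simp
  qed
  have 1: "exp (- lam * c) * Vt \<epsilon> 0 j \<le> cost j \<beta> z c d + exp (- lam * d) * Vt \<epsilon> (z d) j"
    using Vt_dynamic_programming[OF assms(4,5) less_imp_le[OF assms(6)] p assms(1) low] zc by simp
  show ?thesis
  proof (cases "z d = 0")
    case True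
    have "0 \<le> exp (- lam * c) - exp (- lam * d)" using exp_decreasing[of c d] assms(6) by simp
    then have "R / lam * (exp (- lam * c) - exp (- lam * d)) \<le> Vt \<epsilon> 0 j * (exp (- lam * c) - exp (- lam * d))"
      by (intro mult_right_mono v)
    with 1 True show ?thesis by (simp add: algebra_simps)
  next
    case False
    have "exp (- lam * d) * Vt \<epsilon> (z d) j \<le> exp (- lam * d) * (M / lam)"
      using zd assms(1) by (intro mult_left_mono Vt_bounds) auto
    moreover have "exp (- lam * c) * (R / lam) \<le> exp (- lam * c) * Vt \<epsilon> 0 j" by (intro mult_left_mono v) auto
    moreover have "0 \<le> exp (- lam * d) * (R / lam)" using \<open>0 \<le> R\<close> lam by simp
    ultimately have "exp (- lam * c) * (R / lam) - exp (- lam * d) * (R / lam) \<le> cost j \<beta> z c d + exp (- lam * d) * (M / lam)"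
      using 1 by linarith
    then show ?thesis using False by (simp only: mult.commute[of "R / lam"] left_diff_distrib mult.commute[of "M / lam"] if_False)
  qed
qed

text \<open>The contradiction shows, for all small \<open>\<epsilon>\<close>, only that some branch
  has a small value. At most two steps of the cycle carry it to any other branch, at the price of
  \<open>\<delta> / 4\<close> each.\<close>

lemma upper_bound_zero_eventually:
  assumes "0 < \<delta>"
  shows "\<forall>\<^sub>F \<epsilon> in at_right 0. \<forall>i. Vt \<epsilon> 0 i \<le> W + \<delta>"
proof -
  define R where "R = lam * (W + \<delta> / 2)"
  have R: "0 \<le> R" "R / lam = W + \<delta> / 2" using V_bounds(1)[of 0 B1] lam assms by (simp_all add: R_def)
  have "\<not> (\<exists>\<^sub>F \<epsilon> in at_right 0. \<forall>j. R / lam \<le> Vt \<epsilon> 0 j)"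
  proof
    assume fr: "\<exists>\<^sub>F \<epsilon> in at_right 0. \<forall>j. R / lam \<le> Vt \<epsilon> 0 j"
    have "\<exists>\<^sub>F \<epsilon> in at_right 0. (\<forall>j. R / lam \<le> Vt \<epsilon> 0 j) \<and> (0 < \<epsilon> \<and> \<epsilon> < 1)"
      by (intro frequently_eventually_frequently[OF fr] eventually_at_right_small) simp
    then obtain \<epsilon> where e: "\<And>j. R / lam \<le> Vt \<epsilon> 0 j" "0 < \<epsilon>" using frequently_ex by blast
    have "R / lam \<le> W"
    proof (rule V_greatest[OF order_refl])
      fix \<alpha> x i assume \<alpha>: "\<alpha> \<in> admissible_controls A f 0 B1" and tr: "junction_trajectory f \<alpha> 0 B1 x i"
      note mx = admissible_mixed[OF \<alpha>]
      have "R / lam * exp (- lam * 0) \<le> integral {0..} (\<lambda>t. exp (- lam * t) * jl f l \<alpha> x i t)"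
        by (rule junction_tail_ge[OF mx tr order_refl junction_trajectoryD(2)[OF tr], of "M / lam"])
           (use lam M junction_stationary_upper[OF fr R(1)] excursion_upper[OF e(2) R(1) e(1)] in auto)
      then show "R / lam \<le> junction_cost f l lam \<alpha> x i"
        unfolding junction_cost_eq[OF mx tr] discounted_def by simp
    qed
    then show False using R(2) assms by simp
  qed
  then have ev: "\<forall>\<^sub>F \<epsilon> in at_right 0. \<exists>j. Vt \<epsilon> 0 j < W + \<delta> / 2"
    unfolding not_frequently R(2) by (simp add: not_le)
  define C where "C = 3 * M / c0 + 1"
  have C: "0 < C" using M c0 by (simp add: C_def add_pos_pos)
  define b where "b = min (h0 / 2) (\<delta> / 4 / C)"
  have b: "0 < b" using h0 assms C by (simp add: b_def)
  show ?thesis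
    using ev eventually_at_right_small[OF b]
  proof eventually_elim
    case (elim \<epsilon>)
    then obtain j where j: "Vt \<epsilon> 0 j < W + \<delta> / 2" by blast
    have e: "0 < \<epsilon>" "2 * \<epsilon> < h0" "\<epsilon> * C < \<delta> / 4" using elim(2) C by (auto simp: b_def pos_less_divide_eq)
    have s: "Vt \<epsilon> 0 i \<le> Vt \<epsilon> 0 (succ_branch i) + \<delta> / 4" for i
      using Vt_zero_succ[OF e(1,2), of i] e(3) by (simp add: C_def mult.commute)
    show ?case
    proof
      fix i
      show "Vt \<epsilon> 0 i \<le> W + \<delta>"
        using s[of B1] s[of B2] s[of B3] j assms by (cases i; cases j) auto
    qed
  qed
qed

text \<open>Until the junction is reached the trajectory is also one of the thermostat with the same
  cost, and from then on it costs at least the discounted \<open>W\<close>. The estimate is uniform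
  in the starting point because \<open>\<epsilon>\<close> enters only through the values at the
  junction.\<close>

lemma upper_bound_eventually:
  assumes "0 < \<delta>"
  shows "\<forall>\<^sub>F \<epsilon> in at_right 0. \<forall>x\<ge>0. \<forall>i. Vt \<epsilon> x i \<le> V x i + \<delta>"
  using upper_bound_zero_eventually[OF assms] eventually_at_right_small[OF zero_less_one]
proof eventually_elim
  case (elim \<epsilon>)
  then have v: "Vt \<epsilon> 0 i \<le> W + \<delta>" for i by blast
  have e: "0 < \<epsilon>" using elim(2) by blast
  show ?case
  proof (intro allI impI)
    fix x0 :: real and i0 assume x0: "0 \<le> x0"
    have "Vt \<epsilon> x0 i0 - \<delta> \<le> V x0 i0"
    proof (cases "x0 = 0")
      case True
      then show ?thesis using v[of i0] V_zero[of i0] by simp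
    next
      case False
      then have "0 < x0" using x0 by simp
      show ?thesis
      proof (rule V_greatest[OF x0])
        fix \<alpha> x i assume \<alpha>: "\<alpha> \<in> admissible_controls A f x0 i0" and tr: "junction_trajectory f \<alpha> x0 i0 x i"
        note mx = admissible_mixed[OF \<alpha>]
        note bi = jl_bdd_integrable[OF mx tr]
        have xx: "x 0 = x0" by (rule junction_trajectoryD(2)[OF tr])
        define g where "g t = exp (- lam * t) * jl f l \<alpha> x i t" for t
        have ceq: "junction_cost f l lam \<alpha> x i = integral {0..} g"
          unfolding junction_cost_eq[OF mx tr] discounted_def g_def ..
        have i0: "i 0 = i0" using junction_trajectoryD(1)[OF tr] xx \<open>0 < x0\<close> by (simp add: same_point_def)
        have initial: "Vt \<epsilon> x0 i0 \<le> integral {0..T} g + exp (- lam * T) * Vt \<epsilon> (x T) i0"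
          if T: "0 < T" and pos0: "\<And>t. 0 \<le> t \<Longrightarrow> t < T \<Longrightarrow> 0 < x t" for T
        proof -
          have pos: "0 < x t" if "0 < t" "t < T" for t using pos0 that by simp
          obtain j where j: "i (T / 2) = j" "path j (inner_control \<alpha>) x 0 T"
            "integral {0..T} (\<lambda>t. exp (- lam * t) * jl f l \<alpha> x i t) = cost j (inner_control \<alpha>) x 0 T"
          proof (rule junction_trajectory_path[OF mx tr order_refl T])
            fix j assume "\<And>t. 0 < t \<Longrightarrow> t < T \<Longrightarrow> i t = j" "path j (inner_control \<alpha>) x 0 T"
              "integral {0..T} (\<lambda>t. exp (- lam * t) * jl f l \<alpha> x i t) = cost j (inner_control \<alpha>) x 0 T"
            then show thesis using T by (intro that[of j]) simp_all
          qed (rule pos)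
          have "i (T / 2) = i 0"
            by (rule junction_trajectoryD(4)[OF tr]) (use T pos in auto)
          then have ji: "j = i0" using j(1) i0 by simp
          have "exp (- lam * 0) * Vt \<epsilon> (x 0) j \<le> cost j (inner_control \<alpha>) x 0 T + exp (- lam * T) * Vt \<epsilon> (x T) j"
          proof (rule Vt_dynamic_programming[OF inner_control_in_controls[OF mx] order_refl less_imp_le[OF T] j(2) e])
            fix t assume "0 \<le> t" "t \<le> T"
            then show "- \<epsilon> \<le> x t" using junction_trajectoryD(3)[OF tr, of t] e by simp
          qed
          then show ?thesis using j(3) ji xx by (simp add: g_def[abs_def])
        qed
        have Vtx: "Vt \<epsilon> (x T) i0 \<le> M / lam" if "0 \<le> T" for T
          using junction_trajectoryD(3)[OF tr that] e by (intro Vt_bounds) auto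
        show "Vt \<epsilon> x0 i0 - \<delta> \<le> junction_cost f l lam \<alpha> x i"
        proof (cases "\<exists>t\<ge>0. x t \<le> 0")
          case True
          then obtain t where t: "0 \<le> t" "x t \<le> 0" by blast
          have "continuous_on {0..t} x"
            using junction_trajectory_continuous[OF tr] by (rule continuous_on_subset) auto
          moreover have "0 < x 0" using xx \<open>0 < x0\<close> by simp
          ultimately obtain \<tau> where \<tau>: "0 < \<tau>" "x \<tau> = 0" "\<And>r. 0 \<le> r \<Longrightarrow> r < \<tau> \<Longrightarrow> 0 < x r"
            using first_hit_down[of 0 t x 0] t by metis
          have "Vt \<epsilon> x0 i0 \<le> integral {0..\<tau>} g + exp (- lam * \<tau>) * Vt \<epsilon> (x \<tau>) i0"
            by (rule initial[OF \<tau>(1,3)])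
          moreover have "exp (- lam * \<tau>) * Vt \<epsilon> (x \<tau>) i0 \<le> exp (- lam * \<tau>) * (W + \<delta>)"
            using v[of i0] \<tau>(2) by (intro mult_left_mono) auto
          moreover have "exp (- lam * \<tau>) * \<delta> \<le> 1 * \<delta>"
            using assms \<tau>(1) by (intro mult_right_mono exp_le_one) auto
          moreover have "W * exp (- lam * \<tau>) \<le> integral {\<tau>..} g"
            unfolding g_def by (rule junction_tail_ge_W[OF mx tr less_imp_le[OF \<tau>(1)] \<tau>(2)])
          moreover have "integral {0..} g = integral {0..\<tau>} g + integral {\<tau>..} g"
            unfolding g_def by (rule discounted_integral_split[OF bi lam]) (use \<tau> in auto)
          ultimately show ?thesis unfolding ceq by (simp only: distrib_left mult.commute[of W]; linarith)
        next
          case False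
          then have pos: "0 < x t" if "0 \<le> t" for t using that by force
          have "((\<lambda>T. Vt \<epsilon> x0 i0 - M / lam * exp (- lam * T)) \<longlongrightarrow> Vt \<epsilon> x0 i0 - 0) at_top"
            by (intro tendsto_diff tendsto_const tendsto_exp_minus_at_top lam)
          moreover have "((\<lambda>T. integral {0..T} g) \<longlongrightarrow> integral {0..} g) at_top"
            unfolding g_def by (rule tendsto_discounted[OF bi lam order_refl])
          moreover have "\<forall>\<^sub>F T in at_top. Vt \<epsilon> x0 i0 - M / lam * exp (- lam * T) \<le> integral {0..T} g"
            using eventually_gt_at_top[of 0]
          proof eventually_elim
            case (elim T)
            have "exp (- lam * T) * Vt \<epsilon> (x T) i0 \<le> exp (- lam * T) * (M / lam)"
              using Vtx[of T] elim by (intro mult_left_mono) auto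
            then show ?case using initial[OF elim pos] by (simp add: mult.commute)
          qed
          ultimately have "Vt \<epsilon> x0 i0 - 0 \<le> integral {0..} g"
            by (intro tendsto_le[OF trivial_limit_at_top_linorder])
          then show ?thesis unfolding ceq using assms by simp
        qed
      qed
    qed
    then show "Vt \<epsilon> x0 i0 \<le> V x0 i0 + \<delta>" by simp
  qed
qed

section \<open>Uniform convergence\<close>

lemma uniform_limit_Vt:
  "uniform_limit ({0..} \<times> UNIV) (\<lambda>\<epsilon> (x, i). Vt \<epsilon> x i) (\<lambda>(x, i). V x i) (at_right 0)"
proof (rule uniform_limitI)
  fix e :: real assume "0 < e"
  then have "0 < e / 2" by simp
  from lower_bound_eventually[OF this] upper_bound_eventually[OF this]
  show "\<forall>\<^sub>F \<epsilon> in at_right 0. \<forall>z\<in>{0..} \<times> UNIV. dist (case z of (x, i) \<Rightarrow> Vt \<epsilon> x i) (case z of (x, i) \<Rightarrow> V x i) < e"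
  proof eventually_elim
    case (elim \<epsilon>)
    show ?case
    proof
      fix z :: "real \<times> branch" assume "z \<in> {0..} \<times> UNIV"
      then obtain x i where z: "z = (x, i)" "0 \<le> x" by auto
      have "V x i - e / 2 \<le> Vt \<epsilon> x i" "Vt \<epsilon> x i \<le> V x i + e / 2" using elim z(2) by auto
      then show "dist (case z of (x, i) \<Rightarrow> Vt \<epsilon> x i) (case z of (x, i) \<Rightarrow> V x i) < e"
        using \<open>0 < e\<close> z(1) by (simp add: dist_real_def abs_less_iff)
    qed
  qed
qed

end

theorem theorem4p4:
  fixes A :: "'a::metric_space set"
    and f l :: "branch \<Rightarrow> real \<Rightarrow> 'a \<Rightarrow> real"
    and lam :: real
  assumes "compact A"
    and "0 < lam"
    and "\<And>i. continuous_on ({0..} \<times> A) (\<lambda>(x, a). f i x a)"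
    and "\<And>i. bounded ((\<lambda>(x, a). f i x a) ` ({0..} \<times> A))"
    and "\<And>i. continuous_on ({0..} \<times> A) (\<lambda>(x, a). l i x a)"
    and "\<And>i. bounded ((\<lambda>(x, a). l i x a) ` ({0..} \<times> A))"
    and "\<And>i x a. 0 \<le> x \<Longrightarrow> a \<in> A \<Longrightarrow> 0 \<le> l i x a"
    and "\<exists>L>0. \<forall>i. \<forall>a\<in>A. \<forall>x\<ge>0. \<forall>y\<ge>0. \<bar>f i x a - f i y a\<bar> \<le> L * \<bar>x - y\<bar>"
    and "\<And>i. \<exists>am\<in>A. \<exists>ap\<in>A. f i 0 am < 0 \<and> 0 < f i 0 ap"
    and "\<exists>\<omega> :: real \<Rightarrow> real. continuous_on {0..} \<omega> \<and> mono_on {0..} \<omega> \<and> (\<forall>r\<ge>0. 0 \<le> \<omega> r) \<and> \<omega> 0 = 0 \<and>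
           (\<forall>i. \<forall>a\<in>A. \<forall>x\<ge>0. \<forall>y\<ge>0. \<bar>l i x a - l i y a\<bar> \<le> \<omega> \<bar>x - y\<bar>)"
  shows "(\<forall>i. \<forall>x\<ge>0. ((\<lambda>\<epsilon>. V_thermostat A f l lam (\<lambda>_. \<epsilon>) x i) \<longlongrightarrow> V_junction A f l lam x i) (at_right 0))
    \<and> uniform_limit ({0..} \<times> UNIV)
         (\<lambda>\<epsilon> (x, i). V_thermostat A f l lam (\<lambda>_. \<epsilon>) x i)
         (\<lambda>(x, i). V_junction A f l lam x i) (at_right 0)
    \<and> (\<exists>c. \<forall>i. ((\<lambda>\<epsilon>. V_thermostat A f l lam (\<lambda>_. \<epsilon>) 0 i) \<longlongrightarrow> c) (at_right 0))"
proof -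
  obtain L where L: "L > 0" "\<And>i a x y. a \<in> A \<Longrightarrow> 0 \<le> x \<Longrightarrow> 0 \<le> y \<Longrightarrow> \<bar>f i x a - f i y a\<bar> \<le> L * \<bar>x - y\<bar>"
    using assms(8) by blast
  obtain am ap where a: "\<And>i. am i \<in> A" "\<And>i. ap i \<in> A" "\<And>i. f i 0 (am i) < 0" "\<And>i. 0 < f i 0 (ap i)"
    using assms(9) by metis
  have "\<exists>B. \<forall>x\<ge>0. \<forall>a\<in>A. \<bar>f i x a\<bar> \<le> B" for i
    using assms(4)[of i] unfolding bounded_iff by force
  then obtain Bf where Bf: "\<And>i x a. 0 \<le> x \<Longrightarrow> a \<in> A \<Longrightarrow> \<bar>f i x a\<bar> \<le> Bf i" by metis
  have "\<exists>B. \<forall>x\<ge>0. \<forall>a\<in>A. \<bar>l i x a\<bar> \<le> B" for i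
    using assms(6)[of i] unfolding bounded_iff by force
  then obtain Bl where Bl: "\<And>i x a. 0 \<le> x \<Longrightarrow> a \<in> A \<Longrightarrow> \<bar>l i x a\<bar> \<le> Bl i" by metis
  \<comment> \<open>The element \<open>1\<close> makes the common bound \<open>M\<close>
    positive.\<close>
  define S where "S = insert 1 (range Bf \<union> range Bl)"
  define M where "M = Max S"
  have "finite S" by (simp add: S_def)
  then have M: "1 \<le> M" "Bf i \<le> M" "Bl i \<le> M" for i
    unfolding M_def by (rule Max_ge, simp add: S_def)+
  \<comment> \<open>Half of the smallest drift in absolute value: within distance
    \<open>c0 / L\<close> of the junction the Lipschitz bound leaves a drift of at least
    \<open>c0\<close>, whence the choice of \<open>c0 / L\<close> for \<open>h0\<close>.\<close>
  define c0 where "c0 = Min (range (\<lambda>i. min (- f i 0 (am i)) (f i 0 (ap i)))) / 2"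
  have c0: "0 < c0" using a by (simp add: c0_def)
  have c0': "2 * c0 \<le> - f i 0 (am i)" "2 * c0 \<le> f i 0 (ap i)" for i
    using Min_le[of "range (\<lambda>i. min (- f i 0 (am i)) (f i 0 (ap i)))" "min (- f i 0 (am i)) (f i 0 (ap i))"]
    by (auto simp: c0_def)
  obtain \<omega> where \<omega>: "continuous_on {0..} \<omega>" "\<omega> 0 = (0::real)"
    "\<And>i a x y. a \<in> A \<Longrightarrow> 0 \<le> x \<Longrightarrow> 0 \<le> y \<Longrightarrow> \<bar>l i x a - l i y a\<bar> \<le> \<omega> \<bar>x - y\<bar>"
    using assms(10) by blast
  interpret junction_data A f l lam M L c0 "c0 / L" am ap
  proof
    show "0 < lam" "0 < M" "0 < L" "0 < c0" "0 < c0 / L" using assms(2) M(1) L(1) c0 by auto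
    show "continuous_on ({0..} \<times> A) (\<lambda>(x, a). f i x a)" "continuous_on ({0..} \<times> A) (\<lambda>(x, a). l i x a)" for i
      by (rule assms)+
    fix i
    show "am i \<in> A" "ap i \<in> A" by (rule a)+
    {
      fix x :: real and a assume xa: "0 \<le> x" "a \<in> A"
      show "\<bar>f i x a\<bar> \<le> M" using Bf[OF xa, of i] M(2)[of i] by linarith
      show "0 \<le> l i x a" by (rule assms(7)[OF xa])
      show "l i x a \<le> M" using Bl[OF xa, of i] M(3)[of i] by linarith
    }
    show "\<bar>f i x a - f i y a\<bar> \<le> L * \<bar>x - y\<bar>" if "0 \<le> x" "0 \<le> y" "a \<in> A" for x y a
      by (rule L(2)) (use that in auto)
    fix x assume x: "0 \<le> x" "x \<le> c0 / L"
    have Lx: "L * \<bar>x - 0\<bar> \<le> c0" using x L(1) by (simp add: field_simps)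
    show "f i x (am i) \<le> - c0" using L(2)[OF a(1), of x 0 i i] Lx x c0'(1)[of i] by linarith
    show "c0 \<le> f i x (ap i)" using L(2)[OF a(2), of x 0 i i] Lx x c0'(2)[of i] by linarith
  next
    fix \<eta> :: real assume "0 < \<eta>"
    have "(\<omega> \<longlongrightarrow> \<omega> 0) (at 0 within {0..})" using \<omega>(1) by (simp add: continuous_on_def)
    then have "\<forall>\<^sub>F r in at 0 within {0..}. \<omega> r < \<eta>" using \<open>0 < \<eta>\<close> \<omega>(2) by (intro order_tendstoD(2)) auto
    then obtain d where d: "0 < d" "\<And>r. 0 \<le> r \<Longrightarrow> r \<noteq> 0 \<Longrightarrow> dist r 0 < d \<Longrightarrow> \<omega> r < \<eta>"
      unfolding eventually_at by auto
    have small: "\<omega> r \<le> \<eta>" if "0 \<le> r" "r \<le> d / 2" for r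
      using d(2)[of r] that d(1) \<omega>(2) \<open>0 < \<eta>\<close> by (cases "r = 0") (auto simp: dist_real_def less_imp_le)
    show "\<exists>h>0. \<forall>i x. \<forall>a\<in>A. 0 \<le> x \<longrightarrow> x \<le> h \<longrightarrow> \<bar>l i x a - l i 0 a\<bar> \<le> \<eta>"
    proof (intro exI conjI allI ballI impI)
      show "0 < d / 2" using d(1) by simp
      fix i x a assume "a \<in> A" "0 \<le> x" "x \<le> d / 2"
      then show "\<bar>l i x a - l i 0 a\<bar> \<le> \<eta>" using \<omega>(3)[of a x 0 i] small[of x] by simp
    qed
  qed
  note u = uniform_limit_Vt
  have pt: "((\<lambda>\<epsilon>. Vt \<epsilon> x i) \<longlongrightarrow> V x i) (at_right 0)" if "0 \<le> x" for x i
  proof -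
    have "(x, i) \<in> {0..} \<times> UNIV" using that by simp
    from tendsto_uniform_limitI[OF u this] show ?thesis by simp
  qed
  then have "\<forall>i. ((\<lambda>\<epsilon>. Vt \<epsilon> 0 i) \<longlongrightarrow> W) (at_right 0)"
    using V_zero_branch by (metis order_refl)
  with pt u show ?thesis by blast
qed

end
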